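(* Let $N\ge4$, $2<p<2^*$, and suppose $V,f,Q$ satisfy (V1)–(V3) and (D1)–(D2). Then: (i) there exists $a_0>0$ such that for every $0<a<a_0$ and $0<\lambda<\lambda_1(f_\Omega)$ there is $\mu^*>0$ such that for all $\mu>\mu^*$, $(E_{\mu,\lambda})$ has a positive solution $u_\mu^+$ with $J_{\mu,\lambda}(u_\mu^+)<0$; (ii) for each $a>0$ and $\lambda\ge\lambda_1(f_\Omega)$ there is $\mu^*>0$ such that for all $\mu>\mu^*$, $(E_{\mu,\lambda})$ has a positive solution $u_\mu^+$ with $J_{\mu,\lambda}(u_\mu^+)<0$.
   Context: $2^*=2N/(N-2)$. Conditions on $V,f,Q:\mathbb{R}^N\to\mathbb{R}$: (V1) $V$ nonnegative and continuous; (V2) there is $c>0$ with $\{V<c\}$ nonempty of finite Lebesgue measure; (V3) $\Omega=\mathrm{int}\{V=0\}$ is a nonempty bounded domain with smooth boundary and $\overline\Omega=\{V=0\}$; (D1) $f\in L^{N/2}(\mathbb{R}^N)$, $f^+\not\equiv0$ in $\Omega$; (D2) $Q\in L^\infty(\mathbb{R}^N)$, $Q^+\not\equiv0$ in $\Omega$. $\|u\|_{D^{1,2}}^2=\int|\nabla u|^2$, $\|u\|_\mu^2=\int(|\nabla u|^2+\mu Vu^2)$, $X=\{u\in H^1(\mathbb{R}^N):\int Vu^2<\infty\}$. For $a,\lambda,\mu>0$, $(E_{\mu,\lambda})$ is $-\left(a\int|\nabla u|^2dx+1\right)\Delta u+\mu Vu=Q|u|^{p-2}u+\lambda fu$ in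 $\mathbb{R}^N$, $u\in H^1(\mathbb{R}^N)$, in the weak sense; a positive solution is a solution with $u>0$. $J_{\mu,\lambda}(u)=\frac a4\|u\|_{D^{1,2}}^4+\frac12\|u\|_\mu^2-\frac1p\int Q|u|^p-\frac\lambda2\int fu^2$. $\lambda_1(f_\Omega)$ is the positive principal eigenvalue of $-\Delta u=\lambda f_\Omega u$ in $\Omega$, $u=0$ on $\partial\Omega$, $f_\Omega=f|_{\overline\Omega}$. *)

theory Defs
  imports "HOL-Analysis.Analysis"
begin

definition pderiv_dir :: "('n::euclidean_space \<Rightarrow> real) \<Rightarrow> 'n \<Rightarrow> 'n \<Rightarrow> real" where
  "pderiv_dir f i x = frechet_derivative f (at x) i"

definition cgrad :: "('n::euclidean_space \<Rightarrow> real) \<Rightarrow> 'n \<Rightarrow> 'n" where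
  "cgrad f x = (\<Sum>i\<in>Basis. pderiv_dir f i x *\<^sub>R i)"

coinductive smooth_fun :: "('n::euclidean_space \<Rightarrow> real) \<Rightarrow> bool" where
  "(\<forall>x. f differentiable (at x)) \<Longrightarrow> (\<forall>i\<in>Basis. smooth_fun (pderiv_dir f i)) \<Longrightarrow> smooth_fun f"

definition test_fun :: "'n::euclidean_space set \<Rightarrow> ('n \<Rightarrow> real) \<Rightarrow> bool" where
  "test_fun U \<phi> \<longleftrightarrow> smooth_fun \<phi> \<and> compact (closure {x. \<phi> x \<noteq> 0})
     \<and> closure {x. \<phi> x \<noteq> 0} \<subseteq> U"

definition L2_on :: "'n::euclidean_space set \<Rightarrow> ('n \<Rightarrow> real) \<Rightarrow> bool" where
  "L2_on U h \<longleftrightarrow> h \<in> borel_measurable (lebesgue_on U) \<and> integrable (lebesgue_on U) (\<lambda>x. (h x)\<^sup>2)"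

definition weak_grad :: "'n::euclidean_space set \<Rightarrow> ('n \<Rightarrow> real) \<Rightarrow> ('n \<Rightarrow> 'n) \<Rightarrow> bool" where
  "weak_grad U u g \<longleftrightarrow>
     (\<forall>\<phi>. test_fun U \<phi> \<longrightarrow> (\<forall>i\<in>Basis.
        (LINT x|lebesgue_on U. u x * pderiv_dir \<phi> i x) = - (LINT x|lebesgue_on U. (g x \<bullet> i) * \<phi> x)))"

definition H1_grad :: "'n::euclidean_space set \<Rightarrow> ('n \<Rightarrow> real) \<Rightarrow> ('n \<Rightarrow> 'n) \<Rightarrow> bool" where
  "H1_grad U u g \<longleftrightarrow> L2_on U u \<and> (\<forall>i\<in>Basis. L2_on U (\<lambda>x. g x \<bullet> i)) \<and> weak_grad U u g"

definition H10_grad :: "'n::euclidean_space set \<Rightarrow> ('n \<Rightarrow> real) \<Rightarrow> ('n \<Rightarrow> 'n) \<Rightarrow> bool" where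
  "H10_grad U u g \<longleftrightarrow> H1_grad U u g \<and>
     (\<exists>\<phi>::nat \<Rightarrow> 'n \<Rightarrow> real. (\<forall>k. test_fun U (\<phi> k)) \<and>
        (\<lambda>k. (LINT x|lebesgue_on U. (\<phi> k x - u x)\<^sup>2 + (norm (cgrad (\<phi> k) x - g x))\<^sup>2)) \<longlonglongrightarrow> 0)"

definition smooth_boundary :: "'n::euclidean_space set \<Rightarrow> bool" where
  "smooth_boundary U \<longleftrightarrow> (\<forall>x0\<in>frontier U. \<exists>r>0. \<exists>\<rho>. smooth_fun \<rho> \<and> \<rho> x0 = 0 \<and>
      cgrad \<rho> x0 \<noteq> 0 \<and> U \<inter> ball x0 r = {y\<in>ball x0 r. \<rho> y < 0})"

text \<open>The positive principal eigenvalue lambda_1(f_Omega) of -Delta u = lambda f u in Omega,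
  u = 0 on the boundary: the (unique) positive eigenvalue having a positive eigenfunction
  in H^1_0(Omega) (weak formulation).\<close>
definition lambda1 :: "'n::euclidean_space set \<Rightarrow> ('n \<Rightarrow> real) \<Rightarrow> real" where
  "lambda1 U f = (THE l. l > 0 \<and> (\<exists>\<phi> g. H10_grad U \<phi> g \<and> (\<forall>x\<in>U. \<phi> x > 0) \<and>
      (\<forall>\<psi>. test_fun U \<psi> \<longrightarrow>
         (LINT x|lebesgue_on U. g x \<bullet> cgrad \<psi> x) = l * (LINT x|lebesgue_on U. f x * \<phi> x * \<psi> x))))"

definition is_solution :: "real \<Rightarrow> real \<Rightarrow> real \<Rightarrow> real \<Rightarrow> ('n::euclidean_space \<Rightarrow> real)
    \<Rightarrow> ('n \<Rightarrow> real) \<Rightarrow> ('n \<Rightarrow> real) \<Rightarrow> ('n \<Rightarrow> real) \<Rightarrow> ('n \<Rightarrow> 'n) \<Rightarrow> bool" where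
  "is_solution a p \<mu> lam V f Q u g \<longleftrightarrow>
     H1_grad UNIV u g \<and> integrable lebesgue (\<lambda>x. V x * (u x)\<^sup>2) \<and>
     (\<forall>\<phi>. test_fun UNIV \<phi> \<longrightarrow>
        (a * (LINT x|lebesgue. (norm (g x))\<^sup>2) + 1) * (LINT x|lebesgue. g x \<bullet> cgrad \<phi> x)
          + \<mu> * (LINT x|lebesgue. V x * u x * \<phi> x)
        = (LINT x|lebesgue. Q x * \<bar>u x\<bar> powr (p - 2) * u x * \<phi> x)
          + lam * (LINT x|lebesgue. f x * u x * \<phi> x))"

definition J_fun :: "real \<Rightarrow> real \<Rightarrow> real \<Rightarrow> real \<Rightarrow> ('n::euclidean_space \<Rightarrow> real)
    \<Rightarrow> ('n \<Rightarrow> real) \<Rightarrow> ('n \<Rightarrow> real) \<Rightarrow> ('n \<Rightarrow> real) \<Rightarrow> ('n \<Rightarrow> 'n) \<Rightarrow> real" where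
  "J_fun a p \<mu> lam V f Q u g =
     a / 4 * (LINT x|lebesgue. (norm (g x))\<^sup>2)\<^sup>2
     + 1 / 2 * ((LINT x|lebesgue. (norm (g x))\<^sup>2) + \<mu> * (LINT x|lebesgue. V x * (u x)\<^sup>2))
     - 1 / p * (LINT x|lebesgue. Q x * \<bar>u x\<bar> powr p)
     - lam / 2 * (LINT x|lebesgue. f x * (u x)\<^sup>2)"

end

theory Submission
  imports Defs "HOL-Complex_Analysis.Great_Picard"
begin

text \<open>
  The solution is a minimizer of \<open>J\<close>. Since \<open>p < 2\<^sup>* \<le> 4\<close> for \<open>N \<ge> 4\<close>, the quartic term together with
  Sobolev's inequality, the finite measure of \<open>{V < c}\<close> and a large \<open>\<mu>\<close> makes \<open>J\<close> bounded below. By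
  the parallelogram identity, the distance of two almost minimizers is, for large \<open>\<mu>\<close>, controlled
  by their energies and by quantities that are compact by Rellich's theorem, so a subsequence of a
  minimizing sequence of nonnegative test functions converges strongly. The limit is a nonnegative
  weak solution, and it is positive by the strong maximum principle as soon as \<open>J\<close> is negative at
  some test function. In (i) this is a large multiple of a test function \<open>\<phi>\<close> in \<open>\<Omega>\<close> with
  \<open>\<integral>Q \<phi>\<^sup>p > 0\<close>, when \<open>a\<close> is small. In (ii) it is a small multiple of a test function at which the
  quadratic part of \<open>J\<close> is negative. For \<open>\<lambda> = \<lambda>\<^sub>1\<close> such a function exists for every \<open>\<mu>\<close>, because
  otherwise the first eigenfunction of \<open>\<Omega>\<close>, extended by zero, would solve an equation on the whole
  space and vanish outside of \<open>\<Omega>\<close>.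

  \<open>\<lambda>\<^sub>1\<close> is the infimum of the Rayleigh quotient over test functions in \<open>\<Omega>\<close>; uniqueness of the
  eigenvalue with a positive eigenfunction follows from Picone's inequality.
\<close>

text \<open>No Sobolev space is constructed. All inequalities are proved for test functions, and
  weak objects occur only as limits (\<open>H1lim\<close>) of test functions whose gradients
  converge in L^2 and whose values converge in a weighted L^2 space. The weight 1 + V + |f| is taken
  so that every quadratic term of the energy is continuous along such limits; the infimum over test
  functions then plays the role of the infimum over the energy space. Sobolev's inequality comes
  from translations and truncation, without rearrangement. Two features of the statement shape the
  end of each argument. Positivity is demanded at every point although limits are determined only up
  to null sets, so representatives are changed at the last moment. And \<open>lambda1\<close> is a
  definite description, so existence and uniqueness of the eigenvalue precede any use of it. The two
  parts differ only in the source of a test function of negative energy. Below the eigenvalue, small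
  multiples of a function supported in \<open>\<Omega>\<close> have positive energy, so in (i) the
  power term has to win at a fixed amplitude; since p < 4, the quartic term must be kept small
  there, whence the bound on a.\<close>

abbreviation (input) lebesgue_int :: "('n::euclidean_space \<Rightarrow> 'b::{banach, second_countable_topology}) \<Rightarrow> 'b"  (binder "LI " 60) where
  "lebesgue_int h \<equiv> integral\<^sup>L lebesgue h"

abbreviation (input) L1f :: "('n::euclidean_space \<Rightarrow> 'b::{banach, second_countable_topology}) \<Rightarrow> bool" where
  "L1f h \<equiv> integrable lebesgue h"

abbreviation (input) Lmeas :: "('n::euclidean_space \<Rightarrow> 'b::topological_space) set" where
  "Lmeas \<equiv> borel_measurable lebesgue"

abbreviation (input) lims :: "(nat => 'a::topological_space) => 'a => bool"  (infix "---->" 60) where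
  "X ----> l \<equiv> X \<longlonglongrightarrow> l"

section \<open>Smooth functions and test functions\<close>

text \<open>Finite-order unfolding of the coinductive \<open>smooth_fun\<close>. Closure under sums,
  products and compositions can then be proved by induction on the order instead of by a separate
  coinduction each time.\<close>

primrec Ck :: "nat => ('n::euclidean_space => real) => bool" where
  "Ck 0 f = True"
| "Ck (Suc n) f = ((\<forall>x. f differentiable at x) \<and> (\<forall>i\<in>Basis. Ck n (pderiv_dir f i)))"

text \<open>For the coinduction, \<open>Ck (Suc n)\<close> for every n is differentiability together
  with \<open>Ck n\<close> for all partial derivatives, so the predicate reproduces itself.\<close>

lemma smooth_fun_iff_Ck: "smooth_fun f \<longleftrightarrow> (\<forall>n. Ck n f)"
proof
  have "smooth_fun f ==> Ck n f" for n
  proof (induction n arbitrary: f)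
    case (Suc n)
    from Suc.prems show ?case by (cases rule: smooth_fun.cases) (auto intro: Suc.IH)
  qed simp
  then show "smooth_fun f ==> \<forall>n. Ck n f" by blast
next
  assume "\<forall>n. Ck n f"
  then show "smooth_fun f"
  proof (coinduction arbitrary: f rule: smooth_fun.coinduct)
    case (smooth_fun f)
    then have 1: "Ck (Suc n) f" for n by blast
    from 1[of 0] have "\<forall>x. f differentiable at x" by simp
    moreover have "\<forall>i\<in>Basis. \<forall>n. Ck n (pderiv_dir f i)"
      using 1 by simp
    ultimately show ?case by auto
  qed
qed

section \<open>Derivative rules and closure properties of smoothness\<close>

lemma pderiv_dir_eq: "(f has_derivative f') (at x) ==> pderiv_dir f i x = f' i"
  by (simp add: pderiv_dir_def frechet_derivative_at[symmetric])

lemma has_derivative_pderiv_dir: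
  "f differentiable at x ==> (f has_derivative (%i. pderiv_dir f i x)) (at x)"
  unfolding pderiv_dir_def using frechet_derivative_works by blast

lemma pderiv_dir_inner: "pderiv_dir (%x. x \<bullet> b) i = (%x. i \<bullet> b)"
  by (rule ext, rule pderiv_dir_eq) (auto intro!: derivative_eq_intros)

lemma pderiv_dir_const: "pderiv_dir (%x. c) i = (%x. 0)"
  by (rule ext, rule pderiv_dir_eq) (auto intro!: derivative_eq_intros)

lemma pderiv_dir_add:
  assumes "\<forall>x. f differentiable at x" "\<forall>x. g differentiable at x"
  shows "pderiv_dir (%x. f x + g x) i = (%x. pderiv_dir f i x + pderiv_dir g i x)"
  by (rule ext, rule pderiv_dir_eq)
     (auto intro!: has_derivative_add has_derivative_pderiv_dir assms[rule_format])

lemma pderiv_dir_mult: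
  assumes "\<forall>x. f differentiable at x" "\<forall>x. g differentiable at x"
  shows "pderiv_dir (%x. f x * g x) i = (%x. f x * pderiv_dir g i x + pderiv_dir f i x * g x)"
  by (rule ext, rule pderiv_dir_eq)
     (auto intro!: has_derivative_mult has_derivative_pderiv_dir assms[rule_format])

lemma Ck_lower: "Ck (Suc n) f ==> Ck n f"
  by (induction n arbitrary: f) auto

lemma Ck_const: "Ck n (%x. c)"
  by (induction n arbitrary: c) (auto simp: pderiv_dir_const)

lemma Ck_inner: "Ck n (%x. x \<bullet> b)"
proof (cases n)
  case (Suc m)
  have "(%x::'a. x \<bullet> b) differentiable at x" for x
    by (rule differentiableI) (auto intro!: derivative_eq_intros)
  then show ?thesis by (simp add: Suc pderiv_dir_inner Ck_const)
qed simp

lemma Ck_add: "Ck n f ==> Ck n g ==> Ck n (%x. f x + g x)"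
  by (induction n arbitrary: f g) (auto simp: pderiv_dir_add)

lemma Ck_mult: "Ck n f ==> Ck n g ==> Ck n (%x. f x * g x)"
proof (induction n arbitrary: f g)
  case (Suc n)
  then show ?case
    using Ck_lower[OF Suc.prems(1)] Ck_lower[OF Suc.prems(2)]
    by (auto simp: pderiv_dir_mult simp del: Ck.simps(1) intro!: Ck_add)
qed simp

text \<open>The derivative of h(f(x)) contains another outer function h', so the induction has to
  run over a whole family \<open>F\<close> closed under differentiation. Powers on the positive half
  line and flat functions are the two families used.\<close>

lemma Ck_compose:
  assumes F: "!!h. h \<in> F ==> \<exists>h'\<in>F. \<forall>s\<in>S. (h has_real_derivative h' s) (at s)"
    and f: "!!x. f x \<in> S"
  shows "h \<in> F ==> Ck n f ==> Ck n (%x. h (f x))"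
proof (induction n arbitrary: h)
  case (Suc n)
  obtain h' where h': "h' \<in> F" "!!s. s \<in> S ==> (h has_real_derivative h' s) (at s)"
    using F[OF Suc.prems(1)] by blast
  have d: "((%x. h (f x)) has_derivative (%i. h' (f x) * pderiv_dir f i x)) (at x)" for x
    using has_derivative_compose[OF has_derivative_pderiv_dir[of f x]
        h'(2)[OF f, unfolded has_field_derivative_def, of x]]
      Suc.prems(2) by simp
  have "pderiv_dir (%x. h (f x)) i = (%x. h' (f x) * pderiv_dir f i x)" for i
    by (rule ext, rule pderiv_dir_eq, rule d)
  moreover have "Ck n (%x. h' (f x))" using Suc.IH[OF h'(1)] Ck_lower[OF Suc.prems(2)] by blast
  ultimately show ?case using Suc.prems(2) d by (auto intro!: Ck_mult differentiableI)
qed simp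

lemma smooth_const: "smooth_fun (%x. c)"
  and smooth_inner: "smooth_fun (%x. x \<bullet> b)"
  and smooth_add: "smooth_fun f ==> smooth_fun g ==> smooth_fun (%x. f x + g x)"
  and smooth_mult: "smooth_fun f ==> smooth_fun g ==> smooth_fun (%x. f x * g x)"
  by (auto simp: smooth_fun_iff_Ck intro: Ck_const Ck_inner Ck_add Ck_mult)

lemma smooth_minus: "smooth_fun f ==> smooth_fun (%x. - f x)"
  using smooth_mult[OF smooth_const[of "-1"]] by fastforce

lemma smooth_diff: "smooth_fun f ==> smooth_fun g ==> smooth_fun (%x. f x - g x)"
  using smooth_add[OF _ smooth_minus] by fastforce

lemma smooth_sum: "finite I ==> (!!i. i \<in> I ==> smooth_fun (f i)) ==> smooth_fun (%x. \<Sum>i\<in>I. f i x)"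
  by (induction I rule: finite_induct) (auto intro: smooth_const smooth_add)

lemma smooth_power: "smooth_fun f ==> smooth_fun (%x. f x ^ k)"
  by (induction k) (auto intro: smooth_const smooth_mult)

lemma smooth_compose:
  assumes F: "!!h. h \<in> F ==> \<exists>h'\<in>F. \<forall>s\<in>S. (h has_real_derivative h' s) (at s)"
    and f: "!!x. f x \<in> S" "h \<in> F" "smooth_fun f"
  shows "smooth_fun (%x. h (f x))"
  using Ck_compose[of F S f h, OF F] f by (simp add: smooth_fun_iff_Ck)

text \<open>The family c s^r on s > 0 is closed under differentiation. Square roots and inverses are
  special cases.\<close>

lemma smooth_powr:
  assumes "smooth_fun f" "!!x. f x > 0"
  shows "smooth_fun (%x. f x powr r)"
proof (rule smooth_compose[where F = "{h. \<exists>c r. h = (%s::real. c * s powr r)}" and S = "{0<..}"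
      and h = "%s. s powr r" and f = f])
  fix h :: "real => real" assume "h \<in> {h. \<exists>c r. h = (%s. c * s powr r)}"
  then obtain c r where h: "h = (%s. c * s powr r)" by blast
  have "\<forall>s\<in>{0<..}. (h has_real_derivative (c * r) * s powr (r - 1)) (at s)"
    by (auto simp: h intro!: derivative_eq_intros)
  then show "\<exists>h'\<in>{h. \<exists>c r. h = (%s. c * s powr r)}. \<forall>s\<in>{0<..}. (h has_real_derivative h' s) (at s)"
    by (intro bexI[of _ "%s. (c * r) * s powr (r - 1)"]) auto
next
  show "(%s. s powr r) \<in> {h. \<exists>c r. h = (%s::real. c * s powr r)}"
    by (simp, rule exI[of _ 1], rule exI[of _ r]) simp
qed (use assms in auto)

lemma smooth_sqrt:
  assumes "smooth_fun f" "!!x. f x > 0"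
  shows "smooth_fun (%x. sqrt (f x))"
  using smooth_powr[OF assms, of "1/2"] assms(2) by (simp add: powr_half_sqrt less_imp_le)

lemma smooth_inverse:
  assumes "smooth_fun f" "!!x. f x > 0"
  shows "smooth_fun (%x. inverse (f x))"
  using smooth_powr[OF assms, of "-1"] assms(2) by (simp add: powr_minus less_imp_le powr_one_eq_one)

section \<open>Smooth functions that are flat at zero\<close>

lemma poly_exp_tendsto_0: "((%y. poly q y * exp (- y)) \<longlongrightarrow> (0::real)) at_top"
proof -
  have "((%y. \<Sum>i\<le>degree q. coeff q i * (y ^ i / exp y)) \<longlongrightarrow> (\<Sum>i\<le>degree q. coeff q i * 0)) at_top"
    by (intro tendsto_intros tendsto_power_div_exp_0)
  then show ?thesis
    by (simp add: poly_altdef exp_minus divide_inverse sum_distrib_right mult.assoc)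
qed

text \<open>The classical smooth function exp(-1/s), cut off at zero, with a polynomial in 1/s as a
  factor; the factor makes the family closed under differentiation.\<close>

definition flat :: "real poly => real => real" where
  "flat q s = (if s > 0 then poly q (1 / s) * exp (- (1 / s)) else 0)"

text \<open>With y = 1/s one has dy/ds = -y^2, so q(y) exp(-y) has derivative y^2 (q(y) - q'(y))
  exp(-y); the polynomial \<open>[:0,0,1:]\<close> is y^2.\<close>

lemma flat_deriv:
  "(flat q has_real_derivative flat ([:0,0,1:] * (q - pderiv q)) s) (at s)"
proof -
  consider "s > 0" | "s < 0" | "s = 0" by linarith
  then show ?thesis
  proof cases
    case 1
    have "((%s. poly q (1 / s) * exp (- (1 / s))) has_real_derivative
        flat ([:0,0,1:] * (q - pderiv q)) s) (at s)"
      using 1 by (auto intro!: derivative_eq_intros poly_DERIV[THEN DERIV_chain2] simp: flat_def field_simps power2_eq_square)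
    then show ?thesis
      by (rule has_field_derivative_transform_within_open[where S = "{0<..}"]) (use 1 in \<open>auto simp: flat_def\<close>)
  next
    case 2
    have "((%s. 0) has_real_derivative flat ([:0,0,1:] * (q - pderiv q)) s) (at s)"
      using 2 by (simp add: flat_def)
    then show ?thesis
      by (rule has_field_derivative_transform_within_open[where S = "{..<0}"]) (use 2 in \<open>auto simp: flat_def\<close>)
  next
    case 3
    have "((%h. flat q h / h) \<longlongrightarrow> 0) (at_right 0)"
    proof -
      \<comment> \<open>With y = 1/h the difference quotient at zero is y q(y) exp(-y), and
        \<open>pCons 0 q\<close> is the polynomial y q(y).\<close>
      have "((%h. poly (pCons 0 q) (inverse h) * exp (- inverse h)) \<longlongrightarrow> 0) (at_right 0)"
        by (rule filterlim_compose[OF poly_exp_tendsto_0 filterlim_inverse_at_top_right])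
      moreover have "\<forall>\<^sub>F h in at_right 0. poly (pCons 0 q) (inverse h) * exp (- inverse h) = flat q h / h"
        unfolding eventually_at_right_field
        by (intro exI[of _ 1]) (auto simp: flat_def field_simps)
      ultimately show ?thesis by (rule Lim_transform_eventually)
    qed
    moreover have "((%h. flat q h / h) \<longlongrightarrow> 0) (at_left 0)"
    proof (rule Lim_transform_eventually[OF tendsto_const])
      show "\<forall>\<^sub>F h in at_left 0. 0 = flat q h / h"
        unfolding eventually_at_left_field by (intro exI[of _ "-1"]) (auto simp: flat_def)
    qed
    ultimately have "((%h. flat q h / h) \<longlongrightarrow> 0) (at 0)" by (simp add: filterlim_at_split)
    then show ?thesis using 3 by (simp add: has_field_derivative_iff flat_def)
  qed
qed

lemma smooth_flat: "smooth_fun f ==> smooth_fun (%x. flat q (f x))"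
  by (rule smooth_compose[where F = "range flat" and S = UNIV and h = "flat q" and f = f])
     (use flat_deriv in blast, auto)

lemma smooth_imp_differentiable: "smooth_fun f ==> f differentiable at x"
  by (erule smooth_fun.cases) auto

lemma smooth_imp_pderiv: "smooth_fun f ==> i \<in> Basis ==> smooth_fun (pderiv_dir f i)"
  by (erule smooth_fun.cases) auto

lemma smooth_imp_continuous: "smooth_fun f ==> continuous_on S f"
  by (meson continuous_at_imp_continuous_on differentiable_imp_continuous_within smooth_imp_differentiable)

lemma cgrad_inner: "i \<in> Basis ==> cgrad f x \<bullet> i = pderiv_dir f i x"
  unfolding cgrad_def by (simp add: inner_sum_left inner_Basis if_distrib sum.delta cong: if_cong)

lemma cgrad_eqI: "(f has_derivative (%h. v \<bullet> h)) (at x) ==> cgrad f x = v"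
  by (rule euclidean_eqI) (simp add: cgrad_inner pderiv_dir_eq)

lemma has_derivative_cgrad:
  assumes "f differentiable at x"
  shows "(f has_derivative (%h. cgrad f x \<bullet> h)) (at x)"
proof -
  have l: "linear (%i. pderiv_dir f i x)"
    using has_derivative_pderiv_dir[OF assms] has_derivative_linear by blast
  have "pderiv_dir f h x = cgrad f x \<bullet> h" for h
  proof -
    have "pderiv_dir f h x = pderiv_dir f (\<Sum>i\<in>Basis. (h \<bullet> i) *\<^sub>R i) x" by (simp add: euclidean_representation)
    also have "\<dots> = (\<Sum>i\<in>Basis. (h \<bullet> i) * pderiv_dir f i x)"
      using linear_sum[OF l, of "%i. (h \<bullet> i) *\<^sub>R i" Basis] linear_scale[OF l] by simp
    also have "\<dots> = cgrad f x \<bullet> h"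
      by (simp add: cgrad_def inner_sum_left inner_commute[of h] mult.commute)
    finally show ?thesis .
  qed
  then show ?thesis using has_derivative_pderiv_dir[OF assms] by simp
qed

lemma smooth_cgrad_continuous: "smooth_fun f ==> continuous_on S (cgrad f)"
  unfolding cgrad_def[abs_def] by (intro continuous_intros smooth_imp_continuous smooth_imp_pderiv)

section \<open>Algebra and gradients of test functions\<close>

lemma test_fun_mono: "test_fun U \<phi> ==> U \<subseteq> W ==> test_fun W \<phi>"
  by (auto simp: test_fun_def)

lemma test_funI:
  assumes "smooth_fun \<phi>" "compact K" "K \<subseteq> U" "!!x. x \<notin> K ==> \<phi> x = 0"
  shows "test_fun U \<phi>"
proof -
  have sub: "closure {x. \<phi> x \<noteq> 0} \<subseteq> K"
    using assms by (intro closure_minimal) (auto intro: compact_imp_closed)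
  have "compact (closure {x. \<phi> x \<noteq> 0})"
    using compact_Int_closed[OF \<open>compact K\<close> closed_closure, of "{x. \<phi> x \<noteq> 0}"] sub by (simp add: Int_absorb1)
  then show ?thesis
    using assms(1,3) sub by (simp add: test_fun_def)
qed

lemma cgrad_eq_0_outside:
  assumes "closed K" "!!x. x \<notin> K ==> \<phi> x = 0" "x \<notin> K"
  shows "cgrad \<phi> x = 0"
proof (rule cgrad_eqI)
  have "((%x. 0) has_derivative (%h. 0)) (at x)" by simp
  then have "(\<phi> has_derivative (%h. 0)) (at x)"
    by (rule has_derivative_transform_within_open[where s = "- K"]) (use assms in auto)
  then show "(\<phi> has_derivative (%h. 0 \<bullet> h)) (at x)" by simp
qed

lemma test_fun_supp:
  assumes "test_fun U \<phi>"
  shows "\<exists>K. smooth_fun \<phi> \<and> compact K \<and> K \<subseteq> U \<and> (\<forall>x. x \<notin> K \<longrightarrow> \<phi> x = 0 \<and> cgrad \<phi> x = 0)"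
proof -
  let ?K = "closure {x. \<phi> x \<noteq> 0}"
  have z: "x \<notin> ?K ==> \<phi> x = 0" for x using closure_subset[of "{x. \<phi> x \<noteq> 0}"] by auto
  have "x \<notin> ?K ==> cgrad \<phi> x = 0" for x
    by (rule cgrad_eq_0_outside[OF closed_closure z])
  then have "\<forall>x. x \<notin> ?K \<longrightarrow> \<phi> x = 0 \<and> cgrad \<phi> x = 0" using z by blast
  then show ?thesis using assms unfolding test_fun_def by (intro exI[of _ ?K]) blast
qed

lemma test_smooth: "test_fun U \<phi> ==> smooth_fun \<phi>"
  by (simp add: test_fun_def)

lemma test_mult_smooth:
  assumes "test_fun U \<phi>" "smooth_fun \<psi>"
  shows "test_fun U (%x. \<phi> x * \<psi> x)"
proof -
  obtain K where "smooth_fun \<phi>" "compact K" "K \<subseteq> U" "!!x. x \<notin> K ==> \<phi> x = 0" using test_fun_supp[OF assms(1)] by blast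
  then show ?thesis by (intro test_funI[of _ K] smooth_mult assms) auto
qed

lemma test_add:
  assumes "test_fun U \<phi>" "test_fun U \<psi>"
  shows "test_fun U (%x. \<phi> x + \<psi> x)"
proof -
  obtain K where "compact K" "K \<subseteq> U" "!!x. x \<notin> K ==> \<phi> x = 0" using test_fun_supp[OF assms(1)] by blast
  moreover obtain L where "compact L" "L \<subseteq> U" "!!x. x \<notin> L ==> \<psi> x = 0" using test_fun_supp[OF assms(2)] by blast
  ultimately show ?thesis
    by (intro test_funI[of _ "K \<union> L"] smooth_add test_smooth[OF assms(1)] test_smooth[OF assms(2)] compact_Un) auto
qed

lemma test_scale: "test_fun U \<phi> ==> test_fun U (%x. c * \<phi> x)"
  using test_mult_smooth[OF _ smooth_const[of c]] by (simp add: mult.commute)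

lemma test_diff: "test_fun U \<phi> ==> test_fun U \<psi> ==> test_fun U (%x. \<phi> x - \<psi> x)"
  using test_add[OF _ test_scale[of U \<psi> "-1"]] by fastforce

lemma test_zero: "test_fun U (%x. 0)"
  by (rule test_funI[of _ "{}"]) (auto intro: smooth_const)

lemma test_sum: "finite I ==> (!!i. i \<in> I ==> test_fun U (f i)) ==> test_fun U (%x. \<Sum>i\<in>I. f i x)"
  by (induction I rule: finite_induct) (auto intro: test_zero test_add)

lemma test_cgrad: "test_fun U \<phi> ==> (\<phi> has_derivative (%h. cgrad \<phi> x \<bullet> h)) (at x)"
  by (rule has_derivative_cgrad) (auto intro: smooth_imp_differentiable test_smooth)

lemma smooth_has_cgrad: "smooth_fun \<phi> ==> (\<phi> has_derivative (%h. cgrad \<phi> x \<bullet> h)) (at x)"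
  by (rule has_derivative_cgrad) (auto intro: smooth_imp_differentiable)

lemma cgrad_add: "smooth_fun \<phi> ==> smooth_fun \<psi> ==> cgrad (%x. \<phi> x + \<psi> x) x = cgrad \<phi> x + cgrad \<psi> x"
  by (rule cgrad_eqI) (auto intro!: derivative_eq_intros smooth_has_cgrad simp: inner_add_left)

lemma cgrad_diff: "smooth_fun \<phi> ==> smooth_fun \<psi> ==> cgrad (%x. \<phi> x - \<psi> x) x = cgrad \<phi> x - cgrad \<psi> x"
  by (rule cgrad_eqI) (auto intro!: derivative_eq_intros smooth_has_cgrad simp: inner_diff_left)

lemma cgrad_scale: "smooth_fun \<phi> ==> cgrad (%x. c * \<phi> x) x = c *\<^sub>R cgrad \<phi> x"
  by (rule cgrad_eqI) (auto intro!: derivative_eq_intros smooth_has_cgrad)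

lemma cgrad_mult: "smooth_fun \<phi> ==> smooth_fun \<psi> ==>
    cgrad (%x. \<phi> x * \<psi> x) x = \<phi> x *\<^sub>R cgrad \<psi> x + \<psi> x *\<^sub>R cgrad \<phi> x"
  by (rule cgrad_eqI) (auto intro!: derivative_eq_intros smooth_has_cgrad simp: inner_add_left)

lemma cgrad_chain:
  assumes "smooth_fun \<phi>" "(h has_real_derivative d) (at (\<phi> x))"
  shows "cgrad (%x. h (\<phi> x)) x = d *\<^sub>R cgrad \<phi> x"
  using has_derivative_compose[OF smooth_has_cgrad[OF assms(1), of x] assms(2)[unfolded has_field_derivative_def]]
  by (intro cgrad_eqI) simp

lemma test_continuous: "test_fun U \<phi> ==> continuous_on S \<phi>"
  by (auto intro: smooth_imp_continuous test_smooth)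

lemma test_cgrad_continuous: "test_fun U \<phi> ==> continuous_on S (cgrad \<phi>)"
  by (auto intro: smooth_cgrad_continuous test_smooth)

section \<open>Measurability, integrability and bounds for test functions\<close>

lemma continuous_measurable_lebesgue:
  fixes h :: "'n::euclidean_space => 'b::topological_space"
  assumes "continuous_on UNIV h"
  shows "h \<in> Lmeas"
  using measurable_completion[of h lborel borel] borel_measurable_continuous_onI[OF assms] by simp

lemma test_meas:
  "test_fun U \<phi> ==> \<phi> \<in> Lmeas"
  "test_fun U \<phi> ==> cgrad \<phi> \<in> Lmeas"
  by (auto intro!: continuous_measurable_lebesgue test_continuous test_cgrad_continuous)

lemma integrable_continuous_compact:
  fixes h :: "'n::euclidean_space => 'b::{banach, second_countable_topology}"
  assumes "continuous_on UNIV h" "compact K" "!!x. x \<notin> K ==> h x = 0"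
  shows "integrable lborel h" "L1f h"
proof -
  have "integrable lborel (%x. indicator K x *\<^sub>R h x)"
    by (rule borel_integrable_compact[OF assms(2) continuous_on_subset[OF assms(1)]]) auto
  also have "(%x. indicator K x *\<^sub>R h x) = h" using assms(3) by (auto simp: indicator_def)
  finally show "integrable lborel h" .
  then show "L1f h" using integrable_completion[of h lborel] by auto
qed

lemma test_bounded:
  assumes "test_fun U \<phi>"
  obtains B where "B > 0" "!!x. \<bar>\<phi> x\<bar> <= B" "!!x. norm (cgrad \<phi> x) <= B"
proof -
  obtain K where K: "compact K" "!!x. x \<notin> K ==> \<phi> x = 0" "!!x. x \<notin> K ==> cgrad \<phi> x = 0"
    using test_fun_supp[OF assms] by blast
  obtain B1 where B1: "B1 > 0" "!!x. x \<in> K ==> norm (\<phi> x) <= B1"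
    using compact_imp_bounded[OF compact_continuous_image[OF test_continuous[OF assms] K(1)]]
    unfolding bounded_pos by blast
  obtain B2 where B2: "B2 > 0" "!!x. x \<in> K ==> norm (cgrad \<phi> x) <= B2"
    using compact_imp_bounded[OF compact_continuous_image[OF test_cgrad_continuous[OF assms] K(1)]]
    unfolding bounded_pos by blast
  show thesis
  proof (rule that[of "B1 + B2"])
    show "\<bar>\<phi> x\<bar> <= B1 + B2" for x using B1 B2 K(2)[of x] by (cases "x \<in> K") (force+)
    show "norm (cgrad \<phi> x) <= B1 + B2" for x using B1 B2 K(3)[of x] by (cases "x \<in> K") (force+)
  qed (use B1 B2 in auto)
qed

section \<open>Smooth absolute values, bumps and cutoffs\<close>

lemma test_sqrt:
  assumes "test_fun U \<phi>" "\<epsilon> > 0"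
  shows "test_fun U (%x. sqrt ((\<phi> x)^2 + \<epsilon>^2) - \<epsilon>)"
    and "cgrad (%x. sqrt ((\<phi> x)^2 + \<epsilon>^2) - \<epsilon>) x = (\<phi> x / sqrt ((\<phi> x)^2 + \<epsilon>^2)) *\<^sub>R cgrad \<phi> x"
proof -
  have pos: "(\<phi> x)^2 + \<epsilon>^2 > 0" for x using assms(2) by (simp add: add_nonneg_pos)
  obtain K where K: "smooth_fun \<phi>" "compact K" "K \<subseteq> U" "!!x. x \<notin> K ==> \<phi> x = 0"
    using test_fun_supp[OF assms(1)] by blast
  show "test_fun U (%x. sqrt ((\<phi> x)^2 + \<epsilon>^2) - \<epsilon>)"
    by (rule test_funI[OF _ K(2,3)])
       (use K assms pos in \<open>auto intro!: smooth_diff smooth_sqrt smooth_add smooth_power smooth_const\<close>)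
  show "cgrad (%x. sqrt ((\<phi> x)^2 + \<epsilon>^2) - \<epsilon>) x = (\<phi> x / sqrt ((\<phi> x)^2 + \<epsilon>^2)) *\<^sub>R cgrad \<phi> x"
    by (rule cgrad_chain[OF K(1), where h = "%s. sqrt (s^2 + \<epsilon>^2) - \<epsilon>"])
       (use pos[of x] in \<open>auto intro!: derivative_eq_intros simp: field_simps\<close>)
qed

text \<open>The bump is exp(-1/s) at s = r^2 - |x - c|^2. The squared distance is written in
  coordinates, since inner products with fixed vectors are the smooth building blocks at
  hand.\<close>

lemma exists_bump:
  fixes c :: "'n::euclidean_space"
  assumes "r > 0"
  obtains \<beta> where "smooth_fun \<beta>" "!!x. 0 <= \<beta> x" "!!x. \<beta> x <= 1" "!!x. \<beta> x > 0 \<longleftrightarrow> x \<in> ball c r"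
proof
  let ?q = "%x. r^2 - (\<Sum>i\<in>Basis. ((x - c) \<bullet> i)^2)"
  let ?\<beta> = "%x::'n. flat 1 (?q x)"
  show "smooth_fun ?\<beta>"
    unfolding inner_diff_left
    by (intro smooth_flat smooth_diff smooth_const smooth_sum smooth_power smooth_inner) simp
  have q: "?q x = r^2 - (dist c x)^2" for x
    unfolding dist_norm norm_minus_commute[of c] power2_norm_eq_inner euclidean_inner[of "x - c" "x - c"] by (simp add: power2_eq_square)
  show "0 <= ?\<beta> x" "?\<beta> x <= 1" for x by (auto simp: flat_def)
  have "?\<beta> x > 0 \<longleftrightarrow> ?q x > 0" for x by (auto simp: flat_def)
  moreover have "(dist c x)^2 < r^2 \<longleftrightarrow> dist c x < r" for x
    using assms power2_less_imp_less[of "dist c x" r] power_strict_mono[of "dist c x" r 2] by auto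
  ultimately show "?\<beta> x > 0 \<longleftrightarrow> x \<in> ball c r" for x
    unfolding q by simp
qed

lemma exists_test_bump:
  fixes c :: "'n::euclidean_space"
  assumes "r > 0" "cball c r \<subseteq> U"
  obtains \<beta> where "test_fun U \<beta>" "!!x. 0 <= \<beta> x" "!!x. \<beta> x <= 1" "!!x. \<beta> x > 0 \<longleftrightarrow> x \<in> ball c r"
proof -
  obtain \<beta> where b: "smooth_fun \<beta>" "!!x. 0 <= \<beta> x" "!!x. \<beta> x <= 1" "!!x. \<beta> x > 0 \<longleftrightarrow> x \<in> ball c r"
    using exists_bump[OF assms(1)] by metis
  have "test_fun U \<beta>"
  proof (rule test_funI[OF b(1) _ assms(2)])
    fix x assume "x \<notin> cball c r"
    then have "\<not> \<beta> x > 0" unfolding b(4) by auto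
    then show "\<beta> x = 0" using b(2)[of x] by linarith
  qed simp
  then show thesis using that b by blast
qed

text \<open>A bump on the doubled ball, divided by its minimum over the closed ball. A lower bound
  by 1 is all that the local estimates ask of a cutoff, so no plateau has to be built.\<close>

lemma exists_cutoff:
  fixes c :: "'n::euclidean_space"
  assumes "r > 0" "cball c (2 * r) \<subseteq> U"
  obtains \<eta> where "test_fun U \<eta>" "!!x. x \<in> ball c r ==> \<eta> x >= 1"
proof -
  obtain \<beta> where b: "test_fun U \<beta>" "!!x. 0 <= \<beta> x" "!!x. \<beta> x > 0 \<longleftrightarrow> x \<in> ball c (2 * r)"
    using exists_test_bump[of "2 * r" c U] assms by (metis mult_pos_pos zero_less_numeral)
  have "\<exists>x\<in>cball c r. \<forall>y\<in>cball c r. \<beta> x <= \<beta> y"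
    by (rule continuous_attains_inf) (use assms in \<open>auto intro: test_continuous[OF b(1)]\<close>)
  then obtain x where x: "x \<in> cball c r" "!!y. y \<in> cball c r ==> \<beta> x <= \<beta> y" by blast
  have p: "\<beta> x > 0" using x(1) b(3)[of x] assms by auto
  show thesis
  proof (rule that[of "%y. inverse (\<beta> x) * \<beta> y"])
    show "test_fun U (%y. inverse (\<beta> x) * \<beta> y)" by (rule test_scale[OF b(1)])
    show "1 <= inverse (\<beta> x) * \<beta> y" if "y \<in> ball c r" for y
      using x(2)[of y] p that by (simp add: field_simps)
  qed
qed

section \<open>Test functions detect positivity of a function on an open set\<close>

lemma open_eq_Union_balls:
  fixes W :: "'n::euclidean_space set"
  assumes "open W" "W \<noteq> {}"
  obtains c :: "nat => 'n" and r :: "nat => real" where "!!i. r i > 0" "!!i. cball (c i) (2 * r i) \<subseteq> W" "W = (\<Union>i. ball (c i) (r i))"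
proof -
  \<comment> \<open>The doubled closed balls stay inside \<open>W\<close>, which leaves room for the
    cutoffs of \<open>exists_cutoff\<close>.\<close>
  define F where "F = (%(x, s). ball x s) ` {(x, s). s > 0 \<and> cball x (2 * s) \<subseteq> W}"
  have U: "\<Union> F = W"
  proof
    show "\<Union> F \<subseteq> W" unfolding F_def by (force simp: subset_iff)
    show "W \<subseteq> \<Union> F"
    proof
      fix x assume "x \<in> W"
      then obtain e where e: "e > 0" "cball x e \<subseteq> W" using assms(1) open_contains_cball by blast
      then have "ball x (e / 2) \<in> F" unfolding F_def by (intro image_eqI[of _ _ "(x, e / 2)"]) auto
      then show "x \<in> \<Union> F" using e by (intro UnionI) auto
    qed
  qed
  have "!!S. S \<in> F ==> open S" by (auto simp: F_def)
  then obtain F' where F': "F' \<subseteq> F" "countable F'" "\<Union> F' = \<Union> F" by (rule Lindelof)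
  have ne: "F' \<noteq> {}" using F'(3) U assms(2) by auto
  have "\<forall>i. \<exists>x s. s > 0 \<and> cball x (2 * s) \<subseteq> W \<and> from_nat_into F' i = ball x s"
  proof
    fix i
    have "from_nat_into F' i \<in> F" using from_nat_into[OF ne] F'(1) by blast
    then show "\<exists>x s. s > 0 \<and> cball x (2 * s) \<subseteq> W \<and> from_nat_into F' i = ball x s"
      unfolding F_def by auto
  qed
  then obtain c r where cr: "!!i. r i > 0 \<and> cball (c i) (2 * r i) \<subseteq> W \<and> from_nat_into F' i = ball (c i) (r i)" by metis
  have "W = (\<Union>i. from_nat_into F' i)"
    using range_from_nat_into[OF ne F'(2)] F'(3) U by simp
  then show thesis using cr by (intro that[of r c]) auto
qed

text \<open>The indicator of an open set is a bounded limit of test functions, so the sign passes to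
  the integral over the set by dominated convergence, once for a finite union of balls and once for
  the union of all. The limit takes the values 0 and 1 only, hence any exponent q > 0 is
  harmless.\<close>

lemma test_integral_nonpos_imp_open:
  fixes h :: "'n::euclidean_space => real"
  assumes U: "open U" and h: "L1f (%x. indicator U x * h x)" and q: "q > 0"
    and np: "!!\<phi>. test_fun U \<phi> ==> (!!x. 0 <= \<phi> x) ==> (LI x. h x * \<phi> x powr q) <= 0"
    and W: "open W" "W \<subseteq> U"
  shows "(LI x. indicator W x * h x) <= 0"
proof (cases "W = {}")
  case False
  obtain c :: "nat => 'n" and r :: "nat => real" where cr: "!!i. r i > 0" "!!i. cball (c i) (2 * r i) \<subseteq> W" "W = (\<Union>i. ball (c i) (r i))"
    using open_eq_Union_balls[OF W(1) False] by metis
  have "\<exists>\<beta>. test_fun W \<beta> \<and> (\<forall>x. 0 <= \<beta> x \<and> \<beta> x <= 1 \<and> (\<beta> x > 0 \<longleftrightarrow> x \<in> ball (c i) (r i)))" for i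
  proof -
    have "cball (c i) (r i) \<subseteq> W" using cr(1)[of i] cr(2)[of i] by (force simp: subset_iff)
    then show ?thesis using exists_test_bump[OF cr(1)] by metis
  qed
  then obtain \<beta> where \<beta>: "!!i. test_fun W (\<beta> i)" "!!i x. 0 <= \<beta> i x" "!!i x. \<beta> i x <= 1"
      "!!i x. \<beta> i x > 0 \<longleftrightarrow> x \<in> ball (c i) (r i)" by metis
  \<comment> \<open>An average, so that values stay in [0,1]; it is positive exactly on the first n
    balls.\<close>
  define b where "b n x = (\<Sum>i<n. \<beta> i x) / real n" for n x
  have b01: "0 <= b n x" "b n x <= 1" for n x
  proof -
    show "0 <= b n x" by (simp add: b_def sum_nonneg \<beta>)
    have "(\<Sum>i<n. \<beta> i x) <= (\<Sum>i<n. 1)" by (rule sum_mono) (rule \<beta>)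
    then show "b n x <= 1" by (cases "n = 0") (auto simp: b_def field_simps)
  qed
  have bt: "test_fun W (b n)" for n
    using test_scale[OF test_sum[of "{..<n}" W \<beta>], of "1 / real n"] \<beta>(1) by (simp add: b_def[abs_def])
  have bpos: "b n x > 0 \<longleftrightarrow> x \<in> (\<Union>i<n. ball (c i) (r i))" for n x
  proof -
    have "b n x = 0 \<longleftrightarrow> (\<forall>i<n. \<beta> i x = 0)"
      using \<beta>(2) by (cases "n = 0") (auto simp: b_def sum_nonneg_eq_0_iff)
    moreover have "\<beta> i x = 0 \<longleftrightarrow> x \<notin> ball (c i) (r i)" for i
      using \<beta>(4)[of i x] \<beta>(2)[of i x] by linarith
    ultimately have "b n x = 0 \<longleftrightarrow> x \<notin> (\<Union>i<n. ball (c i) (r i))" by auto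
    then show ?thesis using b01(1)[of n x] by linarith
  qed
  have hm: "(%x. indicator U x * h x) \<in> Lmeas" using h by auto
  have step: "(LI x. indicator (\<Union>i<n. ball (c i) (r i)) x * h x) <= 0" for n
  proof -
    \<comment> \<open>A polynomial in \<open>b n\<close> without constant term, hence with the same
      compact support; as k grows it tends to 1 wherever \<open>b n\<close> is positive.\<close>
    define \<phi> where "\<phi> k x = 1 - (1 - b n x) ^ k" for k x
    have p01: "0 <= \<phi> k x" "\<phi> k x <= 1" for k x
      using b01[of n x] by (auto simp: \<phi>_def power_le_one)
    obtain K where K: "smooth_fun (b n)" "compact K" "K \<subseteq> W" "!!x. x \<notin> K ==> b n x = 0"
      using test_fun_supp[OF bt[of n]] by blast
    have pt: "test_fun W (\<phi> k)" for k unfolding \<phi>_def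
      by (rule test_funI[OF _ K(2,3)]) (use K in \<open>auto intro!: smooth_diff smooth_power smooth_const\<close>)
    have p0: "\<phi> k x = 0" if "x \<notin> U" for k x
    proof -
      have "x \<notin> K" using that K(3) W(2) by blast
      then show ?thesis using K(4)[of x] by (simp add: \<phi>_def)
    qed
    have eq: "h x * \<phi> k x powr q = (indicator U x * h x) * \<phi> k x powr q" for k x
      using p0[of x k] by (auto simp: indicator_def)
    have [measurable]: "\<phi> k \<in> Lmeas" for k by (rule test_meas[OF pt])
    have "(%k. LI x. (indicator U x * h x) * \<phi> k x powr q) ---->
        (LI x. indicator (\<Union>i<n. ball (c i) (r i)) x * h x)"
    proof (rule integral_dominated_convergence[where w = "%x. norm (indicator U x * h x)"])
      show "(%x. indicator (\<Union>i<n. ball (c i) (r i)) x * h x) \<in> Lmeas"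
      proof -
        have sub: "(\<Union>i<n. ball (c i) (r i)) \<subseteq> U" using W cr(3) by blast
        have "(%x. indicator (\<Union>i<n. ball (c i) (r i)) x * (indicator U x * h x)) \<in> Lmeas"
          by (intro borel_measurable_times borel_measurable_indicator hm) auto
        also have "(%x. indicator (\<Union>i<n. ball (c i) (r i)) x * (indicator U x * h x)) = (%x. indicator (\<Union>i<n. ball (c i) (r i)) x * h x)"
        proof (rule ext)
          fix x
          show "indicator (\<Union>i<n. ball (c i) (r i)) x * (indicator U x * h x) = indicator (\<Union>i<n. ball (c i) (r i)) x * h x"
          proof (cases "x \<in> (\<Union>i<n. ball (c i) (r i))")
            case True
            then have "x \<in> U" using sub by blast
            then show ?thesis by simp
          qed simp
        qed
        finally show ?thesis .
      qed
      show "(%x. indicator U x * h x * \<phi> k x powr q) \<in> Lmeas" for k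
        using hm by measurable
      show "L1f (%x. norm (indicator U x * h x))" using h by (rule integrable_norm)
      show "AE x in lebesgue. norm (indicator U x * h x * \<phi> k x powr q) <= norm (indicator U x * h x)" for k
        using p01 q by (intro AE_I2) (auto simp: abs_mult indicator_def intro!: mult_left_le powr_le1)
      show "AE x in lebesgue. (%k. indicator U x * h x * \<phi> k x powr q) ----> indicator (\<Union>i<n. ball (c i) (r i)) x * h x"
      proof (rule AE_I2)
        fix x
        show "(%k. indicator U x * h x * \<phi> k x powr q) ----> indicator (\<Union>i<n. ball (c i) (r i)) x * h x"
        proof (cases "x \<in> (\<Union>i<n. ball (c i) (r i))")
          case True
          then have "0 < b n x" "b n x <= 1" using bpos b01 by auto
          then have "(%k. (1 - b n x) ^ k) ----> 0" by (intro LIMSEQ_realpow_zero) auto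
          then have "(%k. \<phi> k x) ----> 1 - 0" unfolding \<phi>_def by (intro tendsto_diff tendsto_const)
          then have "(%k. indicator U x * h x * \<phi> k x powr q) ----> indicator U x * h x * (1 - 0) powr q"
            by (intro tendsto_intros) auto
          moreover have "x \<in> U" using True cr(3) W by blast
          ultimately show ?thesis using True by simp
        next
          case False
          then have "b n x = 0" using bpos[of n x] b01(1)[of n x] by linarith
          then show ?thesis using False q by (simp add: \<phi>_def)
        qed
      qed
    qed
    moreover have "(LI x. (indicator U x * h x) * \<phi> k x powr q) <= 0" for k
      using np[OF test_fun_mono[OF pt W(2)] p01(1), of k] unfolding eq by simp
    ultimately show ?thesis by (meson LIMSEQ_le_const2)
  qed
  have "(%n. LI x. indicator (\<Union>i<n. ball (c i) (r i)) x * (indicator U x * h x)) ---->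
      (LI x. indicator W x * (indicator U x * h x))"
  proof (rule integral_dominated_convergence[where w = "%x. norm (indicator U x * h x)"])
    show "(%x. indicator W x * (indicator U x * h x)) \<in> Lmeas"
      by (intro borel_measurable_times borel_measurable_indicator hm) (use W in auto)
    show "(%x. indicator (\<Union>i<n. ball (c i) (r i)) x * (indicator U x * h x)) \<in> Lmeas" for n
      by (intro borel_measurable_times borel_measurable_indicator hm) auto
    show "L1f (%x. norm (indicator U x * h x))" using h by (rule integrable_norm)
    show "AE x in lebesgue. (%n. indicator (\<Union>i<n. ball (c i) (r i)) x * (indicator U x * h x)) ----> indicator W x * (indicator U x * h x)"
    proof (intro AE_I2 tendsto_mult_right)
      fix x
      show "(%n. indicator (\<Union>i<n. ball (c i) (r i)) x :: real) ----> indicator W x"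
        unfolding cr(3) by (rule LIMSEQ_indicator_UN)
    qed
  qed (auto simp: indicator_def)
  moreover have "indicator (\<Union>i<n. ball (c i) (r i)) x * (indicator U x * h x) = indicator (\<Union>i<n. ball (c i) (r i)) x * h x" for n x
  proof (cases "x \<in> (\<Union>i<n. ball (c i) (r i))")
    case True
    then have "x \<in> U" using cr(3) W by blast
    then show ?thesis by simp
  qed simp
  moreover have "indicator W x * (indicator U x * h x) = indicator W x * h x" for x
    using W(2) by (auto simp: indicator_def)
  ultimately show ?thesis using step by (simp add: LIMSEQ_le_const2)
qed simp

text \<open>Otherwise h has nonpositive integral over every open subset of \<open>U\<close>. By
  outer regularity the set where h > 0 agrees, up to a null set, with a decreasing intersection of
  such open subsets, and so h would have nonpositive integral over it.\<close>

lemma exists_test_integral_pos: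
  fixes h :: "'n::euclidean_space => real"
  assumes U: "open U" and h: "L1f (%x. indicator U x * h x)" and q: "q > 0"
    and pos: "emeasure lebesgue {x\<in>U. h x > 0} > 0"
  obtains \<phi> where "test_fun U \<phi>" "!!x. 0 <= \<phi> x" "(LI x. h x * \<phi> x powr q) > 0"
proof (rule ccontr)
  assume "\<not> thesis"
  then have np: "!!\<phi>. test_fun U \<phi> ==> (!!x. 0 <= \<phi> x) ==> (LI x. h x * \<phi> x powr q) <= 0"
    using that by (meson not_le)
  define H where "H = (%x. indicator U x * h x)"
  have hm [measurable]: "H \<in> Lmeas" using h by (auto simp: H_def)
  define E where "E = {x\<in>U. h x > 0}"
  have Eeq: "E = {x \<in> space lebesgue. H x > 0}" by (auto simp: E_def H_def indicator_def split: if_splits)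
  have E [measurable]: "E \<in> sets lebesgue" unfolding Eeq by measurable
  have "\<exists>T. open T \<and> E \<subseteq> T \<and> T - E \<in> lmeasurable \<and> emeasure lebesgue (T - E) < ennreal (1 / real (Suc n))" for n
    using sets_lebesgue_outer_open[OF E, of "1 / real (Suc n)"] by (metis of_nat_0_less_iff zero_less_Suc zero_less_divide_1_iff)
  then obtain T where T: "!!n. open (T n)" "!!n. E \<subseteq> T n" "!!n. emeasure lebesgue (T n - E) < ennreal (1 / real (Suc n))"
    by metis
  \<comment> \<open>Finite intersections of the outer approximations make the open sets decrease, as
    dominated convergence along indicators requires.\<close>
  define O' where "O' n = U \<inter> (\<Inter>k\<le>n. T k)" for n
  have O': "open (O' n)" "O' n \<subseteq> U" "E \<subseteq> O' n" for n
    using T U by (auto simp: O'_def E_def intro!: open_INT)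
  have le: "(LI x. indicator (O' n) x * H x) <= 0" for n
  proof -
    have "indicator (O' n) x * H x = indicator (O' n) x * h x" for x using O'(2)[of n] by (auto simp: H_def indicator_def)
    then have "(%x. indicator (O' n) x * H x) = (%x. indicator (O' n) x * h x)" by blast
    then show ?thesis using test_integral_nonpos_imp_open[OF U h q np O'(1,2)] by metis
  qed
  define I where "I = (\<Inter>n. O' n)"
  have [measurable]: "O' n \<in> sets lebesgue" for n using O'(1) by auto
  then have [measurable]: "I \<in> sets lebesgue" unfolding I_def by auto
  have "(%n. LI x. indicator (O' n) x * H x) ----> (LI x. indicator I x * H x)"
  proof (rule integral_dominated_convergence[where w = "%x. norm (H x)"])
    show "L1f (%x. norm (H x))" using h by (simp add: H_def integrable_norm)
    show "AE x in lebesgue. (%n. indicator (O' n) x * H x) ----> indicator I x * H x"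
    proof (intro AE_I2 tendsto_mult_right)
      fix x
      have "decseq O'" by (auto simp: decseq_def O'_def)
      then show "(%n. indicator (O' n) x :: real) ----> indicator I x"
        unfolding I_def by (rule LIMSEQ_indicator_decseq)
    qed
  qed (auto simp: indicator_def)
  then have "(LI x. indicator I x * H x) <= 0" using le by (simp add: LIMSEQ_le_const2)
  moreover have "(LI x. indicator I x * H x) = (LI x. indicator E x * H x)"
  proof (rule integral_cong_AE)
    have "emeasure lebesgue (I - E) <= 0"
    proof (rule ennreal_le_epsilon)
      fix e :: real assume "e > 0"
      then obtain n where n: "1 / real (Suc n) < e" using reals_Archimedean by (auto simp: inverse_eq_divide)
      have [measurable]: "T n \<in> sets lebesgue" using T(1) by auto
      have "emeasure lebesgue (I - E) <= emeasure lebesgue (T n - E)"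
        by (rule emeasure_mono) (auto simp: I_def O'_def)
      also have "\<dots> <= ennreal (1 / real (Suc n))" using T(3)[of n] by simp
      also have "\<dots> <= ennreal e" using n by (intro ennreal_leI) simp
      finally show "emeasure lebesgue (I - E) <= 0 + ennreal e" by simp
    qed
    then have "I - E \<in> null_sets lebesgue" by (simp add: null_sets_def)
    then show "AE x in lebesgue. indicator I x * H x = indicator E x * H x"
    proof (rule AE_I')
      show "{x \<in> space lebesgue. indicator I x * H x \<noteq> indicator E x * H x} \<subseteq> I - E"
        using O'(3) by (auto simp: I_def indicator_def)
    qed
  qed measurable
  ultimately have "(LI x. indicator E x * H x) <= 0" by simp
  moreover have nn: "0 <= indicator E x * H x" for x by (auto simp: Eeq indicator_def)
  moreover have int: "L1f (%x. indicator E x * H x)"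
    using integrable_mult_indicator[OF E, of H] h by (simp add: H_def)
  ultimately have "AE x in lebesgue. indicator E x * H x = 0"
    using integral_nonneg_eq_0_iff_AE[OF int] by (simp add: order_antisym)
  then have "AE x in lebesgue. x \<notin> E" by eventually_elim (auto simp: Eeq indicator_def)
  then have "E \<in> null_sets lebesgue" by (simp add: AE_iff_null_sets[OF E])
  then show False using pos by (auto simp: E_def)
qed

section \<open>The Sobolev inequality\<close>

text \<open>Compactly supported C^1 functions together with their gradient. The truncations in the
  proof of Sobolev's inequality are only C^1, so test functions would be too small a class.\<close>

definition C1c :: "('n::euclidean_space => real) => ('n => 'n) => bool" where
  "C1c v G \<longleftrightarrow> (\<forall>x. (v has_derivative (%h. G x \<bullet> h)) (at x)) \<and> continuous_on UNIV G \<and>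
     (\<exists>K. compact K \<and> (\<forall>x. x \<notin> K \<longrightarrow> v x = 0 \<and> G x = 0))"

lemma C1c_test: "test_fun U \<phi> ==> C1c \<phi> (cgrad \<phi>)"
  using test_fun_supp[of U \<phi>] unfolding C1c_def
  by (auto intro: test_cgrad test_cgrad_continuous)

lemma C1_continuous: "(!!x. (v has_derivative (%h. G x \<bullet> h)) (at x)) ==> continuous_on S v"
  by (rule continuous_at_imp_continuous_on) (blast intro: has_derivative_continuous)

text \<open>The increment is the mean over [0,1] of the directional derivative along the segment,
  and the square of a mean is at most the mean of the squares.\<close>

lemma segment_ineq:
  fixes v :: "'n::euclidean_space => real"
  assumes d: "!!x. (v has_derivative (%h. G x \<bullet> h)) (at x)" and c: "continuous_on UNIV G"
  shows "ennreal ((v y - v x)^2) <= (\<integral>\<^sup>+t\<in>{0..1}. ennreal ((norm (y - x))^2 * (norm (G (x + t *\<^sub>R (y - x))))^2) \<partial>lborel)"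
proof -
  define w where "w t = v (x + t *\<^sub>R (y - x))" for t
  define g where "g t = G (x + t *\<^sub>R (y - x)) \<bullet> (y - x)" for t
  define I where "I = v y - v x"
  have "(w has_derivative (%s. G (x + t *\<^sub>R (y - x)) \<bullet> (s *\<^sub>R (y - x)))) (at t)" for t
    unfolding w_def by (rule has_derivative_compose[OF _ d]) (auto intro!: derivative_eq_intros)
  then have w: "(w has_real_derivative g t) (at t)" for t
    by (simp add: has_field_derivative_def g_def mult_commute_abs)
  have gc: "continuous_on UNIV g"
    unfolding g_def by (intro continuous_intros continuous_on_compose2[OF c]) auto
  then have gi: "isCont g t" for t by (simp add: continuous_on_eq_continuous_at)
  have i1: "(\<integral>t. g t * indicator {0..1} t \<partial>lborel) = I"
    using integral_FTC_Icc_real[of 0 1 w g] w gi by (simp add: w_def I_def)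
  have int1: "integrable lborel (%t. g t * indicator {0..1} t)"
    by (rule borel_integrable_atLeastAtMost) (rule gi)
  have int2: "integrable lborel (%t. (g t)^2 * indicator {0..1} t)"
    by (rule borel_integrable_atLeastAtMost) (intro continuous_intros gi)
  have int3: "integrable lborel (indicator {0..1} :: real => real)"
    by (rule integrable_real_indicator) auto
  \<comment> \<open>Nonnegativity of the variance of g replaces the Cauchy-Schwarz
    inequality.\<close>
  have "0 <= (\<integral>t. (g t - I)^2 * indicator {0..1} t \<partial>lborel)" by (rule integral_nonneg_AE) simp
  also have "(%t. (g t - I)^2 * indicator {0..1} t) =
     (%t. (g t)^2 * indicator {0..1} t - 2 * I * (g t * indicator {0..1} t) + I^2 * indicator {0..1} t)"
    by (auto simp: power2_diff algebra_simps)
  also have "(\<integral>t. \<dots> t \<partial>lborel) = (\<integral>t. (g t)^2 * indicator {0..1} t \<partial>lborel) - 2 * I * I + I^2"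
    using int1 int2 int3 i1 by simp
  finally have "I^2 <= (\<integral>t. (g t)^2 * indicator {0..1} t \<partial>lborel)" by (simp add: power2_eq_square)
  then have "ennreal (I^2) <= ennreal (\<integral>t. (g t)^2 * indicator {0..1} t \<partial>lborel)" by (rule ennreal_leI)
  also have "\<dots> = (\<integral>\<^sup>+t. ennreal ((g t)^2 * indicator {0..1} t) \<partial>lborel)"
    by (rule nn_integral_eq_integral[symmetric]) (use int2 in auto)
  also have "\<dots> <= (\<integral>\<^sup>+t\<in>{0..1}. ennreal ((norm (y - x))^2 * (norm (G (x + t *\<^sub>R (y - x))))^2) \<partial>lborel)"
  proof (rule nn_integral_mono)
    fix t
    have "\<bar>g t\<bar> <= norm (G (x + t *\<^sub>R (y - x))) * norm (y - x)" unfolding g_def by (rule Cauchy_Schwarz_ineq2)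
    then have "(g t)^2 <= (norm (y - x))^2 * (norm (G (x + t *\<^sub>R (y - x))))^2"
      using power_mono[of "\<bar>g t\<bar>" "norm (G (x + t *\<^sub>R (y - x))) * norm (y - x)" 2]
      by (simp add: power_mult_distrib mult.commute)
    then show "ennreal ((g t)^2 * indicator {0..1} t) <= ennreal ((norm (y - x))^2 * (norm (G (x + t *\<^sub>R (y - x))))^2) * indicator {0..1} t"
      by (auto simp: indicator_def intro!: ennreal_leI)
  qed
  finally show ?thesis by (simp add: I_def)
qed

section \<open>Translation estimates and the Faber-Krahn inequality\<close>

lemma nn_integral_lborel_shift:
  fixes f :: "'n::euclidean_space => ennreal"
  assumes "f \<in> borel_measurable borel"
  shows "(\<integral>\<^sup>+x. f (a + x) \<partial>lborel) = (\<integral>\<^sup>+x. f x \<partial>lborel)"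
proof -
  have "(\<integral>\<^sup>+x. f x \<partial>lborel) = (\<integral>\<^sup>+x. f x \<partial>distr lborel borel ((+) a))"
    by (simp add: lborel_distr_plus)
  also have "\<dots> = (\<integral>\<^sup>+x. f (a + x) \<partial>lborel)"
    by (rule nn_integral_distr) (use assms in auto)
  finally show ?thesis by simp
qed

text \<open>After exchanging the integrals over x and t, each t contributes the full gradient
  integral, because a shift by t h does not change it.\<close>

lemma translation_ineq:
  fixes v :: "'n::euclidean_space => real"
  assumes d: "!!x. (v has_derivative (%h. G x \<bullet> h)) (at x)" and c: "continuous_on UNIV G"
  shows "(\<integral>\<^sup>+x. ennreal ((v (x + h) - v x)^2) \<partial>lborel) <= ennreal ((norm h)^2) * (\<integral>\<^sup>+x. ennreal ((norm (G x))^2) \<partial>lborel)"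
proof -
  have [measurable]: "G \<in> borel_measurable borel" by (rule borel_measurable_continuous_onI[OF c])
  have meas: "(%(t, x). ennreal ((norm h)^2 * (norm (G (x + t *\<^sub>R h)))^2) * indicator {0..1} t)
      \<in> borel_measurable (lborel \<Otimes>\<^sub>M lborel)" (is "case_prod ?F \<in> _")
    by measurable
  have "(\<integral>\<^sup>+x. ennreal ((v (x + h) - v x)^2) \<partial>lborel) \<le>
      (\<integral>\<^sup>+x. (\<integral>\<^sup>+t\<in>{0..1}. ennreal ((norm h)^2 * (norm (G (x + t *\<^sub>R h)))^2) \<partial>lborel) \<partial>lborel)"
  proof (rule nn_integral_mono)
    fix x
    show "ennreal ((v (x + h) - v x)^2) <= (\<integral>\<^sup>+t\<in>{0..1}. ennreal ((norm h)^2 * (norm (G (x + t *\<^sub>R h)))^2) \<partial>lborel)"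
      using segment_ineq[OF d c, of "x + h" x] by simp
  qed
  also have "\<dots> = (\<integral>\<^sup>+t. (\<integral>\<^sup>+x. ennreal ((norm h)^2 * (norm (G (x + t *\<^sub>R h)))^2) * indicator {0..1} t \<partial>lborel) \<partial>lborel)"
    by (rule lborel_pair.Fubini'[OF meas])
  also have "\<dots> = (\<integral>\<^sup>+t. (ennreal ((norm h)^2) * (\<integral>\<^sup>+x. ennreal ((norm (G x))^2) \<partial>lborel)) * indicator {0..1::real} t \<partial>lborel)"
  proof (rule nn_integral_cong)
    fix t :: real
    have "(\<integral>\<^sup>+x. ennreal ((norm h)^2 * (norm (G (x + t *\<^sub>R h)))^2) * indicator {0..1} t \<partial>lborel)
       = ennreal ((norm h)^2) * (\<integral>\<^sup>+x. ennreal ((norm (G (x + t *\<^sub>R h)))^2) \<partial>lborel) * indicator {0..1} t"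
      by (simp add: ennreal_mult nn_integral_cmult nn_integral_multc)
    also have "(\<integral>\<^sup>+x. ennreal ((norm (G (x + t *\<^sub>R h)))^2) \<partial>lborel) = (\<integral>\<^sup>+x. ennreal ((norm (G x))^2) \<partial>lborel)"
      using nn_integral_lborel_shift[of "%x. ennreal ((norm (G x))^2)" "t *\<^sub>R h"] by (simp add: add.commute)
    finally show "(\<integral>\<^sup>+x. ennreal ((norm h)^2 * (norm (G (x + t *\<^sub>R h)))^2) * indicator {0..1} t \<partial>lborel)
       = ennreal ((norm h)^2) * (\<integral>\<^sup>+x. ennreal ((norm (G x))^2) \<partial>lborel) * indicator {0..1} t" .
  qed
  also have "\<dots> = ennreal ((norm h)^2) * (\<integral>\<^sup>+x. ennreal ((norm (G x))^2) \<partial>lborel)"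
    by (subst nn_integral_cmult) (auto simp: nn_integral_indicator)
  finally show ?thesis .
qed

lemma C1c_facts:
  assumes "C1c v G"
  shows "!!x. (v has_derivative (%h. G x \<bullet> h)) (at x)" "continuous_on UNIV G" "continuous_on UNIV v"
    "v \<in> borel_measurable borel" "G \<in> borel_measurable borel"
    "integrable lborel (%x. (v x)^2)" "integrable lborel (%x. (norm (G x))^2)" "integrable lborel (%x. \<bar>v x\<bar>)"
    "integrable lborel (%x. v x * v (x + h))"
proof -
  obtain K where K: "compact K" "!!x. x \<notin> K ==> v x = 0 \<and> G x = 0" using assms by (auto simp: C1c_def)
  show d: "!!x. (v has_derivative (%h. G x \<bullet> h)) (at x)" and g: "continuous_on UNIV G" using assms by (auto simp: C1c_def)
  show c: "continuous_on UNIV v" by (rule C1_continuous[OF d])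
  show "v \<in> borel_measurable borel" "G \<in> borel_measurable borel" by (auto intro: borel_measurable_continuous_onI c g)
  show "integrable lborel (%x. (v x)^2)" "integrable lborel (%x. (norm (G x))^2)" "integrable lborel (%x. \<bar>v x\<bar>)"
    "integrable lborel (%x. v x * v (x + h))"
    by (rule integrable_continuous_compact(1)[OF _ K(1)]; use K(2) in \<open>auto intro!: continuous_intros c g continuous_on_compose2[OF c]\<close>)+
qed

text \<open>The factor for which \<open>fk_const\<close> times m^(2/N) is the squared radius of the
  ball of measure 2m.\<close>

definition fk_const :: "'n::euclidean_space itself => real" where
  "fk_const _ = (2 / unit_ball_vol (real DIM('n))) powr (2 / real DIM('n))"

lemma fk_const_nonneg: "fk_const x >= 0"
  by (simp add: fk_const_def)

text \<open>Averaging the translation estimate over a ball of twice the measure of the support turns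
  the cross term into at most half of the \<open>L\<^sup>2\<close> norm.\<close>
lemma faber_krahn:
  fixes v :: "'n::euclidean_space => real"
  assumes v: "C1c v G"
  shows "(LINT x|lborel. (v x)^2) \<le>
     fk_const TYPE('n) * measure lborel {x. v x \<noteq> 0} powr (2 / real DIM('n)) * (LINT x|lborel. (norm (G x))^2)"
proof -
  note [measurable] = C1c_facts(4,5)[OF v]
  define X where "X = (LINT x|lborel. (v x)^2)"
  define D where "D = (LINT x|lborel. (norm (G x))^2)"
  define E where "E = {x. v x \<noteq> 0}"
  define m where "m = measure lborel E"
  define \<omega> where "\<omega> = unit_ball_vol (real DIM('n))"
  have \<omega>: "\<omega> > 0" by (simp add: \<omega>_def)
  have E [measurable]: "E \<in> sets borel" unfolding E_def by measurable
  obtain K where K: "compact K" "!!x. x \<notin> K ==> v x = 0" using v by (auto simp: C1c_def)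
  have "emeasure lborel E <= emeasure lborel K"
    by (rule emeasure_mono) (use K in \<open>auto simp: E_def compact_imp_closed\<close>)
  also have "\<dots> < \<infinity>" using emeasure_compact_finite[OF K(1)] by simp
  finally have Em: "emeasure lborel E = ennreal m" by (simp add: m_def emeasure_eq_ennreal_measure)
  have m0: "m >= 0" by (simp add: m_def)
  have D0: "D >= 0" "X >= 0" by (auto simp: D_def X_def)
  have nX: "(\<integral>\<^sup>+x. ennreal ((v x)^2) \<partial>lborel) = ennreal X"
    unfolding X_def by (rule nn_integral_eq_integral) (use C1c_facts[OF v] in auto)
  have nD: "(\<integral>\<^sup>+x. ennreal ((norm (G x))^2) \<partial>lborel) = ennreal D"
    unfolding D_def by (rule nn_integral_eq_integral) (use C1c_facts[OF v] in auto)
  define r where "r = (2 * m / \<omega>) powr (1 / real DIM('n))"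
  have r0: "r >= 0" by (simp add: r_def)
  have rN: "\<omega> * r ^ DIM('n) = 2 * m"
  proof (cases "m = 0")
    case False
    then have "r ^ DIM('n) = 2 * m / \<omega>" using \<omega> m0
      by (simp add: r_def powr_realpow[symmetric] powr_powr)
    then show ?thesis using \<omega> by simp
  qed (simp add: r_def)
  have r2: "r^2 = fk_const TYPE('n) * m powr (2 / real DIM('n))"
  proof -
    have "r^2 = (2 * m / \<omega>) powr (2 / real DIM('n))"
      using \<omega> m0 by (cases "m = 0") (auto simp: r_def powr_realpow[symmetric] powr_powr)
    also have "2 * m / \<omega> = (2 / \<omega>) * m" by simp
    also have "\<dots> powr (2 / real DIM('n)) = (2 / \<omega>) powr (2 / real DIM('n)) * m powr (2 / real DIM('n))"
      by (rule powr_mult)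
    finally show ?thesis by (simp add: fk_const_def \<omega>_def)
  qed
  have "X <= r^2 * D"
  proof (cases "m = 0")
    case True
    then have "emeasure lborel E = 0" using Em by simp
    then have "AE x in lborel. x \<notin> E" by (intro AE_not_in) (simp add: null_sets_def)
    then have "AE x in lborel. (v x)^2 = 0" by eventually_elim (simp add: E_def)
    then have "X = 0" unfolding X_def by (simp add: integral_eq_zero_AE)
    then show ?thesis using D0 by simp
  next
    case False
    with m0 have m: "m > 0" by simp
    define A where "A h = (\<integral>\<^sup>+x. ennreal (\<bar>v x\<bar> * \<bar>v (x + h)\<bar>) \<partial>lborel)" for h
    have A: "ennreal (2 * X - r^2 * D) <= 2 * A h" if h: "norm h <= r" for h
    proof -
      have sh: "(\<integral>\<^sup>+x. ennreal ((v (x + h))^2) \<partial>lborel) = ennreal X"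
        using nn_integral_lborel_shift[of "%x. ennreal ((v x)^2)" h] nX by (simp add: add.commute)
      have ih: "integrable lborel (%x. (v (x + h))^2)"
        by (rule integrableI_nonneg) (auto simp: sh)
      have Xh: "(LINT x|lborel. (v (x + h))^2) = X"
        using nn_integral_eq_integral[OF ih] sh D0 by (simp add: integral_nonneg_AE)
      have ix: "integrable lborel (%x. v x * v (x + h))" by (rule C1c_facts(9)[OF v])
      have eq: "(v (x + h) - v x)^2 = (v (x + h))^2 + (v x)^2 - 2 * (v x * v (x + h))" for x
        by (simp add: power2_diff)
      have i2: "integrable lborel (%x. (v (x + h) - v x)^2)"
        unfolding eq using ih ix C1c_facts(6)[OF v] by simp
      have "ennreal (LINT x|lborel. (v (x + h) - v x)^2) <= ennreal ((norm h)^2) * ennreal D"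
        using translation_ineq[OF C1c_facts(1,2)[OF v], of h] nn_integral_eq_integral[OF i2] nD by simp
      then have "(LINT x|lborel. (v (x + h) - v x)^2) <= (norm h)^2 * D"
        using D0 by (simp add: ennreal_mult[symmetric])
      also have "\<dots> <= r^2 * D" using h D0 by (intro mult_right_mono power_mono) auto
      also have "(LINT x|lborel. (v (x + h) - v x)^2) = 2 * X - 2 * (LINT x|lborel. v x * v (x + h))"
        unfolding eq using ih ix C1c_facts(6)[OF v] Xh by (simp add: X_def)
      finally have "2 * X - r^2 * D <= 2 * (LINT x|lborel. v x * v (x + h))" by simp
      also have "\<dots> <= 2 * (LINT x|lborel. \<bar>v x\<bar> * \<bar>v (x + h)\<bar>)"
        using integral_abs_bound[of lborel "%x. v x * v (x + h)"] by (simp add: abs_mult)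
      finally have "ennreal (2 * X - r^2 * D) <= ennreal (2 * (LINT x|lborel. \<bar>v x\<bar> * \<bar>v (x + h)\<bar>))"
        by (rule ennreal_leI)
      also have "\<dots> = 2 * A h"
        using nn_integral_eq_integral[OF integrable_abs[OF ix]] by (simp add: A_def ennreal_mult' abs_mult)
      finally show ?thesis .
    qed
    have meas2: "(%(x, h). ennreal (\<bar>v x\<bar> * \<bar>v (x + h)\<bar>)) \<in> borel_measurable (lborel \<Otimes>\<^sub>M lborel)"
      by measurable
    have measA: "A \<in> borel_measurable lborel" unfolding A_def by measurable
    \<comment> \<open>The bound for each h is integrated over the ball |h| <= r, whose measure is
      2m. On the right, integrating over all h gives the square of the L^1 norm, at most m X by
      Cauchy-Schwarz on the support.\<close>
    have "ennreal (2 * X - r^2 * D) * ennreal (2 * m) = (\<integral>\<^sup>+h. ennreal (2 * X - r^2 * D) * indicator (cball 0 r :: 'n set) h \<partial>lborel)"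
      using emeasure_cball[OF r0, of "0 :: 'n"] rN by (simp add: nn_integral_cmult_indicator \<omega>_def)
    also have "\<dots> <= (\<integral>\<^sup>+h. 2 * A h \<partial>lborel)"
      by (rule nn_integral_mono) (auto simp: indicator_def A)
    also have "\<dots> = 2 * (\<integral>\<^sup>+h. A h \<partial>lborel)"
      by (rule nn_integral_cmult[OF measA])
    also have "(\<integral>\<^sup>+h. A h \<partial>lborel) = (\<integral>\<^sup>+x. \<integral>\<^sup>+h. ennreal (\<bar>v x\<bar> * \<bar>v (x + h)\<bar>) \<partial>lborel \<partial>lborel)"
      unfolding A_def by (rule lborel_pair.Fubini'[OF meas2])
    also have "\<dots> = (\<integral>\<^sup>+x. ennreal \<bar>v x\<bar> * (\<integral>\<^sup>+y. ennreal \<bar>v y\<bar> \<partial>lborel) \<partial>lborel)"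
      using nn_integral_lborel_shift[of "%x. ennreal \<bar>v x\<bar>"]
      by (intro nn_integral_cong) (simp add: ennreal_mult nn_integral_cmult)
    also have "\<dots> = (\<integral>\<^sup>+x. ennreal \<bar>v x\<bar> * indicator E x \<partial>lborel)^2"
    proof -
      have "(\<integral>\<^sup>+x. ennreal \<bar>v x\<bar> * indicator E x \<partial>lborel) = (\<integral>\<^sup>+x. ennreal \<bar>v x\<bar> \<partial>lborel)"
        by (rule nn_integral_cong) (auto simp: E_def indicator_def)
      then show ?thesis by (simp add: nn_integral_multc power2_eq_square)
    qed
    also have "\<dots> <= (\<integral>\<^sup>+x. (ennreal \<bar>v x\<bar>)^2 \<partial>lborel) * (\<integral>\<^sup>+x. (indicator E x)^2 \<partial>lborel)"
      by (rule Cauchy_Schwarz_nn_integral) auto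
    also have "(\<integral>\<^sup>+x. (indicator E x)^2 \<partial>lborel) = emeasure lborel E"
    proof -
      have "(%x. (indicator E x :: ennreal)^2) = indicator E" by (auto simp: indicator_def)
      then show ?thesis by simp
    qed
    also have "(\<integral>\<^sup>+x. (ennreal \<bar>v x\<bar>)^2 \<partial>lborel) = ennreal X" using nX by (simp add: ennreal_power)
    finally have le: "ennreal (2 * X - r^2 * D) * ennreal (2 * m) <= 2 * (ennreal X * ennreal m)"
      unfolding Em by (simp add: mult_left_mono)
    have "(2 * X - r^2 * D) * (2 * m) <= 2 * (X * m)"
    \<comment> \<open>\<open>ennreal\<close> sends negative reals to zero, so a negative left-hand
      side has to be treated separately.\<close>
    proof (cases "2 * X - r^2 * D >= 0")
      case True
      then have "ennreal ((2 * X - r^2 * D) * (2 * m)) <= ennreal (2 * (X * m))"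
        using le m D0 by (simp add: ennreal_mult)
      then show ?thesis using m D0 by (subst (asm) ennreal_le_iff) auto
    next
      case False
      then have "(2 * X - r^2 * D) * (2 * m) <= 0" using m by (simp add: mult_nonpos_nonneg)
      also have "0 <= 2 * (X * m)" using m D0 by simp
      finally show ?thesis .
    qed
    then have "m * X <= m * (r^2 * D)" by (simp add: algebra_simps)
    then show ?thesis using m by simp
  qed
  then show ?thesis by (simp add: r2 X_def D_def m_def E_def)
qed

section \<open>Truncation at levels and Sobolev's inequality\<close>

definition pos_sq :: "real => real" where
  "pos_sq s = (max 0 s)^2"

lemma pos_sq_deriv: "(pos_sq has_real_derivative 2 * max 0 s) (at s)"
proof -
  consider "s > 0" | "s < 0" | "s = 0" by linarith
  then show ?thesis
  proof cases
    case 1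
    have "((%s. s^2) has_real_derivative 2 * max 0 s) (at s)"
      using 1 by (auto intro!: derivative_eq_intros)
    then show ?thesis
      by (rule has_field_derivative_transform_within_open[where S = "{0<..}"]) (use 1 in \<open>auto simp: pos_sq_def\<close>)
  next
    case 2
    have "((%s. 0) has_real_derivative 2 * max 0 s) (at s)" using 2 by simp
    then show ?thesis
      by (rule has_field_derivative_transform_within_open[where S = "{..<0}"]) (use 2 in \<open>auto simp: pos_sq_def\<close>)
  next
    case 3
    have "((%h. pos_sq h / h) \<longlongrightarrow> 0) (at 0)"
    proof (rule Lim_null_comparison)
      show "\<forall>\<^sub>F h in at 0. norm (pos_sq h / h) <= \<bar>h\<bar>"
        by (rule always_eventually) (auto simp: pos_sq_def power2_eq_square max_def)
      show "((%h. \<bar>h\<bar>) \<longlongrightarrow> 0) (at (0::real))" by (auto intro!: tendsto_eq_intros)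
    qed
    then show ?thesis using 3 by (simp add: has_field_derivative_iff pos_sq_def)
  qed
qed

text \<open>A \<open>C\<^sup>1\<close> step: 0 on the left of 0 and 1 on the right of 1.\<close>
definition step :: "real => real" where
  "step s = 2 * (pos_sq s - 2 * pos_sq (s - 1/2) + pos_sq (s - 1))"

definition step' :: "real => real" where
  "step' s = 4 * (max 0 s - 2 * max 0 (s - 1/2) + max 0 (s - 1))"

lemma step_deriv: "(step has_real_derivative step' s) (at s)"
proof -
  have *: "((%s. pos_sq (s - c)) has_real_derivative 2 * max 0 (s - c)) (at s)" for c
  proof -
    have "((%s. s - c) has_real_derivative 1) (at s)" by (auto intro!: derivative_eq_intros)
    from DERIV_chain2[OF pos_sq_deriv this] show ?thesis by simp
  qed
  have "((%s. 2 * (pos_sq s - 2 * pos_sq (s - 1/2) + pos_sq (s - 1))) has_real_derivative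
     2 * (2 * max 0 s - 2 * (2 * max 0 (s - 1/2)) + 2 * max 0 (s - 1))) (at s)"
    by (intro DERIV_cmult DERIV_add DERIV_diff * pos_sq_deriv)
  then show ?thesis by (simp add: step_def[abs_def] step'_def algebra_simps)
qed

lemma step_simps: "s <= 0 ==> step s = 0" "s >= 1 ==> step s = 1" "s <= 0 ==> step' s = 0" "s >= 1 ==> step' s = 0"
  by (auto simp: step_def step'_def pos_sq_def max_def power2_eq_square algebra_simps)

lemma step'_bound: "\<bar>step' s\<bar> <= 2"
  by (auto simp: step'_def max_def abs_if)

lemma step'_continuous: "continuous_on S step'"
  unfolding step'_def[abs_def] by (intro continuous_intros)

lemma C1c_nonzero_finite:
  fixes v :: "'n::euclidean_space => real"
  assumes "C1c v G" "!!x. P x ==> v x \<noteq> 0" "{x. P x} \<in> sets borel"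
  shows "emeasure lborel {x. P x} < \<infinity>" "{x. P x} \<in> fmeasurable lborel"
proof -
  obtain K where K: "compact K" "!!x. x \<notin> K ==> v x = 0" using assms(1) by (auto simp: C1c_def)
  have "emeasure lborel {x. P x} <= emeasure lborel K"
    by (rule emeasure_mono) (use K assms(2) in \<open>auto simp: compact_imp_closed\<close>)
  also have "\<dots> < \<infinity>" using emeasure_compact_finite[OF K(1)] by simp
  finally show "emeasure lborel {x. P x} < \<infinity>" .
  then show "{x. P x} \<in> fmeasurable lborel" using assms(3) by (intro fmeasurableI) auto
qed

text \<open>\<open>faber_krahn\<close> is applied to a truncation equal to 0 where |v| <= t/2 and to
  1 where |v| >= t, whose gradient lives on the shell between. It is a function of v^2, which avoids
  the kink of |v|. On the shell the derivative factors are at most 2 and 8/(3t), with product at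
  most 6/t, whence 36.\<close>

lemma level_set_ineq:
  fixes v :: "'n::euclidean_space => real"
  assumes v: "C1c v G" and t: "t > 0"
  shows "t^2 * measure lborel {x. \<bar>v x\<bar> > t} <= 36 * fk_const TYPE('n) * measure lborel {x. \<bar>v x\<bar> > t / 2} powr (2 / real DIM('n))
     * (LINT x|lborel. indicator {x. t / 2 < \<bar>v x\<bar> \<and> \<bar>v x\<bar> <= t} x * (norm (G x))^2)" (is "_ <= _ * ?d")
proof -
  note [measurable] = C1c_facts(4,5)[OF v]
  \<comment> \<open>Affine in s^2, with value 0 at |s| = t/2 and value 1 at |s| = t.\<close>
  define w where "w s = (4 * s^2 / t^2 - 1) / 3" for s
  define u where "u x = step (w (v x))" for x
  define H where "H x = (step' (w (v x)) * (8 * v x / (3 * t^2))) *\<^sub>R G x" for x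
  have w_pos: "w s > 0 \<longleftrightarrow> \<bar>s\<bar> > t / 2" for s
  proof -
    have "w s > 0 \<longleftrightarrow> (t/2)\<^sup>2 < \<bar>s\<bar>^2" using t by (simp add: w_def field_simps power2_eq_square)
    also have "\<dots> \<longleftrightarrow> \<bar>s\<bar> > t / 2" using t
      using power2_less_imp_less[of "t / 2" "\<bar>s\<bar>"] power_strict_mono[of "t / 2" "\<bar>s\<bar>" 2] by auto
    finally show ?thesis .
  qed
  have w_1: "w s >= 1 \<longleftrightarrow> \<bar>s\<bar> >= t" for s
  proof -
    have "w s >= 1 \<longleftrightarrow> t\<^sup>2 <= \<bar>s\<bar>^2" using t by (simp add: w_def field_simps)
    also have "\<dots> \<longleftrightarrow> \<bar>s\<bar> >= t" using t abs_le_square_iff[of t s] by simp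
    finally show ?thesis .
  qed
  have wd: "(w has_real_derivative (8 * s / (3 * t^2))) (at s)" for s
    unfolding w_def[abs_def] using t by (auto intro!: derivative_eq_intros simp: field_simps)
  have wc: "continuous_on UNIV (%x. w (v x))" unfolding w_def using t by (intro continuous_intros C1c_facts(3)[OF v]) auto
  have uC: "C1c u H"
    unfolding C1c_def
  proof (intro conjI allI)
    fix x
    have "((%s. step (w s)) has_real_derivative step' (w (v x)) * (8 * v x / (3 * t^2))) (at (v x))"
      by (rule DERIV_chain2[OF step_deriv wd])
    from has_derivative_compose[OF C1c_facts(1)[OF v, of x] this[unfolded has_field_derivative_def]]
    show "(u has_derivative (%h. H x \<bullet> h)) (at x)" by (simp add: u_def[abs_def] H_def mult.assoc)
    show "continuous_on UNIV H" unfolding H_def using t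
      by (intro continuous_intros continuous_on_compose2[OF step'_continuous wc] C1c_facts(2,3)[OF v]) auto
    obtain K where "compact K" "!!x. x \<notin> K ==> v x = 0 \<and> G x = 0" using v by (auto simp: C1c_def)
    then show "\<exists>K. compact K \<and> (\<forall>x. x \<notin> K \<longrightarrow> u x = 0 \<and> H x = 0)"
      by (intro exI[of _ K]) (auto simp: u_def H_def w_def step_simps)
  qed
  have m2: "{x. \<bar>v x\<bar> > c} \<in> sets borel" for c by measurable
  have fin: "{x. \<bar>v x\<bar> > c} \<in> fmeasurable lborel" if "c > 0" for c
    by (rule C1c_nonzero_finite(2)[OF v _ m2]) (use that in auto)
  have d: "(LINT x|lborel. (norm (H x))^2) <= 36 / t^2 * ?d"
  proof -
    have "(LINT x|lborel. (norm (H x))^2) <= (LINT x|lborel. 36 / t^2 * (indicator {x. t / 2 < \<bar>v x\<bar> \<and> \<bar>v x\<bar> <= t} x * (norm (G x))^2))"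
    proof (rule integral_mono)
      show "integrable lborel (%x. (norm (H x))^2)" by (rule C1c_facts(7)[OF uC])
      show "integrable lborel (%x. 36 / t^2 * (indicator {x. t / 2 < \<bar>v x\<bar> \<and> \<bar>v x\<bar> <= t} x * (norm (G x))^2))"
        using integrable_mult_indicator[OF _ C1c_facts(7)[OF v], of "{x. t / 2 < \<bar>v x\<bar> \<and> \<bar>v x\<bar> <= t}"]
        by (intro integrable_mult_right) simp
      fix x
      show "(norm (H x))^2 <= 36 / t^2 * (indicator {x. t / 2 < \<bar>v x\<bar> \<and> \<bar>v x\<bar> <= t} x * (norm (G x))^2)"
      proof (cases "t / 2 < \<bar>v x\<bar> \<and> \<bar>v x\<bar> <= t")
        case True
        have "norm (H x) = \<bar>step' (w (v x))\<bar> * (8 * \<bar>v x\<bar> / (3 * t^2)) * norm (G x)"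
          by (simp add: H_def abs_mult)
        also have "\<dots> <= 2 * (8 * t / (3 * t^2)) * norm (G x)"
          using True t by (intro mult_right_mono mult_mono step'_bound divide_right_mono) auto
        also have "\<dots> <= 6 / t * norm (G x)" using t
          by (intro mult_right_mono) (auto simp: field_simps power2_eq_square)
        finally have "(norm (H x))^2 <= (6 / t * norm (G x))^2" by (intro power_mono) auto
        then show ?thesis using True by (simp add: power_mult_distrib power_divide)
      next
        case False
        then have "w (v x) <= 0 \<or> w (v x) >= 1" using w_pos[of "v x"] w_1[of "v x"] by linarith
        then have "H x = 0" by (auto simp: H_def step_simps)
        then show ?thesis by (simp add: False)
      qed
    qed
    then show ?thesis by simp
  qed
  have d0: "?d >= 0" by (rule integral_nonneg_AE) simp
  have "measure lborel {x. \<bar>v x\<bar> > t} = (LINT x|lborel. indicator {x. \<bar>v x\<bar> > t} x)" by simp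
  also have "\<dots> <= (LINT x|lborel. (u x)^2)"
  proof (rule integral_mono)
    show "integrable lborel (indicator {x. \<bar>v x\<bar> > t} :: 'n => real)"
      by (rule integrable_real_indicator) (use fmeasurableD2[OF fin[OF t]] in \<open>auto simp: top.not_eq_extremum\<close>)
    show "integrable lborel (%x. (u x)^2)" by (rule C1c_facts(6)[OF uC])
    show "indicator {x. \<bar>v x\<bar> > t} x <= (u x)^2" for x
      using w_1[of "v x"] by (auto simp: indicator_def u_def step_simps)
  qed
  also have "\<dots> <= fk_const TYPE('n) * measure lborel {x. u x \<noteq> 0} powr (2 / real DIM('n)) * (LINT x|lborel. (norm (H x))^2)"
    by (rule faber_krahn[OF uC])
  also have "\<dots> <= fk_const TYPE('n) * measure lborel {x. \<bar>v x\<bar> > t / 2} powr (2 / real DIM('n)) * (36 / t^2 * ?d)"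
  proof (intro mult_mono d mult_left_mono powr_mono2 measure_mono_fmeasurable fin fk_const_nonneg)
    show "{x. u x \<noteq> 0} \<subseteq> {x. \<bar>v x\<bar> > t / 2}" using w_pos step_simps(1) by (force simp: u_def)
    have [measurable]: "u \<in> borel_measurable borel" by (rule C1c_facts(4)[OF uC])
    show "{x. u x \<noteq> 0} \<in> sets lborel" by measurable
  qed (use t d0 fk_const_nonneg in \<open>auto intro!: mult_nonneg_nonneg\<close>)
  finally show ?thesis using t by (simp add: field_simps)
qed

text \<open>Maz'ya's truncation method. The level set inequality bounds the weak L^q quantity M
  through M <= C M^\<theta> D, where M is finite since v is bounded with compact support. Inserted
  once more, with the gradient energy of each shell kept apart, it can be summed over dyadic levels
  and yields the strong L^q norm.\<close>

lemma sobolev: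
  fixes v :: "'n::euclidean_space => real"
  assumes v: "C1c v G" and N: "DIM('n) >= 3"
  defines "q \<equiv> 2 * real DIM('n) / (real DIM('n) - 2)"
  defines "C \<equiv> 36 * fk_const TYPE('n) * 2 powr (q - 2)"
  shows "(LINT x|lborel. \<bar>v x\<bar> powr q) <= 2 powr q * (C * (LINT x|lborel. (norm (G x))^2)) powr (q / 2)"
proof -
  note [measurable] = C1c_facts(4,5)[OF v]
  define n where "n = real DIM('n)"
  have n3: "n >= 3" using N by (simp add: n_def)
  have q: "q > 2" using n3 by (simp add: q_def n_def field_simps)
  \<comment> \<open>The Faber-Krahn exponent; q is determined by q \<theta> = q - 2, which makes the
    power of t cancel in the recursion for M.\<close>
  define \<theta> where "\<theta> = 2 / n"
  have th: "\<theta> > 0" "\<theta> < 1" using n3 by (auto simp: \<theta>_def)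
  have qth: "q * \<theta> = q - 2" and q2: "q / 2 = 1 / (1 - \<theta>)" using n3 by (auto simp: q_def \<theta>_def n_def[symmetric] field_simps)
  define a where "a t = measure lborel {x. \<bar>v x\<bar> > t}" for t
  define d where "d t = (LINT x|lborel. indicator {x. t / 2 < \<bar>v x\<bar> \<and> \<bar>v x\<bar> <= t} x * (norm (G x))^2)" for t
  define D where "D = (LINT x|lborel. (norm (G x))^2)"
  obtain K where K: "compact K" "!!x. x \<notin> K ==> v x = 0" using v by (auto simp: C1c_def)
  obtain B where B: "B > 0" "!!x. x \<in> K ==> norm (v x) <= B"
    using compact_imp_bounded[OF compact_continuous_image[OF continuous_on_subset[OF C1c_facts(3)[OF v]] K(1)]]
    unfolding bounded_pos by auto
  have vB: "\<bar>v x\<bar> <= B" for x using B K(2)[of x] by (cases "x \<in> K") force+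
  define k where "k = measure lborel K"
  have Kf: "K \<in> fmeasurable lborel" using K(1) emeasure_compact_finite[OF K(1)] by (intro fmeasurableI) (auto simp: compact_imp_closed)
  have a_nonneg: "a t >= 0" for t by (simp add: a_def)
  have ak: "a t <= k" if "t > 0" for t
    unfolding a_def k_def by (rule measure_mono_fmeasurable[OF _ _ Kf]) (use K(2) that in \<open>force\<close>, measurable)
  have aB: "a t = 0" if "t >= B" for t
  proof -
    have "\<not> t < \<bar>v x\<bar>" for x using vB[of x] that by linarith
    then have "{x. \<bar>v x\<bar> > t} = {}" by blast
    then show ?thesis by (simp add: a_def)
  qed
  have ind: "integrable lborel (%x. indicator {x. t / 2 < \<bar>v x\<bar> \<and> \<bar>v x\<bar> <= t} x * (norm (G x))^2)" for t
    using integrable_mult_indicator[OF _ C1c_facts(7)[OF v], of "{x. t / 2 < \<bar>v x\<bar> \<and> \<bar>v x\<bar> <= t}"] by simp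
  have d0: "d t >= 0" for t unfolding d_def by (rule integral_nonneg_AE) simp
  have dD: "d t <= D" for t unfolding d_def D_def
    by (rule integral_mono[OF ind C1c_facts(7)[OF v]]) (auto simp: indicator_def)
  have D0: "D >= 0" by (simp add: D_def)
  have C0: "C >= 0" by (simp add: C_def fk_const_nonneg)
  have lev: "t^2 * a t <= 36 * fk_const TYPE('n) * a (t / 2) powr \<theta> * d t" if "t > 0" for t
    using level_set_ineq[OF v that] by (simp add: a_def d_def \<theta>_def n_def)
  \<comment> \<open>The q-th power of the weak L^q quasinorm.\<close>
  define M where "M = (SUP t\<in>{0<..}. t powr q * a t)"
  have bdd: "bdd_above ((%t. t powr q * a t) ` {0<..})"
  proof (rule bdd_aboveI2)
    fix t :: real assume t: "t \<in> {0<..}"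
    show "t powr q * a t <= B powr q * k"
    proof (cases "t >= B")
      case True
      then show ?thesis using aB[of t] by (simp add: k_def)
    next
      case False
      then show ?thesis using t ak[of t] q a_nonneg by (intro mult_mono powr_mono2) auto
    qed
  qed
  have Mge: "t powr q * a t <= M" if "t > 0" for t
    unfolding M_def by (rule cSUP_upper[OF _ bdd]) (use that in auto)
  have M0: "M >= 0" using Mge[of 1] a_nonneg[of 1] by simp
  \<comment> \<open>The shell energy \<open>d t\<close> is kept instead of its bound D: it is summed
    over levels later, and D would be counted once per level.\<close>
  have weak: "t powr q * a t <= C * M powr \<theta> * d t" if t: "t > 0" for t
  proof -
    have "a (t / 2) = (t / 2) powr (- q) * ((t / 2) powr q * a (t / 2))"
      using t by (simp add: mult.assoc[symmetric] powr_add[symmetric])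
    also have "\<dots> <= (t / 2) powr (- q) * M" using Mge[of "t / 2"] t by (intro mult_left_mono) auto
    finally have "a (t / 2) powr \<theta> <= ((t / 2) powr (- q) * M) powr \<theta>"
      using th a_nonneg by (intro powr_mono2) auto
    also have "\<dots> = (t / 2) powr (- (q - 2)) * M powr \<theta>"
      using M0 qth by (simp add: powr_mult powr_powr)
    finally have h: "a (t / 2) powr \<theta> <= (t / 2) powr (- (q - 2)) * M powr \<theta>" .
    have "t powr q * a t = t powr (q - 2) * (t^2 * a t)"
    proof -
      have "t powr q = t powr (q - 2) * t powr 2" by (simp add: powr_add[symmetric])
      then show ?thesis using t by (simp add: powr_numeral)
    qed
    also have "\<dots> <= t powr (q - 2) * (36 * fk_const TYPE('n) * ((t / 2) powr (- (q - 2)) * M powr \<theta>) * d t)"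
      using h fk_const_nonneg d0 by (intro mult_left_mono order_trans[OF lev[OF t]] mult_right_mono) auto
    also have "\<dots> = 36 * fk_const TYPE('n) * (t powr (q - 2) * (t / 2) powr (- (q - 2))) * M powr \<theta> * d t"
      by (simp add: mult_ac)
    also have "t powr (q - 2) * (t / 2) powr (- (q - 2)) = 2 powr (q - 2)"
      using t by (simp add: powr_divide field_simps) (simp flip: powr_add)
    finally show ?thesis by (simp add: C_def)
  qed
  have M_le: "M <= C * M powr \<theta> * D"
    unfolding M_def[of] 
  proof (rule cSUP_least)
    fix t :: real assume "t \<in> {0<..}"
    then have "t powr q * a t <= C * M powr \<theta> * d t" using weak by auto
    also have "\<dots> <= C * M powr \<theta> * D" using dD C0 by (intro mult_left_mono) auto
    finally show "t powr q * a t <= C * (SUP t\<in>{0<..}. t powr q * a t) powr \<theta> * D" by (simp add: M_def)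
  qed auto
  have M_bound: "M powr \<theta> <= (C * D) powr (\<theta> / (1 - \<theta>))"
  proof (cases "M = 0")
    case False
    with M0 have Mp: "M > 0" by simp
    have "M powr (1 - \<theta>) = M * M powr (- \<theta>)" using Mp by (simp add: powr_diff powr_minus divide_inverse)
    also have "\<dots> <= C * M powr \<theta> * D * M powr (- \<theta>)" using M_le by (intro mult_right_mono) auto
    also have "\<dots> = C * D * (M powr \<theta> * M powr (- \<theta>))" by (simp add: mult_ac)
    also have "\<dots> = C * D" using Mp by (simp add: powr_add[symmetric])
    finally have "(M powr (1 - \<theta>)) powr (\<theta> / (1 - \<theta>)) <= (C * D) powr (\<theta> / (1 - \<theta>))"
      using th by (intro powr_mono2) auto
    then show ?thesis using th by (simp add: powr_powr)
  qed simp
  define R where "R = 2 powr q * (C * D) powr (q / 2)"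
  \<comment> \<open>Dyadic layers starting at \<tau>. The values below \<tau> cost \<tau>^q times
    the measure of the support and disappear as \<tau> tends to zero.\<close>
  have main: "(LINT x|lborel. \<bar>v x\<bar> powr q) <= \<tau> powr q * k + R" if \<tau>: "\<tau> > 0" for \<tau>
  proof -
    obtain J :: nat where "B / \<tau> < 2 ^ J" using real_arch_pow[of 2 "B / \<tau>"] by auto
    then have J: "B <= 2 ^ J * \<tau>" using \<tau> by (simp add: field_simps)
    define T where "T j = 2 ^ j * \<tau>" for j :: nat
    have T0: "T j > 0" for j using \<tau> by (simp add: T_def)
    have pt: "\<bar>v x\<bar> powr q <= \<tau> powr q * indicator K x + (\<Sum>j<J. (2 * T j) powr q * indicator {x. \<bar>v x\<bar> > T j} x)" for x
    proof (cases "\<bar>v x\<bar> <= \<tau>")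
      case True
      have s: "0 <= (\<Sum>j<J. (2 * T j) powr q * indicator {x. \<bar>v x\<bar> > T j} x)" by (rule sum_nonneg) auto
      show ?thesis
      proof (cases "x \<in> K")
        case xK: True
        have "\<bar>v x\<bar> powr q <= \<tau> powr q" using True q by (intro powr_mono2) auto
        then show ?thesis using s xK by simp
      next
        case False
        then show ?thesis using K(2)[of x] s q by simp
      qed
    next
      case False
      define m where "m = (LEAST m. \<bar>v x\<bar> <= T m)"
      have "\<bar>v x\<bar> <= T J" using vB[of x] J by (simp add: T_def)
      then have m: "\<bar>v x\<bar> <= T m" "m <= J" "!!i. i < m ==> \<not> \<bar>v x\<bar> <= T i"
        unfolding m_def by (auto intro: LeastI Least_le dest: not_less_Least)
      have "m \<noteq> 0" using False m(1) by (cases m) (auto simp: T_def)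
      then obtain j where j: "m = Suc j" by (cases m) auto
      have "\<bar>v x\<bar> powr q <= (2 * T j) powr q" using m(1) j q by (intro powr_mono2) (auto simp: T_def)
      also have "\<dots> = (2 * T j) powr q * indicator {x. \<bar>v x\<bar> > T j} x" using m(3)[of j] j by simp
      also have "\<dots> <= (\<Sum>j<J. (2 * T j) powr q * indicator {x. \<bar>v x\<bar> > T j} x)"
        by (rule member_le_sum) (use m(2) j in auto)
      finally show ?thesis by (simp add: add_increasing)
    qed
    have fin: "integrable lborel (indicator {x. \<bar>v x\<bar> > T j} :: 'n => real)" for j
    proof -
      have "{x. \<bar>v x\<bar> > T j} \<in> fmeasurable lborel"
        by (rule C1c_nonzero_finite(2)[OF v]) (use T0[of j] in auto)
      then show ?thesis by (intro integrable_real_indicator) (auto dest: fmeasurableD2 simp: top.not_eq_extremum)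
    qed
    have Ki: "integrable lborel (indicator K :: 'n => real)"
      using Kf by (intro integrable_real_indicator) (auto dest: fmeasurableD2 fmeasurableD simp: top.not_eq_extremum)
    have vi: "integrable lborel (%x. \<bar>v x\<bar> powr q)"
      by (rule integrable_continuous_compact(1)[OF _ K(1)])
         (use q K(2) in \<open>auto intro!: continuous_on_powr' continuous_on_const continuous_on_rabs C1c_facts(3)[OF v]\<close>)
    have "(LINT x|lborel. \<bar>v x\<bar> powr q) <= (LINT x|lborel. \<tau> powr q * indicator K x + (\<Sum>j<J. (2 * T j) powr q * indicator {x. \<bar>v x\<bar> > T j} x))"
      by (rule integral_mono[OF vi _ pt])
         (intro Bochner_Integration.integrable_add Bochner_Integration.integrable_sum integrable_mult_right fin Ki)
    also have "\<dots> = (LINT x|lborel. \<tau> powr q * indicator K x) + (LINT x|lborel. (\<Sum>j<J. (2 * T j) powr q * indicator {x. \<bar>v x\<bar> > T j} x))"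
      by (intro Bochner_Integration.integral_add Bochner_Integration.integrable_sum integrable_mult_right fin Ki)
    also have "(LINT x|lborel. (\<Sum>j<J. (2 * T j) powr q * indicator {x. \<bar>v x\<bar> > T j} x)) = (\<Sum>j<J. LINT x|lborel. (2 * T j) powr q * indicator {x. \<bar>v x\<bar> > T j} x)"
      by (intro Bochner_Integration.integral_sum integrable_mult_right fin)
    also have "(LINT x|lborel. \<tau> powr q * indicator K x) + \<dots> = \<tau> powr q * k + (\<Sum>j<J. (2 * T j) powr q * a (T j))"
      by (simp add: k_def a_def)
    also have "(\<Sum>j<J. (2 * T j) powr q * a (T j)) <= (\<Sum>j<J. 2 powr q * (C * M powr \<theta> * d (T j)))"
      using weak[OF T0] T0 by (intro sum_mono) (simp add: powr_mult mult.assoc less_imp_le)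
    also have "\<dots> = 2 powr q * (C * M powr \<theta>) * (\<Sum>j<J. d (T j))"
      by (simp add: sum_distrib_left mult.assoc)
    also have "(\<Sum>j<J. d (T j)) = (LINT x|lborel. (\<Sum>j<J. indicator {x. T j / 2 < \<bar>v x\<bar> \<and> \<bar>v x\<bar> <= T j} x * (norm (G x))^2))"
      unfolding d_def by (rule Bochner_Integration.integral_sum[symmetric]) (rule ind)
    also have "\<dots> <= D"
      unfolding D_def
    proof (rule integral_mono[OF _ C1c_facts(7)[OF v]])
      show "integrable lborel (%x. \<Sum>j<J. indicator {x. T j / 2 < \<bar>v x\<bar> \<and> \<bar>v x\<bar> <= T j} x * (norm (G x))^2)"
        by (intro Bochner_Integration.integrable_sum ind)
      fix x
      define P where "P j \<longleftrightarrow> T j / 2 < \<bar>v x\<bar> \<and> \<bar>v x\<bar> <= T j" for j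
      \<comment> \<open>The shells of distinct levels are disjoint, so their energies add up to at
        most D.\<close>
      have uniq: "i = j" if "P i" "P j" for i j
      proof (rule ccontr)
        assume "i \<noteq> j"
        then consider "i < j" | "j < i" by linarith
        then show False
        proof cases
          case 1
          then have "(2::real) ^ Suc i <= 2 ^ j" by (intro power_increasing) auto
          then have "T i <= T j / 2" using \<tau> by (simp add: T_def)
          then show False using that by (auto simp: P_def)
        next
          case 2
          then have "(2::real) ^ Suc j <= 2 ^ i" by (intro power_increasing) auto
          then have "T j <= T i / 2" using \<tau> by (simp add: T_def)
          then show False using that by (auto simp: P_def)
        qed
      qed
      have "(\<Sum>j<J. indicator {x. T j / 2 < \<bar>v x\<bar> \<and> \<bar>v x\<bar> <= T j} x) = (\<Sum>j<J. if P j then 1 else (0::real))"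
        by (rule sum.cong) (auto simp: P_def indicator_def)
      also have "\<dots> = real (card {j\<in>{..<J}. P j})" by (simp add: sum.If_cases Int_def)
      also have "card {j\<in>{..<J}. P j} <= 1" using uniq by (simp add: card_le_Suc0_iff_eq)
      finally have "(\<Sum>j<J. indicator {x. T j / 2 < \<bar>v x\<bar> \<and> \<bar>v x\<bar> <= T j} x) <= (1::real)" by simp
      from mult_right_mono[OF this, of "(norm (G x))^2"]
      show "(\<Sum>j<J. indicator {x. T j / 2 < \<bar>v x\<bar> \<and> \<bar>v x\<bar> <= T j} x * (norm (G x))^2) <= (norm (G x))^2"
        by (simp add: sum_distrib_right)
    qed
    also have "2 powr q * (C * M powr \<theta>) * D <= 2 powr q * (C * (C * D) powr (\<theta> / (1 - \<theta>))) * D"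
      using M_bound C0 D0 by (intro mult_right_mono mult_left_mono) auto
    also have "\<dots> = 2 powr q * ((C * D) powr 1 * (C * D) powr (\<theta> / (1 - \<theta>)))" using C0 D0 by simp
    also have "\<dots> = R" unfolding powr_add[symmetric] R_def q2 using th by (simp add: field_simps)
    finally show ?thesis using C0 by (simp add: mult_left_mono)
  qed
  have "(LINT x|lborel. \<bar>v x\<bar> powr q) <= R"
  proof (rule field_le_epsilon)
    fix e :: real assume e: "e > 0"
    define \<tau> where "\<tau> = (e / (k + 1)) powr (1 / q)"
    have k0: "k >= 0" by (simp add: k_def)
    have "\<tau> > 0" using e k0 by (simp add: \<tau>_def)
    moreover have "\<tau> powr q * k <= e"
      using e k0 q by (simp add: \<tau>_def powr_powr field_simps)
    ultimately show "(LINT x|lborel. \<bar>v x\<bar> powr q) <= R + e" using main[of \<tau>] by linarith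
  qed
  then show ?thesis by (simp add: R_def D_def)
qed

section \<open>Hoelder's inequality and potentials in L^(N/2)\<close>

lemma holder_nonneg:
  fixes a b :: "'a => real"
  assumes [measurable]: "a \<in> borel_measurable M" "b \<in> borel_measurable M"
    and nn: "!!x. a x >= 0" "!!x. b x >= 0"
    and P: "P > 1" "Q > 1" "1 / P + 1 / Q = 1"
    and int: "integrable M (%x. a x powr P)" "integrable M (%x. b x powr Q)"
  shows "integrable M (%x. a x * b x)"
    "(LINT x|M. a x * b x) <= (LINT x|M. a x powr P) powr (1 / P) * (LINT x|M. b x powr Q) powr (1 / Q)"
proof -
  have young: "s * t <= s powr P / P + t powr Q / Q" if "s >= 0" "t >= 0" for s t
    using Youngs_inequality[OF _ _ P(3) that] P by simp
  show i: "integrable M (%x. a x * b x)"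
  proof (rule Bochner_Integration.integrable_bound[where f = "%x. a x powr P / P + b x powr Q / Q"])
    show "AE x in M. norm (a x * b x) <= norm (a x powr P / P + b x powr Q / Q)"
      using young nn P by (intro AE_I2) (auto simp: abs_mult intro: order_trans)
  qed (use int in auto)
  define A where "A = (LINT x|M. a x powr P)"
  define B where "B = (LINT x|M. b x powr Q)"
  have A0: "A >= 0" and B0: "B >= 0" by (auto simp: A_def B_def)
  have z: "(LINT x|M. a x * b x) = 0" if "AE x in M. a x * b x = 0"
    using that by (rule integral_eq_zero_AE)
  show "(LINT x|M. a x * b x) <= A powr (1 / P) * B powr (1 / Q)"
  proof (cases "A = 0 \<or> B = 0")
    case True
    then have "AE x in M. a x * b x = 0"
    proof
      assume "A = 0"
      then have "AE x in M. a x powr P = 0"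
        using integral_nonneg_eq_0_iff_AE[OF int(1)] by (simp add: A_def)
      then show ?thesis by eventually_elim (use P in auto)
    next
      assume "B = 0"
      then have "AE x in M. b x powr Q = 0"
        using integral_nonneg_eq_0_iff_AE[OF int(2)] by (simp add: B_def)
      then show ?thesis by eventually_elim (use P in auto)
    qed
    from z[OF this] show ?thesis by simp
  next
    case False
    then have Ap: "A > 0" and Bp: "B > 0" using A0 B0 by auto
    define s where "s = A powr (1 / P)"
    define t where "t = B powr (1 / Q)"
    have st: "s > 0" "t > 0" "s powr P = A" "t powr Q = B"
      using Ap Bp P by (auto simp: s_def t_def powr_powr)
    have "(LINT x|M. a x * b x) / (s * t) = (LINT x|M. (a x / s) * (b x / t))"
      by (simp add: mult.commute)
    also have "\<dots> <= (LINT x|M. a x powr P / (A * P) + b x powr Q / (B * Q))"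
    proof (rule integral_mono)
      show "integrable M (%x. (a x / s) * (b x / t))" using i by simp
      show "integrable M (%x. a x powr P / (A * P) + b x powr Q / (B * Q))" using int by simp
      show "(a x / s) * (b x / t) <= a x powr P / (A * P) + b x powr Q / (B * Q)" for x
        using young[of "a x / s" "b x / t"] st nn[of x] by (simp add: powr_divide)
    qed
    also have "\<dots> = A / (A * P) + B / (B * Q)" using int by (simp add: A_def B_def)
    also have "\<dots> = 1" using Ap Bp P by simp
    finally show ?thesis using st by (simp add: s_def t_def field_simps)
  qed
qed

definition gnorm2 :: "('n::euclidean_space => real) => real" where
  "gnorm2 \<phi> = (LI x. (norm (cgrad \<phi> x))^2)"

lemma gnorm2_nonneg: "gnorm2 \<phi> >= 0"
  by (simp add: gnorm2_def)

lemma gnorm2_lborel: "test_fun U \<phi> ==> gnorm2 \<phi> = (LINT x|lborel. (norm (cgrad \<phi> x))^2)"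
  unfolding gnorm2_def using C1c_facts(5)[OF C1c_test] by (intro integral_completion) measurable

lemma test_integrable_powr:
  assumes "test_fun U \<phi>" "q > 0"
  shows "L1f (%x. \<bar>\<phi> x\<bar> powr q)" "integrable lborel (%x. \<bar>\<phi> x\<bar> powr q)"
proof -
  obtain K where K: "compact K" "!!x. x \<notin> K ==> \<phi> x = 0" using test_fun_supp[OF assms(1)] by blast
  have c: "continuous_on UNIV (%x. \<bar>\<phi> x\<bar> powr q)"
    using assms(2) by (intro continuous_on_powr' continuous_intros test_continuous[OF assms(1)]) auto
  show "L1f (%x. \<bar>\<phi> x\<bar> powr q)" "integrable lborel (%x. \<bar>\<phi> x\<bar> powr q)"
    by (rule integrable_continuous_compact[OF c K(1)]; use K(2) assms(2) in simp)+
qed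

lemma sobolev_test:
  assumes N: "DIM('n::euclidean_space) >= 3"
  defines "q \<equiv> 2 * real DIM('n) / (real DIM('n) - 2)"
  obtains K where "K > 0" "!!\<phi> :: 'n => real. test_fun UNIV \<phi> ==> (LI x. \<bar>\<phi> x\<bar> powr q) <= K * gnorm2 \<phi> powr (q / 2)"
proof
  define C where "C = 36 * fk_const TYPE('n) * 2 powr (q - 2)"
  have C0: "C >= 0" by (simp add: C_def fk_const_nonneg)
  show "2 powr q * C powr (q / 2) + 1 > 0" by (simp add: add_nonneg_pos)
  fix \<phi> :: "'n => real" assume t: "test_fun UNIV \<phi>"
  have [measurable]: "\<phi> \<in> borel_measurable borel" by (rule C1c_facts(4)[OF C1c_test[OF t]])
  have "(LI x. \<bar>\<phi> x\<bar> powr q) = (LINT x|lborel. \<bar>\<phi> x\<bar> powr q)"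
    by (rule integral_completion) measurable
  also have "\<dots> <= 2 powr q * (C * gnorm2 \<phi>) powr (q / 2)"
    using sobolev[OF C1c_test[OF t] N] by (simp add: C_def q_def gnorm2_lborel[OF t])
  also have "\<dots> = (2 powr q * C powr (q / 2)) * gnorm2 \<phi> powr (q / 2)"
    by (simp add: powr_mult)
  also have "\<dots> <= (2 powr q * C powr (q / 2) + 1) * gnorm2 \<phi> powr (q / 2)"
    by (rule mult_right_mono) auto
  finally show "(LI x. \<bar>\<phi> x\<bar> powr q) <= (2 powr q * C powr (q / 2) + 1) * gnorm2 \<phi> powr (q / 2)" .
qed

text \<open>The exponents N/2 and N/(N-2) are conjugate, and the latter power of \<phi>^2 is
  |\<phi>| to the critical Sobolev exponent. This is the reason why L^(N/2) is the right class for
  f: such a potential is controlled by the Dirichlet integral alone.\<close>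

lemma holder_sobolev:
  assumes N: "DIM('n::euclidean_space) >= 3"
  obtains K where "K > 0" "!!(h :: 'n => real) \<phi>. h \<in> Lmeas ==>
      L1f (%x. \<bar>h x\<bar> powr (real DIM('n) / 2)) ==> test_fun UNIV \<phi> ==>
      L1f (%x. \<bar>h x\<bar> * (\<phi> x)^2) \<and>
      (LI x. \<bar>h x\<bar> * (\<phi> x)^2) \<le>
        K * (LI x. \<bar>h x\<bar> powr (real DIM('n) / 2)) powr (2 / real DIM('n)) * gnorm2 \<phi>"
proof -
  define n where "n = real DIM('n)"
  define q where "q = 2 * n / (n - 2)"
  have n3: "n >= 3" using N by (simp add: n_def)
  obtain K where K: "K > 0" "!!\<phi> :: 'n => real. test_fun UNIV \<phi> ==> (LI x. \<bar>\<phi> x\<bar> powr q) <= K * gnorm2 \<phi> powr (q / 2)"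
    using sobolev_test[OF N] unfolding q_def n_def by metis
  show thesis
  proof (rule that[of "K powr (2 / q)"])
    show "K powr (2 / q) > 0" using K by simp
    fix h \<phi> :: "'n => real"
    assume h: "h \<in> Lmeas" "L1f (%x. \<bar>h x\<bar> powr (real DIM('n) / 2))" and t: "test_fun UNIV \<phi>"
    have [measurable]: "\<phi> \<in> Lmeas" by (rule test_meas[OF t])
    have eq: "((\<phi> x)^2) powr (n / (n - 2)) = \<bar>\<phi> x\<bar> powr q" for x
    proof -
      have "(\<phi> x)^2 = \<bar>\<phi> x\<bar> powr 2" by (cases "\<phi> x = 0") (simp_all add: powr_numeral)
      then have "((\<phi> x)^2) powr (n / (n - 2)) = \<bar>\<phi> x\<bar> powr (2 * (n / (n - 2)))" by (simp only: powr_powr)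
      then show ?thesis by (simp add: q_def)
    qed
    have PQ: "n / 2 > 1" "n / (n - 2) > 1" "1 / (n / 2) + 1 / (n / (n - 2)) = 1"
      using n3 by (auto simp: field_simps)
    have q0: "q > 0" using n3 by (simp add: q_def)
    have i: "L1f (%x. ((\<phi> x)^2) powr (n / (n - 2)))"
      unfolding eq by (rule test_integrable_powr(1)[OF t q0])
    note ho = holder_nonneg[of "%x. \<bar>h x\<bar>" lebesgue "%x. (\<phi> x)^2" "n / 2" "n / (n - 2)", OF _ _ _ _ PQ _ i]
    have i2: "L1f (%x. \<bar>h x\<bar> * (\<phi> x)^2)"
      using ho(1) h by (simp add: n_def)
    have "(LI x. \<bar>h x\<bar> * (\<phi> x)^2) \<le>
       (LI x. \<bar>h x\<bar> powr (n / 2)) powr (1 / (n / 2)) * (LI x. \<bar>\<phi> x\<bar> powr q) powr (1 / (n / (n - 2)))"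
      using ho(2) h unfolding eq by (auto simp: n_def)
    also have "\<dots> <= (LI x. \<bar>h x\<bar> powr (n / 2)) powr (2 / n) * (K powr (2 / q) * gnorm2 \<phi>)"
    proof -
      have "(LI x. \<bar>\<phi> x\<bar> powr q) powr (1 / (n / (n - 2))) <= (K * gnorm2 \<phi> powr (q / 2)) powr (2 / q)"
      proof -
        have "1 / (n / (n - 2)) = 2 / q" using n3 by (simp add: q_def field_simps)
        then show ?thesis using K(2)[OF t] q0 by (simp add: powr_mono2)
      qed
      also have "\<dots> = K powr (2 / q) * gnorm2 \<phi>"
        using q0 gnorm2_nonneg[of \<phi>] by (simp add: powr_mult powr_powr)
      finally show ?thesis by (intro mult_mono) (auto simp: gnorm2_nonneg)
    qed
    finally show "L1f (%x. \<bar>h x\<bar> * (\<phi> x)^2) \<and>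
      (LI x. \<bar>h x\<bar> * (\<phi> x)^2) \<le>
        K powr (2 / q) * (LI x. \<bar>h x\<bar> powr (real DIM('n) / 2)) powr (2 / real DIM('n)) * gnorm2 \<phi>"
      using i2 by (simp add: n_def mult_ac)
  qed
qed

section \<open>Poincare's inequality and Rellich compactness\<close>

text \<open>The Jacobian c^N is at least 2^(-N).\<close>

lemma nn_integral_affine_le:
  fixes f :: "'n::euclidean_space => ennreal"
  assumes [measurable]: "f \<in> borel_measurable borel" and c: "c >= 1 / 2"
  shows "(\<integral>\<^sup>+x. f (a + c *\<^sub>R x) \<partial>lborel) <= ennreal (2 ^ DIM('n)) * (\<integral>\<^sup>+x. f x \<partial>lborel)"
proof -
  have "(\<integral>\<^sup>+x. f x \<partial>lborel) = ennreal (\<bar>c\<bar> ^ DIM('n)) * (\<integral>\<^sup>+x. f (a + c *\<^sub>R x) \<partial>lborel)"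
    using c by (subst lborel_affine[of c a]) (auto simp: nn_integral_density nn_integral_distr nn_integral_cmult)
  then have "ennreal (2 ^ DIM('n)) * (\<integral>\<^sup>+x. f x \<partial>lborel) = ennreal (2 ^ DIM('n) * \<bar>c\<bar> ^ DIM('n)) * (\<integral>\<^sup>+x. f (a + c *\<^sub>R x) \<partial>lborel)"
    by (simp add: ennreal_mult mult.assoc)
  moreover have "1 <= (2 * \<bar>c\<bar>) ^ DIM('n)" using c by (intro one_le_power) auto
  then have "ennreal 1 <= ennreal (2 ^ DIM('n) * \<bar>c\<bar> ^ DIM('n))" by (intro ennreal_leI) (simp add: power_mult_distrib)
  from mult_right_mono[OF this, of "\<integral>\<^sup>+x. f (a + c *\<^sub>R x) \<partial>lborel"] have
    "(\<integral>\<^sup>+x. f (a + c *\<^sub>R x) \<partial>lborel) <= ennreal (2 ^ DIM('n) * \<bar>c\<bar> ^ DIM('n)) * (\<integral>\<^sup>+x. f (a + c *\<^sub>R x) \<partial>lborel)" by simp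
  ultimately show ?thesis by simp
qed

text \<open>On the segment \<open>(1 - t) x + t y\<close> one of the two weights is at least a half; the corresponding
  variable is substituted.\<close>
lemma poincare_double:
  fixes v :: "'n::euclidean_space => real"
  assumes d: "!!x. (v has_derivative (%h. G x \<bullet> h)) (at x)" and c: "continuous_on UNIV G"
    and B [measurable]: "B \<in> sets borel" and cv: "convex B" and diam: "!!x y. x \<in> B ==> y \<in> B ==> norm (y - x) <= \<delta>"
  shows "(\<integral>\<^sup>+x\<in>B. (\<integral>\<^sup>+y\<in>B. ennreal ((v y - v x)^2) \<partial>lborel) \<partial>lborel)
    <= ennreal (2 ^ DIM('n) * \<delta>^2) * emeasure lborel B * (\<integral>\<^sup>+x\<in>B. ennreal ((norm (G x))^2) \<partial>lborel)"
proof -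
  have [measurable]: "G \<in> borel_measurable borel" by (rule borel_measurable_continuous_onI[OF c])
  have [measurable]: "v \<in> borel_measurable borel" by (rule borel_measurable_continuous_onI[OF C1_continuous[OF d]])
  define g where "g z = ennreal ((norm (G z))^2) * indicator B z" for z
  have g [measurable]: "g \<in> borel_measurable borel" unfolding g_def by measurable
  define A where "A = (\<integral>\<^sup>+x. g x \<partial>lborel)"
  define F where "F x y t = ennreal (\<delta>^2) * (g (x + t *\<^sub>R (y - x)) * indicator B x * indicator B y) * indicator {0..1} t" for x y :: 'n and t :: real
  have pt: "ennreal ((v y - v x)^2) * indicator B y * indicator B x <= (\<integral>\<^sup>+t. F x y t \<partial>lborel)" for x y
  proof (cases "x \<in> B \<and> y \<in> B")
    case True
    have "ennreal ((v y - v x)^2) <= (\<integral>\<^sup>+t\<in>{0..1}. ennreal ((norm (y - x))^2 * (norm (G (x + t *\<^sub>R (y - x))))^2) \<partial>lborel)"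
      by (rule segment_ineq[OF d c])
    also have "\<dots> <= (\<integral>\<^sup>+t. F x y t \<partial>lborel)"
    proof (rule nn_integral_mono)
      fix t :: real
      show "ennreal ((norm (y - x))^2 * (norm (G (x + t *\<^sub>R (y - x))))^2) * indicator {0..1} t <= F x y t"
      proof (cases "t \<in> {0..1}")
        case t: True
        have "x + t *\<^sub>R (y - x) = (1 - t) *\<^sub>R x + t *\<^sub>R y" by (simp add: algebra_simps)
        then have "x + t *\<^sub>R (y - x) \<in> B" using convexD_alt[OF cv, of x y t] True t by simp
        moreover have "(norm (y - x))^2 <= \<delta>^2" using diam True by (intro power_mono) auto
        ultimately show ?thesis using t True
          by (simp add: F_def g_def ennreal_mult[symmetric] ennreal_leI mult_right_mono)
      qed simp
    qed
    finally show ?thesis using True by simp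
  qed auto
  have slice: "(\<integral>\<^sup>+x. (\<integral>\<^sup>+y. F x y t \<partial>lborel) \<partial>lborel) <= ennreal (\<delta>^2) * (ennreal (2 ^ DIM('n)) * A * emeasure lborel B) * indicator {0..1} t" for t
  proof (cases "t \<in> {0..1}")
    case t: True
    have "(\<integral>\<^sup>+x. (\<integral>\<^sup>+y. g (x + t *\<^sub>R (y - x)) * indicator B x * indicator B y \<partial>lborel) \<partial>lborel) <= ennreal (2 ^ DIM('n)) * A * emeasure lborel B"
    proof (cases "t >= 1 / 2")
      case True
      have "(\<integral>\<^sup>+x. (\<integral>\<^sup>+y. g (x + t *\<^sub>R (y - x)) * indicator B x * indicator B y \<partial>lborel) \<partial>lborel)
         <= (\<integral>\<^sup>+x. (ennreal (2 ^ DIM('n)) * A) * indicator B x \<partial>lborel)"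
      proof (rule nn_integral_mono)
        fix x
        have "(\<integral>\<^sup>+y. g (x + t *\<^sub>R (y - x)) * indicator B x * indicator B y \<partial>lborel) <= (\<integral>\<^sup>+y. g ((1 - t) *\<^sub>R x + t *\<^sub>R y) * indicator B x \<partial>lborel)"
          by (rule nn_integral_mono) (auto simp: indicator_def algebra_simps)
        also have "\<dots> = (\<integral>\<^sup>+y. g ((1 - t) *\<^sub>R x + t *\<^sub>R y) \<partial>lborel) * indicator B x"
          by (rule nn_integral_multc) measurable
        also have "\<dots> <= (ennreal (2 ^ DIM('n)) * A) * indicator B x"
          unfolding A_def by (intro mult_right_mono nn_integral_affine_le True) auto
        finally show "(\<integral>\<^sup>+y. g (x + t *\<^sub>R (y - x)) * indicator B x * indicator B y \<partial>lborel) <= (ennreal (2 ^ DIM('n)) * A) * indicator B x" .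
      qed
      also have "\<dots> = ennreal (2 ^ DIM('n)) * A * emeasure lborel B" by (simp add: nn_integral_cmult_indicator)
      finally show ?thesis .
    next
      case False
      have m: "(%(x, y). g (x + t *\<^sub>R (y - x)) * indicator B x * indicator B y) \<in> borel_measurable (lborel \<Otimes>\<^sub>M lborel)" by measurable
      have "(\<integral>\<^sup>+x. (\<integral>\<^sup>+y. g (x + t *\<^sub>R (y - x)) * indicator B x * indicator B y \<partial>lborel) \<partial>lborel)
          = (\<integral>\<^sup>+y. (\<integral>\<^sup>+x. g (x + t *\<^sub>R (y - x)) * indicator B x * indicator B y \<partial>lborel) \<partial>lborel)"
        by (rule lborel_pair.Fubini'[OF m, symmetric])
      also have "\<dots> <= (\<integral>\<^sup>+y. (ennreal (2 ^ DIM('n)) * A) * indicator B y \<partial>lborel)"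
      proof (rule nn_integral_mono)
        fix y
        have "(\<integral>\<^sup>+x. g (x + t *\<^sub>R (y - x)) * indicator B x * indicator B y \<partial>lborel) <= (\<integral>\<^sup>+x. g (t *\<^sub>R y + (1 - t) *\<^sub>R x) * indicator B y \<partial>lborel)"
          by (rule nn_integral_mono) (auto simp: indicator_def algebra_simps)
        also have "\<dots> = (\<integral>\<^sup>+x. g (t *\<^sub>R y + (1 - t) *\<^sub>R x) \<partial>lborel) * indicator B y"
          by (rule nn_integral_multc) measurable
        also have "\<dots> <= (ennreal (2 ^ DIM('n)) * A) * indicator B y"
          unfolding A_def by (intro mult_right_mono nn_integral_affine_le) (use False in auto)
        finally show "(\<integral>\<^sup>+x. g (x + t *\<^sub>R (y - x)) * indicator B x * indicator B y \<partial>lborel) <= (ennreal (2 ^ DIM('n)) * A) * indicator B y" .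
      qed
      also have "\<dots> = ennreal (2 ^ DIM('n)) * A * emeasure lborel B" by (simp add: nn_integral_cmult_indicator)
      finally show ?thesis .
    qed
    then have "ennreal (\<delta>^2) * (\<integral>\<^sup>+x. (\<integral>\<^sup>+y. g (x + t *\<^sub>R (y - x)) * indicator B x * indicator B y \<partial>lborel) \<partial>lborel)
        <= ennreal (\<delta>^2) * (ennreal (2 ^ DIM('n)) * A * emeasure lborel B)" by (rule mult_left_mono) simp
    moreover have "(\<integral>\<^sup>+x. (\<integral>\<^sup>+y. F x y t \<partial>lborel) \<partial>lborel) = ennreal (\<delta>^2) * (\<integral>\<^sup>+x. (\<integral>\<^sup>+y. g (x + t *\<^sub>R (y - x)) * indicator B x * indicator B y \<partial>lborel) \<partial>lborel)"
      using t by (simp add: F_def nn_integral_cmult)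
    ultimately show ?thesis using t by simp
  qed (simp add: F_def)
  have "(\<integral>\<^sup>+x\<in>B. (\<integral>\<^sup>+y\<in>B. ennreal ((v y - v x)^2) \<partial>lborel) \<partial>lborel)
     = (\<integral>\<^sup>+x. (\<integral>\<^sup>+y. ennreal ((v y - v x)^2) * indicator B y * indicator B x \<partial>lborel) \<partial>lborel)"
    by (intro nn_integral_cong nn_integral_multc[symmetric]) measurable
  also have "\<dots> <= (\<integral>\<^sup>+x. (\<integral>\<^sup>+y. (\<integral>\<^sup>+t. F x y t \<partial>lborel) \<partial>lborel) \<partial>lborel)"
    by (intro nn_integral_mono pt)
  also have "\<dots> = (\<integral>\<^sup>+x. (\<integral>\<^sup>+t. (\<integral>\<^sup>+y. F x y t \<partial>lborel) \<partial>lborel) \<partial>lborel)"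
  proof (rule nn_integral_cong)
    fix x
    have "(%(t, y). F x y t) \<in> borel_measurable (lborel \<Otimes>\<^sub>M lborel)" unfolding F_def by measurable
    then show "(\<integral>\<^sup>+y. (\<integral>\<^sup>+t. F x y t \<partial>lborel) \<partial>lborel) = (\<integral>\<^sup>+t. (\<integral>\<^sup>+y. F x y t \<partial>lborel) \<partial>lborel)"
      by (rule lborel_pair.Fubini')
  qed
  also have "\<dots> = (\<integral>\<^sup>+t. (\<integral>\<^sup>+x. (\<integral>\<^sup>+y. F x y t \<partial>lborel) \<partial>lborel) \<partial>lborel)"
  proof -
    have "(%(t, x). \<integral>\<^sup>+y. F x y t \<partial>lborel) \<in> borel_measurable (lborel \<Otimes>\<^sub>M lborel)" unfolding F_def by measurable
    then show ?thesis by (rule lborel_pair.Fubini')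
  qed
  also have "\<dots> <= (\<integral>\<^sup>+t. ennreal (\<delta>^2) * (ennreal (2 ^ DIM('n)) * A * emeasure lborel B) * indicator {0..1::real} t \<partial>lborel)"
    by (rule nn_integral_mono) (rule slice)
  also have "\<dots> = ennreal (\<delta>^2) * (ennreal (2 ^ DIM('n)) * A * emeasure lborel B)"
    by (simp add: nn_integral_cmult_indicator)
  also have "\<dots> = ennreal (2 ^ DIM('n) * \<delta>^2) * emeasure lborel B * A"
    by (simp add: ennreal_mult mult_ac)
  finally show ?thesis by (simp add: A_def g_def)
qed

text \<open>The inequality v(x)^2 <= 2 (v(y) - v(x))^2 + 2 v(y)^2 is integrated over y in
  \<open>Z\<close> and x in \<open>B\<close>. The last term is retained because the maximum
  principle uses this for smooth approximants, which are merely small on the zero set of their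
  limit.\<close>

lemma poincare_zero_set:
  fixes v :: "'n::euclidean_space => real"
  assumes d: "!!x. (v has_derivative (%h. G x \<bullet> h)) (at x)" and c: "continuous_on UNIV G"
    and B: "B \<in> sets borel" and cv: "convex B" and diam: "!!x y. x \<in> B ==> y \<in> B ==> norm (y - x) <= \<delta>"
    and Z: "Z \<in> sets lebesgue" "Z \<subseteq> B"
  shows "emeasure lebesgue Z * (\<integral>\<^sup>+x\<in>B. ennreal ((v x)^2) \<partial>lebesgue) \<le>
     2 * (ennreal (2 ^ DIM('n) * \<delta>^2) * emeasure lebesgue B * (\<integral>\<^sup>+x\<in>B. ennreal ((norm (G x))^2) \<partial>lebesgue))
     + 2 * (emeasure lebesgue B * (\<integral>\<^sup>+x\<in>Z. ennreal ((v x)^2) \<partial>lebesgue))"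
proof -
  have v [measurable]: "v \<in> Lmeas" by (rule continuous_measurable_lebesgue[OF C1_continuous[OF d]])
  have vb [measurable]: "v \<in> borel_measurable borel" by (rule borel_measurable_continuous_onI[OF C1_continuous[OF d]])
  have Bl [measurable]: "B \<in> sets lebesgue" using B by simp
  note Z(1) [measurable] B [measurable]
  define I where "I x = (\<integral>\<^sup>+y\<in>B. ennreal ((v y - v x)^2) \<partial>lborel)" for x
  have Im: "I \<in> borel_measurable borel" unfolding I_def by measurable
  have Iml [measurable]: "I \<in> Lmeas" using measurable_completion[of I lborel borel] Im by simp
  define V where "V = (\<integral>\<^sup>+x\<in>Z. ennreal ((v x)^2) \<partial>lebesgue)"
  have "emeasure lebesgue Z * (\<integral>\<^sup>+x\<in>B. ennreal ((v x)^2) \<partial>lebesgue) = (\<integral>\<^sup>+x. emeasure lebesgue Z * (ennreal ((v x)^2) * indicator B x) \<partial>lebesgue)"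
    by (rule nn_integral_cmult[symmetric]) measurable
  also have "\<dots> <= (\<integral>\<^sup>+x. (2 * I x + 2 * V) * indicator B x \<partial>lebesgue)"
  proof (rule nn_integral_mono)
    fix x
    have "emeasure lebesgue Z * ennreal ((v x)^2) = (\<integral>\<^sup>+y. ennreal ((v x)^2) * indicator Z y \<partial>lebesgue)"
      using nn_integral_cmult_indicator[OF Z(1), of "ennreal ((v x)^2)"] by (simp only: mult.commute)
    also have "\<dots> <= (\<integral>\<^sup>+y. 2 * (ennreal ((v y - v x)^2) * indicator B y) + 2 * (ennreal ((v y)^2) * indicator Z y) \<partial>lebesgue)"
    proof (rule nn_integral_mono)
      fix y
      have "(v x)^2 <= 2 * (v y - v x)^2 + 2 * (v y)^2"
        using sum_squares_bound[of "v y" "v x"] zero_le_power2[of "2 * v y - v x"] by (simp add: power2_eq_square algebra_simps)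
      then have "ennreal ((v x)^2) <= 2 * ennreal ((v y - v x)^2) + 2 * ennreal ((v y)^2)"
        by (simp flip: ennreal_numeral ennreal_mult ennreal_plus add: ennreal_leI)
      then show "ennreal ((v x)^2) * indicator Z y <= 2 * (ennreal ((v y - v x)^2) * indicator B y) + 2 * (ennreal ((v y)^2) * indicator Z y)"
        using Z(2) by (auto simp: indicator_def)
    qed
    also have "\<dots> = 2 * (\<integral>\<^sup>+y\<in>B. ennreal ((v y - v x)^2) \<partial>lebesgue) + 2 * V"
      unfolding V_def by (simp add: nn_integral_add nn_integral_cmult)
    also have "(\<integral>\<^sup>+y\<in>B. ennreal ((v y - v x)^2) \<partial>lebesgue) = I x"
      unfolding I_def by (rule nn_integral_completion)
    finally show "emeasure lebesgue Z * (ennreal ((v x)^2) * indicator B x) <= (2 * I x + 2 * V) * indicator B x"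
      by (auto simp: indicator_def)
  qed
  also have "\<dots> = (\<integral>\<^sup>+x. 2 * (I x * indicator B x) + 2 * V * indicator B x \<partial>lebesgue)"
    by (rule nn_integral_cong) (auto simp: indicator_def)
  also have "\<dots> = 2 * (\<integral>\<^sup>+x\<in>B. I x \<partial>lebesgue) + 2 * V * emeasure lebesgue B"
    by (simp add: nn_integral_add nn_integral_cmult nn_integral_cmult_indicator)
  also have "\<dots> <= 2 * (ennreal (2 ^ DIM('n) * \<delta>^2) * emeasure lborel B * (\<integral>\<^sup>+x\<in>B. ennreal ((norm (G x))^2) \<partial>lborel))
      + 2 * V * emeasure lebesgue B"
  proof (intro add_mono mult_left_mono order_refl)
    have "(\<integral>\<^sup>+x\<in>B. I x \<partial>lebesgue) = (\<integral>\<^sup>+x\<in>B. I x \<partial>lborel)"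
      by (rule nn_integral_completion)
    then show "(\<integral>\<^sup>+x\<in>B. I x \<partial>lebesgue) <= ennreal (2 ^ DIM('n) * \<delta>^2) * emeasure lborel B * (\<integral>\<^sup>+x\<in>B. ennreal ((norm (G x))^2) \<partial>lborel)"
      unfolding I_def using poincare_double[OF d c B cv diam] by simp
  qed auto
  finally show ?thesis using B by (simp add: V_def nn_integral_completion mult_ac)
qed

text \<open>Expanding the square, the double integral of (v(y) - v(x))^2 equals 2 m X - 2 Y^2 with m
  the measure of \<open>B\<close>; \<open>poincare_double\<close> bounds it from above.\<close>

lemma poincare_mean:
  fixes v :: "'n::euclidean_space => real"
  assumes v: "C1c v G"
    and B [measurable]: "B \<in> sets borel" and cv: "convex B" and diam: "!!x y. x \<in> B ==> y \<in> B ==> norm (y - x) <= \<delta>"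
    and fin: "emeasure lborel B < \<infinity>"
  shows "(LINT x|lborel. indicator B x * (v x)^2) <= (LINT x|lborel. indicator B x * v x)^2 / measure lborel B
     + 2 ^ DIM('n) * \<delta>^2 * (LINT x|lborel. indicator B x * (norm (G x))^2)"
proof -
  note [measurable] = C1c_facts(4,5)[OF v]
  define m where "m = measure lborel B"
  have em: "emeasure lborel B = ennreal m" using fin by (simp add: m_def emeasure_eq_ennreal_measure)
  define X where "X = (LINT x|lborel. indicator B x * (v x)^2)"
  define Y where "Y = (LINT x|lborel. indicator B x * v x)"
  define D where "D = (LINT x|lborel. indicator B x * (norm (G x))^2)"
  have iB: "integrable lborel (indicator B :: 'n => real)" using fin by (intro integrable_real_indicator) auto
  have iX: "integrable lborel (%x. indicator B x * (v x)^2)"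
    using integrable_mult_indicator[OF _ C1c_facts(6)[OF v], of B] by simp
  have iD: "integrable lborel (%x. indicator B x * (norm (G x))^2)"
    using integrable_mult_indicator[OF _ C1c_facts(7)[OF v], of B] by simp
  have "integrable lborel v"
    using C1c_facts(8)[OF v] by (subst integrable_abs_iff[symmetric]) auto
  then have iY: "integrable lborel (%x. indicator B x * v x)"
    using integrable_mult_indicator[of B lborel v] by simp
  have X0: "X >= 0" "D >= 0" "m >= 0" by (auto simp: X_def D_def m_def intro!: integral_nonneg_AE)
  have inner: "(\<integral>\<^sup>+y\<in>B. ennreal ((v y - v x)^2) \<partial>lborel) = ennreal (X - 2 * v x * Y + m * (v x)^2)" for x
  proof -
    have eq: "indicator B y * (v y - v x)^2 = indicator B y * (v y)^2 - 2 * v x * (indicator B y * v y) + (v x)^2 * indicator B y" for y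
      by (simp add: power2_diff algebra_simps)
    have i: "integrable lborel (%y. indicator B y * (v y - v x)^2)" unfolding eq using iX iY iB by simp
    have "(\<integral>\<^sup>+y\<in>B. ennreal ((v y - v x)^2) \<partial>lborel) = (\<integral>\<^sup>+y. ennreal (indicator B y * (v y - v x)^2) \<partial>lborel)"
      by (rule nn_integral_cong) (auto simp: indicator_def)
    also have "\<dots> = ennreal (LINT y|lborel. indicator B y * (v y - v x)^2)"
      by (rule nn_integral_eq_integral[OF i]) simp
    also have "(LINT y|lborel. indicator B y * (v y - v x)^2) = X - 2 * v x * Y + m * (v x)^2"
      unfolding eq using iX iY iB by (simp add: X_def Y_def m_def)
    finally show ?thesis .
  qed
  have inn0: "X - 2 * v x * Y + m * (v x)^2 >= 0" for x
  proof -
    have "(LINT y|lborel. indicator B y * (v y - v x)^2) >= 0" by (rule integral_nonneg_AE) simp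
    also have "(%y. indicator B y * (v y - v x)^2) = (%y. indicator B y * (v y)^2 - 2 * v x * (indicator B y * v y) + (v x)^2 * indicator B y)"
      by (rule ext) (simp add: power2_diff algebra_simps)
    also have "(LINT y|lborel. \<dots> y) = X - 2 * v x * Y + m * (v x)^2"
      using iX iY iB by (simp add: X_def Y_def m_def)
    finally show ?thesis .
  qed
  have eq2: "indicator B x * (X - 2 * v x * Y + m * (v x)^2) = X * indicator B x - 2 * Y * (indicator B x * v x) + m * (indicator B x * (v x)^2)" for x
    by (simp add: algebra_simps)
  have "(\<integral>\<^sup>+x\<in>B. (\<integral>\<^sup>+y\<in>B. ennreal ((v y - v x)^2) \<partial>lborel) \<partial>lborel) = (\<integral>\<^sup>+x. ennreal (indicator B x * (X - 2 * v x * Y + m * (v x)^2)) \<partial>lborel)"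
    unfolding inner by (rule nn_integral_cong) (auto simp: indicator_def)
  also have "\<dots> = ennreal (LINT x|lborel. indicator B x * (X - 2 * v x * Y + m * (v x)^2))"
  proof (rule nn_integral_eq_integral)
    show "integrable lborel (%x. indicator B x * (X - 2 * v x * Y + m * (v x)^2))"
      unfolding eq2 using iX iY iB by simp
  qed (use inn0 in simp)
  also have "(LINT x|lborel. indicator B x * (X - 2 * v x * Y + m * (v x)^2)) = X * m - 2 * Y * Y + m * X"
    unfolding eq2 using iX iY iB by (simp add: X_def Y_def m_def)
  finally have L: "(\<integral>\<^sup>+x\<in>B. (\<integral>\<^sup>+y\<in>B. ennreal ((v y - v x)^2) \<partial>lborel) \<partial>lborel) = ennreal (X * m - 2 * Y * Y + m * X)" .
  have "(\<integral>\<^sup>+x\<in>B. ennreal ((norm (G x))^2) \<partial>lborel) = (\<integral>\<^sup>+x. ennreal (indicator B x * (norm (G x))^2) \<partial>lborel)"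
    by (rule nn_integral_cong) (auto simp: indicator_def)
  also have "\<dots> = ennreal D" unfolding D_def by (rule nn_integral_eq_integral[OF iD]) simp
  finally have "ennreal (X * m - 2 * Y * Y + m * X) <= ennreal (2 ^ DIM('n) * \<delta>^2) * ennreal m * ennreal D"
    using poincare_double[OF C1c_facts(1,2)[OF v] B cv diam] L em by simp
  then have "ennreal (X * m - 2 * Y * Y + m * X) <= ennreal (2 ^ DIM('n) * \<delta>^2 * m * D)"
    using X0 by (simp add: ennreal_mult)
  then have main: "X * m - 2 * Y * Y + m * X <= 2 ^ DIM('n) * \<delta>^2 * m * D"
    by (subst (asm) ennreal_le_iff) (use X0 in auto)
  have "X <= Y^2 / m + 2 ^ DIM('n) * \<delta>^2 * D"
  \<comment> \<open>For m = 0 the quotient has the default value 0, but then X vanishes too.\<close>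
  proof (cases "m = 0")
    case True
    then have "B \<in> null_sets lborel" using em by (auto simp: null_sets_def)
    then have "AE x in lborel. x \<notin> B" by (rule AE_not_in)
    then have "AE x in lborel. indicator B x * (v x)^2 = 0" by eventually_elim simp
    then have "X = 0" unfolding X_def by (rule integral_eq_zero_AE)
    then show ?thesis using X0 True by simp
  next
    case False
    define A where "A = 2 ^ DIM('n) * \<delta>^2 * m * D"
    have "m * X <= Y^2 + A / 2"
      using main unfolding A_def[symmetric] by (simp add: power2_eq_square[of Y] mult.commute[of X m])
    then have "m * X <= Y^2 + 2 ^ DIM('n) * \<delta>^2 * m * D / 2" by (simp add: A_def)
    also have "\<dots> <= Y^2 + 2 ^ DIM('n) * \<delta>^2 * m * D" using X0 by simp
    finally show ?thesis using False X0 by (simp add: field_simps)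
  qed
  then show ?thesis by (simp add: X_def Y_def D_def m_def)
qed

section \<open>Partition into small cubes and Rellich compactness\<close>

definition cell :: "nat => ('n::euclidean_space => int) => 'n set" where
  "cell j k = {x. \<forall>i\<in>Basis. of_int (k i) <= (x \<bullet> i) * real (Suc j) \<and> (x \<bullet> i) * real (Suc j) < of_int (k i) + 1}"

lemma cell_borel [measurable]: "cell j k \<in> sets borel"
proof -
  have "cell j k = (\<Inter>i\<in>Basis. {x\<in>space borel. of_int (k i) <= (x \<bullet> i) * real (Suc j) \<and> (x \<bullet> i) * real (Suc j) < of_int (k i) + 1})"
    by (auto simp: cell_def)
  also have "\<dots> \<in> sets borel" by (intro sets.finite_INT finite_Basis nonempty_Basis) measurable
  finally show ?thesis .
qed

lemma cell_convex: "convex (cell j k)"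
proof (rule convexI)
  fix x y :: 'a and u v :: real
  assume a: "x \<in> cell j k" "y \<in> cell j k" and uv: "0 <= u" "0 <= v" "u + v = 1"
  show "u *\<^sub>R x + v *\<^sub>R y \<in> cell j k"
    unfolding cell_def
  proof (intro CollectI ballI)
    fix i :: 'a assume i: "i \<in> Basis"
    define s where "s = (x \<bullet> i) * real (Suc j)"
    define t where "t = (y \<bullet> i) * real (Suc j)"
    have st: "s \<in> {of_int (k i)..<of_int (k i) + 1}" "t \<in> {of_int (k i)..<of_int (k i) + 1}"
      using a i by (auto simp: cell_def s_def t_def)
    have "u *\<^sub>R s + v *\<^sub>R t \<in> {of_int (k i)..<of_int (k i) + (1::real)}"
      by (rule convexD[OF convex_real_interval(7) st uv])
    moreover have "((u *\<^sub>R x + v *\<^sub>R y) \<bullet> i) * real (Suc j) = u *\<^sub>R s + v *\<^sub>R t"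
      by (simp add: s_def t_def inner_add_left algebra_simps)
    ultimately show "of_int (k i) <= ((u *\<^sub>R x + v *\<^sub>R y) \<bullet> i) * real (Suc j) \<and> ((u *\<^sub>R x + v *\<^sub>R y) \<bullet> i) * real (Suc j) < of_int (k i) + 1"
      by simp
  qed
qed

lemma cell_diam:
  fixes x y :: "'n::euclidean_space"
  assumes "x \<in> cell j k" "y \<in> cell j k"
  shows "norm (y - x) <= real DIM('n) / real (Suc j)"
proof -
  have "norm (y - x) <= (\<Sum>i\<in>Basis. \<bar>(y - x) \<bullet> i\<bar>)" by (rule norm_le_l1)
  also have "\<dots> <= (\<Sum>i\<in>(Basis::'n set). 1 / real (Suc j))"
  proof (rule sum_mono)
    fix i :: 'n assume i: "i \<in> Basis"
    have "of_int (k i) <= (x \<bullet> i) * real (Suc j)" "(x \<bullet> i) * real (Suc j) < of_int (k i) + 1"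
      "of_int (k i) <= (y \<bullet> i) * real (Suc j)" "(y \<bullet> i) * real (Suc j) < of_int (k i) + 1"
      using assms i by (auto simp: cell_def)
    then have "\<bar>(y \<bullet> i) * real (Suc j) - (x \<bullet> i) * real (Suc j)\<bar> <= 1" by linarith
    then have "\<bar>(y - x) \<bullet> i\<bar> * real (Suc j) <= 1"
      by (simp add: inner_diff_left left_diff_distrib[symmetric] abs_mult del: of_nat_Suc)
    then show "\<bar>(y - x) \<bullet> i\<bar> <= 1 / real (Suc j)" by (simp add: field_simps del: of_nat_Suc)
  qed
  also have "\<dots> = real DIM('n) / real (Suc j)" by simp
  finally show ?thesis .
qed

lemma cell_emeasure: "emeasure lborel (cell j k :: 'n::euclidean_space set) <= emeasure lborel (cball (0::'n) (real DIM('n)))"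
proof (cases "cell j k = ({} :: 'n set)")
  case False
  then obtain z :: 'n where z: "z \<in> cell j k" by auto
  have "real DIM('n) / real (Suc j) <= real DIM('n)" by (simp add: field_simps)
  then have "cell j k \<subseteq> cball z (real DIM('n))"
    using cell_diam[OF z] order_trans by (fastforce simp: dist_norm norm_minus_commute)
  then have "emeasure lborel (cell j k) <= emeasure lborel (cball z (real DIM('n)))" by (intro emeasure_mono) auto
  then show ?thesis by (simp add: emeasure_cball)
qed simp

text \<open>Half-open cubes do not overlap, so a point determines the index through the floors of
  its scaled coordinates; \<open>extensional\<close> fixes the index outside of
  \<open>Basis\<close>.\<close>

lemma cell_unique:
  assumes "x \<in> cell j k" "x \<in> cell j k'" "k \<in> extensional Basis" "k' \<in> extensional Basis"
  shows "k = k'"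
proof (rule extensionalityI[OF assms(3,4)])
  fix i :: 'a assume "i \<in> Basis"
  then have "k i = \<lfloor>(x \<bullet> i) * real (Suc j)\<rfloor>" "k' i = \<lfloor>(x \<bullet> i) * real (Suc j)\<rfloor>"
    using assms(1,2) by (auto simp: cell_def simp del: of_nat_Suc intro!: floor_unique[symmetric])
  then show "k i = k' i" by simp
qed

text \<open>Poincare's inequality on each of the finitely many cubes meeting the ball. The squared
  diameter makes the gradient term small, and what remains depends on finitely many means: this is
  the finite-dimensional reduction behind compactness. The gradient terms add up to at most one
  Dirichlet integral because the cubes are disjoint.\<close>

lemma cell_approx:
  fixes R :: real
  shows "\<exists>F :: ('n::euclidean_space => int) set. finite F \<and> F \<subseteq> extensional Basis \<and>
    (\<forall>\<phi>. test_fun UNIV \<phi> \<longrightarrow> (LINT x|lborel. indicator (cball 0 R) x * (\<phi> x)^2) \<le>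
        (\<Sum>k\<in>F. (LINT x|lborel. indicator (cell j k) x * \<phi> x)^2 / measure lborel (cell j k))
        + 2 ^ DIM('n) * (real DIM('n) / real (Suc j))^2 * gnorm2 \<phi>)"
proof -
  define m where "m = \<lceil>\<bar>R\<bar> * real (Suc j)\<rceil> + 1"
  define F :: "('n => int) set" where "F = (\<Pi>\<^sub>E i\<in>Basis. {-m..m})"
  have fF: "finite F" unfolding F_def by (rule finite_PiE) auto
  have ext: "F \<subseteq> extensional Basis" by (auto simp: F_def PiE_def)
  have cover: "\<exists>k\<in>F. x \<in> cell j k" if x: "x \<in> cball 0 R" for x :: 'n
  proof -
    define k where "k = restrict (%i. \<lfloor>(x \<bullet> i) * real (Suc j)\<rfloor>) Basis"
    have "\<lfloor>(x \<bullet> i) * real (Suc j)\<rfloor> \<in> {-m..m}" if i: "i \<in> Basis" for i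
    proof -
      have "\<bar>x \<bullet> i\<bar> <= \<bar>R\<bar>" using Basis_le_norm[OF i, of x] x by simp
      then have "\<bar>(x \<bullet> i) * real (Suc j)\<bar> <= \<bar>R\<bar> * real (Suc j)" by (simp add: abs_mult mult_right_mono del: of_nat_Suc)
      also have "\<dots> <= of_int (m - 1)" by (simp add: m_def del: of_nat_Suc)
      finally have b: "\<bar>(x \<bullet> i) * real (Suc j)\<bar> <= of_int (m - 1)" .
      have "\<lfloor>(x \<bullet> i) * real (Suc j)\<rfloor> <= \<lfloor>real_of_int (m - 1)\<rfloor>" using b by (intro floor_mono) linarith
      moreover have "\<lfloor>real_of_int (- m)\<rfloor> <= \<lfloor>(x \<bullet> i) * real (Suc j)\<rfloor>" 
      proof (rule floor_mono)
        have "real_of_int (- m) = - real_of_int (m - 1) - 1" by simp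
        then show "real_of_int (- m) <= (x \<bullet> i) * real (Suc j)" using b by linarith
      qed
      ultimately show ?thesis by (simp del: of_nat_Suc)
    qed
    then have "k \<in> F" unfolding F_def k_def by (intro PiE_I) auto
    moreover have "x \<in> cell j k" unfolding cell_def k_def by (simp del: of_nat_Suc)
    ultimately show ?thesis by blast
  qed
  show ?thesis
  proof (intro exI[of _ F] conjI fF ext allI impI)
    fix \<phi> :: "'n => real" assume t: "test_fun UNIV \<phi>"
    note C = C1c_facts[OF C1c_test[OF t]]
    note [measurable] = C(4,5)
    define c where "c = 2 ^ DIM('n) * (real DIM('n) / real (Suc j))^2"
    have c0: "c >= 0" by (simp add: c_def)
    have i1: "integrable lborel (%x. indicator (cell j k) x * (\<phi> x)^2)" for k
      using integrable_mult_indicator[OF _ C(6), of "cell j k"] by simp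
    have i2: "integrable lborel (%x. indicator (cell j k) x * (norm (cgrad \<phi> x))^2)" for k
      using integrable_mult_indicator[OF _ C(7), of "cell j k"] by simp
    have i3: "integrable lborel (%x. indicator (cball 0 R) x * (\<phi> x)^2)"
      using integrable_mult_indicator[OF _ C(6), of "cball 0 R"] by simp
    have "(LINT x|lborel. indicator (cball 0 R) x * (\<phi> x)^2) <= (LINT x|lborel. (\<Sum>k\<in>F. indicator (cell j k) x * (\<phi> x)^2))"
    proof (rule integral_mono[OF i3 Bochner_Integration.integrable_sum[OF i1]])
      fix x
      show "indicator (cball 0 R) x * (\<phi> x)^2 <= (\<Sum>k\<in>F. indicator (cell j k) x * (\<phi> x)^2)"
      proof (cases "x \<in> cball 0 R")
        case True
        then obtain k where k: "k \<in> F" "x \<in> cell j k" using cover by blast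
        have "indicator (cell j k) x * (\<phi> x)^2 <= (\<Sum>k\<in>F. indicator (cell j k) x * (\<phi> x)^2)"
          by (rule member_le_sum) (use k fF in auto)
        then show ?thesis using True k by simp
      qed (simp add: sum_nonneg)
    qed
    also have "\<dots> = (\<Sum>k\<in>F. LINT x|lborel. indicator (cell j k) x * (\<phi> x)^2)"
      by (rule Bochner_Integration.integral_sum[OF i1])
    also have "\<dots> <= (\<Sum>k\<in>F. (LINT x|lborel. indicator (cell j k) x * \<phi> x)^2 / measure lborel (cell j k)
        + c * (LINT x|lborel. indicator (cell j k) x * (norm (cgrad \<phi> x))^2))"
    proof (rule sum_mono)
      fix k
      have "emeasure lborel (cell j k :: 'n set) < \<infinity>"
        using cell_emeasure[of j k] by (rule le_less_trans) (simp add: emeasure_cball)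
      then show "(LINT x|lborel. indicator (cell j k) x * (\<phi> x)^2) <= (LINT x|lborel. indicator (cell j k) x * \<phi> x)^2 / measure lborel (cell j k)
        + c * (LINT x|lborel. indicator (cell j k) x * (norm (cgrad \<phi> x))^2)"
        unfolding c_def by (intro poincare_mean[OF C1c_test[OF t] _ cell_convex cell_diam]) auto
    qed
    also have "\<dots> = (\<Sum>k\<in>F. (LINT x|lborel. indicator (cell j k) x * \<phi> x)^2 / measure lborel (cell j k))
        + c * (\<Sum>k\<in>F. LINT x|lborel. indicator (cell j k) x * (norm (cgrad \<phi> x))^2)"
      by (simp add: sum.distrib sum_distrib_left)
    also have "(\<Sum>k\<in>F. LINT x|lborel. indicator (cell j k) x * (norm (cgrad \<phi> x))^2) = (LINT x|lborel. (\<Sum>k\<in>F. indicator (cell j k) x * (norm (cgrad \<phi> x))^2))"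
      by (rule Bochner_Integration.integral_sum[OF i2, symmetric])
    also have "\<dots> <= gnorm2 \<phi>"
      unfolding gnorm2_lborel[OF t]
    proof (rule integral_mono[OF Bochner_Integration.integrable_sum[OF i2] C(7)])
      fix x
      have "(\<Sum>k\<in>F. indicator (cell j k) x) = (\<Sum>k\<in>F. if x \<in> cell j k then 1 else (0::real))"
        by (rule sum.cong) auto
      also have "\<dots> = real (card {k\<in>F. x \<in> cell j k})" using fF by (simp add: sum.If_cases Int_def)
      also have "card {k\<in>F. x \<in> cell j k} <= 1" using fF ext cell_unique[of x j] by (simp add: card_le_Suc0_iff_eq subset_iff)
      finally have "(\<Sum>k\<in>F. indicator (cell j k) x) <= (1::real)" by simp
      from mult_right_mono[OF this, of "(norm (cgrad \<phi> x))^2"]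
      show "(\<Sum>k\<in>F. indicator (cell j k) x * (norm (cgrad \<phi> x))^2) <= (norm (cgrad \<phi> x))^2"
        by (simp add: sum_distrib_right)
    qed
    finally show "(LINT x|lborel. indicator (cball 0 R) x * (\<phi> x)^2) \<le>
        (\<Sum>k\<in>F. (LINT x|lborel. indicator (cell j k) x * \<phi> x)^2 / measure lborel (cell j k))
        + 2 ^ DIM('n) * (real DIM('n) / real (Suc j))^2 * gnorm2 \<phi>"
      using c0 by (simp add: c_def mult_left_mono)
  qed
qed

lemma gnorm2_diff_le:
  assumes "test_fun U \<phi>" "test_fun U \<psi>"
  shows "gnorm2 (%x. \<phi> x - \<psi> x) <= 2 * gnorm2 \<phi> + 2 * gnorm2 \<psi>"
proof -
  note C = C1c_facts(7)[OF C1c_test]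
  have sm: "smooth_fun \<phi>" "smooth_fun \<psi>" using assms by (auto intro: test_smooth)
  have "gnorm2 (%x. \<phi> x - \<psi> x) <= (LINT x|lborel. 2 * (norm (cgrad \<phi> x))^2 + 2 * (norm (cgrad \<psi> x))^2)"
    unfolding gnorm2_lborel[OF test_diff[OF assms]]
  proof (rule integral_mono[OF C[OF test_diff[OF assms]]])
    show "integrable lborel (%x. 2 * (norm (cgrad \<phi> x))^2 + 2 * (norm (cgrad \<psi> x))^2)"
      using C[OF assms(1)] C[OF assms(2)] by simp
    fix x
    have "(norm (cgrad \<phi> x - cgrad \<psi> x))^2 <= (norm (cgrad \<phi> x) + norm (cgrad \<psi> x))^2"
      by (intro power_mono norm_triangle_ineq4) auto
    also have "\<dots> <= 2 * (norm (cgrad \<phi> x))^2 + 2 * (norm (cgrad \<psi> x))^2"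
      using sum_squares_bound[of "norm (cgrad \<phi> x)" "norm (cgrad \<psi> x)"] by (simp add: power2_sum)
    finally show "(norm (cgrad (%x. \<phi> x - \<psi> x) x))^2 <= 2 * (norm (cgrad \<phi> x))^2 + 2 * (norm (cgrad \<psi> x))^2"
      by (simp add: cgrad_diff[OF sm])
  qed
  then show ?thesis
    using C[OF assms(1)] C[OF assms(2)] by (simp add: gnorm2_lborel[OF assms(1)] gnorm2_lborel[OF assms(2)])
qed

text \<open>The admissible potentials, that is L^(N/2). Both f and the indicators of sets of finite
  measure belong to it, so one compactness statement serves both.\<close>

definition Lhalf :: "('n::euclidean_space => real) => bool" where
  "Lhalf h \<longleftrightarrow> h \<in> Lmeas \<and> L1f (%x. \<bar>h x\<bar> powr (real DIM('n) / 2))"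

lemma Lhalf_indicator:
  assumes "A \<in> sets lebesgue" "emeasure lebesgue A < \<infinity>"
  shows "Lhalf (indicator A :: 'n::euclidean_space => real)"
proof -
  have "(%x. \<bar>indicator A x :: real\<bar> powr (real DIM('n) / 2)) = indicator A" by (auto simp: indicator_def)
  then show ?thesis using assms by (auto simp: Lhalf_def intro!: integrable_real_indicator)
qed

lemma holder_sobolev_Lhalf:
  assumes N: "DIM('n::euclidean_space) >= 3"
  shows "\<exists>K>0. \<forall>(h :: 'n => real) \<phi>. Lhalf h \<longrightarrow> test_fun UNIV \<phi> \<longrightarrow>
      L1f (%x. \<bar>h x\<bar> * (\<phi> x)^2) \<and>
      (LI x. \<bar>h x\<bar> * (\<phi> x)^2) \<le>
        K * (LI x. \<bar>h x\<bar> powr (real DIM('n) / 2)) powr (2 / real DIM('n)) * gnorm2 \<phi>"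
proof (rule holder_sobolev[OF N])
  fix K :: real
  assume K: "K > 0" and b: "!!(h :: 'n => real) \<phi>. h \<in> Lmeas ==>
      L1f (%x. \<bar>h x\<bar> powr (real DIM('n) / 2)) ==> test_fun UNIV \<phi> ==>
      L1f (%x. \<bar>h x\<bar> * (\<phi> x)^2) \<and>
      (LI x. \<bar>h x\<bar> * (\<phi> x)^2) \<le>
        K * (LI x. \<bar>h x\<bar> powr (real DIM('n) / 2)) powr (2 / real DIM('n)) * gnorm2 \<phi>"
  show ?thesis using K b unfolding Lhalf_def by (intro exI[of _ K]) simp
qed

text \<open>On a cube |\<phi>| <= 1 + \<phi>^2, and the indicator of the cube is an admissible
  potential. The bound is uniform over all cubes, as the diagonal extraction of
  \<open>rellich_local\<close> needs.\<close>

lemma cell_bound: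
  assumes N: "DIM('n::euclidean_space) >= 3"
  shows "\<exists>b. \<forall>j k \<phi>. test_fun UNIV (\<phi> :: 'n => real) \<longrightarrow> gnorm2 \<phi> <= M \<longrightarrow>
    \<bar>LINT x|lborel. indicator (cell j k) x * \<phi> x\<bar> <= b"
proof -
  obtain K where K: "K > 0" "!!(h :: 'n => real) \<phi>. Lhalf h ==> test_fun UNIV \<phi> ==>
      L1f (%x. \<bar>h x\<bar> * (\<phi> x)^2) \<and>
      (LI x. \<bar>h x\<bar> * (\<phi> x)^2) \<le>
        K * (LI x. \<bar>h x\<bar> powr (real DIM('n) / 2)) powr (2 / real DIM('n)) * gnorm2 \<phi>"
    using holder_sobolev_Lhalf[where ?'n = 'n, OF N] by blast
  define \<beta> where "\<beta> = measure lborel (cball (0::'n) (real DIM('n)))"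
  have \<beta>: "emeasure lborel (cball (0::'n) (real DIM('n))) = ennreal \<beta>"
    unfolding \<beta>_def by (rule emeasure_eq_ennreal_measure) (simp add: emeasure_cball)
  show ?thesis
  proof (rule exI[of _ "\<beta> + K * \<beta> powr (2 / real DIM('n)) * M"], intro allI impI)
    fix j k and \<phi> :: "'n => real"
    assume t: "test_fun UNIV \<phi>" and M: "gnorm2 \<phi> <= M"
    define B :: "'n set" where "B = cell j k"
    have B [measurable]: "B \<in> sets borel" by (simp add: B_def cell_borel)
    have eB: "emeasure lborel B <= ennreal \<beta>" using cell_emeasure[of j k] by (simp add: B_def \<beta>)
    then have fB: "emeasure lborel B < \<infinity>" by (rule le_less_trans) simp
    then have mB: "measure lborel B <= \<beta>" using eB
      by (subst (asm) emeasure_eq_ennreal_measure) (auto simp: \<beta>_def)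
    have LB: "Lhalf (indicator B :: 'n => real)" by (rule Lhalf_indicator) (use fB in auto)
    have ab: "\<bar>indicator B x\<bar> = (indicator B x :: real)" for x by simp
    have pw: "(indicator B x :: real) powr (real DIM('n) / 2) = indicator B x" for x by (auto simp: indicator_def)
    have "(LI x. indicator B x * (\<phi> x)^2) <= K * (measure lborel B) powr (2 / real DIM('n)) * gnorm2 \<phi>"
      using K(2)[OF LB t] B unfolding ab pw by simp
    also have "\<dots> <= K * \<beta> powr (2 / real DIM('n)) * M"
      using K(1) mB M gnorm2_nonneg[of \<phi>] by (intro mult_mono mult_left_mono powr_mono2) auto
    finally have 1: "(LI x. indicator B x * (\<phi> x)^2) <= K * \<beta> powr (2 / real DIM('n)) * M" .
    note [measurable] = C1c_facts(4)[OF C1c_test[OF t]]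
    have "\<bar>LINT x|lborel. indicator B x * \<phi> x\<bar> <= (LINT x|lborel. \<bar>indicator B x * \<phi> x\<bar>)"
      by (rule integral_abs_bound)
    also have "\<dots> <= (LINT x|lborel. indicator B x + indicator B x * (\<phi> x)^2)"
    proof (rule integral_mono)
      show "integrable lborel (%x. \<bar>indicator B x * \<phi> x\<bar>)"
        using integrable_mult_indicator[OF _ C1c_facts(8)[OF C1c_test[OF t]], of B] by (simp add: abs_mult)
      show "integrable lborel (%x. indicator B x + indicator B x * (\<phi> x)^2)"
        using integrable_mult_indicator[OF _ C1c_facts(6)[OF C1c_test[OF t]], of B] fB
        by (intro Bochner_Integration.integrable_add integrable_real_indicator) auto
      show "\<bar>indicator B x * \<phi> x\<bar> <= indicator B x + indicator B x * (\<phi> x)^2" for x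
        using sum_squares_bound[of "\<bar>\<phi> x\<bar>" 1] by (auto simp: indicator_def)
    qed
    also have "\<dots> = measure lborel B + (LINT x|lborel. indicator B x * (\<phi> x)^2)"
      using integrable_mult_indicator[OF _ C1c_facts(6)[OF C1c_test[OF t]], of B] fB
      by (subst Bochner_Integration.integral_add) (auto intro: integrable_real_indicator)
    also have "(LINT x|lborel. indicator B x * (\<phi> x)^2) = (LI x. indicator B x * (\<phi> x)^2)"
      by (rule integral_completion[symmetric]) measurable
    finally show "\<bar>LINT x|lborel. indicator (cell j k) x * \<phi> x\<bar> <= \<beta> + K * \<beta> powr (2 / real DIM('n)) * M"
      using 1 mB by (simp add: B_def)
  qed
qed

text \<open>There are countably many cubes, so a diagonal subsequence makes all means converge at
  once; then \<open>cell_approx\<close>, applied to differences, bounds their L^2 norm on a ball by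
  finitely many differences of means and a gradient term of order j^(-2).\<close>

lemma rellich_local:
  assumes N: "DIM('n::euclidean_space) >= 3"
    and t: "!!n::nat. test_fun UNIV (\<phi> n :: 'n => real)" and M: "!!n. gnorm2 (\<phi> n) <= M"
  shows "\<exists>r :: nat => nat. strict_mono r \<and> (\<forall>R e. e > 0 \<longrightarrow> (\<exists>n0. \<forall>m\<ge>n0. \<forall>n\<ge>n0. (LINT x|lborel. indicator (cball 0 R) x * (\<phi> (r m) x - \<phi> (r n) x)^2) < e))"
proof -
  obtain b where b: "!!j k \<psi>. test_fun UNIV (\<psi> :: 'n => real) ==> gnorm2 \<psi> <= M ==>
    \<bar>LINT x|lborel. indicator (cell j k) x * \<psi> x\<bar> <= b" using cell_bound[where ?'n = 'n, OF N] by blast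
  define S :: "(nat \<times> ('n => int)) set" where "S = UNIV \<times> (\<Pi>\<^sub>E i\<in>Basis. UNIV)"
  define f where "f n p = (LINT x|lborel. indicator (cell (fst p) (snd p)) x * \<phi> n x)" for n :: nat and p :: "nat \<times> ('n => int)"
  have cS: "countable S" unfolding S_def by (intro countable_SIGMA countable_PiE) auto
  have fb: "norm (f n p) <= b" for n p unfolding f_def using b[OF t M] by simp
  obtain r where r: "strict_mono (r :: nat => nat)" "!!p. p \<in> S ==> \<exists>l. (%n. f (r n) p) ----> l"
    using function_convergent_subsequence[of S f b] cS fb by metis
  show ?thesis
  proof (intro exI[of _ r] conjI r(1) allI impI)
    fix R e :: real assume e: "e > 0"
    have M0: "M >= 0" using M[of 0] gnorm2_nonneg[of "\<phi> 0"] by linarith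
    \<comment> \<open>The Dirichlet integral of a difference is at most 4 M; j is then taken so
      large that the gradient term falls below e/2.\<close>
    define c where "c = 2 ^ DIM('n) * (real DIM('n))^2 * (4 * M)"
    obtain j :: nat where j: "c * 2 / e < real j" using reals_Archimedean2 by blast
    have cj: "c / (real (Suc j))^2 < e / 2"
    proof -
      have "c < e / 2 * real (Suc j)" using j e by (simp add: field_simps)
      also have "\<dots> <= e / 2 * (real (Suc j))^2" using e by (intro mult_left_mono) (auto simp: power2_eq_square)
      finally show ?thesis by (simp add: field_simps)
    qed
    obtain F :: "('n => int) set" where F': "finite F" "F \<subseteq> extensional Basis"
      "\<forall>\<phi>. test_fun UNIV \<phi> \<longrightarrow> (LINT x|lborel. indicator (cball 0 R) x * (\<phi> x)^2) \<le>
        (\<Sum>k\<in>F. (LINT x|lborel. indicator (cell j k) x * \<phi> x)^2 / measure lborel (cell j k))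
        + 2 ^ DIM('n) * (real DIM('n) / real (Suc j))^2 * gnorm2 \<phi>"
      using cell_approx[where ?'n = 'n and j = j and R = R] by (elim exE conjE) (rule that)
    note F = F'(1,2) F'(3)[rule_format]
    have inS: "(j, k) \<in> S" if "k \<in> F" for k using F(2) that by (auto simp: S_def PiE_def)
    then have "\<forall>k\<in>F. \<exists>l. (%n. f (r n) (j, k)) ----> l" using r(2) by blast
    from bchoice[OF this] obtain l where "\<forall>k\<in>F. (%n. f (r n) (j, k)) ----> l k" ..
    then have l: "!!k. k \<in> F ==> (%n. f (r n) (j, k)) ----> l k" by blast
    define g where "g n = (\<Sum>k\<in>F. 2 * (f (r n) (j, k) - l k)^2 / measure lborel (cell j k :: 'n set))" for n
    have "g ----> (\<Sum>k\<in>F. 2 * (l k - l k)^2 * inverse (measure lborel (cell j k :: 'n set)))"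
      unfolding g_def divide_inverse by (intro tendsto_intros l)
    then have "g ----> 0" by simp
    then have "\<forall>\<^sub>F n in sequentially. g n < e / 4" using e by (intro order_tendstoD(2)) auto
    then obtain n0 where n0: "!!n. n >= n0 ==> g n < e / 4" by (auto simp: eventually_sequentially)
    show "\<exists>n0. \<forall>m\<ge>n0. \<forall>n\<ge>n0. (LINT x|lborel. indicator (cball 0 R) x * (\<phi> (r m) x - \<phi> (r n) x)^2) < e"
    proof (intro exI[of _ n0] allI impI)
      fix m n assume mn: "m >= n0" "n >= n0"
      have int: "integrable lborel (%x. indicator (cell j k) x * \<phi> n x)" for n k
      proof -
        note [measurable] = C1c_facts(4)[OF C1c_test[OF t]]
        have "integrable lborel (\<phi> n)" using C1c_facts(8)[OF C1c_test[OF t]] by (subst integrable_abs_iff[symmetric]) auto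
        then show ?thesis using integrable_mult_indicator[of "cell j k" lborel "\<phi> n"] by (simp add: cell_borel)
      qed
      have "(LINT x|lborel. indicator (cball 0 R) x * (\<phi> (r m) x - \<phi> (r n) x)^2) \<le>
         (\<Sum>k\<in>F. (LINT x|lborel. indicator (cell j k) x * (\<phi> (r m) x - \<phi> (r n) x))^2 / measure lborel (cell j k))
        + 2 ^ DIM('n) * (real DIM('n) / real (Suc j))^2 * gnorm2 (%x. \<phi> (r m) x - \<phi> (r n) x)"
        by (rule F(3)[OF test_diff[OF t t]])
      also have "\<dots> <= (g m + g n) + c / (real (Suc j))^2"
      proof (rule add_mono)
        have "(\<Sum>k\<in>F. (LINT x|lborel. indicator (cell j k) x * (\<phi> (r m) x - \<phi> (r n) x))^2 / measure lborel (cell j k))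
          <= (\<Sum>k\<in>F. 2 * (f (r m) (j, k) - l k)^2 / measure lborel (cell j k :: 'n set) + 2 * (f (r n) (j, k) - l k)^2 / measure lborel (cell j k :: 'n set))"
        proof (rule sum_mono)
          fix k
          have "(LINT x|lborel. indicator (cell j k) x * (\<phi> (r m) x - \<phi> (r n) x)) = f (r m) (j, k) - f (r n) (j, k)"
            using int by (simp add: f_def right_diff_distrib)
          moreover have "(f (r m) (j, k) - f (r n) (j, k))^2 <= 2 * (f (r m) (j, k) - l k)^2 + 2 * (f (r n) (j, k) - l k)^2"
            using zero_le_power2[of "f (r m) (j, k) + f (r n) (j, k) - 2 * l k"] by (simp add: power2_eq_square algebra_simps)
          ultimately show "(LINT x|lborel. indicator (cell j k) x * (\<phi> (r m) x - \<phi> (r n) x))^2 / measure lborel (cell j k) \<le>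
             2 * (f (r m) (j, k) - l k)^2 / measure lborel (cell j k :: 'n set) + 2 * (f (r n) (j, k) - l k)^2 / measure lborel (cell j k :: 'n set)"
            by (simp add: add_divide_distrib[symmetric] divide_right_mono)
        qed
        then show "(\<Sum>k\<in>F. (LINT x|lborel. indicator (cell j k) x * (\<phi> (r m) x - \<phi> (r n) x))^2 / measure lborel (cell j k)) <= g m + g n"
          by (simp add: g_def sum.distrib)
        have "gnorm2 (%x. \<phi> (r m) x - \<phi> (r n) x) <= 4 * M"
          using gnorm2_diff_le[OF t t, of "r m" "r n"] M[of "r m"] M[of "r n"] by linarith
        then have "2 ^ DIM('n) * (real DIM('n) / real (Suc j))^2 * gnorm2 (%x. \<phi> (r m) x - \<phi> (r n) x) <= 2 ^ DIM('n) * (real DIM('n) / real (Suc j))^2 * (4 * M)"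
          by (rule mult_left_mono) auto
        also have "\<dots> = c / (real (Suc j))^2" by (simp add: c_def power_divide)
        finally show "2 ^ DIM('n) * (real DIM('n) / real (Suc j))^2 * gnorm2 (%x. \<phi> (r m) x - \<phi> (r n) x) <= c / (real (Suc j))^2" .
      qed
      also have "\<dots> < e" using n0[OF mn(1)] n0[OF mn(2)] cj by linarith
      finally show "(LINT x|lborel. indicator (cball 0 R) x * (\<phi> (r m) x - \<phi> (r n) x)^2) < e" .
    qed
  qed
qed

text \<open>Truncation in height and in space leaves a remainder that vanishes pointwise for large k
  and is dominated by |h|.\<close>

lemma Lhalf_truncate:
  assumes h: "Lhalf (h :: 'n::euclidean_space => real)" and e: "e > 0"
  obtains k :: nat where
    "(LI x. \<bar>if \<bar>h x\<bar> <= real k \<and> norm x <= real k then 0 else h x\<bar> powr (real DIM('n) / 2)) < e"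
    "Lhalf (%x. if \<bar>h x\<bar> <= real k \<and> norm x <= real k then 0 else h x)"
proof -
  define p where "p = real DIM('n) / 2"
  define g where "g k x = (if \<bar>h x\<bar> <= real k \<and> norm x <= real k then 0 else h x)" for k :: nat and x
  have [measurable]: "h \<in> Lmeas" using h by (simp add: Lhalf_def)
  have nm [measurable]: "(%x::'n. norm x) \<in> Lmeas"
    by (rule continuous_measurable_lebesgue) (intro continuous_intros)
  have gm [measurable]: "g k \<in> Lmeas" for k unfolding g_def by measurable
  have ih: "L1f (%x. \<bar>h x\<bar> powr p)" using h by (simp add: Lhalf_def p_def)
  have "(%k. LI x. \<bar>g k x\<bar> powr p) ----> (LINT x|(lebesgue::'n measure). 0)"
  proof (rule integral_dominated_convergence[OF _ _ ih])
    show "AE x in lebesgue. (%k. \<bar>g k x\<bar> powr p) ----> 0"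
    proof (rule AE_I2, rule tendsto_eventually)
      fix x
      obtain k0 :: nat where k0: "max \<bar>h x\<bar> (norm x) < real k0" using reals_Archimedean2 by blast
      show "\<forall>\<^sub>F k in sequentially. \<bar>g k x\<bar> powr p = 0"
        unfolding eventually_sequentially
      proof (intro exI[of _ k0] allI impI)
        fix k assume "k0 <= k"
        then have "real k0 <= real k" by simp
        then show "\<bar>g k x\<bar> powr p = 0" using k0 by (auto simp: g_def p_def)
      qed
    qed
    show "AE x in lebesgue. norm (\<bar>g k x\<bar> powr p) <= \<bar>h x\<bar> powr p" for k by (rule AE_I2) (auto simp: g_def)
  qed auto
  then have "\<forall>\<^sub>F k in sequentially. (LI x. \<bar>g k x\<bar> powr p) < e"
    using e by (intro order_tendstoD(2)) auto
  then obtain k where k: "(LI x. \<bar>g k x\<bar> powr p) < e" by (auto simp: eventually_sequentially)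
  have "L1f (%x. \<bar>g k x\<bar> powr p)"
    by (rule Bochner_Integration.integrable_bound[OF ih]) (auto simp: g_def)
  then have "Lhalf (g k)" by (simp add: Lhalf_def p_def)
  then show thesis using that[of k] k by (simp add: g_def[abs_def] p_def)
qed

text \<open>The part of h that is bounded and lives on a ball is handled by
  \<open>rellich_local\<close>; the tail, of small L^(N/2) norm, by the uniform Hoelder-Sobolev
  bound. The subsequence is independent of h, so it serves several potentials
  simultaneously.\<close>

lemma rellich:
  assumes N: "DIM('n::euclidean_space) >= 3"
    and t: "!!n::nat. test_fun UNIV (\<phi> n :: 'n => real)" and M: "!!n. gnorm2 (\<phi> n) <= M"
  shows "\<exists>r :: nat => nat. strict_mono r \<and> (\<forall>h e. Lhalf h \<longrightarrow> e > 0 \<longrightarrow>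
    (\<exists>n0. \<forall>m\<ge>n0. \<forall>n\<ge>n0. (LI x. \<bar>h x\<bar> * (\<phi> (r m) x - \<phi> (r n) x)^2) < e))"
proof -
  obtain r where r: "strict_mono (r :: nat => nat)"
    "!!R e. e > 0 ==> \<exists>n0. \<forall>m\<ge>n0. \<forall>n\<ge>n0. (LINT x|lborel. indicator (cball 0 R) x * (\<phi> (r m) x - \<phi> (r n) x)^2) < e"
    using rellich_local[where \<phi> = \<phi>, OF N t M] by blast
  obtain K where K: "K > 0" "!!(h :: 'n => real) \<phi>. Lhalf h ==> test_fun UNIV \<phi> ==>
      L1f (%x. \<bar>h x\<bar> * (\<phi> x)^2) \<and>
      (LI x. \<bar>h x\<bar> * (\<phi> x)^2) \<le>
        K * (LI x. \<bar>h x\<bar> powr (real DIM('n) / 2)) powr (2 / real DIM('n)) * gnorm2 \<phi>"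
    using holder_sobolev_Lhalf[where ?'n = 'n, OF N] by blast
  have M0: "M >= 0" using M[of 0] gnorm2_nonneg[of "\<phi> 0"] by linarith
  show ?thesis
  proof (intro exI[of _ r] conjI r(1) allI impI)
    fix h :: "'n => real" and e :: real assume h: "Lhalf h" and e: "e > 0"
    \<comment> \<open>Solves K \<epsilon>^(2/N) (4 M) <= e/2, the share allotted to the
      tail.\<close>
    define \<epsilon> where "\<epsilon> = (e / (2 * (K * (4 * M) + 1))) powr (real DIM('n) / 2)"
    have den: "K * (4 * M) + 1 > 0" using K(1) M0 by (simp add: add_nonneg_pos)
    then have "\<epsilon> > 0" using e by (simp add: \<epsilon>_def)
    then obtain k :: nat where k:
      "(LI x. \<bar>if \<bar>h x\<bar> <= real k \<and> norm x <= real k then 0 else h x\<bar> powr (real DIM('n) / 2)) < \<epsilon>"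
      "Lhalf (%x. if \<bar>h x\<bar> <= real k \<and> norm x <= real k then 0 else h x)"
      by (rule Lhalf_truncate[OF h])
    define g where "g x = (if \<bar>h x\<bar> <= real k \<and> norm x <= real k then 0 else h x)" for x
    have g: "Lhalf g" "(LI x. \<bar>g x\<bar> powr (real DIM('n) / 2)) < \<epsilon>"
      using k by (simp_all add: g_def[abs_def])
    obtain n0 where n0: "!!m n. m >= n0 ==> n >= n0 ==>
        (LINT x|lborel. indicator (cball 0 (real k)) x * (\<phi> (r m) x - \<phi> (r n) x)^2) < e / (2 * (real k + 1))"
      using r(2)[of "e / (2 * (real k + 1))" "real k"] e by auto
    show "\<exists>n0. \<forall>m\<ge>n0. \<forall>n\<ge>n0. (LI x. \<bar>h x\<bar> * (\<phi> (r m) x - \<phi> (r n) x)^2) < e"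
    proof (intro exI[of _ n0] allI impI)
      fix m n assume mn: "m >= n0" "n >= n0"
      define w where "w x = \<phi> (r m) x - \<phi> (r n) x" for x
      have wt: "test_fun UNIV w" unfolding w_def by (rule test_diff[OF t t])
      note [measurable] = C1c_facts(4)[OF C1c_test[OF wt]]
      have wM: "gnorm2 w <= 4 * M"
        using gnorm2_diff_le[OF t t, of "r m" "r n"] M[of "r m"] M[of "r n"] unfolding w_def by linarith
      have iwb: "integrable lborel (%x. indicator (cball 0 (real k)) x * (w x)^2)"
        using integrable_mult_indicator[OF _ C1c_facts(6)[OF C1c_test[OF wt]], of "cball 0 (real k)"] by simp
      then have iw: "L1f (%x. indicator (cball 0 (real k)) x * (w x)^2)"
        using integrable_completion[of "%x. indicator (cball 0 (real k)) x * (w x)^2" lborel] by simp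
      have "(LI x. \<bar>h x\<bar> * (w x)^2) <= (LI x. real k * (indicator (cball 0 (real k)) x * (w x)^2) + \<bar>g x\<bar> * (w x)^2)"
      proof (rule integral_mono)
        show "L1f (%x. \<bar>h x\<bar> * (w x)^2)" using K(2)[OF h wt] by simp
        show "L1f (%x. real k * (indicator (cball 0 (real k)) x * (w x)^2) + \<bar>g x\<bar> * (w x)^2)"
          using K(2)[OF g(1) wt] iw by (intro Bochner_Integration.integrable_add integrable_mult_right) auto
        show "\<bar>h x\<bar> * (w x)^2 <= real k * (indicator (cball 0 (real k)) x * (w x)^2) + \<bar>g x\<bar> * (w x)^2" for x
          by (auto simp: g_def indicator_def mult_right_mono)
      qed
      also have "\<dots> = real k * (LI x. indicator (cball 0 (real k)) x * (w x)^2) + (LI x. \<bar>g x\<bar> * (w x)^2)"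
        using K(2)[OF g(1) wt] iw by (subst Bochner_Integration.integral_add) (auto intro!: integrable_mult_right)
      also have "(LI x. indicator (cball 0 (real k)) x * (w x)^2) = (LINT x|lborel. indicator (cball 0 (real k)) x * (w x)^2)"
        by (rule integral_completion[OF borel_measurable_integrable[OF iwb]])
      finally have main: "(LI x. \<bar>h x\<bar> * (w x)^2) <= real k * (LINT x|lborel. indicator (cball 0 (real k)) x * (w x)^2) + (LI x. \<bar>g x\<bar> * (w x)^2)" .
      have p1: "real k * (LINT x|lborel. indicator (cball 0 (real k)) x * (w x)^2) < e / 2"
      proof -
        define I where "I = (LINT x|lborel. indicator (cball 0 (real k)) x * (w x)^2)"
        have I: "I < e / (2 * (real k + 1))" "I >= 0" using n0[OF mn] by (auto simp: I_def w_def intro!: integral_nonneg_AE)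
        have "real k * I <= (real k + 1) * I" using I by (intro mult_right_mono) auto
        also have "\<dots> < e / 2" using I(1) by (simp add: field_simps)
        finally show ?thesis by (simp add: I_def)
      qed
      have "(LI x. \<bar>g x\<bar> * (w x)^2) <= K * (LI x. \<bar>g x\<bar> powr (real DIM('n) / 2)) powr (2 / real DIM('n)) * gnorm2 w"
        using K(2)[OF g(1) wt] by simp
      also have "\<dots> <= K * \<epsilon> powr (2 / real DIM('n)) * (4 * M)"
        using K(1) g(2) wM gnorm2_nonneg[of w] by (intro mult_mono mult_left_mono powr_mono2) auto
      also have "\<epsilon> powr (2 / real DIM('n)) = e / (2 * (K * (4 * M) + 1))"
        using e den by (simp add: \<epsilon>_def powr_powr)
      also have "K * (e / (2 * (K * (4 * M) + 1))) * (4 * M) <= e / 2"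
        using e den by (simp add: field_simps)
      finally show "(LI x. \<bar>h x\<bar> * (\<phi> (r m) x - \<phi> (r n) x)^2) < e"
        using main p1 unfolding w_def by linarith
    qed
  qed
qed

section \<open>Limits of test functions in weighted Sobolev norms\<close>

definition L2f :: "('n::euclidean_space => 'b::euclidean_space) => bool" where
  "L2f f \<longleftrightarrow> f \<in> Lmeas \<and> L1f (%x. (norm (f x))^2)"

lemma L2f_mult:
  fixes f :: "'n::euclidean_space => 'b::euclidean_space"
  assumes "L2f f" "c \<in> Lmeas" "!!x. \<bar>c x\<bar> <= B"
  shows "L2f (%x. c x *\<^sub>R f x)"
proof -
  note [measurable] = assms(2)
  have [measurable]: "f \<in> Lmeas" using assms(1) by (simp add: L2f_def)
  have "L1f (%x. (norm (c x *\<^sub>R f x))^2)"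
  proof (rule Bochner_Integration.integrable_bound)
    show "L1f (%x. B^2 * (norm (f x))^2)" using assms(1) by (simp add: L2f_def)
    show "AE x in lebesgue. norm ((norm (c x *\<^sub>R f x))^2) <= norm (B^2 * (norm (f x))^2)"
    proof (rule AE_I2)
      fix x
      have "\<bar>c x\<bar>\<^sup>2 <= B^2" using assms(3)[of x] by (intro power_mono) auto
      then show "norm ((norm (c x *\<^sub>R f x))^2) <= norm (B^2 * (norm (f x))^2)"
        by (simp add: power_mult_distrib mult_right_mono)
    qed
  qed measurable
  then show ?thesis by (simp add: L2f_def)
qed

lemma L2f_cmult: "L2f f ==> L2f (%x. c *\<^sub>R f x)"
  using L2f_mult[of f "%_. c" "\<bar>c\<bar>"] by simp

lemma norm_add_sq_le: "(norm (a + b))^2 <= 2 * (norm a)^2 + 2 * (norm b)^2" for a b :: "'a::real_normed_vector"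
proof -
  have "(norm (a + b))^2 <= (norm a + norm b)^2" by (intro power_mono norm_triangle_ineq) auto
  also have "\<dots> <= 2 * (norm a)^2 + 2 * (norm b)^2"
    using sum_squares_bound[of "norm a" "norm b"] by (simp add: power2_sum)
  finally show ?thesis .
qed

lemma L2f_add:
  fixes f g :: "'n::euclidean_space => 'b::euclidean_space"
  assumes "L2f f" "L2f g"
  shows "L2f (%x. f x + g x)"
proof -
  have [measurable]: "f \<in> Lmeas" "g \<in> Lmeas" using assms by (auto simp: L2f_def)
  have "L1f (%x. (norm (f x + g x))^2)"
  proof (rule Bochner_Integration.integrable_bound)
    show "L1f (%x. 2 * (norm (f x))^2 + 2 * (norm (g x))^2)" using assms by (auto simp: L2f_def)
    show "AE x in lebesgue. norm ((norm (f x + g x))^2) <= norm (2 * (norm (f x))^2 + 2 * (norm (g x))^2)"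
      using norm_add_sq_le[of "f _" "g _"] by (intro AE_I2) simp
  qed measurable
  then show ?thesis by (simp add: L2f_def)
qed

lemma L2f_diff: "L2f f ==> L2f g ==> L2f (%x. f x - g x)"
  using L2f_add[OF _ L2f_cmult[of g "-1"], of f] by simp

lemma L2f_inner:
  fixes f g :: "'n::euclidean_space => 'b::euclidean_space"
  assumes "L2f f" "L2f g"
  shows "L1f (%x. f x \<bullet> g x)"
    "\<bar>LI x. f x \<bullet> g x\<bar> <= sqrt (LI x. (norm (f x))^2) * sqrt (LI x. (norm (g x))^2)"
proof -
  have [measurable]: "f \<in> Lmeas" "g \<in> Lmeas" using assms by (auto simp: L2f_def)
  have 2: "norm (h x) powr 2 = (norm (h x))^2" for h :: "'n => 'b" and x by simp
  note ho = holder_nonneg[of "%x. norm (f x)" lebesgue "%x. norm (g x)" 2 2]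
  have i: "L1f (%x. norm (f x) * norm (g x))"
    by (rule ho(1)) (use assms in \<open>auto simp: L2f_def\<close>)
  show ii: "L1f (%x. f x \<bullet> g x)"
    by (rule Bochner_Integration.integrable_bound[OF i]) (auto simp: Cauchy_Schwarz_ineq2)
  have "\<bar>LI x. f x \<bullet> g x\<bar> <= (LI x. \<bar>f x \<bullet> g x\<bar>)" by (rule integral_abs_bound)
  also have "\<dots> <= (LI x. norm (f x) * norm (g x))"
    by (rule integral_mono[OF integrable_abs[OF ii] i Cauchy_Schwarz_ineq2])
  also have "\<dots> <= sqrt (LI x. (norm (f x))^2) * sqrt (LI x. (norm (g x))^2)"
    using ho(2) assms by (simp add: L2f_def powr_half_sqrt)
  finally show "\<bar>LI x. f x \<bullet> g x\<bar> <= sqrt (LI x. (norm (f x))^2) * sqrt (LI x. (norm (g x))^2)" .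
qed

definition L2c :: "(nat => 'n::euclidean_space => 'b::euclidean_space) => ('n => 'b) => bool" where
  "L2c F f \<longleftrightarrow> (\<forall>n. L2f (F n)) \<and> L2f f \<and> (%n. LI x. (norm (F n x - f x))^2) ----> 0"

lemma L2c_const: "L2f f ==> L2c (%_. f) f"
  by (simp add: L2c_def)

lemma L2c_inner:
  fixes f g :: "'n::euclidean_space => 'b::euclidean_space"
  assumes F: "L2c F f" and G: "L2c G g"
  shows "(%n. LI x. F n x \<bullet> G n x) ----> (LI x. f x \<bullet> g x)"
proof -
  have l: "L2f (F n)" "L2f f" "L2f (G n)" "L2f g" for n using F G by (auto simp: L2c_def)
  have z: "(%n. sqrt (LI x. (norm (F n x - f x))^2)) ----> sqrt 0"
     "(%n. sqrt (LI x. (norm (G n x - g x))^2)) ----> sqrt 0"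
    using F G unfolding L2c_def by (intro tendsto_real_sqrt; blast)+
  define a where "a n = sqrt (LI x. (norm (F n x - f x))^2)" for n
  define b where "b n = sqrt (LI x. (norm (G n x - g x))^2)" for n
  define p where "p = sqrt (LI x. (norm (f x))^2)"
  define q where "q = sqrt (LI x. (norm (g x))^2)"
  have eq: "(LI x. F n x \<bullet> G n x) - (LI x. f x \<bullet> g x) =
     (LI x. (F n x - f x) \<bullet> (G n x - g x)) + (LI x. (F n x - f x) \<bullet> g x) + (LI x. f x \<bullet> (G n x - g x))" for n
  proof -
    have "(LI x. (F n x - f x) \<bullet> (G n x - g x)) + (LI x. (F n x - f x) \<bullet> g x) + (LI x. f x \<bullet> (G n x - g x))
       = (LI x. (F n x - f x) \<bullet> (G n x - g x) + (F n x - f x) \<bullet> g x + f x \<bullet> (G n x - g x))"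
      by (simp add: L2f_inner(1) L2f_diff l)
    also have "\<dots> = (LI x. F n x \<bullet> G n x - f x \<bullet> g x)"
      by (intro Bochner_Integration.integral_cong) (auto simp: inner_diff_left inner_diff_right)
    also have "\<dots> = (LI x. F n x \<bullet> G n x) - (LI x. f x \<bullet> g x)"
      by (intro Bochner_Integration.integral_diff L2f_inner(1) l)
    finally show ?thesis by simp
  qed
  have bd: "norm ((LI x. F n x \<bullet> G n x) - (LI x. f x \<bullet> g x)) <= a n * b n + a n * q + p * b n" for n
    unfolding eq a_def b_def p_def q_def real_norm_def
    using L2f_inner(2)[OF L2f_diff[OF l(1,2)] L2f_diff[OF l(3,4)], of n n] L2f_inner(2)[OF L2f_diff[OF l(1,2)] l(4), of n]
      L2f_inner(2)[OF l(2) L2f_diff[OF l(3,4)], of n] by linarith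
  have "(%n. a n * b n + a n * q + p * b n) ----> sqrt 0 * sqrt 0 + sqrt 0 * q + p * sqrt 0"
    unfolding a_def b_def by (intro tendsto_intros z)
  then have "(%n. a n * b n + a n * q + p * b n) ----> 0" by simp
  then have "(%n. (LI x. F n x \<bullet> G n x) - (LI x. f x \<bullet> g x)) ----> 0"
    by (rule Lim_null_comparison[rotated]) (use bd in \<open>auto intro!: always_eventually\<close>)
  then show ?thesis by (rule LIM_zero_cancel)
qed

lemma L2c_norm: "L2c F f ==> (%n. LI x. (norm (F n x))^2) ----> (LI x. (norm (f x))^2)"
  using L2c_inner[of F f F f] by (simp add: power2_norm_eq_inner)

lemma L2c_mult:
  fixes f :: "'n::euclidean_space => 'b::euclidean_space"
  assumes F: "L2c F f" and c: "c \<in> Lmeas" "!!x. \<bar>c x\<bar> <= B"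
  shows "L2c (%n x. c x *\<^sub>R F n x) (%x. c x *\<^sub>R f x)"
proof -
  have l: "L2f (F n)" "L2f f" for n using F by (auto simp: L2c_def)
  have "(%n. LI x. (norm (c x *\<^sub>R F n x - c x *\<^sub>R f x))^2) ----> 0"
  proof (rule tendsto_sandwich[OF _ _ tendsto_const])
    show "\<forall>\<^sub>F n in sequentially. 0 <= (LI x. (norm (c x *\<^sub>R F n x - c x *\<^sub>R f x))^2)" by simp
    have "(LI x. (norm (c x *\<^sub>R F n x - c x *\<^sub>R f x))^2) <= B^2 * (LI x. (norm (F n x - f x))^2)" for n
    proof -
      have "(LI x. (norm (c x *\<^sub>R F n x - c x *\<^sub>R f x))^2) <= (LI x. B^2 * (norm (F n x - f x))^2)"
      proof (rule integral_mono)
        show "L1f (%x. (norm (c x *\<^sub>R F n x - c x *\<^sub>R f x))^2)"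
          using L2f_mult[OF L2f_diff[OF l] c] by (simp add: L2f_def scaleR_diff_right)
        show "L1f (%x. B^2 * (norm (F n x - f x))^2)" using L2f_diff[OF l] by (simp add: L2f_def)
        fix x
        have "\<bar>c x\<bar>\<^sup>2 <= B^2" using c(2)[of x] by (intro power_mono) auto
        then show "(norm (c x *\<^sub>R F n x - c x *\<^sub>R f x))^2 <= B^2 * (norm (F n x - f x))^2"
          by (simp add: scaleR_diff_right[symmetric] power_mult_distrib mult_right_mono)
      qed
      then show ?thesis by simp
    qed
    then show "\<forall>\<^sub>F n in sequentially. (LI x. (norm (c x *\<^sub>R F n x - c x *\<^sub>R f x))^2) <= B^2 * (LI x. (norm (F n x - f x))^2)" by simp
    show "(%n. B^2 * (LI x. (norm (F n x - f x))^2)) ----> 0"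
      using F by (auto simp: L2c_def intro: tendsto_mult_right_zero)
  qed
  then show ?thesis using L2f_mult[OF l(1) c] L2f_mult[OF l(2) c] by (auto simp: L2c_def)
qed

lemma L2c_subseq: "L2c F f ==> strict_mono r ==> L2c (%n. F (r n)) f"
  unfolding L2c_def using LIMSEQ_subseq_LIMSEQ[of "%n. LI x. (norm (F n x - f x))^2" 0 r] by (simp add: o_def)

lemma L2c_add_const:
  assumes "L2c F f" "L2f h"
  shows "L2c (%n x. F n x + h x) (%x. f x + h x)"
  using assms by (auto simp: L2c_def intro: L2f_add)

text \<open>Along a subsequence with \<open>\<integral>\<parallel>F\<^sub>k\<^sub>+\<^sub>1 - F\<^sub>k\<parallel>\<^sup>2 < 8\<^sup>-\<^sup>k\<close> the increments are summable almost everywhere,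
  since \<open>s \<le> 2\<^sup>-\<^sup>k + 2\<^sup>k s\<^sup>2\<close>; Fatou's lemma does the rest.\<close>
lemma L2_complete:
  fixes F :: "nat => 'n::euclidean_space => 'b::euclidean_space"
  assumes F: "!!n. L2f (F n)"
    and cauchy: "!!e. e > 0 ==> \<exists>n0. \<forall>m\<ge>n0. \<forall>n\<ge>n0. (LI x. (norm (F m x - F n x))^2) < e"
  shows "\<exists>f r. strict_mono (r :: nat => nat) \<and> (AE x in lebesgue. (%k. F (r k) x) ----> f x) \<and> L2c F f"
proof -
  have Fm [measurable]: "F n \<in> Lmeas" for n using F by (auto simp: L2f_def)
  have "\<exists>s. \<forall>k m n. m >= s k \<longrightarrow> n >= s k \<longrightarrow> (LI x. (norm (F m x - F n x))^2) < (1/8) ^ k"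
    using cauchy[of "(1/8) ^ k" for k] by (intro choice) force
  then obtain s where s: "!!k m n. m >= s k ==> n >= s k ==> (LI x. (norm (F m x - F n x))^2) < (1/8) ^ k" by blast
  \<comment> \<open>Strictly increasing and beyond every threshold s k.\<close>
  define r where "r = rec_nat (s 0) (%k rk. max (Suc rk) (s (Suc k)))"
  have r0: "r 0 = s 0" and rS: "r (Suc k) = max (Suc (r k)) (s (Suc k))" for k by (auto simp: r_def)
  have rmono: "strict_mono r" by (rule strict_monoI_Suc) (simp add: rS)
  have rs: "s k <= r k" for k by (cases k) (auto simp: r0 rS)
  define d where "d k x = norm (F (r (Suc k)) x - F (r k) x)" for k x
  have dm [measurable]: "d k \<in> Lmeas" for k unfolding d_def by measurable
  have di: "L1f (%x. (d k x)^2)" for k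
    using L2f_diff[OF F F, of "r (Suc k)" "r k"] by (simp add: L2f_def d_def)
  have dk: "(LI x. (d k x)^2) < (1/8) ^ k" for k
    unfolding d_def by (rule s) (use rs[of k] rmono in \<open>auto simp: rS\<close>)
  have "(\<integral>\<^sup>+x. (\<Sum>k. ennreal (2 ^ k * (d k x)^2)) \<partial>lebesgue) = (\<Sum>k. \<integral>\<^sup>+x. ennreal (2 ^ k * (d k x)^2) \<partial>lebesgue)"
    by (rule nn_integral_suminf) measurable
  also have "\<dots> <= (\<Sum>k. ennreal ((1/4) ^ k))"
  proof (intro suminf_le summableI)
    fix k
    have "(\<integral>\<^sup>+x. ennreal (2 ^ k * (d k x)^2) \<partial>lebesgue) = ennreal (LI x. 2 ^ k * (d k x)^2)"
      by (rule nn_integral_eq_integral) (use di in auto)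
    also have "(LI x. 2 ^ k * (d k x)^2) <= 2 ^ k * (1/8) ^ k" using dk[of k] by simp
    also have "2 ^ k * (1/8) ^ k = (1/4 :: real) ^ k" by (simp add: power_mult_distrib[symmetric])
    finally show "(\<integral>\<^sup>+x. ennreal (2 ^ k * (d k x)^2) \<partial>lebesgue) <= ennreal ((1/4) ^ k)" by (simp add: ennreal_leI)
  qed
  also have "\<dots> = ennreal (\<Sum>k. (1/4) ^ k)" by (rule suminf_ennreal2) (auto intro: summable_geometric)
  also have "\<dots> < \<infinity>" by simp
  finally have fin: "(\<integral>\<^sup>+x. (\<Sum>k. ennreal (2 ^ k * (d k x)^2)) \<partial>lebesgue) \<noteq> \<infinity>" by simp
  have "AE x in lebesgue. (\<Sum>k. ennreal (2 ^ k * (d k x)^2)) \<noteq> \<infinity>"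
    by (rule nn_integral_PInf_AE[OF _ fin]) measurable
  then have conv: "AE x in lebesgue. convergent (%k. F (r k) x)"
  proof eventually_elim
    fix x assume "(\<Sum>k. ennreal (2 ^ k * (d k x)^2)) \<noteq> \<infinity>"
    then have "summable (%k. 2 ^ k * (d k x)^2)"
      by (intro summable_suminf_not_top) (auto simp: infinity_ennreal_def)
    then have "summable (%k. (1/2) ^ k + 2 ^ k * (d k x)^2)" by (intro summable_add summable_geometric) auto
    then have "summable (%k. d k x)"
    proof (rule summable_comparison_test'[of _ 0])
      fix k
      have d0: "d k x >= 0" by (simp add: d_def)
      have "d k x <= (1/2) ^ k + 2 ^ k * (d k x)^2"
      proof (cases "d k x <= (1/2) ^ k")
        case True
        have "0 <= 2 ^ k * (d k x)^2" by simp
        with True show ?thesis by linarith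
      next
        case False
        then have "1 <= 2 ^ k * d k x" by (simp add: power_one_over field_simps)
        from mult_right_mono[OF this d0] have "d k x <= 2 ^ k * (d k x)^2" by (simp add: power2_eq_square mult_ac)
        moreover have "(0::real) <= (1/2) ^ k" by simp
        ultimately show ?thesis by linarith
      qed
      then show "norm (d k x) <= (1/2) ^ k + 2 ^ k * (d k x)^2" using d0 by simp
    qed
    then have "summable (%k. F (r (Suc k)) x - F (r k) x)" unfolding d_def by (rule summable_norm_cancel)
    then have "convergent (%n. \<Sum>k<n. F (r (Suc k)) x - F (r k) x)" by (simp add: summable_iff_convergent)
    then have "convergent (%n. F (r n) x - F (r 0) x)"
      by (simp only: sum_lessThan_telescope[of "%k. F (r k) x"])
    then have "convergent (%n. (F (r n) x - F (r 0) x) + F (r 0) x)" by (intro convergent_add convergent_const)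
    then show "convergent (%k. F (r k) x)" by simp
  qed
  define f where "f x = lim (%k. F (r k) x)" for x
  have fm [measurable]: "f \<in> Lmeas"
    unfolding f_def by (rule borel_measurable_lim_metric) measurable
  have fl: "AE x in lebesgue. (%k. F (r k) x) ----> f x"
    using conv by eventually_elim (simp add: f_def convergent_LIMSEQ_iff)
  have est: "(\<integral>\<^sup>+x. ennreal ((norm (F n x - f x))^2) \<partial>lebesgue) <= ennreal e"
    if n0: "!!m n. m >= n0 ==> n >= n0 ==> (LI x. (norm (F m x - F n x))^2) < e" and n: "n >= n0" for e n0 n
  proof -
    have "(\<integral>\<^sup>+x. ennreal ((norm (F n x - f x))^2) \<partial>lebesgue) = (\<integral>\<^sup>+x. liminf (%k. ennreal ((norm (F n x - F (r k) x))^2)) \<partial>lebesgue)"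
    proof (rule nn_integral_cong_AE)
      show "AE x in lebesgue. ennreal ((norm (F n x - f x))^2) = liminf (%k. ennreal ((norm (F n x - F (r k) x))^2))"
        using fl
      proof eventually_elim
        fix x assume "(%k. F (r k) x) ----> f x"
        then have "(%k. ennreal ((norm (F n x - F (r k) x))^2)) ----> ennreal ((norm (F n x - f x))^2)"
          by (intro tendsto_ennrealI tendsto_intros)
        then show "ennreal ((norm (F n x - f x))^2) = liminf (%k. ennreal ((norm (F n x - F (r k) x))^2))"
          by (rule lim_imp_Liminf[OF sequentially_bot, symmetric])
      qed
    qed
    also have "\<dots> <= liminf (%k. \<integral>\<^sup>+x. ennreal ((norm (F n x - F (r k) x))^2) \<partial>lebesgue)"
      by (rule nn_integral_liminf) measurable
    also have "\<dots> <= liminf (%k. ennreal e)"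
    proof (rule Liminf_mono, unfold eventually_sequentially, intro exI[of _ n0] allI impI)
      fix k assume "n0 <= k"
      then have rk: "r k >= n0" using seq_suble[OF rmono, of k] by linarith
      have "(\<integral>\<^sup>+x. ennreal ((norm (F n x - F (r k) x))^2) \<partial>lebesgue) = ennreal (LI x. (norm (F n x - F (r k) x))^2)"
        by (rule nn_integral_eq_integral) (use L2f_diff[OF F F, of n "r k"] in \<open>auto simp: L2f_def\<close>)
      also have "\<dots> <= ennreal e" using n0[OF n rk] by (intro ennreal_leI) simp
      finally show "(\<integral>\<^sup>+x. ennreal ((norm (F n x - F (r k) x))^2) \<partial>lebesgue) <= ennreal e" .
    qed
    also have "\<dots> = ennreal e" by (simp add: Liminf_const)
    finally show ?thesis .
  qed
  obtain n1 where n1: "!!m n. m >= n1 ==> n >= n1 ==> (LI x. (norm (F m x - F n x))^2) < 1" using cauchy[of 1] by auto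
  have "L1f (%x. (norm (F n1 x - f x))^2)"
    by (rule integrableI_nonneg) (use le_less_trans[OF est[OF n1, of n1] ennreal_less_top] in auto)
  then have "L2f (%x. F n1 x - f x)" by (simp add: L2f_def)
  from L2f_diff[OF F[of n1] this] have fL: "L2f f" by simp
  have "(%n. LI x. (norm (F n x - f x))^2) ----> 0"
  proof (rule LIMSEQ_I)
    fix e :: real assume e: "e > 0"
    obtain n0 where n0: "!!m n. m >= n0 ==> n >= n0 ==> (LI x. (norm (F m x - F n x))^2) < e / 2" using cauchy[of "e / 2"] e by auto
    have "norm ((LI x. (norm (F n x - f x))^2) - 0) < e" if "n >= n0" for n
    proof -
      have "ennreal (LI x. (norm (F n x - f x))^2) = (\<integral>\<^sup>+x. ennreal ((norm (F n x - f x))^2) \<partial>lebesgue)"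
        by (rule nn_integral_eq_integral[symmetric]) (use L2f_diff[OF F fL, of n] in \<open>auto simp: L2f_def\<close>)
      also have "\<dots> <= ennreal (e / 2)" by (rule est[OF n0 that])
      finally show ?thesis using e by simp
    qed
    then show "\<exists>n0. \<forall>n\<ge>n0. norm ((LI x. (norm (F n x - f x))^2) - 0) < e" by blast
  qed
  then have "L2c F f" using F fL by (simp add: L2c_def)
  then show ?thesis using rmono fl by blast
qed

section \<open>Weighted energy limits of test functions\<close>

lemma test_L2f:
  assumes "test_fun U \<phi>"
  shows "L2f \<phi>" "L2f (cgrad \<phi>)"
proof -
  have "continuous_on UNIV (%x. (norm (\<phi> x))^2)" "continuous_on UNIV (%x. (norm (cgrad \<phi> x))^2)"
    by (intro continuous_intros test_continuous[OF assms] test_cgrad_continuous[OF assms])+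
  moreover obtain K where "compact K" "!!x. x \<notin> K ==> \<phi> x = 0 \<and> cgrad \<phi> x = 0" using test_fun_supp[OF assms] by blast
  ultimately show "L2f \<phi>" "L2f (cgrad \<phi>)"
    using integrable_continuous_compact(2)[of "%x. (norm (\<phi> x))^2" K] integrable_continuous_compact(2)[of "%x. (norm (cgrad \<phi> x))^2" K] test_meas[OF assms]
    by (auto simp: L2f_def)
qed

lemma gnorm2_diff: "test_fun U \<phi> ==> test_fun U \<psi> ==>
    gnorm2 (%x. \<phi> x - \<psi> x) = (LI x. (norm (cgrad \<phi> x - cgrad \<psi> x))^2)"
  by (simp add: gnorm2_def cgrad_diff test_smooth)

text \<open>The lower bound 1 makes weighted convergence imply convergence in L^2; integrability
  against squares puts all test functions into the weighted space.\<close>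

definition weight :: "('n::euclidean_space => real) => bool" where
  "weight \<omega> \<longleftrightarrow> \<omega> \<in> Lmeas \<and> (\<forall>x. 1 <= \<omega> x) \<and>
     (\<forall>\<phi>. test_fun UNIV \<phi> \<longrightarrow> L1f (%x. \<omega> x * (\<phi> x)^2))"

text \<open>Stands for membership of u in the weighted energy space, with g as its gradient and an
  approximating sequence attached. Convergence almost everywhere is included because it transfers
  signs to the limit and feeds dominated convergence in the nonlinear terms.\<close>

definition H1lim :: "('n::euclidean_space => real) => (nat => 'n => real) => ('n => real) => ('n => 'n) => bool" where
  "H1lim \<omega> \<phi> u g \<longleftrightarrow> weight \<omega> \<and> (\<forall>n. test_fun UNIV (\<phi> n)) \<and> u \<in> Lmeas \<and>
     (AE x in lebesgue. (%n. \<phi> n x) ----> u x) \<and> (AE x in lebesgue. (%n. cgrad (\<phi> n) x) ----> g x) \<and>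
     L2c (%n. cgrad (\<phi> n)) g \<and> L2c (%n x. sqrt (\<omega> x) * \<phi> n x) (%x. sqrt (\<omega> x) * u x)"

lemma weight_L2f:
  assumes "weight \<omega>" "test_fun U \<phi>"
  shows "L2f (%x. sqrt (\<omega> x) * \<phi> x)"
proof -
  have t: "test_fun UNIV \<phi>" using test_fun_mono[OF assms(2)] by simp
  have [measurable]: "\<omega> \<in> Lmeas" "\<phi> \<in> Lmeas"
    using assms test_meas by (auto simp: weight_def)
  have "0 <= \<omega> x" for x using assms(1) by (meson weight_def order_trans zero_le_one)
  then have "(norm (sqrt (\<omega> x) * \<phi> x))^2 = \<omega> x * (\<phi> x)^2" for x by (simp add: power_mult_distrib)
  then show ?thesis using assms(1) t by (simp add: L2f_def weight_def)
qed

lemma H1lim_test: "weight \<omega> ==> test_fun U \<psi> ==> H1lim \<omega> (%_. \<psi>) \<psi> (cgrad \<psi>)"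
  using test_fun_mono[of U \<psi> UNIV] by (simp add: H1lim_def test_meas weight_L2f test_L2f L2c_const)

text \<open>A form with coefficient w dominated by \<omega> is the inner product of sqrt(\<omega>)
  u, multiplied by the bounded function w/\<omega>, with sqrt(\<omega>) v.\<close>

lemma H1lim_weighted:
  assumes u: "H1lim \<omega> \<phi> u g" and v: "H1lim \<omega> \<zeta> v k" and w: "w \<in> Lmeas" "!!x. \<bar>w x\<bar> <= C * \<omega> x"
  shows "(%n. LI x. w x * \<phi> n x * \<zeta> n x) ----> (LI x. w x * u x * v x)"
    "L1f (%x. w x * u x * v x)"
proof -
  have om: "\<omega> \<in> Lmeas" "!!x. 1 <= \<omega> x" using u by (auto simp: H1lim_def weight_def)
  have pos: "\<omega> x > 0" for x using om(2)[of x] by linarith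
  define c where "c x = w x / \<omega> x" for x
  have c: "c \<in> Lmeas" "\<bar>c x\<bar> <= C" for x
    using om(1) w pos[of x] unfolding c_def by (auto simp: abs_divide divide_le_eq)
  have eq: "(c x *\<^sub>R (sqrt (\<omega> x) * a)) \<bullet> (sqrt (\<omega> x) * b) = w x * a * b" for x a b
  proof -
    have "(c x *\<^sub>R (sqrt (\<omega> x) * a)) \<bullet> (sqrt (\<omega> x) * b) = c x * (sqrt (\<omega> x))^2 * a * b" by (simp add: power2_eq_square)
    also have "\<dots> = w x * a * b" using pos[of x] by (simp add: c_def)
    finally show ?thesis .
  qed
  have L: "L2c (%n x. c x *\<^sub>R (sqrt (\<omega> x) * \<phi> n x)) (%x. c x *\<^sub>R (sqrt (\<omega> x) * u x))"
    by (rule L2c_mult[OF _ c]) (use u in \<open>simp add: H1lim_def\<close>)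
  have R: "L2c (%n x. sqrt (\<omega> x) * \<zeta> n x) (%x. sqrt (\<omega> x) * v x)" using v by (simp add: H1lim_def)
  show "(%n. LI x. w x * \<phi> n x * \<zeta> n x) ----> (LI x. w x * u x * v x)"
    using L2c_inner[OF L R] unfolding eq .
  show "L1f (%x. w x * u x * v x)"
    using L2f_inner(1)[of "%x. c x *\<^sub>R (sqrt (\<omega> x) * u x)" "%x. sqrt (\<omega> x) * v x"] L R unfolding eq by (simp add: L2c_def)
qed

lemma H1lim_gnorm2:
  "H1lim \<omega> \<phi> u g ==> (%n. gnorm2 (\<phi> n)) ----> (LI x. (norm (g x))^2)"
  unfolding gnorm2_def by (rule L2c_norm) (simp add: H1lim_def)

text \<open>Completeness is applied to gradient and weighted value as one function into a product
  space, so that a single subsequence converges almost everywhere in both components.\<close>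

lemma H1lim_exists:
  fixes \<phi> :: "nat => 'n::euclidean_space => real"
  assumes \<omega>: "weight \<omega>" and t: "!!n. test_fun UNIV (\<phi> n)"
    and c: "!!e. e > 0 ==> \<exists>n0. \<forall>m\<ge>n0. \<forall>n\<ge>n0. gnorm2 (%x. \<phi> m x - \<phi> n x) + (LI x. \<omega> x * (\<phi> m x - \<phi> n x)^2) < e"
  shows "\<exists>r u g. strict_mono (r :: nat => nat) \<and> H1lim \<omega> (%n. \<phi> (r n)) u g"
proof -
  have om [measurable]: "\<omega> \<in> Lmeas" and om1: "!!x. 1 <= \<omega> x" using \<omega> by (auto simp: weight_def)
  have pos: "\<omega> x > 0" for x using om1[of x] by linarith
  define F where "F n x = (cgrad (\<phi> n) x, sqrt (\<omega> x) * \<phi> n x)" for n x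
  have [measurable]: "\<phi> n \<in> Lmeas" "cgrad (\<phi> n) \<in> Lmeas" for n using test_meas[OF t] by auto
  have FL: "L2f (F n)" for n
    using test_L2f(2)[OF t, of n] weight_L2f[OF \<omega> t, of n] unfolding L2f_def F_def
    by (auto simp: norm_Pair)
  have Fd: "(LI x. (norm (F m x - F n x))^2) = gnorm2 (%x. \<phi> m x - \<phi> n x) + (LI x. \<omega> x * (\<phi> m x - \<phi> n x)^2)" for m n
  proof -
    have d: "test_fun UNIV (%x. \<phi> m x - \<phi> n x)" by (rule test_diff[OF t t])
    have "(norm (F m x - F n x))^2 = (norm (cgrad (%x. \<phi> m x - \<phi> n x) x))^2 + \<omega> x * (\<phi> m x - \<phi> n x)^2" for x
      using pos[of x] by (simp add: F_def norm_Pair cgrad_diff test_smooth[OF t] right_diff_distrib[symmetric] power_mult_distrib)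
    then show ?thesis
      using test_L2f(2)[OF d] \<omega> d by (simp add: L2f_def weight_def gnorm2_def)
  qed
  obtain f r where fr: "strict_mono (r :: nat => nat)" "AE x in lebesgue. (%k. F (r k) x) ----> f x" "L2c F f"
    using L2_complete[of F, OF FL] c unfolding Fd by blast
  define g where "g x = fst (f x)" for x
  define u where "u x = snd (f x) / sqrt (\<omega> x)" for x
  have fL: "L2f f" using fr(3) by (simp add: L2c_def)
  have [measurable]: "f \<in> Lmeas" using fL by (simp add: L2f_def)
  have gm [measurable]: "g \<in> Lmeas"
    unfolding g_def by (rule measurable_compose[OF _ borel_measurable_continuous_onI]) (auto intro!: continuous_intros)
  have sm [measurable]: "(%x. snd (f x)) \<in> Lmeas"
    by (rule measurable_compose[OF _ borel_measurable_continuous_onI]) (auto intro!: continuous_intros)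
  have um [measurable]: "u \<in> Lmeas" unfolding u_def by measurable
  have su: "sqrt (\<omega> x) * u x = snd (f x)" for x using pos[of x] by (simp add: u_def)
  have nfs: "norm (fst z) <= norm z" "norm (snd z) <= norm z" for z :: "'n \<times> real"
    using norm_fst_le[of "fst z" "snd z"] norm_snd_le[of "snd z" "fst z"] by simp_all
  have L1: "L2c (%n. cgrad (\<phi> n)) g"
    unfolding L2c_def
  proof (intro conjI allI)
    show gL: "L2f g" unfolding L2f_def
    proof (intro conjI gm)
      have gle: "norm (g x) <= norm (f x)" for x unfolding g_def using norm_fst_le[of "fst (f x)" "snd (f x)"] by simp
      show "L1f (%x. (norm (g x))^2)"
        by (rule Bochner_Integration.integrable_bound[where f = "%x. (norm (f x))^2"])
           (use fL gle in \<open>auto simp: L2f_def intro!: AE_I2 power_mono\<close>)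
    qed
    show "L2f (cgrad (\<phi> n))" for n by (rule test_L2f(2)[OF t])
    show "(%n. LI x. (norm (cgrad (\<phi> n) x - g x))^2) ----> 0"
    proof (rule tendsto_sandwich[OF _ _ tendsto_const])
      show "\<forall>\<^sub>F n in sequentially. 0 <= (LI x. (norm (cgrad (\<phi> n) x - g x))^2)" by simp
      show "\<forall>\<^sub>F n in sequentially. (LI x. (norm (cgrad (\<phi> n) x - g x))^2) <= (LI x. (norm (F n x - f x))^2)"
      proof (intro always_eventually allI integral_mono)
        fix n
        show "L1f (%x. (norm (cgrad (\<phi> n) x - g x))^2)" using L2f_diff[OF test_L2f(2)[OF t, of n] gL] by (simp add: L2f_def)
        show "L1f (%x. (norm (F n x - f x))^2)" using L2f_diff[OF FL fL, of n] by (simp add: L2f_def)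
        show "(norm (cgrad (\<phi> n) x - g x))^2 <= (norm (F n x - f x))^2" for x
          using nfs(1)[of "F n x - f x"] by (intro power_mono) (auto simp: F_def g_def)
      qed
      show "(%n. LI x. (norm (F n x - f x))^2) ----> 0" using fr(3) by (simp add: L2c_def)
    qed
  qed
  have L2: "L2c (%n x. sqrt (\<omega> x) * \<phi> n x) (%x. sqrt (\<omega> x) * u x)"
    unfolding L2c_def su
  proof (intro conjI allI)
    show sL: "L2f (%x. snd (f x))" unfolding L2f_def
    proof (intro conjI sm)
      show "L1f (%x. (norm (snd (f x)))^2)"
        by (rule Bochner_Integration.integrable_bound[where f = "%x. (norm (f x))^2"])
           (use fL nfs(2)[of "f _"] in \<open>auto simp: L2f_def power2_le_iff_abs_le intro!: AE_I2\<close>)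
    qed
    show "L2f (%x. sqrt (\<omega> x) * \<phi> n x)" for n by (rule weight_L2f[OF \<omega> t])
    show "(%n. LI x. (norm (sqrt (\<omega> x) * \<phi> n x - snd (f x)))^2) ----> 0"
    proof (rule tendsto_sandwich[OF _ _ tendsto_const])
      show "\<forall>\<^sub>F n in sequentially. 0 <= (LI x. (norm (sqrt (\<omega> x) * \<phi> n x - snd (f x)))^2)" by simp
      show "\<forall>\<^sub>F n in sequentially. (LI x. (norm (sqrt (\<omega> x) * \<phi> n x - snd (f x)))^2) <= (LI x. (norm (F n x - f x))^2)"
      proof (intro always_eventually allI integral_mono)
        fix n
        show "L1f (%x. (norm (sqrt (\<omega> x) * \<phi> n x - snd (f x)))^2)" using L2f_diff[OF weight_L2f[OF \<omega> t, of n] sL] by (simp add: L2f_def)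
        show "L1f (%x. (norm (F n x - f x))^2)" using L2f_diff[OF FL fL, of n] by (simp add: L2f_def)
        show "(norm (sqrt (\<omega> x) * \<phi> n x - snd (f x)))^2 <= (norm (F n x - f x))^2" for x
          using nfs(2)[of "F n x - f x"] by (intro power_mono) (auto simp: F_def)
      qed
      show "(%n. LI x. (norm (F n x - f x))^2) ----> 0" using fr(3) by (simp add: L2c_def)
    qed
  qed
  have A1: "AE x in lebesgue. (%n. cgrad (\<phi> (r n)) x) ----> g x"
    using fr(2) by eventually_elim (auto simp: F_def g_def dest: tendsto_fst)
  have A2: "AE x in lebesgue. (%n. \<phi> (r n) x) ----> u x"
    using fr(2)
  proof eventually_elim
    fix x assume "(%k. F (r k) x) ----> f x"
    from tendsto_snd[OF this] have "(%k. sqrt (\<omega> x) * \<phi> (r k) x) ----> snd (f x)" by (simp add: F_def)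
    then have "(%k. sqrt (\<omega> x) * \<phi> (r k) x / sqrt (\<omega> x)) ----> snd (f x) / sqrt (\<omega> x)"
      using pos[of x] by (intro tendsto_divide tendsto_const) auto
    then show "(%n. \<phi> (r n) x) ----> u x" using pos[of x] by (simp add: u_def)
  qed
  have "H1lim \<omega> (%n. \<phi> (r n)) u g"
    unfolding H1lim_def using \<omega> t um A1 A2 L2c_subseq[OF L1 fr(1)] L2c_subseq[OF L2 fr(1)] by simp
  then show ?thesis using fr(1) by blast
qed

section \<open>Integration by parts and weak gradients\<close>

lemma test_L2f_pderiv:
  assumes "test_fun UNIV \<phi>" "i \<in> Basis"
  shows "L2f (pderiv_dir \<phi> i)"
proof -
  have "L2f (%x. cgrad \<phi> x \<bullet> i)"
    unfolding L2f_def
  proof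
    have [measurable]: "cgrad \<phi> \<in> Lmeas" by (rule test_meas(2)[OF assms(1)])
    show "(%x. cgrad \<phi> x \<bullet> i) \<in> Lmeas" by measurable
    show "L1f (%x. (norm (cgrad \<phi> x \<bullet> i))^2)"
      by (rule Bochner_Integration.integrable_bound[where f = "%x. (norm (cgrad \<phi> x))^2"])
         (use test_L2f(2)[OF assms(1)] Basis_le_norm[OF assms(2)] in \<open>auto simp: L2f_def power2_le_iff_abs_le intro!: AE_I2\<close>)
  qed
  then show ?thesis by (simp add: cgrad_inner[OF assms(2)])
qed

text \<open>The difference quotients in direction e have integral zero by translation invariance.
  They are bounded by a Lipschitz constant and supported in one compact set, so the integral of
  their limit is zero as well.\<close>

lemma integral_pderiv_test:
  fixes \<phi> :: "'n::euclidean_space => real"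
  assumes t: "test_fun UNIV \<phi>"
  shows "(LI x. cgrad \<phi> x \<bullet> e) = 0"
proof -
  obtain K where K: "compact K" "!!x. x \<notin> K ==> \<phi> x = 0" "!!x. x \<notin> K ==> cgrad \<phi> x = 0" using test_fun_supp[OF t] by blast
  obtain B where B: "B > 0" "!!x. norm (cgrad \<phi> x) <= B" using test_bounded[OF t] by metis
  define q where "q n x = (\<phi> (x + (1 / real (Suc n)) *\<^sub>R e) - \<phi> x) * real (Suc n)" for n x
  \<comment> \<open>The shifts used have length at most that of e, so \<open>L\<close> contains the
    supports of all difference quotients.\<close>
  define L where "L = {x + y | x y. x \<in> K \<and> y \<in> cball 0 (norm e)}"
  have Lc: "compact L" unfolding L_def by (rule compact_sums[OF K(1) compact_cball])
  have pm [measurable]: "\<phi> \<in> borel_measurable borel" by (rule C1c_facts(4)[OF C1c_test[OF t]])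
  have [measurable]: "cgrad \<phi> \<in> borel_measurable borel" by (rule C1c_facts(5)[OF C1c_test[OF t]])
  have ip: "integrable lborel \<phi>" using C1c_facts(8)[OF C1c_test[OF t]] by (subst integrable_abs_iff[symmetric]) auto
  have q0: "(LINT x|lborel. q n x) = 0" for n
  proof -
    define h where "h = (1 / real (Suc n)) *\<^sub>R e"
    have "integrable (distr lborel borel ((+) h)) \<phi>" using ip by (simp add: lborel_distr_plus)
    then have ih: "integrable lborel (%x. \<phi> (h + x))" by (subst (asm) integrable_distr_eq) auto
    have "(LINT x|lborel. \<phi> x) = (LINT x|distr lborel borel ((+) h). \<phi> x)" by (simp add: lborel_distr_plus)
    also have "\<dots> = (LINT x|lborel. \<phi> (h + x))" by (rule integral_distr) auto
    finally show ?thesis using ip ih by (simp add: q_def h_def[symmetric] add.commute del: of_nat_Suc)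
  qed
  have "(%n. LINT x|lborel. q n x) ----> (LINT x|lborel. cgrad \<phi> x \<bullet> e)"
  proof (rule integral_dominated_convergence[where w = "%x. B * norm e * indicator L x"])
    show "(%x. cgrad \<phi> x \<bullet> e) \<in> borel_measurable lborel" by measurable
    show "q n \<in> borel_measurable lborel" for n unfolding q_def by measurable
    show "integrable lborel (%x. B * norm e * indicator L x)"
      using Lc emeasure_compact_finite[OF Lc] by (intro integrable_mult_right integrable_real_indicator) (auto simp: compact_imp_closed)
    show "AE x in lborel. (%n. q n x) ----> cgrad \<phi> x \<bullet> e"
    proof (rule AE_I2)
      fix x
      have "((%t. \<phi> (x + t *\<^sub>R e)) has_derivative (%t. cgrad \<phi> (x + 0 *\<^sub>R e) \<bullet> (t *\<^sub>R e))) (at 0)"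
        by (rule has_derivative_compose[OF _ test_cgrad[OF t]]) (auto intro!: derivative_eq_intros)
      then have "((%t. \<phi> (x + t *\<^sub>R e)) has_real_derivative (cgrad \<phi> x \<bullet> e)) (at 0)"
        by (simp add: has_field_derivative_def mult_commute_abs)
      then have "((%t. (\<phi> (x + t *\<^sub>R e) - \<phi> x) / t) \<longlongrightarrow> cgrad \<phi> x \<bullet> e) (at 0)"
        by (simp add: has_field_derivative_iff)
      moreover have "filterlim (%n. 1 / real (Suc n)) (at 0) sequentially"
        using LIMSEQ_inverse_real_of_nat by (auto simp: filterlim_at inverse_eq_divide)
      ultimately have "(%n. (\<phi> (x + (1 / real (Suc n)) *\<^sub>R e) - \<phi> x) / (1 / real (Suc n))) ----> cgrad \<phi> x \<bullet> e"
        by (rule filterlim_compose)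
      then show "(%n. q n x) ----> cgrad \<phi> x \<bullet> e" by (simp add: q_def)
    qed
    show "AE x in lborel. norm (q n x) <= B * norm e * indicator L x" for n
    proof (rule AE_I2)
      fix x
      define s where "s = 1 / real (Suc n)"
      have s: "0 < s" "s <= 1" by (auto simp: s_def)
      have lip: "norm (\<phi> (x + s *\<^sub>R e) - \<phi> x) <= B * norm (x + s *\<^sub>R e - x)"
        by (rule differentiable_bound[OF convex_UNIV, where f' = "%x h. cgrad \<phi> x \<bullet> h"])
           (auto intro!: has_derivative_at_withinI test_cgrad[OF t] onorm_le order_trans[OF Cauchy_Schwarz_ineq2] mult_right_mono B)
      then have b: "norm (q n x) <= B * norm e" using s
        by (simp add: q_def s_def[symmetric] abs_mult) (simp add: s_def field_simps)
      show "norm (q n x) <= B * norm e * indicator L x"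
      proof (cases "x \<in> L")
        case False
        have 1: "x \<notin> K" using False unfolding L_def by (auto intro!: exI[of _ x] exI[of _ "0::'n"])
        have 2: "x + s *\<^sub>R e \<notin> K"
        proof
          assume "x + s *\<^sub>R e \<in> K"
          moreover have "- (s *\<^sub>R e) \<in> cball 0 (norm e)" using s by (simp add: mult_left_le_one_le)
          moreover have "x = (x + s *\<^sub>R e) + - (s *\<^sub>R e)" by simp
          ultimately show False using False unfolding L_def by blast
        qed
        show ?thesis using 1 2 K(2) False by (simp add: q_def s_def)
      qed (use b in simp)
    qed
  qed
  then have "(LINT x|lborel. cgrad \<phi> x \<bullet> e) = 0" unfolding q0 by (simp add: LIMSEQ_const_iff)
  moreover have "(LI x. cgrad \<phi> x \<bullet> e) = (LINT x|lborel. cgrad \<phi> x \<bullet> e)"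
    by (rule integral_completion) measurable
  ultimately show ?thesis by simp
qed

lemma test_by_parts:
  assumes a: "test_fun UNIV \<phi>" and b: "test_fun UNIV \<psi>" and i: "i \<in> Basis"
  shows "(LI x. \<phi> x * pderiv_dir \<psi> i x) = - (LI x. (cgrad \<phi> x \<bullet> i) * \<psi> x)"
proof -
  have "(LI x. cgrad (%x. \<phi> x * \<psi> x) x \<bullet> i) = 0"
    by (rule integral_pderiv_test[OF test_mult_smooth[OF a test_smooth[OF b]]])
  also have "(%x. cgrad (%x. \<phi> x * \<psi> x) x \<bullet> i) = (%x. \<phi> x * pderiv_dir \<psi> i x + (cgrad \<phi> x \<bullet> i) * \<psi> x)"
    using i by (auto simp: cgrad_mult test_smooth[OF a] test_smooth[OF b] inner_add_left cgrad_inner)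
  finally show ?thesis
    using L2f_inner(1)[OF test_L2f(1)[OF a] test_L2f_pderiv[OF b i]] L2f_inner(1)[OF test_L2f_pderiv[OF a i] test_L2f(1)[OF b]]
    by (simp add: cgrad_inner[OF i])
qed

lemma H1lim_facts:
  assumes "H1lim \<omega> \<phi> u g"
  shows "weight \<omega>" "!!n. test_fun UNIV (\<phi> n)" "u \<in> Lmeas" "g \<in> Lmeas"
    "L2f g" "L2f u" "L2c \<phi> u" "L2c (%n. cgrad (\<phi> n)) g"
proof -
  show w: "weight \<omega>" and "!!n. test_fun UNIV (\<phi> n)" "u \<in> Lmeas" "L2c (%n. cgrad (\<phi> n)) g"
    using assms by (auto simp: H1lim_def)
  then show "L2f g" "g \<in> Lmeas" by (auto simp: L2c_def L2f_def)
  have om: "\<omega> \<in> Lmeas" "!!x. 1 <= \<omega> x" using w by (auto simp: weight_def)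
  have pos: "\<omega> x > 0" for x using om(2)[of x] by linarith
  have "L2c (%n x. (1 / sqrt (\<omega> x)) *\<^sub>R (sqrt (\<omega> x) * \<phi> n x)) (%x. (1 / sqrt (\<omega> x)) *\<^sub>R (sqrt (\<omega> x) * u x))"
  proof (rule L2c_mult[where B = 1])
    show "\<bar>1 / sqrt (\<omega> x)\<bar> <= 1" for x
      using om(2)[of x] real_sqrt_le_mono[of 1 "\<omega> x"] by (simp add: divide_le_eq)
  qed (use assms om in \<open>auto simp: H1lim_def\<close>)
  moreover have "(1 / sqrt (\<omega> x)) *\<^sub>R (sqrt (\<omega> x) * a) = a" for x a using pos[of x] by simp
  ultimately show "L2c \<phi> u" by simp
  then show "L2f u" by (simp add: L2c_def)
qed

lemma L2_on_UNIV: "L2_on UNIV h \<longleftrightarrow> L2f h"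
  by (simp add: L2_on_def L2f_def lebesgue_on_UNIV_eq)

text \<open>The integration by parts formula holds for the approximants and both of its sides are
  continuous in L^2.\<close>

lemma H1lim_imp_H1_grad:
  assumes u: "H1lim \<omega> \<phi> u g"
  shows "H1_grad UNIV u g"
proof -
  note f = H1lim_facts[OF u]
  have gi: "L2f (%x. g x \<bullet> i)" if "i \<in> Basis" for i
    unfolding L2f_def
  proof
    note [measurable] = f(4)
    show "(%x. g x \<bullet> i) \<in> Lmeas" by measurable
    show "L1f (%x. (norm (g x \<bullet> i))^2)"
      by (rule Bochner_Integration.integrable_bound[where f = "%x. (norm (g x))^2"])
         (use f(5) Basis_le_norm[OF that] in \<open>auto simp: L2f_def power2_le_iff_abs_le intro!: AE_I2\<close>)
  qed
  have "(LI x. u x * pderiv_dir \<psi> i x) = - (LI x. (g x \<bullet> i) * \<psi> x)"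
    if t: "test_fun UNIV \<psi>" and i: "i \<in> Basis" for \<psi> i
  proof -
    have 1: "(%n. LI x. \<phi> n x \<bullet> pderiv_dir \<psi> i x) ----> (LI x. u x \<bullet> pderiv_dir \<psi> i x)"
      by (rule L2c_inner[OF f(7) L2c_const[OF test_L2f_pderiv[OF t i]]])
    have pL: "L2f (%x. \<psi> x *\<^sub>R i)"
      using test_L2f(1)[OF t] i unfolding L2f_def by auto
    have "(%n. LI x. cgrad (\<phi> n) x \<bullet> (\<psi> x *\<^sub>R i)) ----> (LI x. g x \<bullet> (\<psi> x *\<^sub>R i))"
      by (rule L2c_inner[OF f(8) L2c_const[OF pL]])
    then have "(%n. - (LI x. (cgrad (\<phi> n) x \<bullet> i) * \<psi> x)) ----> - (LI x. (g x \<bullet> i) * \<psi> x)"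
      by (intro tendsto_minus) (simp add: mult.commute)
    moreover have "(LI x. \<phi> n x \<bullet> pderiv_dir \<psi> i x) = - (LI x. (cgrad (\<phi> n) x \<bullet> i) * \<psi> x)" for n
      using test_by_parts[OF f(2) t i] by simp
    ultimately show ?thesis using 1 LIMSEQ_unique by (simp add: inner_real_def) blast
  qed
  then show ?thesis using f(6) gi by (simp add: H1_grad_def L2_on_UNIV weak_grad_def lebesgue_on_UNIV_eq)
qed

section \<open>The strong maximum principle\<close>

text \<open>The coefficients vary with n and converge merely almost everywhere, so uniform
  boundedness does the work: the error from F n - f is at most B times its norm, and (c n - d) f
  tends to zero by dominated convergence.\<close>

lemma L2c_coeff:
  fixes f :: "'n::euclidean_space => 'b::euclidean_space"
  assumes F: "L2c F f" and cm: "!!n. c n \<in> Lmeas" "d \<in> Lmeas"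
    and B: "!!n x. \<bar>c n x\<bar> <= B" "!!x. \<bar>d x\<bar> <= B"
    and lim: "AE x in lebesgue. (%n. c n x) ----> d x"
  shows "L2c (%n x. c n x *\<^sub>R F n x) (%x. d x *\<^sub>R f x)"
proof -
  have l: "L2f (F n)" "L2f f" for n using F by (auto simp: L2c_def)
  note [measurable] = cm
  have [measurable]: "f \<in> Lmeas" using l(2) by (simp add: L2f_def)
  have L: "L2f (%x. c n x *\<^sub>R F n x)" "L2f (%x. d x *\<^sub>R f x)" "L2f (%x. c n x *\<^sub>R (F n x - f x))" for n
    by (rule L2f_mult[OF l(1) cm(1) B(1)], rule L2f_mult[OF l(2) cm(2) B(2)], rule L2f_mult[OF L2f_diff[OF l] cm(1) B(1)])
  have Ld: "L2f (%x. (c n x - d x) *\<^sub>R f x)" for n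
  proof (rule L2f_mult[OF l(2), where B = "2 * B"])
    show "\<bar>c n x - d x\<bar> <= 2 * B" for x using B(1)[of n x] B(2)[of x] by linarith
  qed measurable
  have z: "(%n. LI x. (norm ((c n x - d x) *\<^sub>R f x))^2) ----> (LINT x|(lebesgue::'n measure). 0)"
  proof (rule integral_dominated_convergence[where w = "%x. (2 * B)^2 * (norm (f x))^2"])
    show "L1f (%x. (2 * B)^2 * (norm (f x))^2)" using l(2) by (simp add: L2f_def)
    show "AE x in lebesgue. (%n. (norm ((c n x - d x) *\<^sub>R f x))^2) ----> 0"
      using lim
    proof eventually_elim
      fix x assume "(%n. c n x) ----> d x"
      then have "(%n. (norm ((c n x - d x) *\<^sub>R f x))^2) ----> (norm ((d x - d x) *\<^sub>R f x))\<^sup>2" by (intro tendsto_intros)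
      then show "(%n. (norm ((c n x - d x) *\<^sub>R f x))^2) ----> 0" by simp
    qed
    show "AE x in lebesgue. norm ((norm ((c n x - d x) *\<^sub>R f x))^2) <= (2 * B)^2 * (norm (f x))^2" for n
    proof (rule AE_I2)
      fix x
      have "\<bar>c n x - d x\<bar> <= 2 * B" using B(1)[of n x] B(2)[of x] by linarith
      then have "\<bar>c n x - d x\<bar>\<^sup>2 <= (2 * B)^2" by (intro power_mono) auto
      then show "norm ((norm ((c n x - d x) *\<^sub>R f x))^2) <= (2 * B)^2 * (norm (f x))^2"
        by (simp add: power_mult_distrib mult_right_mono)
    qed
  qed measurable
  have "(%n. LI x. (norm (c n x *\<^sub>R F n x - d x *\<^sub>R f x))^2) ----> 0"
  proof (rule tendsto_sandwich[OF _ _ tendsto_const])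
    show "\<forall>\<^sub>F n in sequentially. 0 <= (LI x. (norm (c n x *\<^sub>R F n x - d x *\<^sub>R f x))^2)" by simp
    show "\<forall>\<^sub>F n in sequentially. (LI x. (norm (c n x *\<^sub>R F n x - d x *\<^sub>R f x))^2)
        <= 2 * (B^2 * (LI x. (norm (F n x - f x))^2)) + 2 * (LI x. (norm ((c n x - d x) *\<^sub>R f x))^2)"
    proof (intro always_eventually allI)
      fix n
      have i1: "L1f (%x. (norm (F n x - f x))^2)" using L2f_diff[OF l] by (simp add: L2f_def)
      have i2: "L1f (%x. (norm ((c n x - d x) *\<^sub>R f x))^2)" using Ld[of n] by (simp add: L2f_def)
      have "(LI x. (norm (c n x *\<^sub>R F n x - d x *\<^sub>R f x))^2) <= (LI x. 2 * (B^2 * (norm (F n x - f x))^2) + 2 * (norm ((c n x - d x) *\<^sub>R f x))^2)"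
      proof (rule integral_mono)
        show "L1f (%x. (norm (c n x *\<^sub>R F n x - d x *\<^sub>R f x))^2)" using L2f_diff[OF L(1)[of n] L(2)] by (simp add: L2f_def)
        show "L1f (%x. 2 * (B^2 * (norm (F n x - f x))^2) + 2 * (norm ((c n x - d x) *\<^sub>R f x))^2)"
          by (intro Bochner_Integration.integrable_add integrable_mult_right i1 i2)
        fix x
        have "c n x *\<^sub>R F n x - d x *\<^sub>R f x = c n x *\<^sub>R (F n x - f x) + (c n x - d x) *\<^sub>R f x" by (simp add: algebra_simps)
        then have "(norm (c n x *\<^sub>R F n x - d x *\<^sub>R f x))^2 <= 2 * (norm (c n x *\<^sub>R (F n x - f x)))^2 + 2 * (norm ((c n x - d x) *\<^sub>R f x))^2"
          using norm_add_sq_le by metis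
        moreover have "\<bar>c n x\<bar>\<^sup>2 <= B^2" using B(1)[of n x] by (intro power_mono) auto
        then have "(norm (c n x *\<^sub>R (F n x - f x)))^2 <= B^2 * (norm (F n x - f x))^2"
          by (simp add: power_mult_distrib mult_right_mono)
        ultimately show "(norm (c n x *\<^sub>R F n x - d x *\<^sub>R f x))^2 <= 2 * (B^2 * (norm (F n x - f x))^2) + 2 * (norm ((c n x - d x) *\<^sub>R f x))^2" by linarith
      qed
      also have "\<dots> = 2 * (B^2 * (LI x. (norm (F n x - f x))^2)) + 2 * (LI x. (norm ((c n x - d x) *\<^sub>R f x))^2)"
        using i1 i2 by (subst Bochner_Integration.integral_add) (auto intro!: integrable_mult_right simp del: norm_scaleR)
      finally show "(LI x. (norm (c n x *\<^sub>R F n x - d x *\<^sub>R f x))^2)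
        <= 2 * (B^2 * (LI x. (norm (F n x - f x))^2)) + 2 * (LI x. (norm ((c n x - d x) *\<^sub>R f x))^2)" .
    qed
    have "(%n. 2 * (B^2 * (LI x. (norm (F n x - f x))^2)) + 2 * (LI x. (norm ((c n x - d x) *\<^sub>R f x))^2)) ----> 2 * (B^2 * 0) + 2 * (LINT x|(lebesgue::'n measure). 0)"
      by (intro tendsto_intros z) (use F in \<open>auto simp: L2c_def\<close>)
    then show "(%n. 2 * (B^2 * (LI x. (norm (F n x - f x))^2)) + 2 * (LI x. (norm ((c n x - d x) *\<^sub>R f x))^2)) ----> 0" by simp
  qed
  then show ?thesis using L by (simp add: L2c_def)
qed

text \<open>A nonnegative weak solution of \<open>-\<Delta>u = w\<close> in \<open>U\<close>, together with nonnegative test functions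
  converging to it.\<close>
definition wsol :: "'n::euclidean_space set => ('n => real) => (nat => 'n => real) => ('n => real) => ('n => 'n) => ('n => real) => bool" where
  "wsol U \<omega> \<phi> u g w \<longleftrightarrow> H1lim \<omega> \<phi> u g \<and> (\<forall>n. test_fun U (\<phi> n)) \<and> (\<forall>n x. 0 <= \<phi> n x) \<and> (\<forall>x. 0 <= u x) \<and>
     w \<in> Lmeas \<and> (\<forall>\<eta>. test_fun U \<eta> \<longrightarrow> L1f (%x. w x * (\<eta> x)^2)) \<and>
     (\<forall>\<psi>. test_fun U \<psi> \<longrightarrow> (LI x. g x \<bullet> cgrad \<psi> x) = (LI x. w x * \<psi> x))"

text \<open>Testing with \<open>\<eta>\<^sup>2 / (u + \<delta>)\<close>.\<close>
lemma log_identity: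
  fixes u :: "'n::euclidean_space => real"
  assumes W: "wsol U \<omega> \<phi> u g w" and \<eta>: "test_fun U \<eta>" and \<delta>: "\<delta> > 0"
  defines "X \<equiv> %x. (\<eta> x / (u x + \<delta>)) *\<^sub>R g x"
  shows "L2c (%n x. (\<eta> x / (\<phi> n x + \<delta>)) *\<^sub>R cgrad (\<phi> n) x) X"
    "(LI x. w x * ((\<eta> x)^2 / (u x + \<delta>))) = 2 * (LI x. X x \<bullet> cgrad \<eta> x) - (LI x. (norm (X x))^2)"
    "L1f (%x. w x * ((\<eta> x)^2 / (u x + \<delta>)))"
proof -
  have H: "H1lim \<omega> \<phi> u g" and pt: "!!n. test_fun U (\<phi> n)" and p0: "!!n x. 0 <= \<phi> n x" and u0: "!!x. 0 <= u x"
    and wm [measurable]: "w \<in> Lmeas" and wi: "!!\<eta>. test_fun U \<eta> ==> L1f (%x. w x * (\<eta> x)^2)"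
    and weq: "!!\<psi>. test_fun U \<psi> ==> (LI x. g x \<bullet> cgrad \<psi> x) = (LI x. w x * \<psi> x)"
    using W by (auto simp: wsol_def)
  note f = H1lim_facts[OF H]
  note [measurable] = f(3,4) test_meas[OF \<eta>] test_meas[OF pt]
  have lim: "AE x in lebesgue. (%n. \<phi> n x) ----> u x" using H by (simp add: H1lim_def)
  have pp: "\<phi> n x + \<delta> > 0" "u x + \<delta> > 0" "\<phi> n x + \<delta> >= \<delta>" "u x + \<delta> >= \<delta>" for n x using p0[of n x] u0[of x] \<delta> by auto
  obtain B where B: "B > 0" "!!x. \<bar>\<eta> x\<bar> <= B" "!!x. norm (cgrad \<eta> x) <= B" using test_bounded[OF \<eta>] by metis
  have bd: "\<bar>\<eta> x / t\<bar> <= B / \<delta>" if "t >= \<delta>" for x t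
    using B(2)[of x] that \<delta> B(1) by (simp add: abs_divide frac_le)
  show X: "L2c (%n x. (\<eta> x / (\<phi> n x + \<delta>)) *\<^sub>R cgrad (\<phi> n) x) X"
    unfolding X_def
  proof (rule L2c_coeff[OF f(8), where B = "B / \<delta>"])
    show "AE x in lebesgue. (%n. \<eta> x / (\<phi> n x + \<delta>)) ----> \<eta> x / (u x + \<delta>)"
      using lim by eventually_elim (intro tendsto_intros, use pp in \<open>auto simp: less_imp_neq[symmetric]\<close>)
  qed (use bd pp in auto)
  \<comment> \<open>As u is not smooth, the admissible test functions are built from its
    approximants, and the limit is taken afterwards.\<close>
  define \<psi> where "\<psi> n x = (\<eta> x * \<eta> x) * inverse (\<phi> n x + \<delta>)" for n x
  have sm: "smooth_fun (%x. \<phi> n x + \<delta>)" for n by (intro smooth_add smooth_const test_smooth[OF pt])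
  have \<psi>t: "test_fun U (\<psi> n)" for n unfolding \<psi>_def
    by (intro test_mult_smooth[OF test_mult_smooth[OF \<eta> test_smooth[OF \<eta>]]] smooth_inverse sm pp(1))
  \<comment> \<open>Arranged so that each quotient is a bounded coefficient converging almost
    everywhere, in front of a gradient converging in L^2.\<close>
  have grad: "cgrad (\<psi> n) x = (2 * (\<eta> x / (\<phi> n x + \<delta>))) *\<^sub>R cgrad \<eta> x - (\<eta> x / (\<phi> n x + \<delta>)) *\<^sub>R ((\<eta> x / (\<phi> n x + \<delta>)) *\<^sub>R cgrad (\<phi> n) x)" for n x
  proof -
    have "cgrad (%x. inverse (\<phi> n x + \<delta>)) x = (- (inverse (\<phi> n x + \<delta>))\<^sup>2) *\<^sub>R cgrad (\<phi> n) x"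
      by (rule cgrad_chain[OF test_smooth[OF pt], where h = "%s. inverse (s + \<delta>)"])
         (use pp(1)[of n x] in \<open>auto intro!: derivative_eq_intros simp: power2_eq_square\<close>)
    moreover have "cgrad (%x. \<eta> x * \<eta> x) x = (2 * \<eta> x) *\<^sub>R cgrad \<eta> x"
      by (simp add: cgrad_mult test_smooth[OF \<eta>] scaleR_add_left[symmetric])
    moreover have "cgrad (\<psi> n) x = (\<eta> x * \<eta> x) *\<^sub>R cgrad (%x. inverse (\<phi> n x + \<delta>)) x
        + inverse (\<phi> n x + \<delta>) *\<^sub>R cgrad (%x. \<eta> x * \<eta> x) x"
      unfolding \<psi>_def by (intro cgrad_mult smooth_mult test_smooth[OF \<eta>] smooth_inverse sm pp(1))
    ultimately show ?thesis by (simp add: divide_inverse power2_eq_square mult_ac)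
  qed
  have L: "L2c (%n. cgrad (\<psi> n)) (%x. (2 * (\<eta> x / (u x + \<delta>))) *\<^sub>R cgrad \<eta> x - (\<eta> x / (u x + \<delta>)) *\<^sub>R X x)"
  proof -
    have 1: "L2c (%n x. (2 * (\<eta> x / (\<phi> n x + \<delta>))) *\<^sub>R cgrad \<eta> x) (%x. (2 * (\<eta> x / (u x + \<delta>))) *\<^sub>R cgrad \<eta> x)"
    proof (rule L2c_coeff[OF L2c_const[OF test_L2f(2)[OF \<eta>]], where B = "2 * (B / \<delta>)"])
      show "AE x in lebesgue. (%n. 2 * (\<eta> x / (\<phi> n x + \<delta>))) ----> 2 * (\<eta> x / (u x + \<delta>))"
        using lim by eventually_elim (intro tendsto_intros, use pp in \<open>auto simp: less_imp_neq[symmetric]\<close>)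
      show "\<bar>2 * (\<eta> x / (\<phi> n x + \<delta>))\<bar> <= 2 * (B / \<delta>)" for n x using bd[OF pp(3), of x n x] by (simp only: abs_mult abs_numeral)
      show "\<bar>2 * (\<eta> x / (u x + \<delta>))\<bar> <= 2 * (B / \<delta>)" for x using bd[OF pp(4), of x x] by (simp only: abs_mult abs_numeral)
    qed auto
    have 2: "L2c (%n x. (- (\<eta> x / (\<phi> n x + \<delta>))) *\<^sub>R ((\<eta> x / (\<phi> n x + \<delta>)) *\<^sub>R cgrad (\<phi> n) x)) (%x. (- (\<eta> x / (u x + \<delta>))) *\<^sub>R X x)"
    proof (rule L2c_coeff[OF X, where B = "B / \<delta>"])
      show "AE x in lebesgue. (%n. - (\<eta> x / (\<phi> n x + \<delta>))) ----> - (\<eta> x / (u x + \<delta>))"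
        using lim by eventually_elim (intro tendsto_intros, use pp in \<open>auto simp: less_imp_neq[symmetric]\<close>)
      show "\<bar>- (\<eta> x / (\<phi> n x + \<delta>))\<bar> <= B / \<delta>" for n x using bd[OF pp(3), of x n x] by (simp only: abs_minus_cancel)
      show "\<bar>- (\<eta> x / (u x + \<delta>))\<bar> <= B / \<delta>" for x using bd[OF pp(4), of x x] by (simp only: abs_minus_cancel)
    qed auto
    have 3: "L2c (%n x. F n x + G n x) (%x. f x + g x)" if "L2c F f" "L2c G g" for F G and f g :: "'n => 'n"
    proof -
      have l: "L2f (F n)" "L2f f" "L2f (G n)" "L2f g" for n using that by (auto simp: L2c_def)
      have "(%n. LI x. (norm (F n x + G n x - (f x + g x)))^2) ----> 0"
      proof (rule tendsto_sandwich[OF _ _ tendsto_const])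
        show "\<forall>\<^sub>F n in sequentially. 0 <= (LI x. (norm (F n x + G n x - (f x + g x)))^2)" by simp
        show "\<forall>\<^sub>F n in sequentially. (LI x. (norm (F n x + G n x - (f x + g x)))^2) <= 2 * (LI x. (norm (F n x - f x))^2) + 2 * (LI x. (norm (G n x - g x))^2)"
        proof (intro always_eventually allI)
          fix n
          have i: "L1f (%x. (norm (F n x - f x))^2)" "L1f (%x. (norm (G n x - g x))^2)"
            using L2f_diff[OF l(1,2)] L2f_diff[OF l(3,4)] by (auto simp: L2f_def)
          have "(LI x. (norm (F n x + G n x - (f x + g x)))^2) <= (LI x. 2 * (norm (F n x - f x))^2 + 2 * (norm (G n x - g x))^2)"
          proof (rule integral_mono)
            show "L1f (%x. (norm (F n x + G n x - (f x + g x)))^2)"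
              using L2f_diff[OF L2f_add[OF l(1,3)] L2f_add[OF l(2,4)]] by (simp add: L2f_def)
            show "(norm (F n x + G n x - (f x + g x)))^2 <= 2 * (norm (F n x - f x))^2 + 2 * (norm (G n x - g x))^2" for x
              using norm_add_sq_le[of "F n x - f x" "G n x - g x"] by (simp add: algebra_simps)
          qed (use i in auto)
          then show "(LI x. (norm (F n x + G n x - (f x + g x)))^2) <= 2 * (LI x. (norm (F n x - f x))^2) + 2 * (LI x. (norm (G n x - g x))^2)"
            using i by simp
        qed
        have "(%n. 2 * (LI x. (norm (F n x - f x))^2) + 2 * (LI x. (norm (G n x - g x))^2)) ----> 2 * 0 + 2 * 0"
          by (intro tendsto_intros) (use that in \<open>auto simp: L2c_def\<close>)
        then show "(%n. 2 * (LI x. (norm (F n x - f x))^2) + 2 * (LI x. (norm (G n x - g x))^2)) ----> 0" by simp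
      qed
      then show ?thesis using L2f_add l by (auto simp: L2c_def)
    qed
    show ?thesis using 3[OF 1 2] by (simp add: grad[abs_def])
  qed
  have XL: "L2f X" using X by (simp add: L2c_def)
  have lhs: "(%n. LI x. g x \<bullet> cgrad (\<psi> n) x) ----> 2 * (LI x. X x \<bullet> cgrad \<eta> x) - (LI x. (norm (X x))^2)"
  proof -
    have "(%x. g x \<bullet> ((2 * (\<eta> x / (u x + \<delta>))) *\<^sub>R cgrad \<eta> x - (\<eta> x / (u x + \<delta>)) *\<^sub>R X x)) = (%x. 2 * (X x \<bullet> cgrad \<eta> x) - X x \<bullet> X x)"
      by (rule ext) (simp add: X_def inner_diff_right)
    moreover have "(LI x. 2 * (X x \<bullet> cgrad \<eta> x) - X x \<bullet> X x) = 2 * (LI x. X x \<bullet> cgrad \<eta> x) - (LI x. (norm (X x))^2)"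
      using L2f_inner(1)[OF XL test_L2f(2)[OF \<eta>]] L2f_inner(1)[OF XL XL] by (simp add: power2_norm_eq_inner)
    ultimately show ?thesis using L2c_inner[OF L2c_const[OF f(5)] L] by simp
  qed
  have rhs: "(%n. LI x. w x * \<psi> n x) ----> (LI x. w x * ((\<eta> x)^2 / (u x + \<delta>)))"
  proof (rule integral_dominated_convergence[where w = "%x. norm (w x * (\<eta> x)^2) / \<delta>"])
    show "L1f (%x. norm (w x * (\<eta> x)^2) / \<delta>)" using wi[OF \<eta>] by auto
    show "AE x in lebesgue. (%n. w x * \<psi> n x) ----> w x * ((\<eta> x)^2 / (u x + \<delta>))"
      using lim unfolding \<psi>_def divide_inverse power2_eq_square
      by eventually_elim (intro tendsto_intros, use pp in \<open>auto simp: less_imp_neq[symmetric]\<close>)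
    show "AE x in lebesgue. norm (w x * \<psi> n x) <= norm (w x * (\<eta> x)^2) / \<delta>" for n
    proof (rule AE_I2)
      fix x
      have "inverse (\<phi> n x + \<delta>) <= inverse \<delta>" using pp(3)[of n x] \<delta> by (simp add: le_imp_inverse_le)
      then have "\<bar>w x\<bar> * (\<eta> x)^2 * inverse (\<phi> n x + \<delta>) <= \<bar>w x\<bar> * (\<eta> x)^2 * inverse \<delta>" by (intro mult_left_mono) auto
      moreover have "norm (w x * \<psi> n x) = \<bar>w x\<bar> * (\<eta> x)^2 * inverse (\<phi> n x + \<delta>)"
        using pp(1)[of n x] by (simp add: \<psi>_def abs_mult power2_eq_square)
      moreover have "norm (w x * (\<eta> x)^2) / \<delta> = \<bar>w x\<bar> * (\<eta> x)^2 * inverse \<delta>" by (simp add: abs_mult divide_inverse)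
      ultimately show "norm (w x * \<psi> n x) <= norm (w x * (\<eta> x)^2) / \<delta>" by linarith
    qed
    show "(%x. w x * \<psi> n x) \<in> Lmeas" for n unfolding \<psi>_def by measurable
  qed measurable
  show "(LI x. w x * ((\<eta> x)^2 / (u x + \<delta>))) = 2 * (LI x. X x \<bullet> cgrad \<eta> x) - (LI x. (norm (X x))^2)"
    using LIMSEQ_unique[OF rhs] lhs weq[OF \<psi>t] by simp
  show "L1f (%x. w x * ((\<eta> x)^2 / (u x + \<delta>)))"
  proof (rule Bochner_Integration.integrable_bound[where f = "%x. w x * (\<eta> x)^2 / \<delta>"])
    show "L1f (%x. w x * (\<eta> x)^2 / \<delta>)" using wi[OF \<eta>] by simp
    show "AE x in lebesgue. norm (w x * ((\<eta> x)^2 / (u x + \<delta>))) <= norm (w x * (\<eta> x)^2 / \<delta>)"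
      using pp(2,4) \<delta> by (intro AE_I2) (simp add: abs_mult abs_divide frac_le less_imp_le)
  qed measurable
qed

text \<open>Completing the square in \<open>log_identity\<close>: 2 X \<bullet> grad \<eta> - |X|^2
  is at most |grad \<eta>|^2 pointwise. It compares the equation of a positive solution with the
  Rayleigh quotient of arbitrary test functions.\<close>

lemma picone:
  fixes u :: "'n::euclidean_space => real"
  assumes W: "wsol U \<omega> \<phi> u g w" and \<eta>: "test_fun U \<eta>" and \<delta>: "\<delta> > 0"
  shows "(LI x. w x * ((\<eta> x)^2 / (u x + \<delta>))) <= gnorm2 \<eta>"
proof -
  define X where "X x = (\<eta> x / (u x + \<delta>)) *\<^sub>R g x" for x
  note li = log_identity[OF W \<eta> \<delta>, folded X_def]
  have XL: "L2f X" using li(1) by (simp add: L2c_def)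
  have "2 * (LI x. X x \<bullet> cgrad \<eta> x) - (LI x. (norm (X x))^2) = (LI x. 2 * (X x \<bullet> cgrad \<eta> x) - (norm (X x))^2)"
    using L2f_inner(1)[OF XL test_L2f(2)[OF \<eta>]] XL by (simp add: L2f_def)
  also have "\<dots> <= gnorm2 \<eta>"
    unfolding gnorm2_def
  proof (rule integral_mono)
    show "L1f (%x. 2 * (X x \<bullet> cgrad \<eta> x) - (norm (X x))^2)"
      using L2f_inner(1)[OF XL test_L2f(2)[OF \<eta>]] XL by (simp add: L2f_def)
    show "L1f (%x. (norm (cgrad \<eta> x))^2)" using test_L2f(2)[OF \<eta>] by (simp add: L2f_def)
    fix x
    have "0 <= (X x - cgrad \<eta> x) \<bullet> (X x - cgrad \<eta> x)" by simp
    then show "2 * (X x \<bullet> cgrad \<eta> x) - (norm (X x))^2 <= (norm (cgrad \<eta> x))^2"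
      by (simp add: power2_norm_eq_inner inner_diff_left inner_diff_right inner_commute)
  qed
  finally show ?thesis using li(2) by simp
qed

text \<open>Since |w| <= A u, the left side of \<open>log_identity\<close> is bounded by the
  integral of A \<eta>^2, whatever \<delta> is; the mixed term is absorbed by Young's inequality.
  The independence of \<delta> is the point.\<close>

lemma log_gradient_bound:
  fixes u :: "'n::euclidean_space => real"
  assumes W: "wsol U \<omega> \<phi> u g w" and \<eta>: "test_fun U \<eta>" and \<delta>: "\<delta> > 0"
    and A: "!!x. \<bar>w x\<bar> <= A x * u x" "!!x. 0 <= A x" "L1f (%x. A x * (\<eta> x)^2)"
  shows "(LI x. (norm ((\<eta> x / (u x + \<delta>)) *\<^sub>R g x))^2) <= 4 * gnorm2 \<eta> + 2 * (LI x. A x * (\<eta> x)^2)"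
proof -
  define X where "X x = (\<eta> x / (u x + \<delta>)) *\<^sub>R g x" for x
  note li = log_identity[OF W \<eta> \<delta>, folded X_def]
  have XL: "L2f X" using li(1) by (simp add: L2c_def)
  have u0: "!!x. 0 <= u x" using W by (simp add: wsol_def)
  have "- (LI x. w x * ((\<eta> x)^2 / (u x + \<delta>))) = (LI x. - (w x * ((\<eta> x)^2 / (u x + \<delta>))))" by simp
  also have "\<dots> <= (LI x. A x * (\<eta> x)^2)"
  proof (rule integral_mono[OF _ A(3)])
    show "L1f (%x. - (w x * ((\<eta> x)^2 / (u x + \<delta>))))" using li(3) by simp
    fix x
    have "\<bar>w x\<bar> * ((\<eta> x)^2 / (u x + \<delta>)) <= (A x * u x) * ((\<eta> x)^2 / (u x + \<delta>))"
      using A(1)[of x] u0[of x] \<delta> by (intro mult_right_mono) auto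
    also have "\<dots> = A x * (\<eta> x)^2 * (u x / (u x + \<delta>))" by simp
    also have "\<dots> <= A x * (\<eta> x)^2 * 1"
      using A(2)[of x] u0[of x] \<delta> by (intro mult_left_mono) (auto simp: divide_le_eq)
    finally show "- (w x * ((\<eta> x)^2 / (u x + \<delta>))) <= A x * (\<eta> x)^2"
      using abs_ge_minus_self[of "w x * ((\<eta> x)^2 / (u x + \<delta>))"] u0[of x] \<delta> by (simp add: abs_mult)
  qed
  finally have 1: "(LI x. (norm (X x))^2) <= 2 * (LI x. X x \<bullet> cgrad \<eta> x) + (LI x. A x * (\<eta> x)^2)"
    using li(2) by simp
  have "2 * (LI x. X x \<bullet> cgrad \<eta> x) = (LI x. 2 * (X x \<bullet> cgrad \<eta> x))" by simp
  also have "\<dots> <= (LI x. (norm (X x))^2 / 2 + 2 * (norm (cgrad \<eta> x))^2)"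
  proof (rule integral_mono)
    show "L1f (%x. 2 * (X x \<bullet> cgrad \<eta> x))" using L2f_inner(1)[OF XL test_L2f(2)[OF \<eta>]] by simp
    show "L1f (%x. (norm (X x))^2 / 2 + 2 * (norm (cgrad \<eta> x))^2)"
      using XL test_L2f(2)[OF \<eta>] by (simp add: L2f_def)
    fix x
    have "0 <= (X x - 2 *\<^sub>R cgrad \<eta> x) \<bullet> (X x - 2 *\<^sub>R cgrad \<eta> x)" by simp
    then show "2 * (X x \<bullet> cgrad \<eta> x) <= (norm (X x))^2 / 2 + 2 * (norm (cgrad \<eta> x))^2"
      by (simp add: power2_norm_eq_inner inner_diff_left inner_diff_right inner_commute)
  qed
  also have "\<dots> = (LI x. (norm (X x))^2) / 2 + 2 * gnorm2 \<eta>"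
    using XL test_L2f(2)[OF \<eta>] by (simp add: L2f_def gnorm2_def)
  finally show ?thesis using 1 unfolding X_def by linarith
qed

text \<open>Poincare's inequality applied to \<open>ln (1 + u/\<delta>)\<close>: its gradient stays bounded in \<open>L\<^sup>2\<close> as
  \<open>\<delta> \<rightarrow> 0\<close>, whereas the function itself blows up where \<open>u > 0\<close>.\<close>
lemma smp_local:
  fixes u :: "'n::euclidean_space => real"
  assumes W: "wsol U \<omega> \<phi> u g w"
    and A: "!!x. \<bar>w x\<bar> <= A x * u x" "!!x. 0 <= A x" "!!\<eta>. test_fun U \<eta> ==> L1f (%x. A x * (\<eta> x)^2)"
    and r: "r > 0" "cball c (2 * r) \<subseteq> U"
  shows "(AE x in lebesgue. x \<in> ball c r \<longrightarrow> u x = 0) \<or> (AE x in lebesgue. x \<in> ball c r \<longrightarrow> u x > 0)"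
proof (rule disjCI)
  assume npos: "\<not> (AE x in lebesgue. x \<in> ball c r \<longrightarrow> u x > 0)"
  have H: "H1lim \<omega> \<phi> u g" and pt: "!!n. test_fun U (\<phi> n)" and p0: "!!n x. 0 <= \<phi> n x" and u0: "!!x. 0 <= u x"
    using W by (auto simp: wsol_def)
  note f = H1lim_facts[OF H]
  note [measurable] = f(3,4) test_meas[OF pt]
  have lim: "AE x in lebesgue. (%n. \<phi> n x) ----> u x" using H by (simp add: H1lim_def)
  obtain \<eta> where \<eta>: "test_fun U \<eta>" "!!x. x \<in> ball c r ==> \<eta> x >= 1" using exists_cutoff[OF r] by metis
  define B where "B = ball c r"
  have Bb [measurable]: "B \<in> sets borel" by (simp add: B_def)
  have Bl [measurable]: "B \<in> sets lebesgue" by (simp add: B_def)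
  define \<beta> where "\<beta> = measure lebesgue B"
  have eB: "emeasure lebesgue B = ennreal \<beta>" unfolding \<beta>_def B_def
    by (rule emeasure_eq_ennreal_measure) (use emeasure_ball[of r c] r in simp)
  define Z where "Z = {x\<in>B. u x = 0}"
  have Zl [measurable]: "Z \<in> sets lebesgue"
  proof -
    have "Z = B \<inter> {x\<in>space lebesgue. u x = 0}" by (auto simp: Z_def)
    also have "\<dots> \<in> sets lebesgue" by measurable
    finally show ?thesis .
  qed
  define z where "z = measure lebesgue Z"
  have "emeasure lebesgue Z <= emeasure lebesgue B" by (rule emeasure_mono) (auto simp: Z_def)
  also have "\<dots> < \<infinity>" by (simp add: eB)
  finally have eZ: "emeasure lebesgue Z = ennreal z" unfolding z_def by (intro emeasure_eq_ennreal_measure) auto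
  have zpos: "z > 0"
  proof (rule ccontr)
    assume "\<not> z > 0"
    then have "z = 0" by (simp add: z_def zero_less_measure_iff)
    then have "Z \<in> null_sets lebesgue" using eZ Zl by (simp add: null_sets_def)
    then have "AE x in lebesgue. x \<notin> Z" by (rule AE_not_in)
    then have "AE x in lebesgue. x \<in> ball c r \<longrightarrow> u x > 0"
      by eventually_elim (use u0 in \<open>auto simp: Z_def B_def less_le\<close>)
    then show False using npos by simp
  qed
  define M where "M = 4 * gnorm2 \<eta> + 2 * (LI x. A x * (\<eta> x)^2)"
  define K where "K = 2 * (2 ^ DIM('n) * (2 * r)^2 * \<beta>)"
  have K0: "K >= 0" by (simp add: K_def \<beta>_def)
  have \<beta>0: "\<beta> >= 0" by (simp add: \<beta>_def)
  have main: "ennreal z * (\<integral>\<^sup>+x\<in>B. ennreal ((ln (1 + u x / \<delta>))^2) \<partial>lebesgue) <= ennreal (K * M)" if \<delta>: "\<delta> > 0" for \<delta>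
  proof -
    define X where "X x = (\<eta> x / (u x + \<delta>)) *\<^sub>R g x" for x
    define Xn where "Xn n x = (\<eta> x / (\<phi> n x + \<delta>)) *\<^sub>R cgrad (\<phi> n) x" for n x
    have li: "L2c Xn X" using log_identity(1)[OF W \<eta>(1) \<delta>] unfolding X_def Xn_def .
    have XM: "(LI x. (norm (X x))^2) <= M"
      unfolding X_def M_def by (rule log_gradient_bound[OF W \<eta>(1) \<delta> A(1,2) A(3)[OF \<eta>(1)]])
    have Xni: "L1f (%x. (norm (Xn n x))^2)" for n using li by (simp add: L2c_def L2f_def)
    have pp: "\<phi> n x + \<delta> > 0" "u x + \<delta> > 0" "1 + \<phi> n x / \<delta> > 0" "1 + u x / \<delta> > 0" for n x
      using p0[of n x] u0[of x] \<delta> by (auto simp: add_pos_nonneg)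
    define v where "v n x = ln (1 + \<phi> n x / \<delta>)" for n x
    define G where "G n x = (1 / (\<phi> n x + \<delta>)) *\<^sub>R cgrad (\<phi> n) x" for n x
    have vd: "(v n has_derivative (%h. G n x \<bullet> h)) (at x)" for n x
    proof -
      have "((%s. ln (1 + s / \<delta>)) has_real_derivative 1 / (\<phi> n x + \<delta>)) (at (\<phi> n x))"
        using pp(1,3)[of n x] \<delta> by (auto intro!: derivative_eq_intros simp: field_simps)
      from has_derivative_compose[OF test_cgrad[OF pt, of n x] this[unfolded has_field_derivative_def]]
      show ?thesis by (simp add: v_def[abs_def] G_def)
    qed
    have Gc: "continuous_on UNIV (G n)" for n unfolding G_def
      by (intro continuous_intros test_cgrad_continuous[OF pt] test_continuous[OF pt]) (use pp(1)[of n] in \<open>auto simp: less_imp_neq[symmetric]\<close>)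
    have [measurable]: "v n \<in> Lmeas" for n unfolding v_def by measurable
    \<comment> \<open>The approximants need not vanish on the zero set \<open>Z\<close> of u. Their
      mass there is the extra term of \<open>poincare_zero_set\<close>, and it tends to
      zero.\<close>
    define Y where "Y n = (LI x. (norm (indicator Z x *\<^sub>R \<phi> n x))^2)" for n
    have Yi: "L1f (%x. (norm (indicator Z x *\<^sub>R \<phi> n x))^2)" for n
      using L2f_mult[OF test_L2f(1)[OF pt], of "indicator Z" 1] by (auto simp: L2f_def indicator_def)
    have Yl: "Y ----> 0"
    proof -
      have "L2c (%n x. indicator Z x *\<^sub>R \<phi> n x) (%x. indicator Z x *\<^sub>R u x)"
        by (rule L2c_mult[OF f(7), where B = 1]) (auto simp: indicator_def)
      from L2c_norm[OF this] have "Y ----> (LI x. (norm (indicator Z x *\<^sub>R u x))^2)" by (simp add: Y_def[abs_def])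
      moreover have z: "indicator Z x *\<^sub>R u x = 0" for x by (auto simp: Z_def indicator_def)
      ultimately show ?thesis unfolding z by simp
    qed
    define \<rho> where "\<rho> n = K * (LI x. (norm (Xn n x))^2) + 2 * \<beta> * (Y n / \<delta>^2)" for n
    have Y0: "Y n >= 0" for n by (simp add: Y_def)
    have step: "ennreal z * (\<integral>\<^sup>+x\<in>B. ennreal ((v n x)^2) \<partial>lebesgue) <= ennreal (\<rho> n)" for n
    proof -
      have cvB: "convex B" and ZB: "Z \<subseteq> B" by (auto simp: B_def Z_def convex_ball)
      have dm: "norm (y - x) <= 2 * r" if "x \<in> B" "y \<in> B" for x y
        using that dist_triangle2[of y x c] by (simp add: B_def dist_norm norm_minus_commute)
      have "ennreal z * (\<integral>\<^sup>+x\<in>B. ennreal ((v n x)^2) \<partial>lebesgue) \<le>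
          2 * (ennreal (2 ^ DIM('n) * (2 * r)^2) * ennreal \<beta> * (\<integral>\<^sup>+x\<in>B. ennreal ((norm (G n x))^2) \<partial>lebesgue))
           + 2 * (ennreal \<beta> * (\<integral>\<^sup>+x\<in>Z. ennreal ((v n x)^2) \<partial>lebesgue))"
        using poincare_zero_set[OF vd Gc Bb cvB dm Zl ZB, of n] unfolding eB eZ .
      also have "\<dots> <= 2 * (ennreal (2 ^ DIM('n) * (2 * r)^2) * ennreal \<beta> * ennreal (LI x. (norm (Xn n x))^2))
           + 2 * (ennreal \<beta> * ennreal (Y n / \<delta>^2))"
      proof (intro add_mono mult_left_mono)
        have "(\<integral>\<^sup>+x\<in>B. ennreal ((norm (G n x))^2) \<partial>lebesgue) <= (\<integral>\<^sup>+x. ennreal ((norm (Xn n x))^2) \<partial>lebesgue)"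
        proof (rule nn_integral_mono)
          fix x
          show "ennreal ((norm (G n x))^2) * indicator B x <= ennreal ((norm (Xn n x))^2)"
          proof (cases "x \<in> B")
            case True
            then have "\<eta> x >= 1" using \<eta>(2) by (simp add: B_def)
            then have "norm (G n x) <= norm (Xn n x)"
              using pp(1)[of n x] mult_right_mono[of 1 "\<eta> x" "norm (cgrad (\<phi> n) x)"]
              by (simp add: G_def Xn_def divide_right_mono)
            then show ?thesis using True by (simp add: ennreal_leI power_mono)
          qed simp
        qed
        also have "\<dots> = ennreal (LI x. (norm (Xn n x))^2)" by (rule nn_integral_eq_integral[OF Xni]) simp
        finally show "(\<integral>\<^sup>+x\<in>B. ennreal ((norm (G n x))^2) \<partial>lebesgue) <= ennreal (LI x. (norm (Xn n x))^2)" .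
        have "(\<integral>\<^sup>+x\<in>Z. ennreal ((v n x)^2) \<partial>lebesgue) <= (\<integral>\<^sup>+x. ennreal ((norm (indicator Z x *\<^sub>R \<phi> n x))^2 / \<delta>^2) \<partial>lebesgue)"
        proof (rule nn_integral_mono)
          fix x
          have "0 <= v n x" "v n x <= \<phi> n x / \<delta>"
            using p0[of n x] \<delta> ln_add_one_self_le_self[of "\<phi> n x / \<delta>"] by (auto simp: v_def)
          then have "(v n x)^2 <= (\<phi> n x)^2 / \<delta>^2" using power_mono[of "v n x" "\<phi> n x / \<delta>" 2] by (simp add: power_divide)
          then show "ennreal ((v n x)^2) * indicator Z x <= ennreal ((norm (indicator Z x *\<^sub>R \<phi> n x))^2 / \<delta>^2)"
            by (auto simp: indicator_def ennreal_leI)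
        qed
        also have "\<dots> = ennreal (LI x. (norm (indicator Z x *\<^sub>R \<phi> n x))^2 / \<delta>^2)"
          by (rule nn_integral_eq_integral) (use Yi in auto)
        finally show "(\<integral>\<^sup>+x\<in>Z. ennreal ((v n x)^2) \<partial>lebesgue) <= ennreal (Y n / \<delta>^2)" by (simp add: Y_def)
      qed auto
      also have "\<dots> = ennreal (\<rho> n)"
      proof -
        have h: "2 * (ennreal a * ennreal b * ennreal x) + 2 * (ennreal b * ennreal y) = ennreal (2 * (a * b) * x + 2 * b * y)"
          if "0 <= a" "0 <= b" "0 <= x" "0 <= y" for a b x y
        proof -
          have "ennreal (2 * (a * b) * x + 2 * b * y) = ennreal (2 * (a * b * x)) + ennreal (2 * (b * y))"
            using that by (simp add: ennreal_plus mult.assoc)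
          then show ?thesis using that by (simp add: ennreal_mult)
        qed
        show ?thesis unfolding \<rho>_def K_def by (rule h) (use \<beta>0 Y0[of n] in auto)
      qed
      finally show ?thesis .
    qed
    have "ennreal z * (\<integral>\<^sup>+x\<in>B. ennreal ((ln (1 + u x / \<delta>))^2) \<partial>lebesgue) = (\<integral>\<^sup>+x. ennreal z * (ennreal ((ln (1 + u x / \<delta>))^2) * indicator B x) \<partial>lebesgue)"
      by (rule nn_integral_cmult[symmetric]) measurable
    also have "\<dots> = (\<integral>\<^sup>+x. liminf (%n. ennreal z * (ennreal ((v n x)^2) * indicator B x)) \<partial>lebesgue)"
    proof (rule nn_integral_cong_AE)
      show "AE x in lebesgue. ennreal z * (ennreal ((ln (1 + u x / \<delta>))^2) * indicator B x) = liminf (%n. ennreal z * (ennreal ((v n x)^2) * indicator B x))"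
        using lim
      proof eventually_elim
        fix x assume l: "(%n. \<phi> n x) ----> u x"
        have "(%n. ennreal (z * (v n x)^2)) ----> ennreal (z * (ln (1 + u x / \<delta>))^2)"
          unfolding v_def by (intro tendsto_ennrealI tendsto_intros l) (use \<delta> pp(4)[of x] in auto)
        then have "(%n. ennreal z * (ennreal ((v n x)^2) * indicator B x)) ----> ennreal z * (ennreal ((ln (1 + u x / \<delta>))^2) * indicator B x)"
          using zpos by (cases "x \<in> B") (auto simp: ennreal_mult)
        then show "ennreal z * (ennreal ((ln (1 + u x / \<delta>))^2) * indicator B x) = liminf (%n. ennreal z * (ennreal ((v n x)^2) * indicator B x))"
          by (rule lim_imp_Liminf[OF sequentially_bot, symmetric])
      qed
    qed
    also have "\<dots> <= liminf (%n. \<integral>\<^sup>+x. ennreal z * (ennreal ((v n x)^2) * indicator B x) \<partial>lebesgue)"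
      by (rule nn_integral_liminf) measurable
    also have "\<dots> = liminf (%n. ennreal z * (\<integral>\<^sup>+x\<in>B. ennreal ((v n x)^2) \<partial>lebesgue))"
      by (subst nn_integral_cmult) auto
    also have "\<dots> <= liminf (%n. ennreal (\<rho> n))" by (rule Liminf_mono) (simp add: step)
    also have "\<dots> = ennreal (K * (LI x. (norm (X x))^2) + 2 * \<beta> * (0 / \<delta>^2))"
    proof (rule lim_imp_Liminf[OF sequentially_bot])
      show "(%n. ennreal (\<rho> n)) ----> ennreal (K * (LI x. (norm (X x))^2) + 2 * \<beta> * (0 / \<delta>^2))"
        unfolding \<rho>_def by (intro tendsto_ennrealI tendsto_intros L2c_norm[OF li] Yl) (use \<delta> in auto)
    qed
    also have "\<dots> <= ennreal (K * M)" using XM K0 by (intro ennreal_leI) (simp add: mult_left_mono)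
    finally show ?thesis .
  qed
  have null: "{x\<in>B. u x >= \<tau>} \<in> null_sets lebesgue" if \<tau>: "\<tau> > 0" for \<tau>
  proof -
    define P where "P = {x\<in>B. u x >= \<tau>}"
    have Pl [measurable]: "P \<in> sets lebesgue"
    proof -
      have "P = B \<inter> {x\<in>space lebesgue. u x >= \<tau>}" by (auto simp: P_def)
      also have "\<dots> \<in> sets lebesgue" by measurable
      finally show ?thesis .
    qed
    define p where "p = measure lebesgue P"
    have "emeasure lebesgue P <= emeasure lebesgue B" by (rule emeasure_mono) (auto simp: P_def)
    also have "\<dots> < \<infinity>" by (simp add: eB)
    finally have eP: "emeasure lebesgue P = ennreal p" unfolding p_def by (intro emeasure_eq_ennreal_measure) auto
    have "p = 0"
    proof (rule ccontr)
      assume "p \<noteq> 0"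
      then have p: "p > 0" by (simp add: p_def zero_less_measure_iff)
      have M0: "K * M >= 0" unfolding M_def using K0 A(2) by (intro mult_nonneg_nonneg add_nonneg_nonneg integral_nonneg_AE) (auto simp: gnorm2_nonneg)
      \<comment> \<open>Chosen so that s^2 z p exceeds K M. Then \<delta> is fixed by ln(1 +
        \<tau>/\<delta>) = s, which makes the logarithm at least s on \<open>P\<close>.\<close>
      define s where "s = sqrt (K * M / (z * p)) + 1"
      have s: "s > 0" "s^2 > K * M / (z * p)"
      proof -
        have q: "K * M / (z * p) >= 0" using M0 zpos p by simp
        then show "s > 0" by (simp add: s_def add_nonneg_pos)
        have "s^2 = K * M / (z * p) + 2 * sqrt (K * M / (z * p)) + 1" using q by (simp add: s_def power2_sum)
        then show "s^2 > K * M / (z * p)" using q by (simp add: add_nonneg_pos)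
      qed
      define \<delta> where "\<delta> = \<tau> / (exp s - 1)"
      have es: "exp s > 1" using s by simp
      have \<delta>: "\<delta> > 0" using \<tau> es by (simp add: \<delta>_def)
      have td: "1 + \<tau> / \<delta> = exp s" using \<tau> es by (simp add: \<delta>_def)
      have "ennreal (z * (s^2 * p)) = ennreal z * (ennreal (s^2) * emeasure lebesgue P)"
        using zpos p by (simp add: eP ennreal_mult)
      also have "ennreal (s^2) * emeasure lebesgue P = (\<integral>\<^sup>+x. ennreal (s^2) * indicator P x \<partial>lebesgue)"
        by (rule nn_integral_cmult_indicator[OF Pl, symmetric])
      also have "ennreal z * (\<integral>\<^sup>+x. ennreal (s^2) * indicator P x \<partial>lebesgue) <= ennreal z * (\<integral>\<^sup>+x\<in>B. ennreal ((ln (1 + u x / \<delta>))^2) \<partial>lebesgue)"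
      proof (intro mult_left_mono nn_integral_mono)
        fix x
        show "ennreal (s^2) * indicator P x <= ennreal ((ln (1 + u x / \<delta>))^2) * indicator B x"
        proof (cases "x \<in> P")
          case True
          then have x: "x \<in> B" "u x >= \<tau>" by (auto simp: P_def)
          have "exp s <= 1 + u x / \<delta>" unfolding td[symmetric] using x \<delta> by (simp add: divide_right_mono)
          then have "s <= ln (1 + u x / \<delta>)" using ln_mono[of "exp s" "1 + u x / \<delta>"] by (simp add: less_le_trans[OF exp_gt_zero])
          then have "s^2 <= (ln (1 + u x / \<delta>))^2" using s by (intro power_mono) auto
          then show ?thesis using True x by (simp add: ennreal_leI)
        qed simp
      qed simp
      also have "\<dots> <= ennreal (K * M)" by (rule main[OF \<delta>])
      finally have "z * (s^2 * p) <= K * M" using M0 by (simp add: ennreal_le_iff)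
      then show False using s(2) zpos p by (simp add: field_simps)
    qed
    then show ?thesis using eP Pl by (simp add: null_sets_def P_def)
  qed
  have "(\<Union>k::nat. {x\<in>B. u x >= 1 / real (Suc k)}) \<in> null_sets lebesgue" by (intro null_sets_UN null) simp
  then have "AE x in lebesgue. x \<notin> (\<Union>k::nat. {x\<in>B. u x >= 1 / real (Suc k)})" by (rule AE_not_in)
  then show "AE x in lebesgue. x \<in> ball c r \<longrightarrow> u x = 0"
  proof eventually_elim
    fix x assume a: "x \<notin> (\<Union>k::nat. {x\<in>B. u x >= 1 / real (Suc k)})"
    show "x \<in> ball c r \<longrightarrow> u x = 0"
    proof (intro impI, rule ccontr)
      assume x: "x \<in> ball c r" "u x \<noteq> 0"
      then have "u x > 0" using u0[of x] by simp
      then obtain k where "inverse (real (Suc k)) < u x" using reals_Archimedean by blast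
      then show False using a x by (auto simp: B_def inverse_eq_divide dest!: spec[of _ k])
    qed
  qed
qed

lemma not_AE_False_ball:
  assumes "r > 0" "AE x in lebesgue. x \<notin> ball (c::'n::euclidean_space) r"
  shows False
proof -
  have "ball c r \<in> null_sets lebesgue" using assms(2) by (subst (asm) AE_iff_null_sets[symmetric]) auto
  then have "emeasure lborel (ball c r) = 0" by (simp add: null_sets_def)
  moreover have "0 < unit_ball_vol (real DIM('n)) * r ^ DIM('n)" using assms(1) by simp
  ultimately show False using emeasure_ball[of r c] assms(1) by (simp add: ennreal_eq_0_iff)
qed

text \<open>By \<open>smp_local\<close> each small ball is of vanishing or of positive type. Balls
  of different type cannot meet, since their intersection would be a nonempty open null set, so the
  two unions separate \<open>U\<close>; connectedness leaves one type. A countable cover turns this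
  into a statement almost everywhere.\<close>

lemma strong_maximum_principle:
  fixes u :: "'n::euclidean_space => real"
  assumes W: "wsol U \<omega> \<phi> u g w" and U: "open U" "connected U"
    and A: "!!x. \<bar>w x\<bar> <= A x * u x" "!!x. 0 <= A x" "!!\<eta>. test_fun U \<eta> ==> L1f (%x. A x * (\<eta> x)^2)"
  shows "(AE x in lebesgue. x \<in> U \<longrightarrow> u x = 0) \<or> (AE x in lebesgue. x \<in> U \<longrightarrow> u x > 0)"
proof (cases "U = {}")
  case False
  have loc: "(AE x in lebesgue. x \<in> ball c r \<longrightarrow> u x = 0) \<or> (AE x in lebesgue. x \<in> ball c r \<longrightarrow> u x > 0)"
    if "r > 0" "cball c (2 * r) \<subseteq> U" for c r by (rule smp_local[OF W A(1,2) _ that]) (rule A(3))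
  define E where "E = {(x, r). r > 0 \<and> cball x (2 * r) \<subseteq> U \<and> (AE y in lebesgue. y \<in> ball x r \<longrightarrow> u y = 0)}"
  define F where "F = {(x, r). r > 0 \<and> cball x (2 * r) \<subseteq> U \<and> (AE y in lebesgue. y \<in> ball x r \<longrightarrow> u y > 0)}"
  define A1 where "A1 = (\<Union>(x, r)\<in>E. ball x r)"
  define A2 where "A2 = (\<Union>(x, r)\<in>F. ball x r)"
  have op: "open A1" "open A2" by (auto simp: A1_def A2_def intro!: open_UN)
  have cov: "U \<subseteq> A1 \<union> A2"
  proof
    fix x assume "x \<in> U"
    then obtain e where e: "e > 0" "cball x e \<subseteq> U" using U(1) open_contains_cball by blast
    then have "(x, e / 2) \<in> E \<or> (x, e / 2) \<in> F" using loc[of "e / 2" x] by (auto simp: E_def F_def)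
    then show "x \<in> A1 \<union> A2" using e(1) unfolding A1_def A2_def by force
  qed
  have disj: "A1 \<inter> A2 = {}"
  proof (rule ccontr)
    assume "A1 \<inter> A2 \<noteq> {}"
    then obtain y x r x' r' where y: "(x, r) \<in> E" "(x', r') \<in> F" "y \<in> ball x r" "y \<in> ball x' r'"
      unfolding A1_def A2_def by fastforce
    then have "y \<in> ball x r \<inter> ball x' r'" "open (ball x r \<inter> ball x' r')" by auto
    then obtain s where s: "s > 0" "ball y s \<subseteq> ball x r \<inter> ball x' r'" using open_contains_ball by blast
    have "AE y in lebesgue. y \<in> ball x r \<longrightarrow> u y = 0" "AE y in lebesgue. y \<in> ball x' r' \<longrightarrow> u y > 0"
      using y by (auto simp: E_def F_def)
    then have "AE z in lebesgue. z \<notin> ball y s"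
      by eventually_elim (use s(2) in \<open>auto simp: subset_iff\<close>)
    then show False using not_AE_False_ball s(1) by blast
  qed
  then have "A1 \<inter> U = {} \<or> A2 \<inter> U = {}" using connectedD[OF U(2) op] cov by blast
  obtain c :: "nat => 'n" and r :: "nat => real" where cr: "!!i. r i > 0" "!!i. cball (c i) (2 * r i) \<subseteq> U" "U = (\<Union>i. ball (c i) (r i))"
    using open_eq_Union_balls[OF U(1) False] by metis
  have inU: "c i \<in> U" for i using cr(1)[of i] cr(2)[of i] by force
  have each: "(c i, r i) \<in> E \<or> (c i, r i) \<in> F" for i using loc[OF cr(1,2), of i] cr by (auto simp: E_def F_def)
  have ci: "c i \<in> ball (c i) (r i)" for i using cr(1) by simp
  from \<open>A1 \<inter> U = {} \<or> A2 \<inter> U = {}\<close> show ?thesis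
  proof
    assume e: "A1 \<inter> U = {}"
    have "(c i, r i) \<notin> E" for i
    proof
      assume "(c i, r i) \<in> E"
      then have "c i \<in> A1" unfolding A1_def using ci by force
      then show False using e inU by blast
    qed
    then have "\<forall>i. AE x in lebesgue. x \<in> ball (c i) (r i) \<longrightarrow> u x > 0" using each by (auto simp: F_def)
    then have "AE x in lebesgue. \<forall>i. x \<in> ball (c i) (r i) \<longrightarrow> u x > 0" by (rule AE_all_countable[THEN iffD2])
    then have "AE x in lebesgue. x \<in> U \<longrightarrow> u x > 0" by eventually_elim (use cr(3) in blast)
    then show ?thesis ..
  next
    assume e: "A2 \<inter> U = {}"
    have "(c i, r i) \<notin> F" for i
    proof
      assume "(c i, r i) \<in> F"
      then have "c i \<in> A2" unfolding A2_def using ci by force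
      then show False using e inU by blast
    qed
    then have "\<forall>i. AE x in lebesgue. x \<in> ball (c i) (r i) \<longrightarrow> u x = 0" using each by (auto simp: E_def)
    then have "AE x in lebesgue. \<forall>i. x \<in> ball (c i) (r i) \<longrightarrow> u x = 0" by (rule AE_all_countable[THEN iffD2])
    then have "AE x in lebesgue. x \<in> U \<longrightarrow> u x = 0" by eventually_elim (use cr(3) in blast)
    then show ?thesis ..
  qed
qed simp

section \<open>The principal eigenvalue\<close>

lemma quadratic_nonneg_imp_zero:
  fixes a b :: real
  assumes "!!t. 0 <= 2 * t * a + t^2 * b"
  shows "a = 0"
proof (rule ccontr)
  assume a: "a \<noteq> 0"
  define t where "t = - a / (\<bar>b\<bar> + 1)"
  have "t^2 * b <= t^2 * (\<bar>b\<bar> + 1)" by (intro mult_left_mono) auto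
  also have "\<dots> = a^2 / (\<bar>b\<bar> + 1)" by (simp add: t_def power_divide power2_eq_square)
  finally have "2 * t * a + t^2 * b <= - (a^2 / (\<bar>b\<bar> + 1))" by (simp add: t_def power2_eq_square)
  also have "\<dots> < 0" using a by simp
  finally show False using assms[of t] by simp
qed

lemma L2f_norm_add_expand:
  fixes g k :: "'n::euclidean_space => 'b::euclidean_space"
  assumes "L2f g" "L2f k"
  shows "(LI x. (norm (g x + t *\<^sub>R k x))^2) =
    (LI x. (norm (g x))^2) + 2 * t * (LI x. g x \<bullet> k x) + t^2 * (LI x. (norm (k x))^2)"
proof -
  have "(norm (g x + t *\<^sub>R k x))^2 = (norm (g x))^2 + 2 * t * (g x \<bullet> k x) + t^2 * (norm (k x))^2" for x
    unfolding power2_norm_eq_inner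
    by (simp add: inner_add_left inner_add_right inner_commute power2_eq_square algebra_simps)
  then show ?thesis using assms L2f_inner(1)[OF assms] by (simp add: L2f_def)
qed

lemma weighted_add_expand:
  fixes w u v :: "'n::euclidean_space => real"
  assumes "L1f (%x. w x * u x * u x)" "L1f (%x. w x * u x * v x)" "L1f (%x. w x * v x * v x)"
  shows "(LI x. w x * (u x + t * v x)^2) =
    (LI x. w x * (u x)^2) + 2 * t * (LI x. w x * u x * v x) + t^2 * (LI x. w x * (v x)^2)"
proof -
  have "(LI x. w x * (u x + t * v x)^2) = (LI x. w x * u x * u x + 2 * t * (w x * u x * v x) + t^2 * (w x * v x * v x))"
    by (rule Bochner_Integration.integral_cong) (auto simp: power2_eq_square algebra_simps)
  also have "\<dots> = (LI x. w x * u x * u x) + 2 * t * (LI x. w x * u x * v x) + t^2 * (LI x. w x * v x * v x)"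
    using assms by simp
  finally show ?thesis by (simp add: power2_eq_square mult.assoc)
qed

lemma H1lim_add_test:
  assumes u: "H1lim \<omega> \<phi> u g" and t: "test_fun UNIV \<psi>"
  shows "H1lim \<omega> (%n x. \<phi> n x + \<psi> x) (%x. u x + \<psi> x) (%x. g x + cgrad \<psi> x)"
proof -
  note f = H1lim_facts[OF u]
  have gr: "cgrad (%x. \<phi> n x + \<psi> x) = (%x. cgrad (\<phi> n) x + cgrad \<psi> x)" for n
    by (rule ext) (rule cgrad_add[OF test_smooth[OF f(2)] test_smooth[OF t]])
  have 1: "L2c (%n x. cgrad (\<phi> n) x + cgrad \<psi> x) (%x. g x + cgrad \<psi> x)" by (rule L2c_add_const[OF f(8) test_L2f(2)[OF t]])
  have "L2c (%n x. sqrt (\<omega> x) * \<phi> n x + sqrt (\<omega> x) * \<psi> x) (%x. sqrt (\<omega> x) * u x + sqrt (\<omega> x) * \<psi> x)"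
    by (rule L2c_add_const[OF _ weight_L2f[OF f(1) t]]) (use u in \<open>simp add: H1lim_def\<close>)
  then have 2: "L2c (%n x. sqrt (\<omega> x) * (\<phi> n x + \<psi> x)) (%x. sqrt (\<omega> x) * (u x + \<psi> x))" by (simp add: distrib_left)
  have 3: "AE x in lebesgue. (%n. \<phi> n x + \<psi> x) ----> u x + \<psi> x" "AE x in lebesgue. (%n. cgrad (\<phi> n) x + cgrad \<psi> x) ----> g x + cgrad \<psi> x"
    using u by (auto simp: H1lim_def intro!: tendsto_add)
  show ?thesis
    unfolding H1lim_def gr using f(1) 1 2 3 test_add[OF f(2) t] f(3) test_meas(1)[OF t] by simp
qed

text \<open>Permits changing the limit on a null set, in order to make it nonnegative, positive, or
  zero outside of a set at every point.\<close>

lemma H1lim_cong: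
  assumes H: "H1lim \<omega> \<phi> u g" and e: "AE x in lebesgue. u x = u' x" "AE x in lebesgue. g x = g' x"
    and m: "u' \<in> Lmeas" "g' \<in> Lmeas"
  shows "H1lim \<omega> \<phi> u' g'"
proof -
  have cong: "L2c F f'" if F: "L2c F f" and ff: "AE x in lebesgue. f x = f' x" and m: "f' \<in> Lmeas"
    for F and f f' :: "'a => 'b::euclidean_space"
  proof -
    have [measurable]: "f \<in> Lmeas" "F n \<in> Lmeas" for n using F by (auto simp: L2c_def L2f_def)
    note m [measurable]
    have "AE x in lebesgue. (norm (f x))^2 = (norm (f' x))^2" using ff by eventually_elim simp
    then have "L1f (%x. (norm (f x))^2) \<longleftrightarrow> L1f (%x. (norm (f' x))^2)"
      by (intro integrable_cong_AE) measurable
    then have "L1f (%x. (norm (f' x))^2)" using F by (simp add: L2c_def L2f_def)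
    moreover have "(LI x. (norm (F n x - f' x))^2) = (LI x. (norm (F n x - f x))^2)" for n
      by (rule integral_cong_AE) (use ff in auto)
    ultimately show ?thesis using F m by (simp add: L2c_def L2f_def)
  qed
  have [measurable]: "\<omega> \<in> Lmeas" using H by (auto simp: H1lim_def weight_def)
  note m(1) [measurable]
  have 1: "L2c (%n. cgrad (\<phi> n)) g'" by (rule cong[OF _ e(2) m(2)]) (use H in \<open>simp add: H1lim_def\<close>)
  have 2: "L2c (%n x. sqrt (\<omega> x) * \<phi> n x) (%x. sqrt (\<omega> x) * u' x)"
  proof (rule cong)
    show "L2c (%n x. sqrt (\<omega> x) * \<phi> n x) (%x. sqrt (\<omega> x) * u x)" using H by (simp add: H1lim_def)
  qed (use e(1) in auto)
  have 3: "AE x in lebesgue. (%n. \<phi> n x) ----> u' x" "AE x in lebesgue. (%n. cgrad (\<phi> n) x) ----> g' x"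
  proof -
    have "AE x in lebesgue. (%n. \<phi> n x) ----> u x" "AE x in lebesgue. (%n. cgrad (\<phi> n) x) ----> g x" using H by (auto simp: H1lim_def)
    then show "AE x in lebesgue. (%n. \<phi> n x) ----> u' x" "AE x in lebesgue. (%n. cgrad (\<phi> n) x) ----> g' x"
      using e by (eventually_elim, simp)+
  qed
  show ?thesis using H m 1 2 3 by (simp add: H1lim_def)
qed

lemma L2c_unique:
  fixes f f' :: "'n::euclidean_space => 'b::euclidean_space"
  assumes "L2c F f" "L2c F f'"
  shows "AE x in lebesgue. f x = f' x"
proof -
  have l: "L2f (F n)" "L2f f" "L2f f'" for n using assms by (auto simp: L2c_def)
  have i: "L1f (%x. (norm (f x - f' x))^2)" using L2f_diff[OF l(2,3)] by (simp add: L2f_def)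
  have le: "(LI x. (norm (f x - f' x))^2) <= 2 * (LI x. (norm (F n x - f x))^2) + 2 * (LI x. (norm (F n x - f' x))^2)" for n
  proof -
    have j: "L1f (%x. (norm (F n x - f x))^2)" "L1f (%x. (norm (F n x - f' x))^2)"
      using L2f_diff[OF l(1,2)] L2f_diff[OF l(1,3)] by (auto simp: L2f_def)
    have "(LI x. (norm (f x - f' x))^2) <= (LI x. 2 * (norm (F n x - f x))^2 + 2 * (norm (F n x - f' x))^2)"
    proof (rule integral_mono[OF i])
      fix x show "(norm (f x - f' x))^2 <= 2 * (norm (F n x - f x))^2 + 2 * (norm (F n x - f' x))^2"
        using norm_add_sq_le[of "f x - F n x" "F n x - f' x"] by (simp add: norm_minus_commute)
    qed (use j in auto)
    then show ?thesis using j by simp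
  qed
  have "(%n. 2 * (LI x. (norm (F n x - f x))^2) + 2 * (LI x. (norm (F n x - f' x))^2)) ----> 2 * 0 + 2 * 0"
    by (intro tendsto_intros) (use assms in \<open>auto simp: L2c_def\<close>)
  then have "(LI x. (norm (f x - f' x))^2) <= 0"
    using le by (intro LIMSEQ_le_const[of _ "0::real"]) auto
  then have "AE x in lebesgue. (norm (f x - f' x))^2 = 0"
    using integral_nonneg_eq_0_iff_AE[OF i] by (simp add: order_antisym)
  then show ?thesis by eventually_elim simp
qed

lemma gnorm2_parallelogram:
  assumes "test_fun U \<phi>" "test_fun U \<psi>"
  shows "gnorm2 (%x. \<phi> x + \<psi> x) + gnorm2 (%x. \<phi> x - \<psi> x) = 2 * gnorm2 \<phi> + 2 * gnorm2 \<psi>"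
  using L2f_norm_add_expand[OF test_L2f(2)[OF assms(1)] test_L2f(2)[OF assms(2)], of 1]
    L2f_norm_add_expand[OF test_L2f(2)[OF assms(1)] test_L2f(2)[OF assms(2)], of "-1"]
  by (simp add: gnorm2_def cgrad_add cgrad_diff test_smooth[OF assms(1)] test_smooth[OF assms(2)])

lemma gnorm2_scale: "test_fun U \<phi> ==> gnorm2 (%x. c * \<phi> x) = c^2 * gnorm2 \<phi>"
  by (simp add: gnorm2_def cgrad_scale test_smooth power_mult_distrib)

lemma weighted_test_integrable:
  assumes "weight \<omega>" "test_fun UNIV \<phi>" "test_fun UNIV \<psi>" "w \<in> Lmeas" "!!x. \<bar>w x\<bar> <= C * \<omega> x"
  shows "L1f (%x. w x * \<phi> x * \<psi> x)" "L1f (%x. w x * (\<phi> x)^2)"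
proof -
  show "L1f (%x. w x * \<phi> x * \<psi> x)"
    by (rule H1lim_weighted(2)[OF H1lim_test[OF assms(1,2)] H1lim_test[OF assms(1,3)] assms(4,5)])
  have "L1f (%x. w x * \<phi> x * \<phi> x)"
    by (rule H1lim_weighted(2)[OF H1lim_test[OF assms(1,2)] H1lim_test[OF assms(1,2)] assms(4,5)])
  then show "L1f (%x. w x * (\<phi> x)^2)" by (simp add: power2_eq_square mult.assoc)
qed

lemma weighted_parallelogram:
  assumes "weight \<omega>" "test_fun UNIV \<phi>" "test_fun UNIV \<psi>" "w \<in> Lmeas" "!!x. \<bar>w x\<bar> <= C * \<omega> x"
  shows "(LI x. w x * (\<phi> x + \<psi> x)^2) + (LI x. w x * (\<phi> x - \<psi> x)^2) =
    2 * (LI x. w x * (\<phi> x)^2) + 2 * (LI x. w x * (\<psi> x)^2)"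
proof -
  note i = weighted_test_integrable(1)[OF assms(1) _ _ assms(4,5)]
  show ?thesis
    using weighted_add_expand[OF i[OF assms(2,2)] i[OF assms(2,3)] i[OF assms(3,3)], of 1]
      weighted_add_expand[OF i[OF assms(2,2)] i[OF assms(2,3)] i[OF assms(3,3)], of "-1"] by simp
qed

lemma weight_Lhalf:
  fixes f V :: "'n::euclidean_space => real"
  assumes N: "DIM('n) >= 3" and f: "Lhalf f" and V: "continuous_on UNIV V" "!!x. 0 <= V x"
  shows "weight (%x. 1 + V x + \<bar>f x\<bar>)"
  unfolding weight_def
proof (intro conjI allI impI)
  have [measurable]: "f \<in> Lmeas" using f by (simp add: Lhalf_def)
  have [measurable]: "V \<in> Lmeas" by (rule continuous_measurable_lebesgue[OF V(1)])
  show "(%x. 1 + V x + \<bar>f x\<bar>) \<in> Lmeas" by measurable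
  show "1 <= 1 + V x + \<bar>f x\<bar>" for x using V(2)[of x] by simp
  fix \<phi> :: "'n => real" assume t: "test_fun UNIV \<phi>"
  obtain K where K: "compact K" "!!x. x \<notin> K ==> \<phi> x = 0" using test_fun_supp[OF t] by blast
  have "L1f (%x. (1 + V x) * (\<phi> x)^2)"
    by (rule integrable_continuous_compact(2)[OF _ K(1)]) (use K(2) in \<open>auto intro!: continuous_intros V(1) test_continuous[OF t]\<close>)
  moreover have "L1f (%x. \<bar>f x\<bar> * (\<phi> x)^2)" using holder_sobolev_Lhalf[OF N] f t by blast
  ultimately have "L1f (%x. (1 + V x) * (\<phi> x)^2 + \<bar>f x\<bar> * (\<phi> x)^2)" by simp
  then show "L1f (%x. (1 + V x + \<bar>f x\<bar>) * (\<phi> x)^2)" by (simp add: distrib_right)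
qed

lemma abs_sqrt_sub_le: "\<epsilon> >= 0 ==> 0 <= sqrt (s^2 + \<epsilon>^2) - \<epsilon> \<and> sqrt (s^2 + \<epsilon>^2) - \<epsilon> <= \<bar>s\<bar>" for s \<epsilon> :: real
  using sqrt_add_le_add_sqrt[of "s^2" "\<epsilon>^2"] real_sqrt_le_mono[of "\<epsilon>^2" "s^2 + \<epsilon>^2"] by simp

text \<open>The chain rule factor \<phi> / sqrt(\<phi>^2 + \<epsilon>^2) has modulus at most
  one.\<close>

lemma gnorm2_test_sqrt_le:
  assumes t: "test_fun U \<phi>" and e: "\<epsilon> > 0"
  shows "gnorm2 (%x. sqrt ((\<phi> x)^2 + \<epsilon>^2) - \<epsilon>) <= gnorm2 \<phi>"
  unfolding gnorm2_def
proof (rule integral_mono)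
  show "L1f (%x. (norm (cgrad (%x. sqrt ((\<phi> x)^2 + \<epsilon>^2) - \<epsilon>) x))^2)"
    using test_L2f(2)[OF test_sqrt(1)[OF t e]] by (simp add: L2f_def)
  show "L1f (%x. (norm (cgrad \<phi> x))^2)" using test_L2f(2)[OF t] by (simp add: L2f_def)
  fix x
  have "\<bar>\<phi> x\<bar> <= sqrt ((\<phi> x)^2 + \<epsilon>^2)" by (rule real_le_rsqrt) simp
  moreover have "sqrt ((\<phi> x)^2 + \<epsilon>^2) > 0" using e by (simp add: add_nonneg_pos)
  ultimately have "\<bar>\<phi> x / sqrt ((\<phi> x)^2 + \<epsilon>^2)\<bar> <= 1" by (simp only: abs_divide abs_of_pos divide_le_eq_1_pos)
  then have "norm (cgrad (%x. sqrt ((\<phi> x)^2 + \<epsilon>^2) - \<epsilon>) x) <= 1 * norm (cgrad \<phi> x)"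
    unfolding test_sqrt(2)[OF t e] norm_scaleR by (intro mult_right_mono) auto
  then show "(norm (cgrad (%x. sqrt ((\<phi> x)^2 + \<epsilon>^2) - \<epsilon>) x))^2 <= (norm (cgrad \<phi> x))^2" by (intro power_mono) auto
qed

text \<open>The smooth functions \<open>sqrt (\<phi>\<^sup>2 + \<epsilon>\<^sup>2) - \<epsilon>\<close> are nonnegative substitutes for \<open>\<bar>\<phi>\<bar>\<close>.\<close>
lemma tendsto_test_sqrt_integral:
  fixes H :: "'n::euclidean_space => real => real"
  assumes t: "test_fun U \<phi>"
    and H: "!!x. continuous_on UNIV (H x)" "!!x s. 0 <= s ==> s <= \<bar>\<phi> x\<bar> ==> \<bar>H x s\<bar> <= b x" "L1f b"
    and m: "!!\<psi>. \<psi> \<in> Lmeas ==> (%x. H x (\<psi> x)) \<in> Lmeas"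
  shows "(%k. LI x. H x (sqrt ((\<phi> x)^2 + (1 / real (Suc k))^2) - 1 / real (Suc k))) ----> (LI x. H x \<bar>\<phi> x\<bar>)"
proof (rule integral_dominated_convergence[OF _ _ H(3)])
  note [measurable] = test_meas(1)[OF t]
  show "(%x. H x \<bar>\<phi> x\<bar>) \<in> Lmeas" by (rule m) measurable
  show "(%x. H x (sqrt ((\<phi> x)^2 + (1 / real (Suc k))^2) - 1 / real (Suc k))) \<in> Lmeas" for k by (rule m) measurable
  show "AE x in lebesgue. norm (H x (sqrt ((\<phi> x)^2 + (1 / real (Suc k))^2) - 1 / real (Suc k))) <= b x" for k
  proof (rule AE_I2)
    fix x
    have "0 <= sqrt ((\<phi> x)^2 + (1 / real (Suc k))^2) - 1 / real (Suc k) \<and> sqrt ((\<phi> x)^2 + (1 / real (Suc k))^2) - 1 / real (Suc k) <= \<bar>\<phi> x\<bar>"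
      by (rule abs_sqrt_sub_le) simp
    then show "norm (H x (sqrt ((\<phi> x)^2 + (1 / real (Suc k))^2) - 1 / real (Suc k))) <= b x" using H(2) by simp
  qed
  show "AE x in lebesgue. (%k. H x (sqrt ((\<phi> x)^2 + (1 / real (Suc k))^2) - 1 / real (Suc k))) ----> H x \<bar>\<phi> x\<bar>"
  proof (rule AE_I2)
    fix x
    have "(%k. 1 / real (Suc k)) ----> 0" using LIMSEQ_inverse_real_of_nat by (simp add: inverse_eq_divide)
    then have "(%k. sqrt ((\<phi> x)^2 + (1 / real (Suc k))^2) - 1 / real (Suc k)) ----> sqrt ((\<phi> x)^2 + 0^2) - 0"
      by (intro tendsto_intros)
    then have "(%k. sqrt ((\<phi> x)^2 + (1 / real (Suc k))^2) - 1 / real (Suc k)) ----> \<bar>\<phi> x\<bar>" by simp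
    then show "(%k. H x (sqrt ((\<phi> x)^2 + (1 / real (Suc k))^2) - 1 / real (Suc k))) ----> H x \<bar>\<phi> x\<bar>"
      using continuous_on_tendsto_compose[OF H(1)] by auto
  qed
qed

section \<open>Variational characterization of the principal eigenvalue\<close>

locale principal =
  fixes \<Omega> :: "'n::euclidean_space set" and f :: "'n => real"
  assumes N: "DIM('n) >= 3" and op: "open \<Omega>" and con: "connected \<Omega>" and ne: "\<Omega> \<noteq> {}" and bd: "bounded \<Omega>"
    and f: "Lhalf f" and pos: "emeasure lebesgue {x\<in>\<Omega>. f x > 0} > 0"
begin

text \<open>The summand 0 stands for a vanishing potential V, which puts the weight into the shape
  of \<open>weight_Lhalf\<close>.\<close>

definition \<omega>1 :: "'n => real" where "\<omega>1 x = 1 + 0 + \<bar>f x\<bar>"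

lemma \<omega>1: "weight \<omega>1"
  unfolding \<omega>1_def[abs_def] by (rule weight_Lhalf[OF N f]) auto

lemma fm [measurable]: "f \<in> Lmeas" using f by (simp add: Lhalf_def)

lemma f\<omega>: "\<bar>f x\<bar> <= 1 * \<omega>1 x" by (simp add: \<omega>1_def)

lemma fin\<Omega>: "emeasure lebesgue \<Omega> < \<infinity>" "\<Omega> \<in> sets lebesgue"
  using emeasure_bounded_finite[OF bd] op by auto

lemma L\<Omega>: "Lhalf (indicator \<Omega> :: 'n => real)"
  by (rule Lhalf_indicator[OF fin\<Omega>(2,1)])

definition ff :: "('n => real) => real" where "ff \<phi> = (LI x. f x * (\<phi> x)^2)"

definition l1 :: real where "l1 = Inf (gnorm2 ` {\<phi>. test_fun \<Omega> \<phi> \<and> ff \<phi> = 1})"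

lemma testU: "test_fun \<Omega> \<phi> ==> test_fun UNIV \<phi>"
  using test_fun_mono by blast

lemma ff_scale: "ff (%x. c * \<phi> x) = c^2 * ff \<phi>"
proof -
  have "ff (%x. c * \<phi> x) = (LI x. c^2 * (f x * (\<phi> x)^2))"
    unfolding ff_def by (rule Bochner_Integration.integral_cong) (auto simp: power_mult_distrib)
  then show ?thesis by (simp add: ff_def)
qed

text \<open>On a set of finite measure L^(N/2) lies in L^1, by |f| <= 1 + |f|^(N/2).\<close>

lemma f_loc: "L1f (%x. indicator \<Omega> x * f x)"
proof (rule Bochner_Integration.integrable_bound)
  show "L1f (%x. indicator \<Omega> x + \<bar>f x\<bar> powr (real DIM('n) / 2))"
    using f fin\<Omega> by (intro Bochner_Integration.integrable_add integrable_real_indicator) (auto simp: Lhalf_def)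
  show "(%x. indicator \<Omega> x * f x) \<in> Lmeas"
    by (intro borel_measurable_times borel_measurable_indicator fin\<Omega> fm)
  show "AE x in lebesgue. norm (indicator \<Omega> x * f x) <= norm (indicator \<Omega> x + \<bar>f x\<bar> powr (real DIM('n) / 2))"
  proof (rule AE_I2)
    fix x
    have "\<bar>f x\<bar> <= 1 + \<bar>f x\<bar> powr (real DIM('n) / 2)"
    proof (cases "\<bar>f x\<bar> <= 1")
      case False
      then have "\<bar>f x\<bar> powr 1 <= \<bar>f x\<bar> powr (real DIM('n) / 2)" using N by (intro powr_mono) auto
      then show ?thesis by simp
    qed (simp add: add_increasing2)
    then show "norm (indicator \<Omega> x * f x) <= norm (indicator \<Omega> x + \<bar>f x\<bar> powr (real DIM('n) / 2))"
      by (auto simp: indicator_def)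
  qed
qed

lemma ex_normalized: "\<exists>\<phi>. test_fun \<Omega> \<phi> \<and> ff \<phi> = 1"
proof -
  obtain \<phi> where p: "test_fun \<Omega> \<phi>" "!!x. 0 <= \<phi> x" "(LI x. f x * \<phi> x powr 2) > 0"
    using exists_test_integral_pos[OF op f_loc _ pos, of 2] by auto
  have "ff \<phi> > 0" using p(2,3) by (simp add: ff_def)
  then have "ff (%x. (1 / sqrt (ff \<phi>)) * \<phi> x) = 1" unfolding ff_scale by (simp add: power_divide)
  then show ?thesis using test_scale[OF p(1)] by blast
qed

text \<open>Since \<open>\<Omega>\<close> has finite measure its indicator is an admissible
  potential, so the weighted L^2 norm over \<open>\<Omega>\<close> is controlled by the gradient: a
  Poincare inequality.\<close>

lemma ff_bound: "\<exists>K>0. \<forall>\<phi>. test_fun UNIV \<phi> \<longrightarrow> (LI x. \<omega>1 x * indicator \<Omega> x * (\<phi> x)^2) <= K * gnorm2 \<phi> \<and> \<bar>ff \<phi>\<bar> <= K * gnorm2 \<phi>"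
proof -
  obtain K where K: "K > 0" "\<forall>(h :: 'n => real) \<phi>. Lhalf h \<longrightarrow> test_fun UNIV \<phi> \<longrightarrow>
      L1f (%x. \<bar>h x\<bar> * (\<phi> x)^2) \<and>
      (LI x. \<bar>h x\<bar> * (\<phi> x)^2) \<le>
        K * (LI x. \<bar>h x\<bar> powr (real DIM('n) / 2)) powr (2 / real DIM('n)) * gnorm2 \<phi>"
    using holder_sobolev_Lhalf[OF N] by blast
  define A where "A h = K * (LI x. \<bar>h x\<bar> powr (real DIM('n) / 2)) powr (2 / real DIM('n))" for h :: "'n => real"
  have A0: "A h >= 0" for h using K(1) by (simp add: A_def)
  have "(LI x. \<omega>1 x * indicator \<Omega> x * (\<phi> x)^2) <= (A f + A (indicator \<Omega>) + 1) * gnorm2 \<phi> \<and> \<bar>ff \<phi>\<bar> <= (A f + A (indicator \<Omega>) + 1) * gnorm2 \<phi>"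
    if t: "test_fun UNIV \<phi>" for \<phi>
  proof -
    have 1: "L1f (%x. \<bar>f x\<bar> * (\<phi> x)^2)" "(LI x. \<bar>f x\<bar> * (\<phi> x)^2) <= A f * gnorm2 \<phi>"
      using K(2) f t by (auto simp: A_def)
    have 2: "L1f (%x. indicator \<Omega> x * (\<phi> x)^2)" "(LI x. indicator \<Omega> x * (\<phi> x)^2) <= A (indicator \<Omega>) * gnorm2 \<phi>"
      using K(2)[rule_format, OF L\<Omega> t] by (auto simp: A_def)
    have "(LI x. \<omega>1 x * indicator \<Omega> x * (\<phi> x)^2) <= (LI x. indicator \<Omega> x * (\<phi> x)^2 + \<bar>f x\<bar> * (\<phi> x)^2)"
    proof (rule integral_mono')
      show "L1f (%x. indicator \<Omega> x * (\<phi> x)^2 + \<bar>f x\<bar> * (\<phi> x)^2)" using 1(1) 2(1) by simp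
    qed (auto simp: \<omega>1_def indicator_def distrib_right)
    also have "\<dots> = (LI x. indicator \<Omega> x * (\<phi> x)^2) + (LI x. \<bar>f x\<bar> * (\<phi> x)^2)"
      by (rule Bochner_Integration.integral_add[OF 2(1) 1(1)])
    also have "\<dots> <= (A f + A (indicator \<Omega>) + 1) * gnorm2 \<phi>"
      using 1 2 gnorm2_nonneg[of \<phi>] by (simp add: algebra_simps)
    finally have 3: "(LI x. \<omega>1 x * indicator \<Omega> x * (\<phi> x)^2) <= (A f + A (indicator \<Omega>) + 1) * gnorm2 \<phi>" .
    have "\<bar>ff \<phi>\<bar> <= (LI x. \<bar>f x * (\<phi> x)^2\<bar>)" unfolding ff_def by (rule integral_abs_bound)
    also have "\<dots> <= A f * gnorm2 \<phi>" using 1(2) by (simp add: abs_mult)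
    also have "\<dots> <= (A f + A (indicator \<Omega>) + 1) * gnorm2 \<phi>"
      using A0 gnorm2_nonneg by (intro mult_right_mono) (auto simp: add_increasing2)
    finally show ?thesis using 3 by blast
  qed
  then show ?thesis using A0[of f] A0[of "indicator \<Omega>"] by (intro exI[of _ "A f + A (indicator \<Omega>) + 1"]) auto
qed

lemma l1_pos: "l1 > 0"
proof -
  obtain K where K: "K > 0" "!!\<phi>. test_fun UNIV \<phi> ==> \<bar>ff \<phi>\<bar> <= K * gnorm2 \<phi>" using ff_bound by blast
  have "1 / K <= l1" unfolding l1_def
  proof (rule cINF_greatest)
    show "{\<phi>. test_fun \<Omega> \<phi> \<and> ff \<phi> = 1} \<noteq> {}" using ex_normalized by blast
    fix \<phi> assume "\<phi> \<in> {\<phi>. test_fun \<Omega> \<phi> \<and> ff \<phi> = 1}"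
    then have "1 <= K * gnorm2 \<phi>" using K(2)[OF testU, of \<phi>] by simp
    then show "1 / K <= gnorm2 \<phi>" using K(1) by (simp add: field_simps)
  qed
  then show ?thesis using K(1) by (meson less_le_trans zero_less_divide_1_iff)
qed

text \<open>Homogeneity if \<open>ff \<phi>\<close> is positive; otherwise the left side is
  nonpositive because \<open>l1\<close> is positive.\<close>

lemma rayleigh: "test_fun \<Omega> \<phi> ==> l1 * ff \<phi> <= gnorm2 \<phi>"
proof (cases "ff \<phi> > 0")
  case True
  assume t: "test_fun \<Omega> \<phi>"
  define c where "c = 1 / sqrt (ff \<phi>)"
  have c2: "c^2 = 1 / ff \<phi>" using True by (simp add: c_def power_divide)
  have "ff (%x. c * \<phi> x) = 1" unfolding ff_scale c2 using True by simp
  then have "l1 <= gnorm2 (%x. c * \<phi> x)" unfolding l1_def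
    by (intro cINF_lower bdd_belowI2[of _ 0]) (auto simp: gnorm2_nonneg test_scale[OF t])
  also have "\<dots> = gnorm2 \<phi> / ff \<phi>" by (simp add: gnorm2_scale[OF t] c2)
  finally show ?thesis using True by (simp add: field_simps)
next
  case False
  then have "l1 * ff \<phi> <= 0" using l1_pos by (simp add: mult_nonneg_nonpos)
  then show "l1 * ff \<phi> <= gnorm2 \<phi>" using gnorm2_nonneg[of \<phi>] by linarith
qed

lemma ff_parallelogram:
  assumes "test_fun UNIV \<phi>" "test_fun UNIV \<psi>"
  shows "ff (%x. \<phi> x + \<psi> x) + ff (%x. \<phi> x - \<psi> x) = 2 * ff \<phi> + 2 * ff \<psi>"
  unfolding ff_def by (rule weighted_parallelogram[OF \<omega>1 assms fm f\<omega>])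

text \<open>Smoothed absolute values do not raise the Dirichlet integral but perturb the
  normalization, which is therefore only reached in the limit.\<close>

lemma minimizing_sequence:
  "\<exists>\<zeta>. (\<forall>n. test_fun \<Omega> (\<zeta> n)) \<and> (\<forall>n x. 0 <= \<zeta> n x) \<and> (%n. ff (\<zeta> n)) ----> 1 \<and> (\<forall>n. gnorm2 (\<zeta> n) <= l1 + 1 / real (Suc n))"
proof -
  have "\<exists>\<zeta>. test_fun \<Omega> \<zeta> \<and> (\<forall>x. 0 <= \<zeta> x) \<and> \<bar>ff \<zeta> - 1\<bar> < 1 / real (Suc n) \<and> gnorm2 \<zeta> <= l1 + 1 / real (Suc n)" for n
  proof -
    have "l1 < l1 + 1 / real (Suc n)" by simp
    then have "\<exists>y\<in>gnorm2 ` {\<phi>. test_fun \<Omega> \<phi> \<and> ff \<phi> = 1}. y < l1 + 1 / real (Suc n)"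
      unfolding l1_def using ex_normalized by (intro cInf_lessD) auto
    then obtain \<phi> where p: "test_fun \<Omega> \<phi>" "ff \<phi> = 1" "gnorm2 \<phi> < l1 + 1 / real (Suc n)" by auto
    define \<zeta> where "\<zeta> k x = sqrt ((\<phi> x)^2 + (1 / real (Suc k))^2) - 1 / real (Suc k)" for k x
    have i: "L1f (%x. \<bar>f x * (\<phi> x)^2\<bar>)"
      using weighted_test_integrable(2)[OF \<omega>1 testU[OF p(1)] testU[OF p(1)] fm f\<omega>] by (rule integrable_abs)
    have "(%k. LI x. f x * (\<zeta> k x)^2) ----> (LI x. f x * \<bar>\<phi> x\<bar>\<^sup>2)"
      unfolding \<zeta>_def
    proof (rule tendsto_test_sqrt_integral[OF p(1), where H = "%x s. f x * s^2", OF _ _ i])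
      show "\<bar>f x * s^2\<bar> <= \<bar>f x * (\<phi> x)^2\<bar>" if "0 <= s" "s <= \<bar>\<phi> x\<bar>" for x s
        using power_mono[OF that(2,1), of 2] by (simp add: abs_mult mult_left_mono)
      show "(%x. f x * (\<psi> x)^2) \<in> Lmeas" if [measurable]: "\<psi> \<in> Lmeas" for \<psi> by measurable
    qed (auto intro!: continuous_intros)
    then have "(%k. ff (\<zeta> k)) ----> 1" using p(2) by (simp add: ff_def)
    then obtain k where k: "\<bar>ff (\<zeta> k) - 1\<bar> < 1 / real (Suc n)"
      using LIMSEQ_D[of "%k. ff (\<zeta> k)" 1 "1 / real (Suc n)"] by force
    have "test_fun \<Omega> (\<zeta> k)" unfolding \<zeta>_def by (rule test_sqrt(1)[OF p(1)]) simp
    moreover have "0 <= \<zeta> k x" for x unfolding \<zeta>_def using abs_sqrt_sub_le[of "1 / real (Suc k)" "\<phi> x"] by simp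
    moreover have "gnorm2 (\<zeta> k) <= gnorm2 \<phi>" unfolding \<zeta>_def by (rule gnorm2_test_sqrt_le[OF p(1)]) simp
    ultimately show ?thesis using k p(3) by (intro exI[of _ "\<zeta> k"]) auto
  qed
  then obtain \<zeta> where z: "!!n. test_fun \<Omega> (\<zeta> n)" "!!n x. 0 <= \<zeta> n x" "!!n. \<bar>ff (\<zeta> n) - 1\<bar> < 1 / real (Suc n)" "!!n. gnorm2 (\<zeta> n) <= l1 + 1 / real (Suc n)"
    by metis
  have "(%n. 1 / real (Suc n)) ----> 0" using LIMSEQ_inverse_real_of_nat by (simp add: inverse_eq_divide)
  then have "(%n. ff (\<zeta> n) - 1) ----> 0"
    by (rule Lim_null_comparison[rotated]) (auto intro!: always_eventually less_imp_le z(3) simp del: of_nat_Suc)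
  then have "(%n. ff (\<zeta> n)) ----> 1" by (rule LIM_zero_cancel)
  then show ?thesis using z by blast
qed

text \<open>By the parallelogram identity the minimizing sequence is Cauchy up to terms made small
  by \<open>rellich\<close>. The limit attains the infimum, the vanishing first variation is the
  eigenvalue equation, and the normalization excludes the zero alternative of the strong maximum
  principle.\<close>

lemma first_eigenfunction:
  "\<exists>\<zeta> u g. wsol \<Omega> \<omega>1 \<zeta> u g (%x. l1 * f x * u x) \<and> (LI x. f x * u x * u x) = 1 \<and>
     (LI x. (norm (g x))^2) = l1 \<and> (\<forall>x. x \<notin> \<Omega> \<longrightarrow> u x = 0) \<and> (AE x in lebesgue. x \<in> \<Omega> \<longrightarrow> u x > 0)"
proof -
  obtain \<xi> where z: "!!n. test_fun \<Omega> (\<xi> n)" "!!n x. 0 <= \<xi> n x" "(%n. ff (\<xi> n)) ----> 1" "!!n. gnorm2 (\<xi> n) <= l1 + 1 / real (Suc n)"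
    using minimizing_sequence by blast
  note zU = testU[OF z(1)]
  have zM: "gnorm2 (\<xi> n) <= l1 + 1" for n
  proof -
    have "1 / real (Suc n) <= 1" by (simp add: field_simps)
    then show ?thesis using z(4)[of n] by linarith
  qed
  from rellich[where \<phi> = \<xi>, OF N zU zM] obtain r where r': "strict_mono (r :: nat => nat)"
    "\<forall>h e. Lhalf h \<longrightarrow> e > 0 \<longrightarrow> (\<exists>n0. \<forall>m\<ge>n0. \<forall>n\<ge>n0. (LI x. \<bar>h x\<bar> * (\<xi> (r m) x - \<xi> (r n) x)^2) < e)"
    by (elim exE conjE) (rule that)
  note r = r'(1) r'(2)[rule_format]
  define \<phi> where "\<phi> n = \<xi> (r n)" for n
  have p: "!!n. test_fun \<Omega> (\<phi> n)" "!!n x. 0 <= \<phi> n x" "(%n. ff (\<phi> n)) ----> 1" "!!n. test_fun UNIV (\<phi> n)"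
    using z(1,2) zU LIMSEQ_subseq_LIMSEQ[OF z(3) r(1)] by (auto simp: \<phi>_def o_def)
  have pg: "gnorm2 (\<phi> n) <= l1 + 1 / real (Suc n)" for n
  proof -
    have "1 / real (Suc (r n)) <= 1 / real (Suc n)" using seq_suble[OF r(1), of n] by (intro divide_left_mono) auto
    then show ?thesis using z(4)[of "r n"] by (simp add: \<phi>_def)
  qed
  have cauchy: "\<exists>n0. \<forall>m\<ge>n0. \<forall>n\<ge>n0. gnorm2 (%x. \<phi> m x - \<phi> n x) + (LI x. \<omega>1 x * (\<phi> m x - \<phi> n x)^2) < e" if e: "e > 0" for e
  proof -
    \<comment> \<open>The final bound is 6 e' + 5 l1 e', which is at most 8 (l1 + 1) e' = e.\<close>
    define e' where "e' = e / (8 * (l1 + 1))"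
    have e': "e' > 0" "l1 * e' < e / 8" "e' <= e / 8" using e l1_pos by (auto simp: e'_def field_simps)
    obtain n1 where n1: "!!m n. m >= n1 ==> n >= n1 ==> (LI x. \<bar>f x\<bar> * (\<phi> m x - \<phi> n x)^2) < e'"
      using r(2)[OF f e'(1)] unfolding \<phi>_def by blast
    obtain n2 where n2: "!!m n. m >= n2 ==> n >= n2 ==> (LI x. \<bar>indicator \<Omega> x\<bar> * (\<phi> m x - \<phi> n x)^2) < e'"
      using r(2)[OF L\<Omega> e'(1)] unfolding \<phi>_def by blast
    obtain n3 where n3: "!!n. n >= n3 ==> \<bar>ff (\<phi> n) - 1\<bar> < e'" using LIMSEQ_D[OF p(3) e'(1)] by auto
    obtain n4 :: nat where "1 / e' < real n4" using reals_Archimedean2 by blast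
    then have n4: "1 / real (Suc n) < e'" if "n >= n4" for n
    proof -
      have "1 / e' < real (Suc n)" using \<open>1 / e' < real n4\<close> that by linarith
      then show ?thesis using e'(1) by (simp add: field_simps)
    qed
    show ?thesis
    proof (intro exI[of _ "max (max n1 n2) (max n3 n4)"] allI impI)
      fix m n assume "m >= max (max n1 n2) (max n3 n4)" "n >= max (max n1 n2) (max n3 n4)"
      then have mn: "m >= n1" "n >= n1" "m >= n2" "n >= n2" "m >= n3" "n >= n3" "m >= n4" "n >= n4" by auto
      define d where "d x = \<phi> m x - \<phi> n x" for x
      have dt: "test_fun \<Omega> d" unfolding d_def by (rule test_diff[OF p(1,1)])
      have fd: "\<bar>ff d\<bar> <= e'"
      proof -
        have "\<bar>ff d\<bar> <= (LI x. \<bar>f x * (d x)^2\<bar>)" unfolding ff_def by (rule integral_abs_bound)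
        then show ?thesis using n1[OF mn(1,2)] by (simp add: abs_mult d_def)
      qed
      have fs: "ff (%x. \<phi> m x + \<phi> n x) = 2 * ff (\<phi> m) + 2 * ff (\<phi> n) - ff d"
        using ff_parallelogram[OF p(4,4), of m n] unfolding d_def by simp
      \<comment> \<open>The Rayleigh inequality for the sum, inserted into the parallelogram
        identity, leaves only the excess over the infimum and the compact term
        \<open>ff d\<close>.\<close>
      have "l1 * (2 * ff (\<phi> m) + 2 * ff (\<phi> n) - ff d) <= gnorm2 (%x. \<phi> m x + \<phi> n x)"
        using rayleigh[OF test_add[OF p(1,1)], of m n] unfolding fs .
      then have "gnorm2 d <= 2 * gnorm2 (\<phi> m) + 2 * gnorm2 (\<phi> n) - l1 * (2 * ff (\<phi> m) + 2 * ff (\<phi> n) - ff d)"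
        using gnorm2_parallelogram[OF p(1,1), of m n] unfolding d_def by linarith
      also have "\<dots> <= 2 * (l1 + e') + 2 * (l1 + e') - l1 * (2 * (1 - e') + 2 * (1 - e') - e')"
      proof -
        have "l1 * (2 * (1 - e') + 2 * (1 - e') - e') <= l1 * (2 * ff (\<phi> m) + 2 * ff (\<phi> n) - ff d)"
          using n3[OF mn(5)] n3[OF mn(6)] fd l1_pos by (intro mult_left_mono) auto
        moreover have "2 * gnorm2 (\<phi> m) + 2 * gnorm2 (\<phi> n) <= 2 * (l1 + e') + 2 * (l1 + e')"
          by (intro add_mono mult_left_mono order_trans[OF pg add_left_mono[OF less_imp_le[OF n4[OF mn(7)]]]]
            order_trans[OF pg add_left_mono[OF less_imp_le[OF n4[OF mn(8)]]]]) auto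
        ultimately show ?thesis by (intro diff_mono)
      qed
      also have "\<dots> = 4 * e' + 5 * (l1 * e')" by (simp add: algebra_simps)
      finally have g: "gnorm2 d <= 4 * e' + 5 * (l1 * e')" .
      have i1: "L1f (%x. \<bar>f x\<bar> * (d x)^2)" and i2: "L1f (%x. indicator \<Omega> x * (d x)^2)"
        using holder_sobolev_Lhalf[OF N] f testU[OF dt] L\<Omega> by (blast, force)
      obtain Kd where Kd: "Kd \<subseteq> \<Omega>" "!!x. x \<notin> Kd ==> d x = 0" using test_fun_supp[OF dt] by blast
      have "(LI x. \<omega>1 x * (d x)^2) = (LI x. indicator \<Omega> x * (d x)^2 + \<bar>f x\<bar> * (d x)^2)"
        by (rule Bochner_Integration.integral_cong) (use Kd in \<open>auto simp: \<omega>1_def indicator_def distrib_right\<close>)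
      also have "\<dots> = (LI x. indicator \<Omega> x * (d x)^2) + (LI x. \<bar>f x\<bar> * (d x)^2)"
        by (rule Bochner_Integration.integral_add[OF i2 i1])
      also have "\<dots> < 2 * e'" using n1[OF mn(1,2)] n2[OF mn(3,4)] by (simp add: d_def)
      finally have "gnorm2 d + (LI x. \<omega>1 x * (d x)^2) < 6 * e' + 5 * (l1 * e')" using g by simp
      also have "\<dots> <= 6 * e' + 5 * (l1 * e') + 2 * e' + 3 * (l1 * e')" using e' l1_pos by simp
      also have "\<dots> = 8 * (l1 + 1) * e'" by (simp add: algebra_simps)
      also have "\<dots> = e" using l1_pos by (simp add: e'_def)
      finally show "gnorm2 (%x. \<phi> m x - \<phi> n x) + (LI x. \<omega>1 x * (\<phi> m x - \<phi> n x)^2) < e" unfolding d_def .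
    qed
  qed
  obtain s u0 g where s: "strict_mono (s :: nat => nat)" "H1lim \<omega>1 (%n. \<phi> (s n)) u0 g"
    using H1lim_exists[OF \<omega>1 p(4) cauchy] by blast
  define \<zeta> where "\<zeta> n = \<phi> (s n)" for n
  \<comment> \<open>A representative that is nonnegative and zero outside of \<open>\<Omega>\<close>
    at every point.\<close>
  define u where "u x = indicator \<Omega> x * \<bar>u0 x\<bar>" for x
  have zt: "test_fun \<Omega> (\<zeta> n)" "0 <= \<zeta> n x" for n x using p(1,2) by (auto simp: \<zeta>_def)
  have [measurable]: "u0 \<in> Lmeas" by (rule H1lim_facts(3)[OF s(2)])
  have um: "u \<in> Lmeas" unfolding u_def by (intro borel_measurable_times borel_measurable_indicator fin\<Omega>) measurable
  have eqAE: "AE x in lebesgue. u0 x = u x"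
  proof -
    have "AE x in lebesgue. (%n. \<zeta> n x) ----> u0 x" using s(2) by (simp add: H1lim_def \<zeta>_def)
    then show ?thesis
    proof eventually_elim
      fix x assume l: "(%n. \<zeta> n x) ----> u0 x"
      have "0 <= u0 x" using l zt(2) by (intro LIMSEQ_le_const) auto
      moreover have "u0 x = 0" if "x \<notin> \<Omega>"
      proof -
        have "\<zeta> n x = 0" for n
        proof -
          obtain Kz where "Kz \<subseteq> \<Omega>" "!!x. x \<notin> Kz ==> \<zeta> n x = 0" using test_fun_supp[OF zt(1)[of n]] by blast
          then show ?thesis using that by blast
        qed
        then show ?thesis using l by (simp add: LIMSEQ_const_iff)
      qed
      ultimately show "u0 x = u x" by (auto simp: u_def indicator_def)
    qed
  qed
  have H: "H1lim \<omega>1 \<zeta> u g"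
    unfolding \<zeta>_def by (rule H1lim_cong[OF s(2) eqAE _ um]) (auto intro: H1lim_facts(4)[OF s(2)])
  note Hf = H1lim_facts[OF H]
  note fw = H1lim_weighted[OF _ _ fm f\<omega>]
  have fu: "(LI x. f x * u x * u x) = 1"
  proof (rule LIMSEQ_unique)
    show "(%n. ff (\<zeta> n)) ----> (LI x. f x * u x * u x)"
      using fw(1)[OF H H] by (simp add: ff_def power2_eq_square mult.assoc)
    show "(%n. ff (\<zeta> n)) ----> 1" using LIMSEQ_subseq_LIMSEQ[OF p(3) s(1)] by (simp add: \<zeta>_def o_def)
  qed
  have gu: "(LI x. (norm (g x))^2) = l1"
  proof (rule order_antisym)
    have gl: "(%n. gnorm2 (\<zeta> n)) ----> (LI x. (norm (g x))^2)" by (rule H1lim_gnorm2[OF H])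
    have "(%n. 1 / real (Suc n)) ----> 0" using LIMSEQ_inverse_real_of_nat by (simp add: inverse_eq_divide)
    then have "(%n. l1 + 1 / real (Suc n)) ----> l1 + 0" by (intro tendsto_intros)
    moreover have "gnorm2 (\<zeta> n) <= l1 + 1 / real (Suc n)" for n
    proof -
      have "1 / real (Suc (s n)) <= 1 / real (Suc n)" using seq_suble[OF s(1), of n] by (intro divide_left_mono) auto
      then show ?thesis using pg[of "s n"] by (simp add: \<zeta>_def)
    qed
    ultimately show "(LI x. (norm (g x))^2) <= l1" using LIMSEQ_le[OF gl, of "%n. l1 + 1 / real (Suc n)" l1] by auto
    have "(%n. l1 * ff (\<zeta> n)) ----> l1 * 1"
      using LIMSEQ_subseq_LIMSEQ[OF p(3) s(1)] by (intro tendsto_intros) (simp add: \<zeta>_def o_def)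
    then show "l1 <= (LI x. (norm (g x))^2)"
      using LIMSEQ_le[OF _ gl, of "%n. l1 * ff (\<zeta> n)" "l1 * 1"] rayleigh[OF zt(1)] by auto
  qed
  \<comment> \<open>The form \<open>gnorm2 - l1 * ff\<close> is nonnegative along u + t \<psi> and
    zero at t = 0, so its linear coefficient in t vanishes.\<close>
  have eq: "(LI x. g x \<bullet> cgrad \<psi> x) = (LI x. l1 * f x * u x * \<psi> x)" if t: "test_fun \<Omega> \<psi>" for \<psi>
  proof -
    note tU = testU[OF t]
    have Ht: "H1lim \<omega>1 (%_. \<psi>) \<psi> (cgrad \<psi>)" by (rule H1lim_test[OF \<omega>1 tU])
    define a where "a = (LI x. g x \<bullet> cgrad \<psi> x) - l1 * (LI x. f x * u x * \<psi> x)"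
    have "0 <= 2 * t * a + t^2 * (gnorm2 \<psi> - l1 * ff \<psi>)" for t
    proof -
      have st: "test_fun \<Omega> (%x. t * \<psi> x)" by (rule test_scale[OF t])
      have Hs: "H1lim \<omega>1 (%n x. \<zeta> n x + t * \<psi> x) (%x. u x + t * \<psi> x) (%x. g x + t *\<^sub>R cgrad \<psi> x)"
        using H1lim_add_test[OF H testU[OF st]] by (simp add: cgrad_scale test_smooth[OF t])
      have "(%n. l1 * ff (%x. \<zeta> n x + t * \<psi> x)) ----> l1 * (LI x. f x * (u x + t * \<psi> x) * (u x + t * \<psi> x))"
        using fw(1)[OF Hs Hs] by (intro tendsto_intros) (simp add: ff_def power2_eq_square mult.assoc)
      moreover have "l1 * ff (%x. \<zeta> n x + t * \<psi> x) <= gnorm2 (%x. \<zeta> n x + t * \<psi> x)" for n by (rule rayleigh[OF test_add[OF zt(1) st]])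
      ultimately have "l1 * (LI x. f x * (u x + t * \<psi> x) * (u x + t * \<psi> x)) <= (LI x. (norm (g x + t *\<^sub>R cgrad \<psi> x))^2)"
        using LIMSEQ_le[OF _ H1lim_gnorm2[OF Hs]] by auto
      then have "l1 * (LI x. f x * (u x + t * \<psi> x)^2) <= (LI x. (norm (g x + t *\<^sub>R cgrad \<psi> x))^2)"
        by (simp add: power2_eq_square mult.assoc)
      then have "l1 * ((LI x. f x * (u x)^2) + 2 * t * (LI x. f x * u x * \<psi> x) + t^2 * (LI x. f x * (\<psi> x)^2))
         <= l1 + 2 * t * (LI x. g x \<bullet> cgrad \<psi> x) + t^2 * gnorm2 \<psi>"
        unfolding L2f_norm_add_expand[OF Hf(5) test_L2f(2)[OF t]] weighted_add_expand[OF fw(2)[OF H H] fw(2)[OF H Ht] fw(2)[OF Ht Ht]]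
        by (simp add: gu gnorm2_def)
      moreover have "(LI x. f x * (u x)^2) = 1" using fu by (simp add: power2_eq_square mult.assoc)
      ultimately show ?thesis by (simp add: a_def ff_def algebra_simps)
    qed
    then have "a = 0" by (rule quadratic_nonneg_imp_zero)
    then show ?thesis by (simp add: a_def mult.assoc)
  qed
  have wm: "(%x. l1 * f x * u x) \<in> Lmeas" using um by measurable
  have wi: "L1f (%x. l1 * f x * u x * (\<eta> x)^2)" if t: "test_fun UNIV \<eta>" for \<eta>
  proof -
    have "test_fun UNIV (%x. \<eta> x * \<eta> x)" by (rule test_mult_smooth[OF t test_smooth[OF t]])
    from fw(2)[OF H H1lim_test[OF \<omega>1 this]] have "L1f (%x. l1 * (f x * u x * (\<eta> x * \<eta> x)))" by (rule integrable_mult_right)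
    then show ?thesis by (simp add: power2_eq_square mult.assoc)
  qed
  have W: "wsol \<Omega> \<omega>1 \<zeta> u g (%x. l1 * f x * u x)"
    unfolding wsol_def using H zt wm wi[OF testU] eq by (auto simp: u_def)
  have A: "\<bar>l1 * f x * u x\<bar> <= l1 * \<bar>f x\<bar> * u x" "0 <= l1 * \<bar>f x\<bar>" for x
    using l1_pos by (auto simp: abs_mult u_def)
  have Ai: "L1f (%x. l1 * \<bar>f x\<bar> * (\<eta> x)^2)" if "test_fun \<Omega> \<eta>" for \<eta>
  proof -
    have "L1f (%x. l1 * (\<bar>f x\<bar> * (\<eta> x)^2))"
      using holder_sobolev_Lhalf[OF N] f testU[OF that] by (intro integrable_mult_right) blast
    then show ?thesis by (simp add: mult.assoc)
  qed
  have "AE x in lebesgue. x \<in> \<Omega> \<longrightarrow> u x > 0"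
  proof (rule ccontr)
    assume "\<not> ?thesis"
    then have "AE x in lebesgue. x \<in> \<Omega> \<longrightarrow> u x = 0"
      using strong_maximum_principle[OF W op con A] Ai by blast
    then have "AE x in lebesgue. f x * u x * u x = 0" by eventually_elim (auto simp: u_def)
    then have "(LI x. f x * u x * u x) = 0" by (rule integral_eq_zero_AE)
    then show False using fu by simp
  qed
  then show ?thesis using W fu gu by (intro exI[of _ \<zeta>] exI[of _ u] exI[of _ g]) (auto simp: u_def)
qed

section \<open>Eigenfunctions in H^1_0, their zero extension, and uniqueness of the
  eigenvalue\<close>

lemma integral_on_\<Omega>: "(LINT x|lebesgue_on \<Omega>. F x) = (LI x. indicator \<Omega> x *\<^sub>R F x)" for F :: "'n => real"
  by (rule integral_restrict_space) (use fin\<Omega> in auto)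

lemma integrable_on_\<Omega>: "integrable (lebesgue_on \<Omega>) F \<longleftrightarrow> L1f (%x. indicator \<Omega> x *\<^sub>R F x)" for F :: "'n => real"
  by (rule integrable_restrict_space) (use fin\<Omega> in auto)

lemma L2_on_ext: "L2_on \<Omega> h ==> L2f (%x. indicator \<Omega> x * h x)" for h :: "'n => real"
proof -
  assume h: "L2_on \<Omega> h"
  have "(%x. (norm (indicator \<Omega> x * h x))^2) = (%x. indicator \<Omega> x *\<^sub>R (h x)\<^sup>2)" by (auto simp: indicator_def)
  then show ?thesis
    using h borel_measurable_restrict_space_iff[of \<Omega> lebesgue h] fin\<Omega>(2) by (simp add: L2_on_def L2f_def integrable_on_\<Omega>)
qed

lemma test_outside: "test_fun \<Omega> \<phi> ==> x \<notin> \<Omega> ==> \<phi> x = 0 \<and> cgrad \<phi> x = 0"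
  using test_fun_supp[of \<Omega> \<phi>] by blast

text \<open>Zero extension turns an eigenfunction in \<open>\<Omega>\<close> into a global object.
  The approximants supplied by \<open>H10_grad\<close> may change sign; they are replaced by the
  smoothed absolute values with \<epsilon> tending to zero, which still converge to p because p is
  nonnegative.\<close>

lemma H10_grad_imp_wsol:
  assumes H: "H10_grad \<Omega> \<psi> h" and pos: "\<forall>x\<in>\<Omega>. \<psi> x > 0"
    and eq: "\<forall>\<eta>. test_fun \<Omega> \<eta> \<longrightarrow> (LINT x|lebesgue_on \<Omega>. h x \<bullet> cgrad \<eta> x) = l * (LINT x|lebesgue_on \<Omega>. f x * \<psi> x * \<eta> x)"
  defines "p \<equiv> %x. indicator \<Omega> x * \<psi> x" and "k \<equiv> %x. indicator \<Omega> x *\<^sub>R h x"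
  shows "\<exists>\<zeta>. wsol \<Omega> \<omega>1 \<zeta> p k (%x. l * f x * p x)"
proof -
  have pL: "L2f p" using L2_on_ext[of \<psi>] H by (simp add: H10_grad_def H1_grad_def p_def)
  have ki: "L2f (%x. k x \<bullet> i)" if "i \<in> Basis" for i
    using L2_on_ext[of "%x. h x \<bullet> i"] H that by (simp add: H10_grad_def H1_grad_def k_def)
  have kL: "L2f k"
  proof -
    have "k \<in> Lmeas"
      using ki by (subst borel_measurable_euclidean_space) (auto simp: L2f_def)
    moreover have "(norm (k x))^2 = (\<Sum>i\<in>Basis. (norm (k x \<bullet> i))^2)" for x
      unfolding power2_norm_eq_inner[of "k x"] euclidean_inner[of "k x" "k x"] by (simp add: power2_eq_square)
    ultimately show ?thesis using ki by (simp add: L2f_def)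
  qed
  obtain \<phi> where t: "!!n. test_fun \<Omega> (\<phi> n)"
    and lim: "(%n. (LINT x|lebesgue_on \<Omega>. (\<phi> n x - \<psi> x)^2 + (norm (cgrad (\<phi> n) x - h x))^2)) ----> 0"
    using H by (auto simp: H10_grad_def)
  note tU = testU[OF t]
  define a where "a n = (LI x. (norm (\<phi> n x - p x))^2)" for n
  define b where "b n = (LI x. (norm (cgrad (\<phi> n) x - k x))^2)" for n
  have a0: "a n >= 0" "b n >= 0" for n by (auto simp: a_def b_def)
  have "(LINT x|lebesgue_on \<Omega>. (\<phi> n x - \<psi> x)^2 + (norm (cgrad (\<phi> n) x - h x))^2) = a n + b n" for n
  proof -
    have "(%x. indicator \<Omega> x *\<^sub>R ((\<phi> n x - \<psi> x)^2 + (norm (cgrad (\<phi> n) x - h x))^2)) = (%x. (norm (\<phi> n x - p x))^2 + (norm (cgrad (\<phi> n) x - k x))^2)"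
      using test_outside[OF t] by (auto simp: p_def k_def indicator_def)
    moreover have "L1f (%x. (norm (\<phi> n x - p x))^2)" "L1f (%x. (norm (cgrad (\<phi> n) x - k x))^2)"
      using L2f_diff[OF test_L2f(1)[OF t] pL] L2f_diff[OF test_L2f(2)[OF t] kL] by (auto simp: L2f_def)
    ultimately show ?thesis unfolding integral_on_\<Omega> by (simp add: a_def b_def)
  qed
  then have ab: "(%n. a n + b n) ----> 0" using lim by simp
  have al: "a ----> 0" by (rule tendsto_sandwich[OF _ _ tendsto_const ab]) (use a0 in auto)
  have bl: "b ----> 0" by (rule tendsto_sandwich[OF _ _ tendsto_const ab]) (use a0 in auto)
  have L1: "L2c \<phi> p" using al test_L2f(1)[OF t] pL by (simp add: L2c_def a_def[abs_def])
  have L2: "L2c (%n. cgrad (\<phi> n)) k" using bl test_L2f(2)[OF t] kL by (simp add: L2c_def b_def[abs_def])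
  obtain K where K: "K > 0" "!!\<phi>. test_fun UNIV \<phi> ==> (LI x. \<omega>1 x * indicator \<Omega> x * (\<phi> x)^2) <= K * gnorm2 \<phi>" using ff_bound by blast
  \<comment> \<open>Only unweighted convergence is given. As everything vanishes outside of
    \<open>\<Omega>\<close>, \<open>ff_bound\<close> upgrades convergence of the gradients to
    convergence in the weight \<open>\<omega>1\<close>.\<close>
  have cauchy: "\<exists>n0. \<forall>m\<ge>n0. \<forall>n\<ge>n0. gnorm2 (%x. \<phi> m x - \<phi> n x) + (LI x. \<omega>1 x * (\<phi> m x - \<phi> n x)^2) < e" if e: "e > 0" for e
  proof -
    have "e / (4 * (K + 1)) > 0" using e K(1) by simp
    from LIMSEQ_D[OF bl this] obtain n0 where n0: "!!n. n >= n0 ==> b n < e / (4 * (K + 1))" using a0 by auto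
    show ?thesis
    proof (intro exI[of _ n0] allI impI)
      fix m n assume mn: "m >= n0" "n >= n0"
      define d where "d x = \<phi> m x - \<phi> n x" for x
      have dt: "test_fun \<Omega> d" unfolding d_def by (rule test_diff[OF t t])
      have "gnorm2 d <= (LI x. 2 * (norm (cgrad (\<phi> m) x - k x))^2 + 2 * (norm (cgrad (\<phi> n) x - k x))^2)"
        unfolding gnorm2_def
      proof (rule integral_mono)
        show "L1f (%x. (norm (cgrad d x))^2)" using test_L2f(2)[OF dt] by (simp add: L2f_def)
        show "L1f (%x. 2 * (norm (cgrad (\<phi> m) x - k x))^2 + 2 * (norm (cgrad (\<phi> n) x - k x))^2)"
          using L2f_diff[OF test_L2f(2)[OF t] kL] by (simp add: L2f_def)
        fix x
        have "cgrad d x = (cgrad (\<phi> m) x - k x) + (k x - cgrad (\<phi> n) x)" unfolding d_def by (simp add: cgrad_diff test_smooth[OF t])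
        then show "(norm (cgrad d x))^2 <= 2 * (norm (cgrad (\<phi> m) x - k x))^2 + 2 * (norm (cgrad (\<phi> n) x - k x))^2"
          using norm_add_sq_le[of "cgrad (\<phi> m) x - k x" "k x - cgrad (\<phi> n) x"] by (simp add: norm_minus_commute)
      qed
      also have "\<dots> = 2 * b m + 2 * b n" using L2f_diff[OF test_L2f(2)[OF t] kL] by (simp add: L2f_def b_def)
      finally have "gnorm2 d < 4 * (e / (4 * (K + 1)))" using n0[OF mn(1)] n0[OF mn(2)] by linarith
      moreover have "4 * (e / (4 * t)) = e / t" for t :: real by simp
      ultimately have g: "gnorm2 d < e / (K + 1)" by metis
      have "(LI x. \<omega>1 x * (d x)^2) = (LI x. \<omega>1 x * indicator \<Omega> x * (d x)^2)"
        by (rule Bochner_Integration.integral_cong) (use test_outside[OF dt] in \<open>auto simp: indicator_def\<close>)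
      also have "\<dots> <= K * gnorm2 d" by (rule K(2)[OF testU[OF dt]])
      finally have "gnorm2 d + (LI x. \<omega>1 x * (d x)^2) <= (K + 1) * gnorm2 d" by (simp add: algebra_simps)
      also have "\<dots> < e" using g K(1) by (simp add: field_simps)
      finally show "gnorm2 (%x. \<phi> m x - \<phi> n x) + (LI x. \<omega>1 x * (\<phi> m x - \<phi> n x)^2) < e" unfolding d_def .
    qed
  qed
  obtain s u g where s: "strict_mono (s :: nat => nat)" "H1lim \<omega>1 (%n. \<phi> (s n)) u g"
    using H1lim_exists[OF \<omega>1 tU cauchy] by blast
  have HS: "H1lim \<omega>1 (%n. \<phi> (s n)) p k"
  proof (rule H1lim_cong[OF s(2)])
    show "AE x in lebesgue. u x = p x" by (rule L2c_unique[OF H1lim_facts(7)[OF s(2)] L2c_subseq[OF L1 s(1)]])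
    show "AE x in lebesgue. g x = k x" by (rule L2c_unique[OF H1lim_facts(8)[OF s(2)] L2c_subseq[OF L2 s(1)]])
  qed (use pL kL in \<open>auto simp: L2f_def\<close>)
  define \<xi> where "\<xi> n = \<phi> (s n)" for n
  have xt: "test_fun \<Omega> (\<xi> n)" for n using t by (simp add: \<xi>_def)
  define \<epsilon> where "\<epsilon> n = 1 / real (Suc n)" for n
  have e0: "\<epsilon> n > 0" for n by (simp add: \<epsilon>_def)
  have el: "\<epsilon> ----> 0" unfolding \<epsilon>_def[abs_def] using LIMSEQ_inverse_real_of_nat by (simp add: inverse_eq_divide)
  define \<zeta> where "\<zeta> n x = sqrt ((\<xi> n x)^2 + (\<epsilon> n)^2) - \<epsilon> n" for n x
  have zt: "test_fun \<Omega> (\<zeta> n)" for n unfolding \<zeta>_def by (rule test_sqrt(1)[OF xt e0])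
  have zb: "0 <= \<zeta> n x" "\<zeta> n x <= \<bar>\<xi> n x\<bar>" for n x unfolding \<zeta>_def using abs_sqrt_sub_le[of "\<epsilon> n" "\<xi> n x"] e0[of n] by auto
  \<comment> \<open>The multipliers taking \<xi> to \<zeta> and its gradient to that of \<zeta>.
    Both are bounded by 1 and tend to the indicator of \<open>\<Omega>\<close>, since the limit p is
    positive there; hence \<open>L2c_coeff\<close> applies.\<close>
  define m where "m n x = (if \<xi> n x = 0 then 0 else \<zeta> n x / \<xi> n x)" for n x
  define c where "c n x = \<xi> n x / sqrt ((\<xi> n x)^2 + (\<epsilon> n)^2)" for n x
  have mz: "m n x * \<xi> n x = \<zeta> n x" for n x using zb[of n x] by (auto simp: m_def)
  have cz: "cgrad (\<zeta> n) x = c n x *\<^sub>R cgrad (\<xi> n) x" for n x unfolding \<zeta>_def c_def by (rule test_sqrt(2)[OF xt e0])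
  have mb: "\<bar>m n x\<bar> <= 1" for n x using zb[of n x] by (auto simp: m_def abs_divide divide_le_eq_1)
  have sq: "sqrt ((\<xi> n x)^2 + (\<epsilon> n)^2) > 0" "\<bar>\<xi> n x\<bar> <= sqrt ((\<xi> n x)^2 + (\<epsilon> n)^2)" for n x
    using e0[of n] by (auto simp: add_nonneg_pos intro!: real_le_rsqrt)
  have cb: "\<bar>c n x\<bar> <= 1" for n x unfolding c_def using sq[of n x] by (simp only: abs_divide abs_of_pos divide_le_eq_1_pos)
  note [measurable] = test_meas(1)[OF xt] test_meas(1)[OF zt]
  have mm: "m n \<in> Lmeas" "c n \<in> Lmeas" for n unfolding m_def c_def by measurable
  have im: "(indicator \<Omega> :: 'n => real) \<in> Lmeas" using fin\<Omega> by simp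
  have zlim: "AE x in lebesgue. (%n. \<zeta> n x) ----> p x \<and> (%n. m n x) ----> indicator \<Omega> x \<and> (%n. c n x) ----> indicator \<Omega> x"
  proof -
    have "AE x in lebesgue. (%n. \<xi> n x) ----> p x" using HS by (simp add: H1lim_def \<xi>_def)
    then show ?thesis
    proof eventually_elim
      fix x assume l: "(%n. \<xi> n x) ----> p x"
      have p0: "p x >= 0" using pos by (auto simp: p_def indicator_def less_imp_le)
      have sl: "(%n. sqrt ((\<xi> n x)^2 + (\<epsilon> n)^2)) ----> sqrt ((p x)^2 + 0^2)" by (intro tendsto_intros l el)
      have zl: "(%n. \<zeta> n x) ----> p x" using tendsto_diff[OF sl el] p0 by (simp add: \<zeta>_def)
      show "(%n. \<zeta> n x) ----> p x \<and> (%n. m n x) ----> indicator \<Omega> x \<and> (%n. c n x) ----> indicator \<Omega> x"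
      proof (cases "x \<in> \<Omega>")
        case True
        then have pp: "p x > 0" using pos by (simp add: p_def)
        have "(%n. c n x) ----> p x / sqrt ((p x)^2 + 0^2)" unfolding c_def by (rule tendsto_divide[OF l sl]) (use pp in simp)
        moreover have "(%n. m n x) ----> 1"
        proof (rule Lim_transform_eventually)
          show "(%n. \<zeta> n x / \<xi> n x) ----> 1" using tendsto_divide[OF zl l] pp by simp
          have "\<forall>\<^sub>F n in sequentially. \<xi> n x > 0" using l pp by (rule order_tendstoD(1))
          then show "\<forall>\<^sub>F n in sequentially. \<zeta> n x / \<xi> n x = m n x" by eventually_elim (simp add: m_def)
        qed
        ultimately show ?thesis using zl True pp by simp
      next
        case False
        then have "\<xi> n x = 0" for n using test_outside[OF xt] by blast
        then show ?thesis using zl False by (simp add: m_def c_def)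
      qed
    qed
  qed
  have HZ: "H1lim \<omega>1 \<zeta> p k"
    unfolding H1lim_def
  proof (intro conjI allI \<omega>1 testU[OF zt])
    show "p \<in> Lmeas" using pL by (simp add: L2f_def)
    show "AE x in lebesgue. (%n. \<zeta> n x) ----> p x" using zlim by eventually_elim simp
    have kk: "indicator \<Omega> x *\<^sub>R k x = k x" "indicator \<Omega> x * p x = p x" for x by (auto simp: k_def p_def indicator_def)
    have gl: "AE x in lebesgue. (%n. cgrad (\<xi> n) x) ----> k x" using HS by (simp add: H1lim_def \<xi>_def)
    show "AE x in lebesgue. (%n. cgrad (\<zeta> n) x) ----> k x"
      using gl zlim
    proof eventually_elim
      fix x assume 1: "(%n. cgrad (\<xi> n) x) ----> k x" and 2: "(%n. \<zeta> n x) ----> p x \<and> (%n. m n x) ----> indicator \<Omega> x \<and> (%n. c n x) ----> indicator \<Omega> x"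
      have "(%n. c n x *\<^sub>R cgrad (\<xi> n) x) ----> indicator \<Omega> x *\<^sub>R k x" using 1 2 by (intro tendsto_scaleR) auto
      then show "(%n. cgrad (\<zeta> n) x) ----> k x" by (simp only: cz kk)
    qed
    have "L2c (%n x. c n x *\<^sub>R cgrad (\<xi> n) x) (%x. indicator \<Omega> x *\<^sub>R k x)"
    proof (rule L2c_coeff[where B = 1, OF _ mm(2) im cb])
      show "L2c (%n. cgrad (\<xi> n)) k" using HS by (simp add: H1lim_def \<xi>_def)
    qed (use zlim in \<open>auto simp: indicator_def\<close>)
    then show "L2c (%n. cgrad (\<zeta> n)) k" by (simp only: cz[abs_def] kk)
    have "L2c (%n x. m n x *\<^sub>R (sqrt (\<omega>1 x) * \<xi> n x)) (%x. indicator \<Omega> x *\<^sub>R (sqrt (\<omega>1 x) * p x))"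
    proof (rule L2c_coeff[where B = 1, OF _ mm(1) im mb])
      show "L2c (%n x. sqrt (\<omega>1 x) * \<xi> n x) (%x. sqrt (\<omega>1 x) * p x)" using HS by (simp add: H1lim_def \<xi>_def)
    qed (use zlim in \<open>auto simp: indicator_def\<close>)
    moreover have "m n x *\<^sub>R (sqrt (\<omega>1 x) * \<xi> n x) = sqrt (\<omega>1 x) * \<zeta> n x" for n x by (simp add: mz[symmetric])
    moreover have "indicator \<Omega> x *\<^sub>R (sqrt (\<omega>1 x) * p x) = sqrt (\<omega>1 x) * p x" for x by (auto simp: p_def indicator_def)
    ultimately show "L2c (%n x. sqrt (\<omega>1 x) * \<zeta> n x) (%x. sqrt (\<omega>1 x) * p x)" by (simp only:)
  qed
  have weq: "(LI x. k x \<bullet> cgrad \<eta> x) = (LI x. l * f x * p x * \<eta> x)" if "test_fun \<Omega> \<eta>" for \<eta>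
  proof -
    have "(LI x. k x \<bullet> cgrad \<eta> x) = (LINT x|lebesgue_on \<Omega>. h x \<bullet> cgrad \<eta> x)" unfolding integral_on_\<Omega> by (simp add: k_def)
    also have "\<dots> = l * (LINT x|lebesgue_on \<Omega>. f x * \<psi> x * \<eta> x)" using eq that by blast
    also have "\<dots> = l * (LI x. f x * p x * \<eta> x)" unfolding integral_on_\<Omega> by (simp add: p_def mult_ac)
    finally show ?thesis by (simp add: mult.assoc)
  qed
  have pm: "p \<in> Lmeas" using pL by (simp add: L2f_def)
  have wi: "L1f (%x. l * f x * p x * (\<eta> x)^2)" if t: "test_fun \<Omega> \<eta>" for \<eta>
  proof -
    have "test_fun UNIV (%x. \<eta> x * \<eta> x)" by (rule testU[OF test_mult_smooth[OF t test_smooth[OF t]]])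
    from H1lim_weighted(2)[OF HZ H1lim_test[OF \<omega>1 this] fm f\<omega>] have "L1f (%x. l * (f x * p x * (\<eta> x * \<eta> x)))" by (rule integrable_mult_right)
    then show ?thesis by (simp add: power2_eq_square mult.assoc)
  qed
  have "p x >= 0" for x using pos by (auto simp: p_def indicator_def less_imp_le)
  moreover have "(%x. l * f x * p x) \<in> Lmeas" using pm by measurable
  ultimately show ?thesis using HZ zt zb(1) wi weq unfolding wsol_def by (intro exI[of _ \<zeta>]) blast
qed

text \<open>Picone's inequality for \<psi>, with \<delta> tending to zero, gives l * ff \<eta> <=
  gnorm2 \<eta> for all test functions, hence l <= l1. Conversely, testing the equation with the
  approximants of \<psi> gives D = l F, while Rayleigh's inequality gives l1 F <= D, and F is
  positive.\<close>

lemma eigenvalue_unique: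
  assumes H: "H10_grad \<Omega> \<psi> h" and pos: "\<forall>x\<in>\<Omega>. \<psi> x > 0" and l: "l > 0"
    and eq: "\<forall>\<eta>. test_fun \<Omega> \<eta> \<longrightarrow> (LINT x|lebesgue_on \<Omega>. h x \<bullet> cgrad \<eta> x) = l * (LINT x|lebesgue_on \<Omega>. f x * \<psi> x * \<eta> x)"
  shows "l = l1"
proof -
  define p where "p x = indicator \<Omega> x * \<psi> x" for x
  define k where "k x = indicator \<Omega> x *\<^sub>R h x" for x
  obtain \<zeta> where W: "wsol \<Omega> \<omega>1 \<zeta> p k (%x. l * f x * p x)"
    using H10_grad_imp_wsol[OF H pos eq] unfolding p_def[abs_def] k_def[abs_def] by blast
  have HZ: "H1lim \<omega>1 \<zeta> p k" and zt: "!!n. test_fun \<Omega> (\<zeta> n)"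
    and weq: "!!\<psi>. test_fun \<Omega> \<psi> ==> (LI x. k x \<bullet> cgrad \<psi> x) = (LI x. l * f x * p x * \<psi> x)"
    using W by (auto simp: wsol_def)
  note fw = H1lim_weighted[OF _ _ fm f\<omega>]
  have up: "l * ff \<eta> <= gnorm2 \<eta>" if t: "test_fun \<Omega> \<eta>" for \<eta>
  proof -
    have i: "L1f (%x. l * (f x * (\<eta> x)^2))"
      using weighted_test_integrable(2)[OF \<omega>1 testU[OF t] testU[OF t] fm f\<omega>] by (rule integrable_mult_right)
    note [measurable] = test_meas(1)[OF t] H1lim_facts(3)[OF HZ]
    have p0: "p x >= 0" for x using W by (simp add: wsol_def)
    have "(%n. LI x. l * f x * p x * ((\<eta> x)^2 / (p x + 1 / real (Suc n)))) ----> (LI x. l * (f x * (\<eta> x)^2))"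
    proof (rule integral_dominated_convergence[where w = "%x. norm (l * (f x * (\<eta> x)^2))"])
      show "L1f (%x. norm (l * (f x * (\<eta> x)^2)))" by (rule integrable_norm[OF i])
      show "AE x in lebesgue. (%n. l * f x * p x * ((\<eta> x)^2 / (p x + 1 / real (Suc n)))) ----> l * (f x * (\<eta> x)^2)"
      proof (rule AE_I2)
        fix x
        show "(%n. l * f x * p x * ((\<eta> x)^2 / (p x + 1 / real (Suc n)))) ----> l * (f x * (\<eta> x)^2)"
        proof (cases "x \<in> \<Omega>")
          case True
          then have px: "p x > 0" using pos by (simp add: p_def)
          have "(%n. 1 / real (Suc n)) ----> 0" using LIMSEQ_inverse_real_of_nat by (simp add: inverse_eq_divide)
          then have "(%n. l * f x * p x * ((\<eta> x)^2 / (p x + 1 / real (Suc n)))) ----> l * f x * p x * ((\<eta> x)^2 / (p x + 0))"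
            using px by (intro tendsto_mult tendsto_divide tendsto_add tendsto_const) auto
          then show ?thesis using px by (simp add: mult_ac)
        next
          case False
          then show ?thesis using test_outside[OF t] by simp
        qed
      qed
      show "AE x in lebesgue. norm (l * f x * p x * ((\<eta> x)^2 / (p x + 1 / real (Suc n)))) <= norm (l * (f x * (\<eta> x)^2))" for n
      proof (rule AE_I2)
        fix x
        have "p x / (p x + 1 / real (Suc n)) <= 1" "0 <= p x / (p x + 1 / real (Suc n))" using p0[of x] by (auto simp: divide_le_eq_1 add_nonneg_pos)
        moreover have "norm (l * f x * p x * ((\<eta> x)^2 / (p x + 1 / real (Suc n)))) = norm (l * (f x * (\<eta> x)^2)) * \<bar>p x / (p x + 1 / real (Suc n))\<bar>"
          by (simp add: abs_mult abs_divide)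
        ultimately show "norm (l * f x * p x * ((\<eta> x)^2 / (p x + 1 / real (Suc n)))) <= norm (l * (f x * (\<eta> x)^2))"
          by (simp only: abs_of_nonneg) (rule mult_left_le, auto)
      qed
    qed measurable
    moreover have "(LI x. l * f x * p x * ((\<eta> x)^2 / (p x + 1 / real (Suc n)))) <= gnorm2 \<eta>" for n
      by (rule picone[OF W t]) simp
    ultimately have "(LI x. l * (f x * (\<eta> x)^2)) <= gnorm2 \<eta>" by (meson LIMSEQ_le_const2)
    then show ?thesis by (simp add: ff_def)
  qed
  have le: "l <= l1" unfolding l1_def
  proof (rule cINF_greatest)
    show "{\<phi>. test_fun \<Omega> \<phi> \<and> ff \<phi> = 1} \<noteq> {}" using ex_normalized by blast
    show "l <= gnorm2 \<phi>" if "\<phi> \<in> {\<phi>. test_fun \<Omega> \<phi> \<and> ff \<phi> = 1}" for \<phi> using up[of \<phi>] that by simp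
  qed
  define F where "F = (LI x. f x * p x * p x)"
  define D where "D = (LI x. (norm (k x))^2)"
  have DF: "D = l * F"
  proof (rule LIMSEQ_unique)
    show "(%n. LI x. k x \<bullet> cgrad (\<zeta> n) x) ----> D"
      using L2c_inner[OF L2c_const[OF H1lim_facts(5)[OF HZ]] H1lim_facts(8)[OF HZ]] by (simp add: D_def power2_norm_eq_inner)
    have "(%n. LI x. f x * \<zeta> n x * p x) ----> F"
    proof -
      have 1: "L2c (%n x. (f x / \<omega>1 x) *\<^sub>R (sqrt (\<omega>1 x) * \<zeta> n x)) (%x. (f x / \<omega>1 x) *\<^sub>R (sqrt (\<omega>1 x) * p x))"
      proof (rule L2c_mult[where B = 1])
        show "L2c (%n x. sqrt (\<omega>1 x) * \<zeta> n x) (%x. sqrt (\<omega>1 x) * p x)" using HZ by (simp add: H1lim_def)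
        show "(%x. f x / \<omega>1 x) \<in> Lmeas" unfolding \<omega>1_def by measurable
        show "\<bar>f x / \<omega>1 x\<bar> <= 1" for x by (simp add: \<omega>1_def abs_divide)
      qed
      have 2: "L2f (%x. sqrt (\<omega>1 x) * p x)" using HZ by (simp add: H1lim_def L2c_def)
      have "((f x / \<omega>1 x) *\<^sub>R (sqrt (\<omega>1 x) * a)) \<bullet> (sqrt (\<omega>1 x) * b) = f x * a * b" for x a b
      proof -
        have w0: "\<omega>1 x > 0" by (simp add: \<omega>1_def add_pos_nonneg)
        have "((f x / \<omega>1 x) *\<^sub>R (sqrt (\<omega>1 x) * a)) \<bullet> (sqrt (\<omega>1 x) * b) = (f x / \<omega>1 x) * (sqrt (\<omega>1 x))^2 * a * b" by (simp add: power2_eq_square)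
        then show ?thesis using w0 by simp
      qed
      then show ?thesis using L2c_inner[OF 1 L2c_const[OF 2]] by (simp add: F_def)
    qed
    then have "(%n. l * (LI x. f x * \<zeta> n x * p x)) ----> l * F" by (intro tendsto_intros)
    moreover have "l * (LI x. f x * \<zeta> n x * p x) = (LI x. k x \<bullet> cgrad (\<zeta> n) x)" for n
      unfolding weq[OF zt] by (subst integral_mult_right_zero[symmetric]) (simp add: mult_ac)
    ultimately show "(%n. LI x. k x \<bullet> cgrad (\<zeta> n) x) ----> l * F" by simp
  qed
  have Fl: "(%n. ff (\<zeta> n)) ----> F" using fw(1)[OF HZ HZ] by (simp add: F_def ff_def power2_eq_square mult.assoc)
  have Dl: "(%n. gnorm2 (\<zeta> n)) ----> D" unfolding D_def by (rule H1lim_gnorm2[OF HZ])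
  have "(%n. l1 * ff (\<zeta> n)) ----> l1 * F" by (intro tendsto_intros Fl)
  then have "l1 * F <= D" using LIMSEQ_le[OF _ Dl] rayleigh[OF zt] by auto
  then have l1F: "l1 * F <= l * F" by (simp add: DF)
  \<comment> \<open>Without gradient energy the weighted L^2 norm over \<open>\<Omega>\<close> would
    vanish by \<open>ff_bound\<close>, although p is positive on this nonempty open set.\<close>
  have "D > 0"
  proof (rule ccontr)
    assume "\<not> D > 0"
    then have D0: "D <= 0" by simp
    obtain K where K: "K > 0" "!!\<phi>. test_fun UNIV \<phi> ==> (LI x. \<omega>1 x * indicator \<Omega> x * (\<phi> x)^2) <= K * gnorm2 \<phi>" using ff_bound by blast
    have m: "(%x. \<omega>1 x * indicator \<Omega> x) \<in> Lmeas"
      using fin\<Omega>(2) unfolding \<omega>1_def by (intro borel_measurable_times borel_measurable_indicator) measurable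
    have b: "\<bar>\<omega>1 x * indicator \<Omega> x\<bar> <= 1 * \<omega>1 x" for x by (auto simp: \<omega>1_def indicator_def)
    have "(%n. LI x. \<omega>1 x * indicator \<Omega> x * (\<zeta> n x)^2) ----> (LI x. \<omega>1 x * indicator \<Omega> x * p x * p x)"
      using H1lim_weighted(1)[OF HZ HZ m b] by (simp add: power2_eq_square mult.assoc)
    moreover have "(%n. K * gnorm2 (\<zeta> n)) ----> K * D" by (intro tendsto_intros Dl)
    ultimately have "(LI x. \<omega>1 x * indicator \<Omega> x * p x * p x) <= K * D"
      using K(2)[OF testU[OF zt]] by (intro LIMSEQ_le) auto
    also have "\<dots> <= 0" using D0 K(1) by (simp add: mult_nonneg_nonpos)
    finally have "(LI x. \<omega>1 x * indicator \<Omega> x * p x * p x) = 0"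
      by (intro order_antisym integral_nonneg_AE) (auto simp: \<omega>1_def indicator_def mult.assoc)
    then have "AE x in lebesgue. \<omega>1 x * indicator \<Omega> x * p x * p x = 0"
      using integral_nonneg_eq_0_iff_AE[OF H1lim_weighted(2)[OF HZ HZ m b]] by (auto simp: \<omega>1_def indicator_def mult.assoc)
    then have ae: "AE x in lebesgue. x \<notin> \<Omega>"
    proof eventually_elim
      fix x assume z: "\<omega>1 x * indicator \<Omega> x * p x * p x = 0"
      have "\<omega>1 x > 0" by (simp add: \<omega>1_def add_pos_nonneg)
      then show "x \<notin> \<Omega>" using z pos by (auto simp: p_def)
    qed
    obtain x r where "r > 0" "ball x r \<subseteq> \<Omega>" using ne op open_contains_ball by blast
    moreover have "AE y in lebesgue. y \<notin> ball x r" using ae by eventually_elim (use \<open>ball x r \<subseteq> \<Omega>\<close> in blast)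
    ultimately show False using not_AE_False_ball by blast
  qed
  then have "F > 0" using DF l by (simp add: zero_less_mult_iff)
  then have "l1 <= l" using l1F by simp
  then show ?thesis using le by simp
qed

text \<open>Existence comes from \<open>first_eigenfunction\<close> and uniqueness from
  \<open>eigenvalue_unique\<close>; what remains is the transfer between integrals over
  \<open>\<Omega>\<close> and over the whole space.\<close>

lemma lambda1_eq: "lambda1 \<Omega> f = l1"
  unfolding lambda1_def
proof (rule the_equality)
  obtain \<zeta> u g where W: "wsol \<Omega> \<omega>1 \<zeta> u g (%x. l1 * f x * u x)" and u0: "!!x. x \<notin> \<Omega> ==> u x = 0" and up: "AE x in lebesgue. x \<in> \<Omega> \<longrightarrow> u x > 0"
    using first_eigenfunction by blast
  have HZ: "H1lim \<omega>1 \<zeta> u g" and zt: "!!n. test_fun \<Omega> (\<zeta> n)"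
    and weq: "!!\<psi>. test_fun \<Omega> \<psi> ==> (LI x. g x \<bullet> cgrad \<psi> x) = (LI x. l1 * f x * u x * \<psi> x)"
    using W by (auto simp: wsol_def)
  note Hf = H1lim_facts[OF HZ]
  have G: "H1_grad UNIV u g" by (rule H1lim_imp_H1_grad[OF HZ])
  \<comment> \<open>The definition asks for positivity at every point of \<open>\<Omega>\<close>,
    while u is positive only almost everywhere there; the value 1 is arbitrary.\<close>
  define \<phi> where "\<phi> x = (if u x > 0 then u x else 1)" for x
  note [measurable] = Hf(3,4) test_meas[OF zt]
  have pm [measurable]: "\<phi> \<in> Lmeas" unfolding \<phi>_def by measurable
  note fin\<Omega>(2) [measurable]
  have pu: "AE x in lebesgue. x \<in> \<Omega> \<longrightarrow> \<phi> x = u x" using up by eventually_elim (simp add: \<phi>_def)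
  have on: "L2_on \<Omega> w" if "L2f w'" "w \<in> Lmeas" "AE x in lebesgue. x \<in> \<Omega> \<longrightarrow> w x = w' x" for w w' :: "'n => real"
  proof -
    note that(2) [measurable]
    have "L1f (%x. indicator \<Omega> x *\<^sub>R (w x)\<^sup>2)"
    proof (rule Bochner_Integration.integrable_bound[where f = "%x. (w' x)^2"])
      show "L1f (%x. (w' x)^2)" using that(1) by (simp add: L2f_def)
      show "AE x in lebesgue. norm (indicator \<Omega> x *\<^sub>R (w x)\<^sup>2) <= norm ((w' x)^2)" using that(3) by eventually_elim (auto simp: indicator_def)
    qed measurable
    then show ?thesis using that(2) by (simp add: L2_on_def integrable_on_\<Omega> measurable_restrict_space1)
  qed
  have int: "(LINT x|lebesgue_on \<Omega>. F x) = (LI x. F' x)"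
    if "F \<in> Lmeas" "F' \<in> Lmeas" "AE x in lebesgue. x \<in> \<Omega> \<longrightarrow> F x = F' x" "!!x. x \<notin> \<Omega> ==> F' x = 0" for F F' :: "'n => real"
    unfolding integral_on_\<Omega>
  proof (rule integral_cong_AE)
    note that(1) [measurable]
    show "(%x. indicator \<Omega> x *\<^sub>R F x) \<in> Lmeas" by measurable
    show "AE x in lebesgue. indicator \<Omega> x *\<^sub>R F x = F' x" using that(3) by eventually_elim (use that(4) in \<open>auto simp: indicator_def\<close>)
  qed (rule that(2))
  have "H1_grad \<Omega> \<phi> g"
    unfolding H1_grad_def
  proof (intro conjI ballI)
    show "L2_on \<Omega> \<phi>" by (rule on[OF Hf(6) pm pu])
    show "L2_on \<Omega> (%x. g x \<bullet> i)" if "i \<in> Basis" for i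
      by (rule on[of "%x. g x \<bullet> i"]) (use G that in \<open>auto simp: H1_grad_def L2_on_UNIV\<close>)
    show "weak_grad \<Omega> \<phi> g" unfolding weak_grad_def
    proof (intro allI impI ballI)
      fix \<eta> :: "'n => real" and i :: 'n assume t: "test_fun \<Omega> \<eta>" and i: "i \<in> Basis"
      note [measurable] = test_meas(1)[OF t] test_L2f_pderiv[OF testU[OF t] i, unfolded L2f_def, THEN conjunct1]
      have 1: "(LINT x|lebesgue_on \<Omega>. \<phi> x * pderiv_dir \<eta> i x) = (LI x. u x * pderiv_dir \<eta> i x)"
        by (rule int) (use pu u0 in auto)
      have 2: "(LINT x|lebesgue_on \<Omega>. (g x \<bullet> i) * \<eta> x) = (LI x. (g x \<bullet> i) * \<eta> x)"
        by (rule int) (use test_outside[OF t] in auto)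
      show "(LINT x|lebesgue_on \<Omega>. \<phi> x * pderiv_dir \<eta> i x) = - (LINT x|lebesgue_on \<Omega>. (g x \<bullet> i) * \<eta> x)"
        unfolding 1 2 using G testU[OF t] i by (simp add: H1_grad_def weak_grad_def lebesgue_on_UNIV_eq)
    qed
  qed
  moreover have "(%n. LINT x|lebesgue_on \<Omega>. (\<zeta> n x - \<phi> x)^2 + (norm (cgrad (\<zeta> n) x - g x))^2) ----> 0"
  proof (rule tendsto_sandwich[OF _ _ tendsto_const])
    show "\<forall>\<^sub>F n in sequentially. 0 <= (LINT x|lebesgue_on \<Omega>. (\<zeta> n x - \<phi> x)^2 + (norm (cgrad (\<zeta> n) x - g x))^2)" by simp
    have i: "L1f (%x. (norm (\<zeta> n x - u x))^2)" "L1f (%x. (norm (cgrad (\<zeta> n) x - g x))^2)" for n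
      using L2f_diff[OF test_L2f(1)[OF zt] Hf(6)] L2f_diff[OF test_L2f(2)[OF zt] Hf(5)] by (auto simp: L2f_def)
    have "(LINT x|lebesgue_on \<Omega>. (\<zeta> n x - \<phi> x)^2 + (norm (cgrad (\<zeta> n) x - g x))^2) <= (LI x. (norm (\<zeta> n x - u x))^2) + (LI x. (norm (cgrad (\<zeta> n) x - g x))^2)" for n
    proof -
      have le: "AE x in lebesgue. indicator \<Omega> x *\<^sub>R ((\<zeta> n x - \<phi> x)^2 + (norm (cgrad (\<zeta> n) x - g x))^2) <= (norm (\<zeta> n x - u x))^2 + (norm (cgrad (\<zeta> n) x - g x))^2"
        using pu by eventually_elim (auto simp: indicator_def)
      have ii: "L1f (%x. (norm (\<zeta> n x - u x))^2 + (norm (cgrad (\<zeta> n) x - g x))^2)" using i by simp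
      have "(LI x. indicator \<Omega> x *\<^sub>R ((\<zeta> n x - \<phi> x)^2 + (norm (cgrad (\<zeta> n) x - g x))^2)) <= (LI x. (norm (\<zeta> n x - u x))^2 + (norm (cgrad (\<zeta> n) x - g x))^2)"
      proof (rule integral_mono_AE[OF _ ii le])
        show "L1f (%x. indicator \<Omega> x *\<^sub>R ((\<zeta> n x - \<phi> x)^2 + (norm (cgrad (\<zeta> n) x - g x))^2))"
        proof (rule Bochner_Integration.integrable_bound[OF ii])
          show "AE x in lebesgue. norm (indicator \<Omega> x *\<^sub>R ((\<zeta> n x - \<phi> x)^2 + (norm (cgrad (\<zeta> n) x - g x))^2)) <= norm ((norm (\<zeta> n x - u x))^2 + (norm (cgrad (\<zeta> n) x - g x))^2)"
            using le by eventually_elim (auto simp: indicator_def)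
        qed measurable
      qed
      then show ?thesis unfolding integral_on_\<Omega> using i by simp
    qed
    then show "\<forall>\<^sub>F n in sequentially. (LINT x|lebesgue_on \<Omega>. (\<zeta> n x - \<phi> x)^2 + (norm (cgrad (\<zeta> n) x - g x))^2) <= (LI x. (norm (\<zeta> n x - u x))^2) + (LI x. (norm (cgrad (\<zeta> n) x - g x))^2)" by simp
    show "(%n. (LI x. (norm (\<zeta> n x - u x))^2) + (LI x. (norm (cgrad (\<zeta> n) x - g x))^2)) ----> 0"
      by (rule tendsto_add_zero) (use Hf(7,8) in \<open>auto simp: L2c_def\<close>)
  qed
  ultimately have "H10_grad \<Omega> \<phi> g" using zt unfolding H10_grad_def by blast
  moreover have "\<forall>x\<in>\<Omega>. \<phi> x > 0" by (simp add: \<phi>_def)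
  moreover have "(LINT x|lebesgue_on \<Omega>. g x \<bullet> cgrad \<eta> x) = l1 * (LINT x|lebesgue_on \<Omega>. f x * \<phi> x * \<eta> x)" if t: "test_fun \<Omega> \<eta>" for \<eta>
  proof -
    note [measurable] = test_meas[OF t]
    have 1: "(LINT x|lebesgue_on \<Omega>. g x \<bullet> cgrad \<eta> x) = (LI x. g x \<bullet> cgrad \<eta> x)"
      by (rule int) (use test_outside[OF t] in auto)
    have 2: "(LINT x|lebesgue_on \<Omega>. f x * \<phi> x * \<eta> x) = (LI x. f x * u x * \<eta> x)"
      by (rule int) (use pu test_outside[OF t] in auto)
    show ?thesis unfolding 1 2 weq[OF t] by (simp add: mult.assoc)
  qed
  ultimately show "0 < l1 \<and> (\<exists>\<phi> g. H10_grad \<Omega> \<phi> g \<and> (\<forall>x\<in>\<Omega>. 0 < \<phi> x) \<and> (\<forall>\<psi>. test_fun \<Omega> \<psi> \<longrightarrow>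
      (LINT x|lebesgue_on \<Omega>. g x \<bullet> cgrad \<psi> x) = l1 * (LINT x|lebesgue_on \<Omega>. f x * \<phi> x * \<psi> x)))"
    using l1_pos by blast
  show "l = l1" if "0 < l \<and> (\<exists>\<phi> g. H10_grad \<Omega> \<phi> g \<and> (\<forall>x\<in>\<Omega>. 0 < \<phi> x) \<and> (\<forall>\<psi>. test_fun \<Omega> \<psi> \<longrightarrow>
      (LINT x|lebesgue_on \<Omega>. g x \<bullet> cgrad \<psi> x) = l * (LINT x|lebesgue_on \<Omega>. f x * \<phi> x * \<psi> x)))" for l
    using that eigenvalue_unique by blast
qed

text \<open>At \<open>\<lambda> = \<lambda>\<^sub>1\<close>: otherwise the first eigenfunction, extended by zero, would minimise the quadratic
  form on the whole space and hence solve an equation there, against the strong maximum principle.\<close>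
lemma negative_direction:
  assumes V: "continuous_on UNIV V" "!!x. x \<in> \<Omega> ==> V x = (0::real)" and lam: "lam >= l1"
  shows "\<exists>\<psi>. test_fun UNIV \<psi> \<and> gnorm2 \<psi> + \<mu> * (LI x. V x * (\<psi> x)^2) < lam * ff \<psi>"
proof (rule ccontr)
  assume "\<not> ?thesis"
  then have q0: "lam * ff \<psi> <= gnorm2 \<psi> + \<mu> * (LI x. V x * (\<psi> x)^2)" if "test_fun UNIV \<psi>" for \<psi>
    using that by (meson not_le)
  obtain \<zeta> u g where W: "wsol \<Omega> \<omega>1 \<zeta> u g (%x. l1 * f x * u x)" and fu: "(LI x. f x * u x * u x) = 1"
    and gu: "(LI x. (norm (g x))^2) = l1" and u0: "!!x. x \<notin> \<Omega> ==> u x = 0"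
    using first_eigenfunction by blast
  have HZ: "H1lim \<omega>1 \<zeta> u g" and zt: "!!n. test_fun \<Omega> (\<zeta> n)" using W by (auto simp: wsol_def)
  note Hf = H1lim_facts[OF HZ]
  note fw = H1lim_weighted[OF _ _ fm f\<omega>]
  \<comment> \<open>The form along u + t \<psi>. Its constant term is l1 - lam, because u has
    Dirichlet energy l1 and the integral of f u^2 is 1.\<close>
  have q: "0 <= (l1 - lam) + 2 * t * ((LI x. g x \<bullet> cgrad \<psi> x) - lam * (LI x. f x * u x * \<psi> x))
      + t^2 * (gnorm2 \<psi> + \<mu> * (LI x. V x * (\<psi> x)^2) - lam * ff \<psi>)" if t: "test_fun UNIV \<psi>" for t \<psi>
  proof -
    have Ht: "H1lim \<omega>1 (%_. \<psi>) \<psi> (cgrad \<psi>)" by (rule H1lim_test[OF \<omega>1 t])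
    have st: "test_fun UNIV (%x. t * \<psi> x)" by (rule test_scale[OF t])
    have Hs: "H1lim \<omega>1 (%n x. \<zeta> n x + t * \<psi> x) (%x. u x + t * \<psi> x) (%x. g x + t *\<^sub>R cgrad \<psi> x)"
      using H1lim_add_test[OF HZ st] by (simp add: cgrad_scale test_smooth[OF t])
    have ml: "(%n. lam * ff (%x. \<zeta> n x + t * \<psi> x)) ----> lam * (LI x. f x * (u x + t * \<psi> x) * (u x + t * \<psi> x))"
      using fw(1)[OF Hs Hs] by (intro tendsto_intros) (simp add: ff_def power2_eq_square mult.assoc)
    \<comment> \<open>The approximants of u live in \<open>\<Omega>\<close>, where V vanishes, so V
      sees only t \<psi> and produces no mixed term.\<close>
    have Vz: "V x * (\<zeta> n x + t * \<psi> x)^2 = t^2 * (V x * (\<psi> x)^2)" for n x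
      using V(2)[of x] test_outside[OF zt, of x n] by (cases "x \<in> \<Omega>") (auto simp: power_mult_distrib)
    have "lam * ff (%x. \<zeta> n x + t * \<psi> x) <= gnorm2 (%x. \<zeta> n x + t * \<psi> x) + \<mu> * (t^2 * (LI x. V x * (\<psi> x)^2))" for n
      using q0[OF test_add[OF testU[OF zt] st], of n] unfolding Vz by simp
    moreover have "(%n. gnorm2 (%x. \<zeta> n x + t * \<psi> x) + \<mu> * (t^2 * (LI x. V x * (\<psi> x)^2))) ---->
        (LI x. (norm (g x + t *\<^sub>R cgrad \<psi> x))^2) + \<mu> * (t^2 * (LI x. V x * (\<psi> x)^2))"
      by (intro tendsto_add tendsto_const H1lim_gnorm2[OF Hs])
    ultimately have "lam * (LI x. f x * (u x + t * \<psi> x) * (u x + t * \<psi> x)) \<le>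
        (LI x. (norm (g x + t *\<^sub>R cgrad \<psi> x))^2) + \<mu> * (t^2 * (LI x. V x * (\<psi> x)^2))"
      using LIMSEQ_le[OF ml] by blast
    then have "lam * (LI x. f x * (u x + t * \<psi> x)^2) \<le>
        (LI x. (norm (g x + t *\<^sub>R cgrad \<psi> x))^2) + \<mu> * (t^2 * (LI x. V x * (\<psi> x)^2))"
      by (simp add: power2_eq_square mult.assoc)
    then have "lam * ((LI x. f x * (u x)^2) + 2 * t * (LI x. f x * u x * \<psi> x) + t^2 * (LI x. f x * (\<psi> x)^2))
         <= l1 + 2 * t * (LI x. g x \<bullet> cgrad \<psi> x) + t^2 * gnorm2 \<psi> + \<mu> * (t^2 * (LI x. V x * (\<psi> x)^2))"
      unfolding L2f_norm_add_expand[OF Hf(5) test_L2f(2)[OF t]] weighted_add_expand[OF fw(2)[OF HZ HZ] fw(2)[OF HZ Ht] fw(2)[OF Ht Ht]]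
      by (simp add: gu gnorm2_def)
    moreover have "(LI x. f x * (u x)^2) = 1" using fu by (simp add: power2_eq_square mult.assoc)
    ultimately show ?thesis by (simp add: ff_def algebra_simps)
  qed
  \<comment> \<open>At t = 0 the inequality reads l1 >= lam. For lam > l1 the contradiction is
    reached here already; the borderline case goes on.\<close>
  have lam_eq: "lam = l1" using q[OF test_zero, of 0] lam by simp
  have eq: "(LI x. g x \<bullet> cgrad \<psi> x) = (LI x. l1 * f x * u x * \<psi> x)" if t: "test_fun UNIV \<psi>" for \<psi>
  proof -
    have "(LI x. g x \<bullet> cgrad \<psi> x) - lam * (LI x. f x * u x * \<psi> x) = 0"
      by (rule quadratic_nonneg_imp_zero) (use q[OF t] lam_eq in simp)
    then show ?thesis by (simp add: lam_eq mult.assoc)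
  qed
  have wi: "L1f (%x. l1 * f x * u x * (\<eta> x)^2)" if t: "test_fun UNIV \<eta>" for \<eta>
  proof -
    have "test_fun UNIV (%x. \<eta> x * \<eta> x)" by (rule test_mult_smooth[OF t test_smooth[OF t]])
    from fw(2)[OF HZ H1lim_test[OF \<omega>1 this]] have "L1f (%x. l1 * (f x * u x * (\<eta> x * \<eta> x)))" by (rule integrable_mult_right)
    then show ?thesis by (simp add: power2_eq_square mult.assoc)
  qed
  have WU: "wsol UNIV \<omega>1 \<zeta> u g (%x. l1 * f x * u x)"
    using W wi eq testU[OF zt] unfolding wsol_def by blast
  have un: "u x >= 0" for x using W by (simp add: wsol_def)
  have A: "\<bar>l1 * f x * u x\<bar> <= l1 * \<bar>f x\<bar> * u x" "0 <= l1 * \<bar>f x\<bar>" for x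
    using l1_pos un[of x] by (auto simp: abs_mult)
  have Ai: "L1f (%x. l1 * \<bar>f x\<bar> * (\<eta> x)^2)" if "test_fun UNIV \<eta>" for \<eta>
  proof -
    have "L1f (%x. l1 * (\<bar>f x\<bar> * (\<eta> x)^2))"
      using holder_sobolev_Lhalf[OF N] f that by (intro integrable_mult_right) blast
    then show ?thesis by (simp add: mult.assoc)
  qed
  have "(AE x in lebesgue. x \<in> UNIV \<longrightarrow> u x = 0) \<or> (AE x in lebesgue. x \<in> UNIV \<longrightarrow> u x > 0)"
    using strong_maximum_principle[OF WU open_UNIV connected_UNIV A] Ai by blast
  then show False
  proof
    assume "AE x in lebesgue. x \<in> UNIV \<longrightarrow> u x = 0"
    then have "AE x in lebesgue. f x * u x * u x = 0" by eventually_elim simp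
    then have "(LI x. f x * u x * u x) = 0" by (rule integral_eq_zero_AE)
    then show False using fu by simp
  next
    assume a: "AE x in lebesgue. x \<in> UNIV \<longrightarrow> u x > 0"
    have "\<not> bounded (UNIV :: 'n set)" by simp
    then have "- closure \<Omega> \<noteq> {}" using bounded_closure[OF bd] by (metis Compl_empty_eq double_compl)
    moreover have "open (- closure \<Omega>)" by auto
    ultimately obtain x r where r: "r > 0" "ball x r \<subseteq> - closure \<Omega>" using open_contains_ball by blast
    have "AE y in lebesgue. y \<notin> ball x r"
      using a
    proof eventually_elim
      fix y assume "y \<in> UNIV \<longrightarrow> u y > 0"
      then have "y \<in> \<Omega>" using u0[of y] by force
      then show "y \<notin> ball x r" using r(2) closure_subset by blast
    qed
    then show False using not_AE_False_ball r(1) by blast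
  qed
qed

end

section \<open>The Kirchhoff functional\<close>

lemma powr_split:
  fixes r t \<kappa> :: real
  assumes "0 < r" "r < t" "\<kappa> > 0"
  shows "\<exists>L>0. \<forall>s\<ge>0. s powr r <= \<kappa> * s powr t + L"
proof -
  \<comment> \<open>The crossover point, where \<kappa> M^(t-r) = 1; beyond it the higher power
    dominates.\<close>
  define M where "M = (1 / \<kappa>) powr (1 / (t - r))"
  have "s powr r <= \<kappa> * s powr t + (M powr r + 1)" if s: "s >= 0" for s
  proof (cases "s <= M")
    case True
    then have "s powr r <= M powr r" using assms s by (intro powr_mono2) auto
    moreover have "0 <= \<kappa> * s powr t" using assms by simp
    ultimately show ?thesis by linarith
  next
    case False
    have M0: "M > 0" using assms by (simp add: M_def)
    then have s0: "s > 0" using False by simp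
    have "M powr (t - r) <= s powr (t - r)" using False M0 assms by (intro powr_mono2) auto
    then have "1 <= \<kappa> * s powr (t - r)" using assms by (simp add: M_def powr_powr field_simps)
    then have "s powr r * 1 <= s powr r * (\<kappa> * s powr (t - r))" by (intro mult_left_mono) auto
    also have "\<dots> = \<kappa> * s powr t" using s0 by (simp add: mult.left_commute powr_add[symmetric])
    finally show ?thesis by (simp add: add_increasing2)
  qed
  moreover have "M powr r + 1 > 0" by (simp add: add_nonneg_pos)
  ultimately show ?thesis by blast
qed

lemma abs_powr_tendsto_0: "r > 0 ==> ((%h::real. \<bar>h\<bar> powr r) \<longlongrightarrow> 0) (at 0)"
  using tendsto_powr'[OF tendsto_rabs[OF tendsto_ident_at], of "%_. r" r 0 UNIV] by auto

lemma DERIV_abs_powr_at: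
  fixes s :: real
  assumes "s \<noteq> 0"
  shows "((%s. \<bar>s\<bar> powr r) has_real_derivative r * (\<bar>s\<bar> powr (r - 2) * s)) (at s)"
proof -
  have e: "(t^2) powr d = \<bar>t\<bar> powr (2 * d)" for t d :: real
  proof -
    have "t^2 = \<bar>t\<bar> powr 2" by (cases "t = 0") (simp_all add: powr_numeral)
    then show ?thesis by (simp only: powr_powr)
  qed
  have "((%s. (s^2) powr (r / 2)) has_real_derivative (r / 2) * (s^2) powr (r / 2 - 1) * (2 * s)) (at s)"
    by (rule DERIV_chain2[OF has_real_derivative_powr]) (use assms in \<open>auto intro!: derivative_eq_intros\<close>)
  then show ?thesis unfolding e by (simp add: right_diff_distrib mult.assoc)
qed

lemma DERIV_abs_powr:
  fixes s :: real
  assumes "r > 1"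
  shows "((%s. \<bar>s\<bar> powr r) has_real_derivative r * (\<bar>s\<bar> powr (r - 2) * s)) (at s)"
proof (cases "s = 0")
  case True
  have "((%h. \<bar>h\<bar> powr r / h) \<longlongrightarrow> 0) (at (0::real))"
  proof (rule Lim_null_comparison)
    show "((%h. \<bar>h\<bar> powr (r - 1)) \<longlongrightarrow> 0) (at (0::real))" using assms by (intro abs_powr_tendsto_0) simp
    have "norm (\<bar>h\<bar> powr r / h) <= \<bar>h\<bar> powr (r - 1)" for h :: real
      by (cases "h = 0") (auto simp: abs_divide powr_diff)
    then show "\<forall>\<^sub>F h in at (0::real). norm (\<bar>h\<bar> powr r / h) <= \<bar>h\<bar> powr (r - 1)" by simp
  qed
  then show ?thesis using True by (simp add: has_field_derivative_iff)
qed (rule DERIV_abs_powr_at)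

lemma DERIV_signed_powr:
  fixes s :: real
  assumes "r > 0"
  shows "((%s. \<bar>s\<bar> powr r * s) has_real_derivative (r + 1) * \<bar>s\<bar> powr r) (at s)"
proof (cases "s = 0")
  case True
  have "((%h. \<bar>h\<bar> powr r * h / h) \<longlongrightarrow> 0) (at (0::real))"
    by (rule Lim_transform_eventually[OF abs_powr_tendsto_0[OF assms]]) (simp add: eventually_at_filter)
  then show ?thesis using True by (simp add: has_field_derivative_iff)
next
  case False
  have "((%s. \<bar>s\<bar> powr r * s) has_real_derivative r * (\<bar>s\<bar> powr (r - 2) * s) * s + \<bar>s\<bar> powr r * 1) (at s)"
    using DERIV_mult[OF DERIV_abs_powr_at[OF False, of r] DERIV_ident] by (simp add: algebra_simps)
  moreover have "\<bar>s\<bar> powr (r - 2) * s * s = \<bar>s\<bar> powr r"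
  proof -
    have "\<bar>s\<bar> powr r = \<bar>s\<bar> powr (r - 2) * s^2" using powr_add[of "\<bar>s\<bar>" "r - 2" 2] by simp
    then show ?thesis by (simp add: power2_eq_square)
  qed
  ultimately show ?thesis by (simp add: mult.assoc distrib_right)
qed

lemma max_powr_le: "r > 0 ==> (\<bar>a\<bar> + \<bar>b\<bar>) powr r <= 2 powr r * (\<bar>a\<bar> powr r + \<bar>b\<bar> powr r)" for a b r :: real
proof -
  assume r: "r > 0"
  have "(\<bar>a\<bar> + \<bar>b\<bar>) powr r <= (2 * max \<bar>a\<bar> \<bar>b\<bar>) powr r" using r by (intro powr_mono2) auto
  also have "\<dots> = 2 powr r * (max \<bar>a\<bar> \<bar>b\<bar>) powr r" by (simp add: powr_mult)
  also have "\<dots> <= 2 powr r * (\<bar>a\<bar> powr r + \<bar>b\<bar> powr r)" by (intro mult_left_mono) (auto simp: max_def)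
  finally show ?thesis .
qed

text \<open>For p > 2 the function |s|^p has second derivative p (p-1) |s|^(p-2); two applications
  of the mean value theorem give the remainder.\<close>

lemma powr_taylor:
  assumes p: "p > 2"
  shows "\<exists>C>0. \<forall>s b :: real. \<bar>\<bar>s + b\<bar> powr p - \<bar>s\<bar> powr p - p * (\<bar>s\<bar> powr (p - 2) * s) * b\<bar> <= C * ((\<bar>s\<bar> powr (p - 2) + \<bar>b\<bar> powr (p - 2)) * b^2)"
proof -
  define G where "G s = \<bar>s\<bar> powr (p - 2) * s" for s :: real
  define C where "C = p * (p - 1) * 2 powr (p - 2)"
  have "\<bar>\<bar>s + b\<bar> powr p - \<bar>s\<bar> powr p - p * G s * b\<bar> <= C * ((\<bar>s\<bar> powr (p - 2) + \<bar>b\<bar> powr (p - 2)) * b^2)" for s b :: real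
  proof -
    have 1: "((%t. \<bar>s + t * b\<bar> powr p) has_real_derivative p * G (s + t * b) * b) (at t)" for t
      unfolding G_def by (rule DERIV_chain2[OF DERIV_abs_powr]) (use p in \<open>auto intro!: derivative_eq_intros\<close>)
    obtain x where x: "0 < x" "x < 1" "\<bar>s + b\<bar> powr p - \<bar>s\<bar> powr p = p * G (s + x * b) * b"
      using MVT2[of 0 1 "%t. \<bar>s + t * b\<bar> powr p" "%t. p * G (s + t * b) * b"] 1 by auto
    have 2: "((%t. G (s + t * (x * b))) has_real_derivative (p - 1) * \<bar>s + t * (x * b)\<bar> powr (p - 2) * (x * b)) (at t)" for t
      unfolding G_def by (rule DERIV_chain2[OF DERIV_signed_powr[of "p - 2", simplified]]) (use p in \<open>auto intro!: derivative_eq_intros\<close>)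
    obtain y where y: "0 < y" "y < 1" "G (s + x * b) - G s = (p - 1) * \<bar>s + y * (x * b)\<bar> powr (p - 2) * (x * b)"
      using MVT2[of 0 1 "%t. G (s + t * (x * b))" "%t. (p - 1) * \<bar>s + t * (x * b)\<bar> powr (p - 2) * (x * b)"] 2 by auto
    have "\<bar>s + b\<bar> powr p - \<bar>s\<bar> powr p - p * G s * b = p * (G (s + x * b) - G s) * b" using x(3) by (simp add: algebra_simps)
    also have "\<dots> = p * (p - 1) * \<bar>s + y * (x * b)\<bar> powr (p - 2) * (x * b^2)" unfolding y(3) by (simp add: power2_eq_square)
    finally have e: "\<bar>\<bar>s + b\<bar> powr p - \<bar>s\<bar> powr p - p * G s * b\<bar> = p * (p - 1) * \<bar>s + y * (x * b)\<bar> powr (p - 2) * (x * b^2)"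
      using p x(1) by (simp add: abs_mult)
    have "\<bar>y * (x * b)\<bar> <= \<bar>b\<bar>"
    proof -
      have "y * x <= 1" "0 <= y * x" using x y by (auto simp: mult_le_one)
      then have "y * x * \<bar>b\<bar> <= 1 * \<bar>b\<bar>" by (intro mult_right_mono) auto
      then show ?thesis using x y by (simp add: abs_mult)
    qed
    then have "\<bar>s + y * (x * b)\<bar> powr (p - 2) <= (\<bar>s\<bar> + \<bar>b\<bar>) powr (p - 2)" using p by (intro powr_mono2) auto
    also have "\<dots> <= 2 powr (p - 2) * (\<bar>s\<bar> powr (p - 2) + \<bar>b\<bar> powr (p - 2))" using p by (intro max_powr_le) simp
    finally have 3: "\<bar>s + y * (x * b)\<bar> powr (p - 2) <= 2 powr (p - 2) * (\<bar>s\<bar> powr (p - 2) + \<bar>b\<bar> powr (p - 2))" .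
    have "x * b^2 <= 1 * b^2" using x by (intro mult_right_mono) auto
    then have "p * (p - 1) * \<bar>s + y * (x * b)\<bar> powr (p - 2) * (x * b^2) <= p * (p - 1) * (2 powr (p - 2) * (\<bar>s\<bar> powr (p - 2) + \<bar>b\<bar> powr (p - 2))) * (1 * b^2)"
      using p x(1,2) 3 by (intro mult_mono mult_left_mono) auto
    then show ?thesis unfolding e by (simp add: C_def mult.assoc)
  qed
  moreover have "C > 0" using p by (simp add: C_def)
  ultimately show ?thesis unfolding G_def by blast
qed

text \<open>Taylor expansion at the midpoint, towards a and towards b; the linear terms cancel, and
  the defect of convexity is quadratic in a - b.\<close>

lemma powr_midpoint:
  assumes p: "p > 2"
  shows "\<exists>C>0. \<forall>a b :: real. \<bar>(\<bar>a\<bar> powr p + \<bar>b\<bar> powr p) / 2 - \<bar>(a + b) / 2\<bar> powr p\<bar> <= C * ((\<bar>a\<bar> powr (p - 2) + \<bar>b\<bar> powr (p - 2)) * (a - b)^2)"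
proof -
  obtain C where C: "C > 0" "!!s b :: real. \<bar>\<bar>s + b\<bar> powr p - \<bar>s\<bar> powr p - p * (\<bar>s\<bar> powr (p - 2) * s) * b\<bar> <= C * ((\<bar>s\<bar> powr (p - 2) + \<bar>b\<bar> powr (p - 2)) * b^2)"
    using powr_taylor[OF p] by blast
  have "\<bar>(\<bar>a\<bar> powr p + \<bar>b\<bar> powr p) / 2 - \<bar>(a + b) / 2\<bar> powr p\<bar> <= C * ((\<bar>a\<bar> powr (p - 2) + \<bar>b\<bar> powr (p - 2)) * (a - b)^2)" for a b :: real
  proof -
    define s where "s = (a + b) / 2"
    define d where "d = (a - b) / 2"
    define T where "T = \<bar>a\<bar> powr (p - 2) + \<bar>b\<bar> powr (p - 2)"
    define E where "E = C * ((\<bar>s\<bar> powr (p - 2) + \<bar>d\<bar> powr (p - 2)) * d^2)"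
    have sd: "s + d = a" "s + (- d) = b" by (auto simp: s_def d_def field_simps)
    define W where "W = p * (\<bar>s\<bar> powr (p - 2) * s) * d"
    have 1: "\<bar>\<bar>a\<bar> powr p - \<bar>s\<bar> powr p - W\<bar> <= E" "\<bar>\<bar>b\<bar> powr p - \<bar>s\<bar> powr p + W\<bar> <= E"
      using C(2)[of s d] C(2)[of s "- d"] unfolding sd E_def W_def by auto
    have "\<bar>(x + y) / 2 - z\<bar> <= e" if "\<bar>x - z - w\<bar> <= e" "\<bar>y - z + w\<bar> <= e" for x y z w e :: real
    proof -
      have "\<bar>(x - z - w) + (y - z + w)\<bar> <= e + e" by (rule order_trans[OF abs_triangle_ineq add_mono[OF that]])
      then show ?thesis by (simp add: abs_le_iff field_simps)
    qed
    from this[OF 1] have 2: "\<bar>(\<bar>a\<bar> powr p + \<bar>b\<bar> powr p) / 2 - \<bar>s\<bar> powr p\<bar> <= E" .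
    have mx: "\<bar>x\<bar> powr (p - 2) <= T" if "\<bar>x\<bar> <= max \<bar>a\<bar> \<bar>b\<bar>" for x
    proof -
      have "\<bar>x\<bar> powr (p - 2) <= (max \<bar>a\<bar> \<bar>b\<bar>) powr (p - 2)" using that p by (intro powr_mono2) auto
      also have "\<dots> <= T" by (auto simp: T_def max_def)
      finally show ?thesis .
    qed
    have "E <= C * ((T + T) * d^2)" unfolding E_def
      using C(1) by (intro mult_left_mono mult_right_mono add_mono mx) (auto simp: s_def d_def)
    also have "(T + T) * d^2 = T * (a - b)^2 / 2" by (simp add: d_def power_divide)
    also have "C * (T * (a - b)^2 / 2) <= C * (T * (a - b)^2)" using C(1) by (intro mult_left_mono) (auto simp: T_def)
    finally have "E <= C * (T * (a - b)^2)" .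
    then show ?thesis using 2 unfolding T_def s_def[symmetric] by (rule order_trans[rotated])
  qed
  then show ?thesis using C(1) by blast
qed

text \<open>Restricted to |t| <= 1, the range in which the remainder of the energy along u + t
  \<psi> is bounded by a fixed multiple of t^2.\<close>

lemma small_quadratic_nonneg_imp_zero:
  fixes L B :: real
  assumes h: "!!t. \<bar>t\<bar> <= 1 ==> 0 <= t * L + t^2 * B"
  shows "L = 0"
proof (rule ccontr)
  assume L: "L \<noteq> 0"
  define t where "t = - L / (\<bar>L\<bar> + \<bar>B\<bar> + 1)"
  have D: "\<bar>L\<bar> + \<bar>B\<bar> + 1 > 0" by simp
  have t1: "\<bar>t\<bar> <= 1"
    unfolding t_def abs_divide abs_minus_cancel abs_of_pos[OF D] divide_le_eq_1_pos[OF D] by simp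
  have "t^2 * B <= t^2 * (\<bar>L\<bar> + \<bar>B\<bar>)" by (intro mult_left_mono) auto
  also have "\<dots> < t^2 * (\<bar>L\<bar> + \<bar>B\<bar> + 1)" using L D by (intro mult_strict_left_mono) (auto simp: t_def)
  also have "\<dots> = - t * L" by (simp add: t_def power2_eq_square)
  finally show False using h[OF t1] by simp
qed

section \<open>Bounds and continuity for the individual terms of the energy\<close>

locale kirchhoff =
  fixes V f Q :: "'n::euclidean_space => real" and p c B :: real
  assumes N4: "DIM('n) >= 4" and p2: "2 < p" and pq: "p < 2 * real DIM('n) / (real DIM('n) - 2)"
    and V0: "!!x. 0 <= V x" and Vc: "continuous_on UNIV V"
    and c: "c > 0" and Afin: "emeasure lebesgue {x. V x < c} < \<infinity>"
    and f: "Lhalf f" and Qm [measurable]: "Q \<in> Lmeas" and QB: "!!x. \<bar>Q x\<bar> <= B" and B: "B > 0"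
begin

definition q :: real where "q = 2 * real DIM('n) / (real DIM('n) - 2)"

lemma N3: "DIM('n) >= 3" using N4 by simp

lemma q: "p < q" "2 < q" "q <= 4"
  using N4 pq p2 by (auto simp: q_def field_simps)

definition \<omega> :: "'n => real" where "\<omega> x = 1 + V x + \<bar>f x\<bar>"

lemma \<omega>: "weight \<omega>" unfolding \<omega>_def[abs_def] by (rule weight_Lhalf[OF N3 f Vc V0])

lemma fm [measurable]: "f \<in> Lmeas" using f by (simp add: Lhalf_def)

lemma Vm [measurable]: "V \<in> Lmeas" by (rule continuous_measurable_lebesgue[OF Vc])

definition A :: "'n set" where "A = {x. V x < c}"

lemma LA: "Lhalf (indicator A :: 'n => real)"
proof (rule Lhalf_indicator)
  have "A = {x\<in>space lebesgue. V x < c}" by (auto simp: A_def)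
  also have "\<dots> \<in> sets lebesgue" by measurable
  finally show "A \<in> sets lebesgue" .
qed (use Afin in \<open>simp add: A_def\<close>)

lemma dominated: "\<bar>f x\<bar> <= 1 * \<omega> x" "\<bar>V x\<bar> <= 1 * \<omega> x" "\<bar>1\<bar> <= 1 * \<omega> x"
  using V0[of x] by (auto simp: \<omega>_def)

abbreviation "Fq \<phi> \<equiv> (LI x. f x * (\<phi> x)^2)"
abbreviation "Vq \<phi> \<equiv> (LI x. V x * (\<phi> x)^2)"
abbreviation "Pq \<phi> \<equiv> (LI x. Q x * \<bar>\<phi> x\<bar> powr p)"
abbreviation "Aq \<phi> \<equiv> (LI x. \<bar>indicator A x\<bar> * (\<phi> x)^2)"
abbreviation "test \<equiv> test_fun (UNIV :: 'n set)"

lemma Vq_nonneg: "Vq \<phi> >= 0"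
  using V0 by (intro integral_nonneg_AE) auto

lemma test_int:
  assumes "test \<phi>"
  shows "L1f (%x. f x * (\<phi> x)^2)" "L1f (%x. V x * (\<phi> x)^2)" "L1f (%x. (\<phi> x)^2)"
    "L1f (%x. \<bar>indicator A x\<bar> * (\<phi> x)^2)" "L1f (%x. \<bar>f x\<bar> * (\<phi> x)^2)"
    "L1f (%x. Q x * \<bar>\<phi> x\<bar> powr p)"
proof -
  show "L1f (%x. f x * (\<phi> x)^2)" by (rule weighted_test_integrable(2)[OF \<omega> assms assms fm dominated(1)])
  show "L1f (%x. V x * (\<phi> x)^2)" by (rule weighted_test_integrable(2)[OF \<omega> assms assms Vm dominated(2)])
  show "L1f (%x. (\<phi> x)^2)" using test_L2f(1)[OF assms] by (simp add: L2f_def)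
  show "L1f (%x. \<bar>indicator A x\<bar> * (\<phi> x)^2)" "L1f (%x. \<bar>f x\<bar> * (\<phi> x)^2)"
    using holder_sobolev_Lhalf[OF N3] LA f assms by blast+
  note [measurable] = test_meas(1)[OF assms]
  show "L1f (%x. Q x * \<bar>\<phi> x\<bar> powr p)"
  proof (rule Bochner_Integration.integrable_bound[where f = "%x. B * \<bar>\<phi> x\<bar> powr p"])
    show "L1f (%x. B * \<bar>\<phi> x\<bar> powr p)" using test_integrable_powr(1)[OF assms, of p] p2 by simp
  qed (use QB B in \<open>auto simp: abs_mult intro!: AE_I2 mult_right_mono\<close>)
qed

text \<open>Where V >= c the L^2 mass is paid for by the potential term; the rest lives on the set
  \<open>A\<close> of finite measure, whose indicator is an admissible potential. This is how a
  large \<mu> controls the L^2 norm.\<close>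

lemma L2_split: "test \<phi> ==> (LI x. (\<phi> x)^2) <= Vq \<phi> / c + Aq \<phi>"
proof -
  assume t: "test \<phi>"
  have "(LI x. (\<phi> x)^2) <= (LI x. V x * (\<phi> x)^2 / c + \<bar>indicator A x\<bar> * (\<phi> x)^2)"
  proof (rule integral_mono)
    show "(\<phi> x)^2 <= V x * (\<phi> x)^2 / c + \<bar>indicator A x\<bar> * (\<phi> x)^2" for x
    proof (cases "x \<in> A")
      case False
      then have "c * (\<phi> x)^2 <= V x * (\<phi> x)^2" by (intro mult_right_mono) (auto simp: A_def)
      then show ?thesis using False c by (simp add: field_simps)
    qed (use V0[of x] c in simp)
  qed (use test_int[OF t] in auto)
  then show ?thesis using test_int[OF t] by simp
qed

text \<open>One constant for all uses of Sobolev's inequality. In the last bound |\<phi>|^(q-2)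
  itself serves as the potential in L^(N/2), since (q-2) N/2 = q.\<close>

lemma sobolev_bounds:
  "\<exists>K>0. (\<forall>\<phi>. test \<phi> \<longrightarrow> (LI x. \<bar>\<phi> x\<bar> powr q) <= K * gnorm2 \<phi> powr (q / 2)) \<and>
    (\<forall>\<phi>. test \<phi> \<longrightarrow> Aq \<phi> <= K * gnorm2 \<phi> \<and> (LI x. \<bar>f x\<bar> * (\<phi> x)^2) <= K * gnorm2 \<phi>) \<and>
    (\<forall>\<phi> \<psi>. test \<phi> \<longrightarrow> test \<psi> \<longrightarrow> L1f (%x. \<bar>\<phi> x\<bar> powr (q - 2) * (\<psi> x)^2) \<and>
       (LI x. \<bar>\<phi> x\<bar> powr (q - 2) * (\<psi> x)^2) <= K * (LI x. \<bar>\<phi> x\<bar> powr q) powr (2 / real DIM('n)) * gnorm2 \<psi>)"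
proof -
  obtain K1 where K1: "K1 > 0" "!!\<phi> :: 'n => real. test \<phi> ==> (LI x. \<bar>\<phi> x\<bar> powr q) <= K1 * gnorm2 \<phi> powr (q / 2)"
    using sobolev_test[OF N3] unfolding q_def by blast
  obtain K2 where K2: "K2 > 0" "\<forall>(h :: 'n => real) \<phi>. Lhalf h \<longrightarrow> test \<phi> \<longrightarrow>
      L1f (%x. \<bar>h x\<bar> * (\<phi> x)^2) \<and>
      (LI x. \<bar>h x\<bar> * (\<phi> x)^2) <= K2 * (LI x. \<bar>h x\<bar> powr (real DIM('n) / 2)) powr (2 / real DIM('n)) * gnorm2 \<phi>"
    using holder_sobolev_Lhalf[OF N3] by blast
  define I where "I h = (LI x. \<bar>h x\<bar> powr (real DIM('n) / 2)) powr (2 / real DIM('n))" for h :: "'n => real"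
  define K where "K = K1 + K2 + K2 * I (indicator A) + K2 * I f"
  have I0: "I h >= 0" for h by (simp add: I_def)
  have K: "K > 0" "K1 <= K" "K2 <= K" "K2 * I (indicator A) <= K" "K2 * I f <= K"
    using K1(1) K2(1) I0 by (auto simp: K_def add_pos_nonneg intro!: add_increasing add_increasing2)
  have 3: "L1f (%x. \<bar>\<phi> x\<bar> powr (q - 2) * (\<psi> x)^2) \<and>
       (LI x. \<bar>\<phi> x\<bar> powr (q - 2) * (\<psi> x)^2) <= K * (LI x. \<bar>\<phi> x\<bar> powr q) powr (2 / real DIM('n)) * gnorm2 \<psi>"
    if t: "test \<phi>" "test \<psi>" for \<phi> \<psi>
  proof -
    note [measurable] = test_meas(1)[OF t(1)]
    have e: "(q - 2) * (real DIM('n) / 2) = q" using N4 by (simp add: q_def field_simps)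
    have e2: "\<bar>\<bar>\<phi> x\<bar> powr (q - 2)\<bar> powr (real DIM('n) / 2) = \<bar>\<phi> x\<bar> powr q" for x
    proof -
      have "\<bar>\<bar>\<phi> x\<bar> powr (q - 2)\<bar> = \<bar>\<phi> x\<bar> powr (q - 2)" by simp
      then show ?thesis by (simp only: powr_powr e)
    qed
    have L: "Lhalf (%x. \<bar>\<phi> x\<bar> powr (q - 2))"
      unfolding Lhalf_def e2 using test_integrable_powr(1)[OF t(1), of q] q by simp
    have "K2 * (LI x. \<bar>\<phi> x\<bar> powr q) powr (2 / real DIM('n)) * gnorm2 \<psi> <= K * (LI x. \<bar>\<phi> x\<bar> powr q) powr (2 / real DIM('n)) * gnorm2 \<psi>"
      using K(3) gnorm2_nonneg by (intro mult_right_mono) auto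
    then show ?thesis using K2(2)[rule_format, OF L t(2)] unfolding e2 by simp
  qed
  have m: "x <= K * y" if "x <= k * y" "k <= K" "0 <= y" for x y k using that by (meson mult_right_mono order_trans)
  have 2: "Aq \<phi> <= K * gnorm2 \<phi> \<and> (LI x. \<bar>f x\<bar> * (\<phi> x)^2) <= K * gnorm2 \<phi>" if "test \<phi>" for \<phi>
    using m[OF _ K(4) gnorm2_nonneg] m[OF _ K(5) gnorm2_nonneg] K2(2)[rule_format, OF LA that] K2(2)[rule_format, OF f that]
    unfolding I_def by blast
  show ?thesis using K(1) 3 2 m[OF K1(2) K(2)] by (intro exI[of _ K]) auto
qed

lemma weighted_limits:
  assumes H: "H1lim \<omega> \<phi> u g"
  shows "(%n. Fq (\<phi> n)) ----> Fq u" "(%n. Vq (\<phi> n)) ----> Vq u"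
  using H1lim_weighted(1)[OF H H fm dominated(1)] H1lim_weighted(1)[OF H H Vm dominated(2)]
  by (simp_all add: power2_eq_square mult.assoc)

text \<open>Fatou's lemma and Sobolev's inequality for differences of approximants give convergence
  in L^q; with convergence in L^2 and 2 < p < q this gives convergence in L^p. For the term with Q a
  Brezis-Lieb type truncation of the error is used.\<close>

lemma Lp_limit:
  assumes H: "H1lim \<omega> \<phi> u g"
  shows "L1f (%x. \<bar>u x\<bar> powr p)" "(%n. Pq (\<phi> n)) ----> Pq u"
proof -
  note Hf = H1lim_facts[OF H]
  note [measurable] = Hf(3) test_meas(1)[OF Hf(2)]
  obtain K where K: "K > 0" "!!\<phi>. test \<phi> ==> (LI x. \<bar>\<phi> x\<bar> powr q) <= K * gnorm2 \<phi> powr (q / 2)"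
    using sobolev_bounds by blast
  define b where "b n = (LI x. (norm (cgrad (\<phi> n) x - g x))^2)" for n
  have lim: "AE x in lebesgue. (%n. \<phi> n x) ----> u x" using H by (simp add: H1lim_def)
  have sq: "(\<integral>\<^sup>+x. ennreal (\<bar>\<phi> n x - u x\<bar> powr q) \<partial>lebesgue) <= ennreal (K * b n powr (q / 2))" for n
  proof -
    have dt: "test (%x. \<phi> n x - \<phi> m x)" for m by (rule test_diff[OF Hf(2) Hf(2)])
    have "(\<integral>\<^sup>+x. ennreal (\<bar>\<phi> n x - u x\<bar> powr q) \<partial>lebesgue) = (\<integral>\<^sup>+x. liminf (%m. ennreal (\<bar>\<phi> n x - \<phi> m x\<bar> powr q)) \<partial>lebesgue)"
    proof (rule nn_integral_cong_AE)
      show "AE x in lebesgue. ennreal (\<bar>\<phi> n x - u x\<bar> powr q) = liminf (%m. ennreal (\<bar>\<phi> n x - \<phi> m x\<bar> powr q))"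
        using lim
      proof eventually_elim
        fix x assume "(%n. \<phi> n x) ----> u x"
        then have "(%m. \<bar>\<phi> n x - \<phi> m x\<bar> powr q) ----> \<bar>\<phi> n x - u x\<bar> powr q"
          using q by (intro tendsto_powr' tendsto_rabs tendsto_diff tendsto_const) auto
        then show "ennreal (\<bar>\<phi> n x - u x\<bar> powr q) = liminf (%m. ennreal (\<bar>\<phi> n x - \<phi> m x\<bar> powr q))"
          by (intro lim_imp_Liminf[OF sequentially_bot, symmetric] tendsto_ennrealI)
      qed
    qed
    also have "\<dots> <= liminf (%m. \<integral>\<^sup>+x. ennreal (\<bar>\<phi> n x - \<phi> m x\<bar> powr q) \<partial>lebesgue)"
      by (rule nn_integral_liminf) measurable
    also have "\<dots> <= liminf (%m. ennreal (K * gnorm2 (%x. \<phi> n x - \<phi> m x) powr (q / 2)))"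
    proof (rule Liminf_mono, rule always_eventually, rule allI)
      fix m
      have "(\<integral>\<^sup>+x. ennreal (\<bar>\<phi> n x - \<phi> m x\<bar> powr q) \<partial>lebesgue) = ennreal (LI x. \<bar>\<phi> n x - \<phi> m x\<bar> powr q)"
        by (rule nn_integral_eq_integral) (use test_integrable_powr(1)[OF dt, of q] q in auto)
      then show "(\<integral>\<^sup>+x. ennreal (\<bar>\<phi> n x - \<phi> m x\<bar> powr q) \<partial>lebesgue) <= ennreal (K * gnorm2 (%x. \<phi> n x - \<phi> m x) powr (q / 2))"
        using K(2)[OF dt] by (simp add: ennreal_leI)
    qed
    also have "\<dots> = ennreal (K * b n powr (q / 2))"
    proof (rule lim_imp_Liminf[OF sequentially_bot], rule tendsto_ennrealI)
      have mt: "test (%x. - 1 * \<phi> n x)" by (rule test_scale[OF Hf(2)])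
      have "(%m. gnorm2 (%x. \<phi> m x + - 1 * \<phi> n x)) ----> (LI x. (norm (g x + cgrad (%x. - 1 * \<phi> n x) x))^2)"
        by (rule H1lim_gnorm2[OF H1lim_add_test[OF H mt]])
      moreover have "gnorm2 (%x. \<phi> m x + - 1 * \<phi> n x) = gnorm2 (%x. \<phi> n x - \<phi> m x)" for m
        using gnorm2_diff[OF Hf(2) Hf(2), of m n] gnorm2_diff[OF Hf(2) Hf(2), of n m] by (simp add: norm_minus_commute)
      moreover have "(LI x. (norm (g x + cgrad (%x. - 1 * \<phi> n x) x))^2) = b n"
        using cgrad_scale[OF test_smooth[OF Hf(2)], of "- 1" n] by (simp add: b_def norm_minus_commute)
      ultimately have "(%m. gnorm2 (%x. \<phi> n x - \<phi> m x)) ----> b n" by simp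
      then show "(%m. K * gnorm2 (%x. \<phi> n x - \<phi> m x) powr (q / 2)) ----> K * b n powr (q / 2)"
        using q by (intro tendsto_mult tendsto_const tendsto_powr') (auto simp: gnorm2_nonneg)
    qed
    finally show ?thesis .
  qed
  have iq: "L1f (%x. \<bar>\<phi> n x - u x\<bar> powr q)" for n
    by (rule integrableI_nonneg) (use le_less_trans[OF sq[of n] ennreal_less_top] in auto)
  have iqle: "(LI x. \<bar>\<phi> n x - u x\<bar> powr q) <= K * b n powr (q / 2)" for n
    using sq[of n] nn_integral_eq_integral[OF iq[of n]] K(1) by simp
  have i2: "L1f (%x. (norm (\<phi> n x - u x))^2)" for n
    using L2f_diff[OF test_L2f(1)[OF Hf(2)] Hf(6)] by (simp add: L2f_def)
  have pw: "\<bar>s\<bar> powr p <= \<bar>s\<bar> powr q + (norm s)^2" for s :: real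
  proof (cases "\<bar>s\<bar> <= 1")
    case True
    then have "\<bar>s\<bar> powr p <= \<bar>s\<bar> powr 2" using p2 by (intro powr_mono') auto
    then show ?thesis by (cases "s = 0") (auto simp: powr_numeral intro: order_trans)
  next
    case False
    then have "\<bar>s\<bar> powr p <= \<bar>s\<bar> powr q" using q by (intro powr_mono) auto
    then show ?thesis by (simp add: add_increasing2)
  qed
  have ip: "L1f (%x. \<bar>\<phi> n x - u x\<bar> powr p)" for n
  proof (rule Bochner_Integration.integrable_bound)
    show "L1f (%x. \<bar>\<phi> n x - u x\<bar> powr q + (norm (\<phi> n x - u x))^2)"
      by (rule Bochner_Integration.integrable_add[OF iq i2])
  qed (use pw in auto)
  have p0: "(%n. LI x. \<bar>\<phi> n x - u x\<bar> powr p) ----> 0"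
  proof (rule tendsto_sandwich[OF _ _ tendsto_const])
    show "\<forall>\<^sub>F n in sequentially. 0 <= (LI x. \<bar>\<phi> n x - u x\<bar> powr p)" by simp
    have "(LI x. \<bar>\<phi> n x - u x\<bar> powr p) <= K * b n powr (q / 2) + (LI x. (norm (\<phi> n x - u x))^2)" for n
    proof -
      have "(LI x. \<bar>\<phi> n x - u x\<bar> powr p) <= (LI x. \<bar>\<phi> n x - u x\<bar> powr q + (norm (\<phi> n x - u x))^2)"
        by (rule integral_mono[OF ip Bochner_Integration.integrable_add[OF iq i2] pw])
      also have "\<dots> = (LI x. \<bar>\<phi> n x - u x\<bar> powr q) + (LI x. (norm (\<phi> n x - u x))^2)"
        by (rule Bochner_Integration.integral_add[OF iq i2])
      finally show ?thesis using iqle[of n] by linarith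
    qed
    then show "\<forall>\<^sub>F n in sequentially. (LI x. \<bar>\<phi> n x - u x\<bar> powr p) <= K * b n powr (q / 2) + (LI x. (norm (\<phi> n x - u x))^2)" by simp
    have "(%n. K * b n powr (q / 2) + (LI x. (norm (\<phi> n x - u x))^2)) ----> K * 0 powr (q / 2) + 0"
      using Hf(7,8) q by (intro tendsto_add tendsto_mult tendsto_const tendsto_powr') (auto simp: L2c_def b_def)
    then show "(%n. K * b n powr (q / 2) + (LI x. (norm (\<phi> n x - u x))^2)) ----> 0" by simp
  qed
  have tri: "\<bar>s\<bar> powr p <= 2 powr p * (\<bar>s - t\<bar> powr p + \<bar>t\<bar> powr p)" for s t :: real
  proof -
    have "\<bar>s\<bar> powr p <= (\<bar>s - t\<bar> + \<bar>t\<bar>) powr p" using p2 by (intro powr_mono2) auto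
    then show ?thesis using max_powr_le[of p "s - t" t] p2 by linarith
  qed
  show iu: "L1f (%x. \<bar>u x\<bar> powr p)"
  proof (rule Bochner_Integration.integrable_bound)
    show "L1f (%x. 2 powr p * (\<bar>\<phi> 0 x - u x\<bar> powr p + \<bar>\<phi> 0 x\<bar> powr p))"
      using ip[of 0] test_integrable_powr(1)[OF Hf(2), of p 0] p2 by simp
    show "AE x in lebesgue. norm (\<bar>u x\<bar> powr p) <= norm (2 powr p * (\<bar>\<phi> 0 x - u x\<bar> powr p + \<bar>\<phi> 0 x\<bar> powr p))"
      using tri[of "u _" "\<phi> 0 _"] by (intro AE_I2) (simp add: abs_minus_commute)
  qed measurable
  define E where "E n x = \<bar>Q x * \<bar>\<phi> n x\<bar> powr p - Q x * \<bar>u x\<bar> powr p\<bar>" for n x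
  define T where "T = B * 2 powr p"
  have T0: "T >= 0" using B by (simp add: T_def)
  have iQu: "L1f (%x. Q x * \<bar>u x\<bar> powr p)"
  proof (rule Bochner_Integration.integrable_bound)
    show "L1f (%x. B * \<bar>u x\<bar> powr p)" using iu by simp
  qed (use QB B in \<open>auto simp: abs_mult intro!: AE_I2 mult_right_mono\<close>)
  have iE: "L1f (E n)" for n unfolding E_def using iQu test_int(6)[OF Hf(2)] by simp
  have Eb: "E n x <= T * \<bar>\<phi> n x - u x\<bar> powr p + (T + B) * \<bar>u x\<bar> powr p" for n x
  proof -
    have "E n x = \<bar>Q x\<bar> * \<bar>\<bar>\<phi> n x\<bar> powr p - \<bar>u x\<bar> powr p\<bar>" by (simp add: E_def abs_mult[symmetric] right_diff_distrib)
    also have "\<dots> <= B * (\<bar>\<phi> n x\<bar> powr p + \<bar>u x\<bar> powr p)" using QB[of x] B abs_triangle_ineq4[of "\<bar>\<phi> n x\<bar> powr p" "\<bar>u x\<bar> powr p"] by (intro mult_mono) auto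
    also have "\<dots> <= B * (2 powr p * (\<bar>\<phi> n x - u x\<bar> powr p + \<bar>u x\<bar> powr p) + \<bar>u x\<bar> powr p)"
      using tri[of "\<phi> n x" "u x"] B by (intro mult_left_mono) auto
    finally show ?thesis by (simp add: T_def algebra_simps)
  qed
  \<comment> \<open>The error exceeds T |\<phi> n - u|^p by at most (T + B) |u|^p, so its positive
    excess has an integrable majorant, while the subtracted part is already known to vanish.\<close>
  have m0: "(%n. LI x. max 0 (E n x - T * \<bar>\<phi> n x - u x\<bar> powr p)) ----> (LINT x|(lebesgue::'n measure). 0)"
  proof (rule integral_dominated_convergence[where w = "%x. (T + B) * \<bar>u x\<bar> powr p"])
    show "L1f (%x. (T + B) * \<bar>u x\<bar> powr p)" using iu by simp
    show "AE x in lebesgue. (%n. max 0 (E n x - T * \<bar>\<phi> n x - u x\<bar> powr p)) ----> 0"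
      using lim
    proof eventually_elim
      fix x assume l: "(%n. \<phi> n x) ----> u x"
      have "(%n. max 0 (E n x - T * \<bar>\<phi> n x - u x\<bar> powr p)) ----> max 0 (\<bar>Q x * \<bar>u x\<bar> powr p - Q x * \<bar>u x\<bar> powr p\<bar> - T * \<bar>u x - u x\<bar> powr p)"
        unfolding E_def using p2 by (intro tendsto_max tendsto_const tendsto_diff tendsto_rabs tendsto_mult tendsto_powr' l) auto
      then show "(%n. max 0 (E n x - T * \<bar>\<phi> n x - u x\<bar> powr p)) ----> 0" by simp
    qed
    show "AE x in lebesgue. norm (max 0 (E n x - T * \<bar>\<phi> n x - u x\<bar> powr p)) <= (T + B) * \<bar>u x\<bar> powr p" for n
      using Eb[of n] T0 B by (intro AE_I2) (simp add: algebra_simps)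
    show "(%x. max 0 (E n x - T * \<bar>\<phi> n x - u x\<bar> powr p)) \<in> Lmeas" for n unfolding E_def by measurable
  qed simp
  have "(%n. Pq (\<phi> n) - Pq u) ----> 0"
  proof (rule Lim_null_comparison)
    have "norm (Pq (\<phi> n) - Pq u) <= (LI x. max 0 (E n x - T * \<bar>\<phi> n x - u x\<bar> powr p)) + T * (LI x. \<bar>\<phi> n x - u x\<bar> powr p)" for n
    proof -
      have im: "L1f (%x. max 0 (E n x - T * \<bar>\<phi> n x - u x\<bar> powr p))" using iE[of n] ip[of n] by (intro integrable_max) auto
      have "norm (Pq (\<phi> n) - Pq u) = \<bar>LI x. Q x * \<bar>\<phi> n x\<bar> powr p - Q x * \<bar>u x\<bar> powr p\<bar>"
        using iQu test_int(6)[OF Hf(2)] by simp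
      also have "\<dots> <= (LI x. E n x)" unfolding E_def by (rule integral_abs_bound)
      also have "\<dots> <= (LI x. max 0 (E n x - T * \<bar>\<phi> n x - u x\<bar> powr p) + T * \<bar>\<phi> n x - u x\<bar> powr p)"
        by (rule integral_mono[OF iE]) (use im ip[of n] in auto)
      also have "\<dots> = (LI x. max 0 (E n x - T * \<bar>\<phi> n x - u x\<bar> powr p)) + T * (LI x. \<bar>\<phi> n x - u x\<bar> powr p)"
        using im ip[of n] by (subst Bochner_Integration.integral_add) auto
      finally show ?thesis .
    qed
    then show "\<forall>\<^sub>F n in sequentially. norm (Pq (\<phi> n) - Pq u) <= (LI x. max 0 (E n x - T * \<bar>\<phi> n x - u x\<bar> powr p)) + T * (LI x. \<bar>\<phi> n x - u x\<bar> powr p)" by simp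
    show "(%n. (LI x. max 0 (E n x - T * \<bar>\<phi> n x - u x\<bar> powr p)) + T * (LI x. \<bar>\<phi> n x - u x\<bar> powr p)) ----> 0"
      using tendsto_add[OF m0 tendsto_mult[OF tendsto_const[of T] p0]] by simp
  qed
  then show "(%n. Pq (\<phi> n)) ----> Pq u" by (rule LIM_zero_cancel)
qed

end

context kirchhoff
begin

section \<open>Energy estimates for test functions\<close>

definition Jt :: "real => real => real => ('n => real) => real" where
  "Jt a lam \<mu> \<phi> = J_fun a p \<mu> lam V f Q \<phi> (cgrad \<phi>)"

lemma Jt_eq: "Jt a lam \<mu> \<phi> = a / 4 * (gnorm2 \<phi>)^2 + 1 / 2 * (gnorm2 \<phi> + \<mu> * Vq \<phi>) - 1 / p * Pq \<phi> - lam / 2 * Fq \<phi>"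
  by (simp add: Jt_def J_fun_def gnorm2_def)

lemma Fq_abs: "test \<phi> ==> \<bar>Fq \<phi>\<bar> <= (LI x. \<bar>f x\<bar> * (\<phi> x)^2)"
  using integral_abs_bound[of lebesgue "%x. f x * (\<phi> x)^2"] by (simp add: abs_mult)

text \<open>The power is split as |s|^p <= \<kappa> |s|^q + L s^2. The first part is absorbed by the
  quartic term, the second goes through \<open>L2_split\<close> into the potential term and the
  gradient. The constants are uniform in \<mu>, so that the threshold is fixed before any minimizing
  sequence is chosen.\<close>

lemma coercive:
  assumes a: "a > 0" and lam: "lam >= 0"
  shows "\<exists>\<mu>1>0. \<exists>M>0. \<forall>\<mu>\<ge>\<mu>1. \<forall>\<phi>. test \<phi> \<longrightarrow> a / 8 * (gnorm2 \<phi>)^2 - M * gnorm2 \<phi> - M <= Jt a lam \<mu> \<phi>"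
proof -
  obtain K where K: "K > 0" "!!\<phi>. test \<phi> ==> (LI x. \<bar>\<phi> x\<bar> powr q) <= K * gnorm2 \<phi> powr (q / 2)"
    "!!\<phi>. test \<phi> ==> Aq \<phi> <= K * gnorm2 \<phi>" "!!\<phi>. test \<phi> ==> (LI x. \<bar>f x\<bar> * (\<phi> x)^2) <= K * gnorm2 \<phi>"
    using sobolev_bounds by blast
  \<comment> \<open>Gives B \<kappa> K / p = a/8, half of the quartic coefficient a/4.\<close>
  define \<kappa> where "\<kappa> = a * p / (8 * B * K)"
  have k0: "\<kappa> > 0" using a p2 B K(1) by (simp add: \<kappa>_def)
  obtain L where L: "L > 0" "!!s. s >= 0 ==> s powr (p - 2) <= \<kappa> * s powr (q - 2) + L"
    using powr_split[of "p - 2" "q - 2" \<kappa>] q p2 k0 by auto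
  \<comment> \<open>The L^2 remainder contributes B L / (p c) times the potential term, which
    \<mu>/2 has to dominate.\<close>
  define \<mu>1 where "\<mu>1 = 2 * B * L / (p * c) + 1"
  define M where "M = a / 8 + B * L * K / p + lam * K / 2"
  have m1: "\<mu>1 > 0" using B L(1) p2 c by (simp add: \<mu>1_def add_nonneg_pos)
  have M0: "M > 0" using a B L(1) K(1) p2 lam by (simp add: M_def add_pos_nonneg)
  have "a / 8 * (gnorm2 \<phi>)^2 - M * gnorm2 \<phi> - M <= Jt a lam \<mu> \<phi>" if \<mu>: "\<mu> >= \<mu>1" and t: "test \<phi>" for \<mu> \<phi>
  proof -
    define D where "D = gnorm2 \<phi>"
    define v where "v = Vq \<phi>"
    have D0: "D >= 0" and v0: "v >= 0" using gnorm2_nonneg Vq_nonneg by (auto simp: D_def v_def)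
    have i: "L1f (%x. \<bar>\<phi> x\<bar> powr r)" if "r > 0" for r by (rule test_integrable_powr(1)[OF t that])
    have ip: "L1f (%x. \<bar>\<phi> x\<bar> powr p)" "L1f (%x. \<bar>\<phi> x\<bar> powr q)" using i p2 q by auto
    have "(LI x. \<bar>\<phi> x\<bar> powr p) <= (LI x. \<kappa> * \<bar>\<phi> x\<bar> powr q + L * (\<phi> x)^2)"
    proof (rule integral_mono[OF ip(1)])
      show "L1f (%x. \<kappa> * \<bar>\<phi> x\<bar> powr q + L * (\<phi> x)^2)" using ip(2) test_int(3)[OF t] by simp
      fix x
      have e: "\<bar>\<phi> x\<bar> powr r = \<bar>\<phi> x\<bar> powr (r - 2) * (\<phi> x)^2" for r using powr_add[of "\<bar>\<phi> x\<bar>" "r - 2" 2] by simp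
      have "\<bar>\<phi> x\<bar> powr (p - 2) * (\<phi> x)^2 <= (\<kappa> * \<bar>\<phi> x\<bar> powr (q - 2) + L) * (\<phi> x)^2" by (intro mult_right_mono L(2)) auto
      then show "\<bar>\<phi> x\<bar> powr p <= \<kappa> * \<bar>\<phi> x\<bar> powr q + L * (\<phi> x)^2" unfolding e[of p] e[of q] by (simp add: algebra_simps)
    qed
    also have "\<dots> = \<kappa> * (LI x. \<bar>\<phi> x\<bar> powr q) + L * (LI x. (\<phi> x)^2)" using ip(2) test_int(3)[OF t] by simp
    also have "\<dots> <= \<kappa> * (K * (1 + D^2)) + L * (v / c + K * D)"
    proof (intro add_mono mult_left_mono)
      \<comment> \<open>Here the dimension enters: N >= 4 gives q / 2 <= 2.\<close>
      have "D powr (q / 2) <= 1 + D^2"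
      proof (cases "D <= 1")
        case True
        then have "D powr (q / 2) <= 1" using D0 q by (intro powr_le1) auto
        then show ?thesis by (simp add: add_increasing2)
      next
        case False
        then have "D powr (q / 2) <= D powr 2" using q by (intro powr_mono) auto
        then show ?thesis using False by (simp add: powr_numeral)
      qed
      then show "(LI x. \<bar>\<phi> x\<bar> powr q) <= K * (1 + D^2)"
        using order_trans[OF K(2)[OF t] mult_left_mono[OF _ less_imp_le[OF K(1)]]] unfolding D_def by blast
      show "(LI x. (\<phi> x)^2) <= v / c + K * D" using L2_split[OF t] K(3)[OF t] by (simp add: v_def D_def)
    qed (use k0 L in auto)
    finally have 1: "(LI x. \<bar>\<phi> x\<bar> powr p) <= \<kappa> * (K * (1 + D^2)) + L * (v / c + K * D)" .
    have "Pq \<phi> <= (LI x. B * \<bar>\<phi> x\<bar> powr p)"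
      by (rule integral_mono[OF test_int(6)[OF t]]) (use ip QB in \<open>auto intro!: mult_right_mono intro: order_trans[OF abs_ge_self]\<close>)
    also have "\<dots> <= B * (\<kappa> * (K * (1 + D^2)) + L * (v / c + K * D))" using 1 B by simp
    finally have "1 / p * Pq \<phi> <= 1 / p * (B * (\<kappa> * (K * (1 + D^2)) + L * (v / c + K * D)))" using p2 by (intro mult_left_mono) auto
    also have "\<dots> = a / 8 * (1 + D^2) + B * L / (p * c) * v + B * L * K / p * D"
      using p2 B K(1) by (simp add: \<kappa>_def field_simps)
    finally have 2: "1 / p * Pq \<phi> <= a / 8 * (1 + D^2) + B * L / (p * c) * v + B * L * K / p * D" .
    have "Fq \<phi> <= K * D" using Fq_abs[OF t] K(4)[OF t] unfolding D_def by linarith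
    then have 3: "lam / 2 * Fq \<phi> <= lam / 2 * (K * D)" using lam by (intro mult_left_mono) auto
    have "2 * (B * L / (p * c)) + 1 <= \<mu>" using \<mu> by (simp add: \<mu>1_def mult.assoc)
    then have "B * L / (p * c) <= \<mu> / 2" by linarith
    then have 4: "B * L / (p * c) * v <= \<mu> / 2 * v" using v0 by (rule mult_right_mono)
    have "Jt a lam \<mu> \<phi> = a / 4 * D^2 + D / 2 + \<mu> / 2 * v - 1 / p * Pq \<phi> - lam / 2 * Fq \<phi>" by (simp add: Jt_eq D_def v_def algebra_simps)
    also have "\<dots> >= a / 4 * D^2 - a / 8 * (1 + D^2) - B * L * K / p * D - lam / 2 * (K * D)" using 2 3 4 D0 by linarith
    also have "a / 4 * D^2 - a / 8 * (1 + D^2) - B * L * K / p * D - lam / 2 * (K * D) = a / 8 * D^2 - (B * L * K / p + lam * K / 2) * D - a / 8"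
      by (simp add: algebra_simps)
    finally have 5: "a / 8 * D^2 - (B * L * K / p + lam * K / 2) * D - a / 8 <= Jt a lam \<mu> \<phi>" .
    have "(B * L * K / p + lam * K / 2) * D <= M * D" using D0 a by (intro mult_right_mono) (auto simp: M_def)
    then have "a / 8 * D^2 - M * D - a / 8 <= Jt a lam \<mu> \<phi>" using 5 by linarith
    moreover have "a / 8 <= M" using B L(1) K(1) p2 lam by (simp add: M_def)
    ultimately show ?thesis unfolding D_def by linarith
  qed
  then show ?thesis using m1 M0 by blast
qed

text \<open>The parallelogram identity makes minimizing sequences Cauchy: the defect of the power term is
  quadratic in the difference, and for large \<open>\<mu>\<close> it is absorbed except on the set \<open>V < c\<close> of
  finite measure, where compactness is available.\<close>
lemma cauchy_estimate:
  assumes a: "a > 0" and lam: "lam >= 0" and M: "M > 0"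
  shows "\<exists>\<mu>2>0. \<exists>Z>0. \<forall>\<mu>\<ge>\<mu>2. \<forall>m \<phi> \<psi>. (\<forall>\<xi>. test \<xi> \<longrightarrow> m <= Jt a lam \<mu> \<xi>) \<longrightarrow> test \<phi> \<longrightarrow> test \<psi> \<longrightarrow> gnorm2 \<phi> <= M \<longrightarrow> gnorm2 \<psi> <= M \<longrightarrow>
    gnorm2 (%x. \<phi> x - \<psi> x) + (LI x. \<omega> x * (\<phi> x - \<psi> x)^2) \<le>
      Z * ((Jt a lam \<mu> \<phi> + Jt a lam \<mu> \<psi>) / 2 - m + (LI x. \<bar>f x\<bar> * (\<phi> x - \<psi> x)^2) + Aq (%x. \<phi> x - \<psi> x))"
proof -
  obtain K where K: "K > 0" "!!\<phi>. test \<phi> ==> (LI x. \<bar>\<phi> x\<bar> powr q) <= K * gnorm2 \<phi> powr (q / 2)"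
    "!!\<phi> \<psi>. test \<phi> ==> test \<psi> ==> L1f (%x. \<bar>\<phi> x\<bar> powr (q - 2) * (\<psi> x)^2)"
    "!!\<phi> \<psi>. test \<phi> ==> test \<psi> ==> (LI x. \<bar>\<phi> x\<bar> powr (q - 2) * (\<psi> x)^2) <= K * (LI x. \<bar>\<phi> x\<bar> powr q) powr (2 / real DIM('n)) * gnorm2 \<psi>"
    using sobolev_bounds by blast
  obtain C where C: "C > 0" "!!s t :: real. \<bar>(\<bar>s\<bar> powr p + \<bar>t\<bar> powr p) / 2 - \<bar>(s + t) / 2\<bar> powr p\<bar> <= C * ((\<bar>s\<bar> powr (p - 2) + \<bar>t\<bar> powr (p - 2)) * (s - t)^2)"
    using powr_midpoint[OF p2] by blast
  \<comment> \<open>Bounds the integral of |\<phi>|^(q-2) w^2 by \<open>S\<close> times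
    \<open>gnorm2 w\<close>, for all \<phi> with Dirichlet integral at most M.\<close>
  define S where "S = K * (K * M powr (q / 2)) powr (2 / real DIM('n))"
  have S0: "S >= 0" using K(1) by (simp add: S_def)
  define C1 where "C1 = B * C / p"
  have C10: "C1 > 0" using B C p2 by (simp add: C1_def)
  \<comment> \<open>The midpoint comparison gains \<open>gnorm2 w / 8\<close>; half of this, 1/16,
    is spent on the critical part of the power term.\<close>
  define \<kappa> where "\<kappa> = 1 / (32 * C1 * (S + 1))"
  have k0: "\<kappa> > 0" using C10 S0 by (simp add: \<kappa>_def)
  have kS: "C1 * (2 * \<kappa> * S) <= 1 / 16"
  proof -
    have "C1 * (2 * \<kappa> * S) = S / (16 * (S + 1))" using C10 by (simp add: \<kappa>_def)
    also have "\<dots> <= 1 / 16" using S0 by (simp add: divide_simps)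
    finally show ?thesis .
  qed
  obtain L where L: "L > 0" "!!s. s >= 0 ==> s powr (p - 2) <= \<kappa> * s powr (q - 2) + L"
    using powr_split[of "p - 2" "q - 2" \<kappa>] q p2 k0 by auto
  \<comment> \<open>Likewise half of the gain \<mu>/8 in the potential term has to cover 2 C1 L /
    c.\<close>
  define \<mu>2 where "\<mu>2 = 32 * C1 * L / c"
  define Z1 where "Z1 = 1 + lam + 2 * C1 * L"
  define Z where "Z = (16 + (1 / c + 1) * (16 / \<mu>2)) * Z1 + 1"
  have m2: "\<mu>2 > 0" using C10 L(1) c by (simp add: \<mu>2_def)
  have Z1: "Z1 > 0" "1 <= Z1" "lam / 8 <= Z1" "2 * C1 * L <= Z1" using C10 L(1) lam by (auto simp: Z1_def add_pos_nonneg)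
  have Z0: "Z > 0" using Z1 c m2 by (simp add: Z_def add_nonneg_pos)
  have main: "gnorm2 (%x. \<phi> x - \<psi> x) + (LI x. \<omega> x * (\<phi> x - \<psi> x)^2) \<le>
      Z * ((Jt a lam \<mu> \<phi> + Jt a lam \<mu> \<psi>) / 2 - m + (LI x. \<bar>f x\<bar> * (\<phi> x - \<psi> x)^2) + Aq (%x. \<phi> x - \<psi> x))"
    if \<mu>: "\<mu> >= \<mu>2" and m: "!!\<xi>. test \<xi> ==> m <= Jt a lam \<mu> \<xi>" and t: "test \<phi>" "test \<psi>" and gM: "gnorm2 \<phi> <= M" "gnorm2 \<psi> <= M" for \<mu> m \<phi> \<psi>
  proof -
    define w where "w x = \<phi> x - \<psi> x" for x
    define s where "s x = (1 / 2) * (\<phi> x + \<psi> x)" for x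
    have wt: "test w" unfolding w_def by (rule test_diff[OF t])
    have at: "test (%x. \<phi> x + \<psi> x)" by (rule test_add[OF t])
    have st: "test s" unfolding s_def by (rule test_scale[OF at])
    have sc: "(LI x. h x * (s x)^2) = (LI x. h x * (\<phi> x + \<psi> x)^2) / 4" for h
      unfolding s_def by (simp add: power_mult_distrib power2_eq_square)
    have Ds: "gnorm2 s = (gnorm2 \<phi> + gnorm2 \<psi>) / 2 - gnorm2 w / 4"
      using gnorm2_parallelogram[OF t] gnorm2_scale[OF at, of "1 / 2"] unfolding s_def w_def by (simp add: power2_eq_square field_simps)
    have Vs: "Vq s = (Vq \<phi> + Vq \<psi>) / 2 - Vq w / 4"
      unfolding sc using weighted_parallelogram[OF \<omega> t Vm dominated(2)] unfolding w_def by (simp add: field_simps)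
    have Fs: "Fq s = (Fq \<phi> + Fq \<psi>) / 2 - Fq w / 4"
      unfolding sc using weighted_parallelogram[OF \<omega> t fm dominated(1)] unfolding w_def by (simp add: field_simps)
    have pw: "(\<bar>\<phi> x\<bar> powr (p - 2) + \<bar>\<psi> x\<bar> powr (p - 2)) * (w x)^2 <= \<kappa> * (\<bar>\<phi> x\<bar> powr (q - 2) * (w x)^2) + \<kappa> * (\<bar>\<psi> x\<bar> powr (q - 2) * (w x)^2) + 2 * L * (w x)^2" for x
    proof -
      have "(\<bar>\<phi> x\<bar> powr (p - 2) + \<bar>\<psi> x\<bar> powr (p - 2)) * (w x)^2 <= ((\<kappa> * \<bar>\<phi> x\<bar> powr (q - 2) + L) + (\<kappa> * \<bar>\<psi> x\<bar> powr (q - 2) + L)) * (w x)^2"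
        by (intro mult_right_mono add_mono L(2)) auto
      then show ?thesis by (simp add: algebra_simps)
    qed
    define R where "R x = B * C * (\<kappa> * (\<bar>\<phi> x\<bar> powr (q - 2) * (w x)^2) + \<kappa> * (\<bar>\<psi> x\<bar> powr (q - 2) * (w x)^2) + 2 * L * (w x)^2)" for x
    have Ri: "L1f R" unfolding R_def using K(3)[OF t(1) wt] K(3)[OF t(2) wt] test_int(3)[OF wt] by simp
    have "(Pq \<phi> + Pq \<psi>) / 2 - Pq s = (LI x. (Q x * \<bar>\<phi> x\<bar> powr p + Q x * \<bar>\<psi> x\<bar> powr p) / 2 - Q x * \<bar>s x\<bar> powr p)"
      using test_int(6)[OF t(1)] test_int(6)[OF t(2)] test_int(6)[OF st] by simp
    also have "\<dots> <= (LI x. R x)"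
    proof (rule integral_mono[OF _ Ri])
      show "L1f (%x. (Q x * \<bar>\<phi> x\<bar> powr p + Q x * \<bar>\<psi> x\<bar> powr p) / 2 - Q x * \<bar>s x\<bar> powr p)"
        using test_int(6)[OF t(1)] test_int(6)[OF t(2)] test_int(6)[OF st] by simp
      fix x
      define T where "T = (\<bar>\<phi> x\<bar> powr p + \<bar>\<psi> x\<bar> powr p) / 2 - \<bar>s x\<bar> powr p"
      have "(Q x * \<bar>\<phi> x\<bar> powr p + Q x * \<bar>\<psi> x\<bar> powr p) / 2 - Q x * \<bar>s x\<bar> powr p = Q x * T" by (simp add: T_def algebra_simps)
      also have "\<dots> <= \<bar>Q x\<bar> * \<bar>T\<bar>" by (metis abs_ge_self abs_mult)
      also have "\<dots> <= B * (C * ((\<bar>\<phi> x\<bar> powr (p - 2) + \<bar>\<psi> x\<bar> powr (p - 2)) * (w x)^2))"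
        using C(2)[of "\<phi> x" "\<psi> x"] QB[of x] B by (intro mult_mono) (auto simp: T_def s_def w_def)
      also have "\<dots> <= R x" unfolding R_def using pw[of x] B C(1) by (simp add: mult.assoc)
      finally show "(Q x * \<bar>\<phi> x\<bar> powr p + Q x * \<bar>\<psi> x\<bar> powr p) / 2 - Q x * \<bar>s x\<bar> powr p <= R x" .
    qed
    also have "\<dots> = B * C * (\<kappa> * (LI x. \<bar>\<phi> x\<bar> powr (q - 2) * (w x)^2) + \<kappa> * (LI x. \<bar>\<psi> x\<bar> powr (q - 2) * (w x)^2) + 2 * L * (LI x. (w x)^2))"
      unfolding R_def using K(3)[OF t(1) wt] K(3)[OF t(2) wt] test_int(3)[OF wt] by simp
    also have "\<dots> <= B * C * (\<kappa> * (S * gnorm2 w) + \<kappa> * (S * gnorm2 w) + 2 * L * (Vq w / c + Aq w))"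
    proof -
      have k: "(LI x. \<bar>\<xi> x\<bar> powr (q - 2) * (w x)^2) <= S * gnorm2 w" if x: "test \<xi>" "gnorm2 \<xi> <= M" for \<xi>
      proof -
        have "gnorm2 \<xi> powr (q / 2) <= M powr (q / 2)" using x(2) q gnorm2_nonneg by (intro powr_mono2) auto
        then have "(LI x. \<bar>\<xi> x\<bar> powr q) <= K * M powr (q / 2)" using K(2)[OF x(1)] K(1) by (meson mult_left_mono order_trans less_imp_le)
        then have "K * (LI x. \<bar>\<xi> x\<bar> powr q) powr (2 / real DIM('n)) * gnorm2 w <= S * gnorm2 w"
          unfolding S_def using K(1) gnorm2_nonneg by (intro mult_right_mono mult_left_mono powr_mono2) auto
        then show ?thesis using K(4)[OF x(1) wt] by linarith
      qed
      show ?thesis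
        using B C(1) k0 L(1) by (intro mult_left_mono add_mono k t gM L2_split[OF wt]) auto
    qed
    finally have P1: "(Pq \<phi> + Pq \<psi>) / 2 - Pq s <= B * C * (\<kappa> * (S * gnorm2 w) + \<kappa> * (S * gnorm2 w) + 2 * L * (Vq w / c + Aq w))" .
    have P: "1 / p * ((Pq \<phi> + Pq \<psi>) / 2 - Pq s) <= 1 / 16 * gnorm2 w + \<mu> / 16 * Vq w + 2 * C1 * L * Aq w"
    proof -
      have "1 / p * ((Pq \<phi> + Pq \<psi>) / 2 - Pq s) <= 1 / p * (B * C * (\<kappa> * (S * gnorm2 w) + \<kappa> * (S * gnorm2 w) + 2 * L * (Vq w / c + Aq w)))"
        using P1 p2 by (intro mult_left_mono) auto
      also have "\<dots> = C1 * (2 * \<kappa> * S) * gnorm2 w + 2 * C1 * L / c * Vq w + 2 * C1 * L * Aq w" by (simp add: C1_def algebra_simps add_divide_distrib)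
      also have "\<dots> <= 1 / 16 * gnorm2 w + \<mu> / 16 * Vq w + 2 * C1 * L * Aq w"
        using \<mu> C10 L(1) by (intro add_mono mult_right_mono kS gnorm2_nonneg Vq_nonneg) (auto simp: \<mu>2_def)
      finally show ?thesis .
    qed
    have sq: "(gnorm2 s)^2 <= ((gnorm2 \<phi>)^2 + (gnorm2 \<psi>)^2) / 2"
    proof -
      have "gnorm2 s <= (gnorm2 \<phi> + gnorm2 \<psi>) / 2" using gnorm2_nonneg[of w] unfolding Ds by linarith
      then have "(gnorm2 s)^2 <= ((gnorm2 \<phi> + gnorm2 \<psi>) / 2)^2" using gnorm2_nonneg by (intro power_mono)
      also have "\<dots> <= ((gnorm2 \<phi>)^2 + (gnorm2 \<psi>)^2) / 2"
        using zero_le_power2[of "gnorm2 \<phi> - gnorm2 \<psi>"] by (simp add: power2_eq_square field_simps)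
      finally show ?thesis .
    qed
    define R0 where "R0 = (Jt a lam \<mu> \<phi> + Jt a lam \<mu> \<psi>) / 2 - m"
    define Fa where "Fa = (LI x. \<bar>f x\<bar> * (w x)^2)"
    have R00: "R0 >= 0" using m[OF t(1)] m[OF t(2)] by (simp add: R0_def)
    have Fa0: "Fa >= 0" "Aq w >= 0" by (auto simp: Fa_def intro!: integral_nonneg_AE)
    have "a / 4 * (gnorm2 s)^2 <= a / 4 * (((gnorm2 \<phi>)^2 + (gnorm2 \<psi>)^2) / 2)" using sq a by (intro mult_left_mono) auto
    moreover have e: "k * ((x + y) / 2 - z) = (k * x + k * y) / 2 - k * z" for k x y z :: real by (simp add: algebra_simps)
    moreover have "\<mu> * Vq s = (\<mu> * Vq \<phi> + \<mu> * Vq \<psi>) / 2 - \<mu> / 4 * Vq w" "lam / 2 * Fq s = (lam / 2 * Fq \<phi> + lam / 2 * Fq \<psi>) / 2 - lam / 8 * Fq w"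
      unfolding Vs Fs by (simp_all add: algebra_simps)
    moreover note e[of "1 / p" "Pq \<phi>" "Pq \<psi>" "Pq s"] e[of "a / 4" "(gnorm2 \<phi>)^2" "(gnorm2 \<psi>)^2" 0] Ds
    \<comment> \<open>At the midpoint the quadratic terms drop below the average by exact multiples
      of those of w. As the midpoint energy is still at least m, this drop is bounded by the excess
      energy, the defect of the power term and the f term.\<close>
    ultimately have "Jt a lam \<mu> s <= (Jt a lam \<mu> \<phi> + Jt a lam \<mu> \<psi>) / 2 - gnorm2 w / 8 - \<mu> / 8 * Vq w + 1 / p * ((Pq \<phi> + Pq \<psi>) / 2 - Pq s) + lam / 8 * Fq w"
      unfolding Jt_eq diff_zero by argo
    moreover have "lam / 8 * Fq w <= lam / 8 * Fa" using Fq_abs[OF wt] lam unfolding Fa_def by (intro mult_left_mono) auto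
    ultimately have "1 / 16 * gnorm2 w + \<mu> / 16 * Vq w <= R0 + lam / 8 * Fa + 2 * C1 * L * Aq w"
      using m[OF st] P unfolding R0_def by linarith
    also have "\<dots> <= Z1 * R0 + Z1 * Fa + Z1 * Aq w"
      using mult_right_mono[OF Z1(2) R00] by (intro add_mono mult_right_mono Z1 Fa0) auto
    finally have T: "1 / 16 * gnorm2 w + \<mu> / 16 * Vq w <= Z1 * (R0 + Fa + Aq w)" by (simp add: algebra_simps)
    define T where "T = Z1 * (R0 + Fa + Aq w)"
    have mV: "\<mu>2 * Vq w <= \<mu> * Vq w" using \<mu> Vq_nonneg by (rule mult_right_mono)
    have "0 <= \<mu>2 * Vq w" using m2 Vq_nonneg by simp
    then have g: "gnorm2 w <= 16 * T" "\<mu>2 * Vq w <= 16 * T" using T mV gnorm2_nonneg[of w] unfolding T_def[symmetric] by linarith+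
    have v: "Vq w <= 16 / \<mu>2 * T" using g(2) m2 by (simp add: field_simps)
    have "(LI x. \<omega> x * (w x)^2) = (LI x. (w x)^2 + V x * (w x)^2 + \<bar>f x\<bar> * (w x)^2)"
      by (rule Bochner_Integration.integral_cong) (auto simp: \<omega>_def algebra_simps)
    also have "\<dots> = (LI x. (w x)^2) + Vq w + Fa" using test_int[OF wt] by (simp add: Fa_def)
    also have "\<dots> <= (1 / c + 1) * Vq w + Aq w + Fa" using L2_split[OF wt] by (simp add: algebra_simps)
    also have "(1 / c + 1) * Vq w <= (1 / c + 1) * (16 / \<mu>2 * T)" using v c by (intro mult_left_mono) auto
    finally have "gnorm2 w + (LI x. \<omega> x * (w x)^2) <= 16 * T + (1 / c + 1) * (16 / \<mu>2 * T) + (R0 + Fa + Aq w)" using g(1) R00 by simp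
    also have "\<dots> = Z * (R0 + Fa + Aq w)"
    proof -
      have "16 * (z * y) + k * (h * (z * y)) + y = ((16 + k * h) * z + 1) * y" for z y k h :: real by (simp add: algebra_simps)
      then show ?thesis unfolding Z_def T_def .
    qed
    finally show ?thesis unfolding w_def R0_def Fa_def .
  qed
  show ?thesis
    by (rule exI[of _ \<mu>2], rule conjI[OF m2], rule exI[of _ Z], rule conjI[OF Z0]) (intro allI impI main, auto)
qed

text \<open>Smoothed absolute values do not increase the gradient and potential terms, and the two
  terms without a sign converge to their values at \<phi>. Minimizing sequences can therefore be
  taken nonnegative.\<close>

lemma nonneg_competitor:
  assumes t: "test \<phi>" and e: "e > 0" and a: "a >= 0" and \<mu>: "\<mu> >= 0"
  shows "\<exists>\<zeta>. test \<zeta> \<and> (\<forall>x. 0 <= \<zeta> x) \<and> Jt a lam \<mu> \<zeta> < Jt a lam \<mu> \<phi> + e"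
proof -
  define \<zeta> where "\<zeta> k x = sqrt ((\<phi> x)^2 + (1 / real (Suc k))^2) - 1 / real (Suc k)" for k x
  have zt: "test (\<zeta> k)" for k unfolding \<zeta>_def by (rule test_sqrt(1)[OF t]) simp
  have zb: "0 <= \<zeta> k x" "\<zeta> k x <= \<bar>\<phi> x\<bar>" for k x unfolding \<zeta>_def using abs_sqrt_sub_le[of "1 / real (Suc k)" "\<phi> x"] by auto
  have 1: "(%k. Fq (\<zeta> k)) ----> (LI x. f x * \<bar>\<phi> x\<bar>\<^sup>2)"
    unfolding \<zeta>_def
  proof (rule tendsto_test_sqrt_integral[OF t, where H = "%x s. f x * s^2", OF _ _ test_int(5)[OF t]])
    show "\<bar>f x * s^2\<bar> <= \<bar>f x\<bar> * (\<phi> x)^2" if "0 <= s" "s <= \<bar>\<phi> x\<bar>" for x s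
      using power_mono[OF that(2,1), of 2] by (simp add: abs_mult mult_left_mono)
    show "(%x. f x * (\<psi> x)^2) \<in> Lmeas" if [measurable]: "\<psi> \<in> Lmeas" for \<psi> by measurable
  qed (auto intro!: continuous_intros)
  have 2: "(%k. Pq (\<zeta> k)) ----> (LI x. Q x * \<bar>\<bar>\<phi> x\<bar>\<bar> powr p)"
    unfolding \<zeta>_def
  proof (rule tendsto_test_sqrt_integral[OF t, where H = "%x s. Q x * \<bar>s\<bar> powr p"])
    show "\<bar>Q x * \<bar>s\<bar> powr p\<bar> <= B * \<bar>\<phi> x\<bar> powr p" if "0 <= s" "s <= \<bar>\<phi> x\<bar>" for x s
      using that p2 QB[of x] B by (auto simp: abs_mult intro!: mult_mono powr_mono2)
    show "(%x. Q x * \<bar>\<psi> x\<bar> powr p) \<in> Lmeas" if [measurable]: "\<psi> \<in> Lmeas" for \<psi> by measurable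
    show "L1f (%x. B * \<bar>\<phi> x\<bar> powr p)" using test_integrable_powr(1)[OF t, of p] p2 by simp
  qed (use p2 in \<open>auto intro!: continuous_on_mult_left continuous_on_powr' continuous_on_rabs\<close>)
  have "(%k. - (1 / p * Pq (\<zeta> k)) - lam / 2 * Fq (\<zeta> k)) ----> - (1 / p * Pq \<phi>) - lam / 2 * Fq \<phi>"
    using tendsto_diff[OF tendsto_minus[OF tendsto_mult[OF tendsto_const[of "1 / p"] 2]] tendsto_mult[OF tendsto_const[of "lam / 2"] 1]] by simp
  then have "\<forall>\<^sub>F k in sequentially. - (1 / p * Pq (\<zeta> k)) - lam / 2 * Fq (\<zeta> k) < - (1 / p * Pq \<phi>) - lam / 2 * Fq \<phi> + e"
    using e by (intro order_tendstoD(2)) auto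
  then obtain k where k: "- (1 / p * Pq (\<zeta> k)) - lam / 2 * Fq (\<zeta> k) < - (1 / p * Pq \<phi>) - lam / 2 * Fq \<phi> + e"
    by (auto simp: eventually_sequentially)
  have g: "gnorm2 (\<zeta> k) <= gnorm2 \<phi>" unfolding \<zeta>_def by (rule gnorm2_test_sqrt_le[OF t]) simp
  then have g2: "a / 4 * (gnorm2 (\<zeta> k))^2 <= a / 4 * (gnorm2 \<phi>)^2" using a gnorm2_nonneg by (intro mult_left_mono power_mono) auto
  have "Vq (\<zeta> k) <= Vq \<phi>"
  proof (rule integral_mono[OF test_int(2)[OF zt] test_int(2)[OF t]])
    fix x
    show "V x * (\<zeta> k x)^2 <= V x * (\<phi> x)^2" using power_mono[OF zb(2,1), of k x 2] V0[of x] by (intro mult_left_mono) auto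
  qed
  then have "\<mu> * Vq (\<zeta> k) <= \<mu> * Vq \<phi>" using \<mu> by (rule mult_left_mono)
  then have "Jt a lam \<mu> (\<zeta> k) < Jt a lam \<mu> \<phi> + e" unfolding Jt_eq using g g2 k by argo
  then show ?thesis using zt zb(1) by blast
qed

section \<open>First variation, minimizers and positive solutions\<close>

lemma J_limit:
  assumes H: "H1lim \<omega> \<phi> u g"
  shows "(%n. Jt a lam \<mu> (\<phi> n)) ----> J_fun a p \<mu> lam V f Q u g"
  unfolding Jt_eq J_fun_def by (intro tendsto_intros H1lim_gnorm2[OF H] weighted_limits[OF H] Lp_limit(2)[OF H])

text \<open>A product of powers of total degree p is at most the p-th power of the larger
  base.\<close>

lemma power_test_integrable:
  assumes up: "L1f (%x. \<bar>u x\<bar> powr p)" and [measurable]: "u \<in> Lmeas" and t: "test \<psi>"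
  shows "L1f (%x. (\<bar>u x\<bar> powr (p - 2) + \<bar>\<psi> x\<bar> powr (p - 2)) * (\<psi> x)^2)"
    "L1f (%x. Q x * \<bar>u x\<bar> powr (p - 2) * u x * \<psi> x)"
proof -
  note [measurable] = test_meas(1)[OF t]
  have tp: "L1f (%x. \<bar>\<psi> x\<bar> powr p)" using test_integrable_powr(1)[OF t, of p] p2 by simp
  have yg: "\<bar>x\<bar> powr r * \<bar>y\<bar> powr s <= \<bar>x\<bar> powr p + \<bar>y\<bar> powr p" if "r >= 0" "s > 0" "r + s = p" for x y r s :: real
  proof -
    have "\<bar>x\<bar> powr r * \<bar>y\<bar> powr s <= (max \<bar>x\<bar> \<bar>y\<bar>) powr r * (max \<bar>x\<bar> \<bar>y\<bar>) powr s" using that by (intro mult_mono powr_mono2) auto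
    also have "\<dots> = (max \<bar>x\<bar> \<bar>y\<bar>) powr p" using that by (simp add: powr_add[symmetric])
    also have "\<dots> <= \<bar>x\<bar> powr p + \<bar>y\<bar> powr p" by (auto simp: max_def)
    finally show ?thesis .
  qed
  have sqp: "\<bar>y\<bar> powr 2 = y^2" for y :: real by (cases "y = 0") (simp_all add: powr_numeral)
  show "L1f (%x. (\<bar>u x\<bar> powr (p - 2) + \<bar>\<psi> x\<bar> powr (p - 2)) * (\<psi> x)^2)"
  proof (rule Bochner_Integration.integrable_bound)
    show "L1f (%x. \<bar>u x\<bar> powr p + 3 * \<bar>\<psi> x\<bar> powr p)" using up tp by simp
    have "(\<bar>u x\<bar> powr (p - 2) + \<bar>\<psi> x\<bar> powr (p - 2)) * (\<psi> x)^2 <= \<bar>u x\<bar> powr p + 3 * \<bar>\<psi> x\<bar> powr p" for x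
      using yg[of "p - 2" 2 "u x" "\<psi> x"] yg[of "p - 2" 2 "\<psi> x" "\<psi> x"] p2 unfolding sqp by (simp add: distrib_right)
    then show "AE x in lebesgue. norm ((\<bar>u x\<bar> powr (p - 2) + \<bar>\<psi> x\<bar> powr (p - 2)) * (\<psi> x)^2) <= norm (\<bar>u x\<bar> powr p + 3 * \<bar>\<psi> x\<bar> powr p)"
      by (intro AE_I2) simp
  qed measurable
  show "L1f (%x. Q x * \<bar>u x\<bar> powr (p - 2) * u x * \<psi> x)"
  proof (rule Bochner_Integration.integrable_bound)
    show "L1f (%x. B * (\<bar>u x\<bar> powr p + \<bar>\<psi> x\<bar> powr p))" using up tp by simp
    show "AE x in lebesgue. norm (Q x * \<bar>u x\<bar> powr (p - 2) * u x * \<psi> x) <= norm (B * (\<bar>u x\<bar> powr p + \<bar>\<psi> x\<bar> powr p))"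
    proof (rule AE_I2)
      fix x
      have "\<bar>u x\<bar> powr (p - 2) * \<bar>u x\<bar> * \<bar>\<psi> x\<bar> = \<bar>u x\<bar> powr (p - 1) * \<bar>\<psi> x\<bar> powr 1" using powr_add[of "\<bar>u x\<bar>" "p - 2" 1] by simp
      also have "\<dots> <= \<bar>u x\<bar> powr p + \<bar>\<psi> x\<bar> powr p" using p2 by (intro yg) auto
      finally have "\<bar>Q x\<bar> * (\<bar>u x\<bar> powr (p - 2) * \<bar>u x\<bar> * \<bar>\<psi> x\<bar>) <= B * (\<bar>u x\<bar> powr p + \<bar>\<psi> x\<bar> powr p)" using QB[of x] B by (intro mult_mono) auto
      then show "norm (Q x * \<bar>u x\<bar> powr (p - 2) * u x * \<psi> x) <= norm (B * (\<bar>u x\<bar> powr p + \<bar>\<psi> x\<bar> powr p))"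
        using B by (simp add: abs_mult mult.assoc)
    qed
  qed measurable
qed

text \<open>Instead of differentiating the energy, it is compared at u and at u + s \<psi>: the
  quadratic and quartic terms are polynomials in s, the power term has a Taylor remainder of order
  s^2. Minimality becomes 0 <= s \<Lambda> + s^2 X for |s| <= 1, and \<Lambda> = 0 is the weak
  equation.\<close>

lemma euler_lagrange:
  assumes H: "H1lim \<omega> \<phi> u g" and m: "!!\<xi>. test \<xi> ==> J_fun a p \<mu> lam V f Q u g <= Jt a lam \<mu> \<xi>" and a: "a > 0" and \<mu>: "\<mu> > 0"
  shows "is_solution a p \<mu> lam V f Q u g"
proof -
  note Hf = H1lim_facts[OF H]
  have upm [measurable]: "u \<in> Lmeas" by (rule Hf(3))
  have eq: "(a * (LI x. (norm (g x))^2) + 1) * (LI x. g x \<bullet> cgrad \<psi> x) + \<mu> * (LI x. V x * u x * \<psi> x)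
        = (LI x. Q x * \<bar>u x\<bar> powr (p - 2) * u x * \<psi> x) + lam * (LI x. f x * u x * \<psi> x)" if t: "test \<psi>" for \<psi>
  proof -
    note [measurable] = test_meas(1)[OF t]
    have Ht: "H1lim \<omega> (%_. \<psi>) \<psi> (cgrad \<psi>)" by (rule H1lim_test[OF \<omega> t])
    note fw = H1lim_weighted(2)[OF _ _ fm dominated(1)] and vw = H1lim_weighted(2)[OF _ _ Vm dominated(2)]
    define D where "D = (LI x. (norm (g x))^2)"
    define \<alpha> where "\<alpha> = (LI x. g x \<bullet> cgrad \<psi> x)"
    define \<beta> where "\<beta> = (LI x. (norm (cgrad \<psi> x))^2)"
    define \<gamma> where "\<gamma> = (LI x. V x * u x * \<psi> x)"
    define \<epsilon> where "\<epsilon> = (LI x. f x * u x * \<psi> x)"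
    define \<pi>1 where "\<pi>1 = (LI x. Q x * \<bar>u x\<bar> powr (p - 2) * u x * \<psi> x)"
    obtain C where C: "C > 0" "!!s b :: real. \<bar>\<bar>s + b\<bar> powr p - \<bar>s\<bar> powr p - p * (\<bar>s\<bar> powr (p - 2) * s) * b\<bar> <= C * ((\<bar>s\<bar> powr (p - 2) + \<bar>b\<bar> powr (p - 2)) * b^2)"
      using powr_taylor[OF p2] by blast
    have up: "L1f (%x. \<bar>u x\<bar> powr p)" by (rule Lp_limit(1)[OF H])
    have i1: "L1f (%x. (\<bar>u x\<bar> powr (p - 2) + \<bar>\<psi> x\<bar> powr (p - 2)) * (\<psi> x)^2)"
      by (rule power_test_integrable(1)[OF up upm t])
    have i2: "L1f (%x. Q x * \<bar>u x\<bar> powr (p - 2) * u x * \<psi> x)"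
      by (rule power_test_integrable(2)[OF up upm t])
    define R where "R = B * C * (LI x. (\<bar>u x\<bar> powr (p - 2) + \<bar>\<psi> x\<bar> powr (p - 2)) * (\<psi> x)^2)"
    have iQ: "L1f (%x. Q x * \<bar>v x\<bar> powr p)" if "L1f (%x. \<bar>v x\<bar> powr p)" and [measurable]: "v \<in> Lmeas" for v
    proof (rule Bochner_Integration.integrable_bound)
      show "L1f (%x. B * \<bar>v x\<bar> powr p)" using that by simp
    qed (use QB B in \<open>auto simp: abs_mult intro!: AE_I2 mult_right_mono\<close>)
    \<comment> \<open>A lower bound is what matters, as the power term enters the energy with a
      minus sign.\<close>
    have Pexp: "Pq (%x. u x + s * \<psi> x) >= Pq u + s * (p * \<pi>1) - s^2 * R" if s: "\<bar>s\<bar> <= 1" for s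
    proof -
      have "H1lim \<omega> (%n x. \<phi> n x + s * \<psi> x) (%x. u x + s * \<psi> x) (%x. g x + cgrad (%x. s * \<psi> x) x)" by (rule H1lim_add_test[OF H test_scale[OF t]])
      from Lp_limit(1)[OF this] have is': "L1f (%x. Q x * \<bar>u x + s * \<psi> x\<bar> powr p)" by (rule iQ) measurable
      have "Pq u + s * (p * \<pi>1) - s^2 * R = (LI x. Q x * \<bar>u x\<bar> powr p + s * p * (Q x * \<bar>u x\<bar> powr (p - 2) * u x * \<psi> x) - s^2 * (B * C) * ((\<bar>u x\<bar> powr (p - 2) + \<bar>\<psi> x\<bar> powr (p - 2)) * (\<psi> x)^2))"
        using iQ[OF up upm] i1 i2 by (simp add: \<pi>1_def R_def)
      also have "\<dots> <= Pq (%x. u x + s * \<psi> x)"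
      proof (rule integral_mono)
        show "L1f (%x. Q x * \<bar>u x\<bar> powr p + s * p * (Q x * \<bar>u x\<bar> powr (p - 2) * u x * \<psi> x) - s^2 * (B * C) * ((\<bar>u x\<bar> powr (p - 2) + \<bar>\<psi> x\<bar> powr (p - 2)) * (\<psi> x)^2))"
          using iQ[OF up upm] i1 i2 by simp
        fix x
        define T where "T = \<bar>u x + s * \<psi> x\<bar> powr p - \<bar>u x\<bar> powr p - p * (\<bar>u x\<bar> powr (p - 2) * u x) * (s * \<psi> x)"
        define W where "W = (\<bar>u x\<bar> powr (p - 2) + \<bar>\<psi> x\<bar> powr (p - 2)) * (\<psi> x)^2"
        have "\<bar>s * \<psi> x\<bar> <= \<bar>\<psi> x\<bar>" using mult_right_mono[OF s, of "\<bar>\<psi> x\<bar>"] by (simp add: abs_mult)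
        then have "\<bar>s * \<psi> x\<bar> powr (p - 2) <= \<bar>\<psi> x\<bar> powr (p - 2)" using p2 by (intro powr_mono2) auto
        then have "(\<bar>u x\<bar> powr (p - 2) + \<bar>s * \<psi> x\<bar> powr (p - 2)) * (s * \<psi> x)^2 <= (\<bar>u x\<bar> powr (p - 2) + \<bar>\<psi> x\<bar> powr (p - 2)) * (s * \<psi> x)^2" by (intro mult_right_mono add_left_mono) auto
        also have "\<dots> = s^2 * W" by (simp add: W_def power_mult_distrib)
        finally have "C * ((\<bar>u x\<bar> powr (p - 2) + \<bar>s * \<psi> x\<bar> powr (p - 2)) * (s * \<psi> x)^2) <= C * (s^2 * W)" using C(1) by simp
        then have "\<bar>T\<bar> <= C * (s^2 * W)" using C(2)[of "u x" "s * \<psi> x"] unfolding T_def by linarith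
        then have "\<bar>Q x\<bar> * \<bar>T\<bar> <= B * (C * (s^2 * W))" using QB[of x] B by (intro mult_mono) auto
        then have "- (Q x * T) <= s^2 * (B * C) * W" using abs_ge_minus_self[of "Q x * T"] by (simp add: abs_mult mult_ac)
        moreover have "Q x * \<bar>u x + s * \<psi> x\<bar> powr p = Q x * \<bar>u x\<bar> powr p + s * p * (Q x * \<bar>u x\<bar> powr (p - 2) * u x * \<psi> x) + Q x * T" by (simp add: T_def algebra_simps)
        ultimately show "Q x * \<bar>u x\<bar> powr p + s * p * (Q x * \<bar>u x\<bar> powr (p - 2) * u x * \<psi> x) - s^2 * (B * C) * ((\<bar>u x\<bar> powr (p - 2) + \<bar>\<psi> x\<bar> powr (p - 2)) * (\<psi> x)^2) <= Q x * \<bar>u x + s * \<psi> x\<bar> powr p"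
          unfolding W_def by linarith
      qed (rule is')
      finally show ?thesis .
    qed
    \<comment> \<open>Collects everything of second order in s, with |s| <= 1 used to bound the
      square of the change y in the Dirichlet integral.\<close>
    define X where "X = a / 4 * (2 * \<bar>\<alpha>\<bar> + \<bar>\<beta>\<bar>)^2 + a / 2 * D * \<beta> + \<beta> / 2 + \<mu> / 2 * Vq \<psi> + R / p - lam / 2 * Fq \<psi>"
    define \<Lambda> where "\<Lambda> = a * D * \<alpha> + \<alpha> + \<mu> * \<gamma> - \<pi>1 - lam * \<epsilon>"
    have "0 <= s * \<Lambda> + s^2 * X" if s: "\<bar>s\<bar> <= 1" for s
    proof -
      have Hs: "H1lim \<omega> (%n x. \<phi> n x + s * \<psi> x) (%x. u x + s * \<psi> x) (%x. g x + s *\<^sub>R cgrad \<psi> x)"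
        using H1lim_add_test[OF H test_scale[OF t, of s]] by (simp add: cgrad_scale test_smooth[OF t])
      define y where "y = 2 * s * \<alpha> + s^2 * \<beta>"
      have "J_fun a p \<mu> lam V f Q u g <= J_fun a p \<mu> lam V f Q (%x. u x + s * \<psi> x) (%x. g x + s *\<^sub>R cgrad \<psi> x)"
        by (rule LIMSEQ_le_const[OF J_limit[OF Hs]]) (use m[OF test_add[OF Hf(2) test_scale[OF t]]] in blast)
      then have "a / 4 * D^2 + 1 / 2 * (D + \<mu> * Vq u) - 1 / p * Pq u - lam / 2 * Fq u \<le>
          a / 4 * (D + y)^2 + 1 / 2 * (D + y + \<mu> * (Vq u + 2 * s * \<gamma> + s^2 * Vq \<psi>)) - 1 / p * Pq (%x. u x + s * \<psi> x) - lam / 2 * (Fq u + 2 * s * \<epsilon> + s^2 * Fq \<psi>)"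
        unfolding J_fun_def L2f_norm_add_expand[OF Hf(5) test_L2f(2)[OF t]] weighted_add_expand[OF fw[OF H H] fw[OF H Ht] fw[OF Ht Ht]]
          weighted_add_expand[OF vw[OF H H] vw[OF H Ht] vw[OF Ht Ht]]
        by (simp add: D_def \<alpha>_def \<beta>_def \<gamma>_def \<epsilon>_def y_def add.assoc)
      note l1 = this
      have l2: "1 / p * (Pq u + s * (p * \<pi>1) - s^2 * R) <= 1 / p * Pq (%x. u x + s * \<psi> x)" using Pexp[OF s] p2 by (intro mult_left_mono) auto
      have l3: "1 / p * (Pq u + s * (p * \<pi>1) - s^2 * R) = 1 / p * Pq u + s * \<pi>1 - s^2 * (R / p)" using p2 by (simp add: field_simps)
      have l4: "a / 4 * y^2 <= s^2 * (a / 4 * (2 * \<bar>\<alpha>\<bar> + \<bar>\<beta>\<bar>)^2)"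
      proof -
        have "\<bar>2 * \<alpha> + s * \<beta>\<bar> <= 2 * \<bar>\<alpha>\<bar> + \<bar>\<beta>\<bar>" using mult_right_mono[OF s, of "\<bar>\<beta>\<bar>"] abs_triangle_ineq[of "2 * \<alpha>" "s * \<beta>"] by (simp add: abs_mult)
        then have "\<bar>2 * \<alpha> + s * \<beta>\<bar>^2 <= (2 * \<bar>\<alpha>\<bar> + \<bar>\<beta>\<bar>)^2" by (intro power_mono) auto
        moreover have "y = s * (2 * \<alpha> + s * \<beta>)" by (simp add: y_def power2_eq_square algebra_simps)
        ultimately have "y^2 <= s^2 * (2 * \<bar>\<alpha>\<bar> + \<bar>\<beta>\<bar>)^2" by (simp add: power_mult_distrib mult_left_mono)
        from mult_left_mono[OF this, of "a / 4"] show ?thesis using a by (simp add: mult_ac)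
      qed
      have l5: "a / 4 * (D + y)^2 = a / 4 * D^2 + a / 2 * D * y + a / 4 * y^2" by (simp add: power2_eq_square algebra_simps)
      \<comment> \<open>The remaining comparison is linear in the integrals and is isolated for
        arbitrary reals.\<close>
      have "A + 1 / 2 * (E + m * Vu) - Pu - h * Fu <= Ay + 1 / 2 * (E + y + m * (Vu + v1 + v2)) - Pn - h * (Fu + f1 + f2) ==> P3 <= Pn ==> P3 = Pu + sp - r ==> ys <= Z ==> Ay = A + Dy + ys ==>
          0 <= Dy + Z + 1 / 2 * (y + m * (v1 + v2)) - sp + r - h * (f1 + f2)" for A E m Vu Pu h Fu Ay y v1 v2 Pn f1 f2 P3 sp r ys Z Dy :: real
        by (simp add: distrib_left)
      from this[OF l1 l2 l3 l4 l5] have "0 <= a / 2 * D * y + s^2 * (a / 4 * (2 * \<bar>\<alpha>\<bar> + \<bar>\<beta>\<bar>)^2) + 1 / 2 * (y + \<mu> * (2 * s * \<gamma> + s^2 * Vq \<psi>)) - s * \<pi>1 + s^2 * (R / p) - lam / 2 * (2 * s * \<epsilon> + s^2 * Fq \<psi>)" .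
      then show ?thesis unfolding y_def \<Lambda>_def X_def by (simp add: algebra_simps)
    qed
    then have "\<Lambda> = 0" by (rule small_quadratic_nonneg_imp_zero)
    then have "(a * D + 1) * \<alpha> + \<mu> * \<gamma> = \<pi>1 + lam * \<epsilon>" by (simp add: \<Lambda>_def distrib_right)
    then show ?thesis unfolding D_def \<alpha>_def \<gamma>_def \<epsilon>_def \<pi>1_def .
  qed
  have "L1f (%x. V x * (u x)^2)"
    using H1lim_weighted(2)[OF H H Vm dominated(2)] by (simp add: power2_eq_square mult.assoc)
  then show ?thesis using eq H1lim_imp_H1_grad[OF H] by (simp add: is_solution_def)
qed

end

context kirchhoff
begin

text \<open>Coercivity bounds the Dirichlet integral of every function of negative energy by a
  constant free of \<mu>. Only with this constant fixed does \<open>cauchy_estimate\<close> yield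
  its threshold, and that order makes \<mu>0 independent of the sequence.\<close>

lemma minimizer:
  assumes a: "a > 0" and lam: "lam >= 0"
  shows "\<exists>\<mu>0>0. \<forall>\<mu>\<ge>\<mu>0. (\<exists>\<psi>. test \<psi> \<and> Jt a lam \<mu> \<psi> < 0) \<longrightarrow>
    (\<exists>\<zeta> u g. H1lim \<omega> \<zeta> u g \<and> (\<forall>n x. 0 <= \<zeta> n x) \<and> J_fun a p \<mu> lam V f Q u g < 0 \<and>
       (\<forall>\<xi>. test \<xi> \<longrightarrow> J_fun a p \<mu> lam V f Q u g <= Jt a lam \<mu> \<xi>))"
proof -
  obtain \<mu>1 M where m1: "\<mu>1 > 0" and M: "M > 0" and co: "!!\<mu> \<phi>. \<mu> >= \<mu>1 ==> test \<phi> ==> a / 8 * (gnorm2 \<phi>)^2 - M * gnorm2 \<phi> - M <= Jt a lam \<mu> \<phi>"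
    using coercive[OF a lam] by blast
  \<comment> \<open>For D > M2 one has D > 1 and (a/8) D^2 >= 2 M D, so the coercive lower bound is
    positive.\<close>
  define M2 where "M2 = 1 + 16 * M / a"
  have M2: "M2 > 0" using M a by (simp add: M2_def add_pos_pos)
  obtain \<mu>2 Z where m2: "\<mu>2 > 0" and Z: "Z > 0" and ce: "\<forall>\<mu>\<ge>\<mu>2. \<forall>m \<phi> \<psi>. (\<forall>\<xi>. test \<xi> \<longrightarrow> m <= Jt a lam \<mu> \<xi>) \<longrightarrow> test \<phi> \<longrightarrow> test \<psi> \<longrightarrow> gnorm2 \<phi> <= M2 \<longrightarrow> gnorm2 \<psi> <= M2 \<longrightarrow>
    gnorm2 (%x. \<phi> x - \<psi> x) + (LI x. \<omega> x * (\<phi> x - \<psi> x)^2) \<le>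
      Z * ((Jt a lam \<mu> \<phi> + Jt a lam \<mu> \<psi>) / 2 - m + (LI x. \<bar>f x\<bar> * (\<phi> x - \<psi> x)^2) + Aq (%x. \<phi> x - \<psi> x))"
    using cauchy_estimate[OF a lam M2] by (elim exE conjE) (rule that)
  note ca = ce[rule_format]
  have main: "\<exists>\<zeta> u g. H1lim \<omega> \<zeta> u g \<and> (\<forall>n x. 0 <= \<zeta> n x) \<and> J_fun a p \<mu> lam V f Q u g < 0 \<and>
       (\<forall>\<xi>. test \<xi> \<longrightarrow> J_fun a p \<mu> lam V f Q u g <= Jt a lam \<mu> \<xi>)"
    if \<mu>: "\<mu> >= max \<mu>1 \<mu>2" and \<psi>: "test \<psi>" "Jt a lam \<mu> \<psi> < 0" for \<mu> \<psi>
  proof -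
    have \<mu>': "\<mu> >= \<mu>1" "\<mu> >= \<mu>2" "\<mu> >= 0" using \<mu> m1 by auto
    define m where "m = Inf (Jt a lam \<mu> ` Collect test)"
    have lb: "- 2 * M^2 / a - M <= Jt a lam \<mu> \<phi>" if t: "test \<phi>" for \<phi>
    proof -
      have "0 <= a / 8 * (gnorm2 \<phi> - 4 * M / a)^2" using a by simp
      also have "\<dots> = a / 8 * (gnorm2 \<phi>)^2 - M * gnorm2 \<phi> + 2 * M^2 / a" using a by (simp add: power2_eq_square field_simps)
      finally show ?thesis using co[OF \<mu>'(1) t] by simp
    qed
    then have bdd: "bdd_below (Jt a lam \<mu> ` Collect test)" by (intro bdd_belowI2[of _ "- 2 * M^2 / a - M"]) auto
    have ml: "m <= Jt a lam \<mu> \<xi>" if "test \<xi>" for \<xi> unfolding m_def using that bdd by (intro cINF_lower) auto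
    have m0: "m < 0" using ml[OF \<psi>(1)] \<psi>(2) by simp
    \<comment> \<open>The minimum with 0 keeps the energies negative from the start, which is what
      brings the whole sequence under the bound \<open>M2\<close>.\<close>
    have "\<exists>\<zeta>. test \<zeta> \<and> (\<forall>x. 0 <= \<zeta> x) \<and> Jt a lam \<mu> \<zeta> < min 0 (m + 1 / real (Suc n))" for n
    proof -
      define b where "b = min 0 (m + 1 / real (Suc n))"
      have "m < b" using m0 by (simp add: b_def)
      then obtain \<phi> where p: "test \<phi>" "Jt a lam \<mu> \<phi> < b"
        using cInf_less_iff[of "Jt a lam \<mu> ` Collect test" b] bdd \<psi>(1) unfolding m_def by blast
      then show ?thesis using nonneg_competitor[OF p(1), of "b - Jt a lam \<mu> \<phi>" a \<mu> lam] a \<mu>'(3) unfolding b_def by auto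
    qed
    then obtain \<zeta> where z: "!!n. test (\<zeta> n)" "!!n x. 0 <= \<zeta> n x" and zJ: "!!n. Jt a lam \<mu> (\<zeta> n) < min 0 (m + 1 / real (Suc n))" by metis
    have gM: "gnorm2 (\<zeta> n) <= M2" for n
    proof (rule ccontr)
      define D where "D = gnorm2 (\<zeta> n)"
      assume "\<not> gnorm2 (\<zeta> n) <= M2"
      then have D: "D > M2" by (simp add: D_def)
      have D1: "D > 1" using D M a by (simp add: M2_def) (smt (verit) divide_pos_pos)
      have "a / 8 * D * (16 * M / a) <= a / 8 * D * D" using D D1 a by (intro mult_left_mono) (auto simp: M2_def)
      then have "2 * M * D <= a / 8 * D^2" using a by (simp add: power2_eq_square mult_ac)
      moreover have "M * 1 <= M * D" using D1 M by (intro mult_left_mono) auto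
      moreover have "a / 8 * D^2 - M * D - M < 0" using co[OF \<mu>'(1) z(1), of n] zJ[of n] unfolding D_def by simp
      ultimately show False by simp
    qed
    obtain r :: "nat => nat" where r: "strict_mono r" "\<forall>h e. Lhalf h \<longrightarrow> e > 0 \<longrightarrow>
        (\<exists>n0. \<forall>m\<ge>n0. \<forall>n\<ge>n0. (LI x. \<bar>h x\<bar> * (\<zeta> (r m) x - \<zeta> (r n) x)^2) < e)"
      using rellich[where \<phi> = \<zeta>, OF N3 z(1) gM] by (elim exE conjE) (rule that)
    have "\<exists>r' u g. strict_mono (r' :: nat => nat) \<and> H1lim \<omega> (%n. \<zeta> (r (r' n))) u g"
    proof (rule H1lim_exists[OF \<omega>])
      show "test (\<zeta> (r n))" for n by (rule z(1))
      fix e :: real assume e: "e > 0"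
      define d where "d = e / (4 * Z)"
      have d: "d > 0" using e Z by (simp add: d_def)
      obtain n1 where n1: "!!m n. m >= n1 ==> n >= n1 ==> (LI x. \<bar>f x\<bar> * (\<zeta> (r m) x - \<zeta> (r n) x)^2) < d"
        using r(2)[rule_format, OF f d] by blast
      obtain n2 where n2: "!!m n. m >= n2 ==> n >= n2 ==> Aq (%x. \<zeta> (r m) x - \<zeta> (r n) x) < d"
        using r(2)[rule_format, OF LA d] by blast
      obtain n3 where n3: "1 / real (Suc n3) < d" using nat_approx_posE[OF d] by blast
      have J: "Jt a lam \<mu> (\<zeta> (r n)) < m + d" if "n >= n3" for n
      proof -
        have "1 / real (Suc (r n)) <= 1 / real (Suc n3)" using that seq_suble[OF r(1), of n] by (intro divide_left_mono) auto
        then show ?thesis using zJ[of "r n"] n3 by simp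
      qed
      show "\<exists>n0. \<forall>m\<ge>n0. \<forall>n\<ge>n0. gnorm2 (%x. \<zeta> (r m) x - \<zeta> (r n) x) + (LI x. \<omega> x * (\<zeta> (r m) x - \<zeta> (r n) x)^2) < e"
      proof (intro exI allI impI)
        fix i j assume "i >= max n1 (max n2 n3)" "j >= max n1 (max n2 n3)"
        then have ij: "i >= n1" "i >= n2" "i >= n3" "j >= n1" "j >= n2" "j >= n3" by auto
        have "(Jt a lam \<mu> (\<zeta> (r i)) + Jt a lam \<mu> (\<zeta> (r j))) / 2 - m + (LI x. \<bar>f x\<bar> * (\<zeta> (r i) x - \<zeta> (r j) x)^2) + Aq (%x. \<zeta> (r i) x - \<zeta> (r j) x) <= 3 * d"
          using J[OF ij(3)] J[OF ij(6)] n1[OF ij(1,4)] n2[OF ij(2,5)] by argo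
        from mult_left_mono[OF this, of Z] have "Z * ((Jt a lam \<mu> (\<zeta> (r i)) + Jt a lam \<mu> (\<zeta> (r j))) / 2 - m + (LI x. \<bar>f x\<bar> * (\<zeta> (r i) x - \<zeta> (r j) x)^2) + Aq (%x. \<zeta> (r i) x - \<zeta> (r j) x)) <= Z * (3 * d)"
          using Z by simp
        also have "\<dots> < e" using Z e by (simp add: d_def)
        finally have le: "Z * ((Jt a lam \<mu> (\<zeta> (r i)) + Jt a lam \<mu> (\<zeta> (r j))) / 2 - m + (LI x. \<bar>f x\<bar> * (\<zeta> (r i) x - \<zeta> (r j) x)^2) + Aq (%x. \<zeta> (r i) x - \<zeta> (r j) x)) < e" .
        show "gnorm2 (%x. \<zeta> (r i) x - \<zeta> (r j) x) + (LI x. \<omega> x * (\<zeta> (r i) x - \<zeta> (r j) x)^2) < e"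
          by (rule le_less_trans[OF ca le]) (rule \<mu>'(2) ml z(1) gM | assumption)+
      qed
    qed
    then obtain r' :: "nat => nat" and u g where r': "strict_mono r'" and H: "H1lim \<omega> (%n. \<zeta> (r (r' n))) u g" by blast
    have "(%n. Jt a lam \<mu> (\<zeta> (r (r' n)))) ----> m"
    proof (rule tendsto_sandwich[OF _ _ tendsto_const])
      show "\<forall>\<^sub>F n in sequentially. m <= Jt a lam \<mu> (\<zeta> (r (r' n)))" using ml z(1) by simp
      have "Jt a lam \<mu> (\<zeta> (r (r' n))) <= m + 1 / real (Suc n)" for n
      proof -
        have "n <= r (r' n)" using seq_suble[OF r(1), of "r' n"] seq_suble[OF r', of n] by simp
        then have "1 / real (Suc (r (r' n))) <= 1 / real (Suc n)" by (intro divide_left_mono) auto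
        then show ?thesis using zJ[of "r (r' n)"] by simp
      qed
      then show "\<forall>\<^sub>F n in sequentially. Jt a lam \<mu> (\<zeta> (r (r' n))) <= m + 1 / real (Suc n)" by simp
      show "(%n. m + 1 / real (Suc n)) ----> m" using tendsto_add[OF tendsto_const[of m] LIMSEQ_Suc[OF lim_1_over_n]] by simp
    qed
    then have "J_fun a p \<mu> lam V f Q u g = m" using J_limit[OF H] LIMSEQ_unique by blast
    then show ?thesis using H z(2) m0 ml by (intro exI[of _ "%n. \<zeta> (r (r' n))"] exI[of _ u] exI[of _ g]) auto
  qed
  show ?thesis using m1 main by (intro exI[of _ "max \<mu>1 \<mu>2"]) auto
qed

text \<open>Every representative of the limit has the same energy and solves the equation. With the
  nonlocal factor frozen, the equation reads -\<Delta>v = w with |w| <= W v, so the strong maximum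
  principle applies. The zero alternative is excluded because only the nonnegative gradient terms of
  the energy would survive.\<close>

lemma positive_solution:
  assumes a: "a > 0" and lam: "lam >= 0" and \<mu>: "\<mu> > 0"
    and H: "H1lim \<omega> \<zeta> u g" and z: "!!n x. 0 <= \<zeta> n x" and neg: "J_fun a p \<mu> lam V f Q u g < 0"
    and min: "!!\<xi>. test \<xi> ==> J_fun a p \<mu> lam V f Q u g <= Jt a lam \<mu> \<xi>"
  shows "\<exists>u. u \<in> Lmeas \<and> is_solution a p \<mu> lam V f Q u g \<and> (\<forall>x. u x > 0) \<and> J_fun a p \<mu> lam V f Q u g < 0"
proof -
  define v where "v x = \<bar>u x\<bar>" for x
  note Hu = H1lim_facts[OF H]
  note [measurable] = Hu(3,4)
  have vm [measurable]: "v \<in> Lmeas" unfolding v_def by measurable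
  have "AE x in lebesgue. (%n. \<zeta> n x) ----> u x" using H by (simp add: H1lim_def)
  then have "AE x in lebesgue. u x = v x"
  proof eventually_elim
    fix x assume "(%n. \<zeta> n x) ----> u x"
    then have "0 <= u x" using z by (intro LIMSEQ_le_const) auto
    then show "u x = v x" by (simp add: v_def)
  qed
  then have Hv: "H1lim \<omega> \<zeta> v g" by (rule H1lim_cong[OF H]) (auto simp: vm Hu(4))
  have transfer: "J_fun a p \<mu> lam V f Q v' g = J_fun a p \<mu> lam V f Q u g" if "H1lim \<omega> \<zeta> v' g" for v'
    by (rule LIMSEQ_unique[OF J_limit[OF that] J_limit[OF H]])
  have sol: "is_solution a p \<mu> lam V f Q v' g" if "H1lim \<omega> \<zeta> v' g" for v'
    by (rule euler_lagrange[OF that _ a \<mu>]) (use min in \<open>simp add: transfer[OF that]\<close>)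
  \<comment> \<open>The Kirchhoff factor is a positive number once the solution is given; dividing
    by it makes the equation one for the Laplacian.\<close>
  define k where "k = a * (LI x. (norm (g x))^2) + 1"
  have k: "k > 0" using a by (simp add: k_def add_nonneg_pos)
  define w where "w x = (lam * (f x * v x) + Q x * \<bar>v x\<bar> powr (p - 2) * v x - \<mu> * (V x * v x)) / k" for x
  define W where "W x = (lam * \<bar>f x\<bar> + B * \<bar>v x\<bar> powr (p - 2) + \<mu> * V x) / k" for x
  have v0: "0 <= v x" for x by (simp add: v_def)
  have vp: "L1f (%x. \<bar>v x\<bar> powr p)" by (rule Lp_limit(1)[OF Hv])
  have int: "L1f (%x. f x * v x * \<psi> x)" "L1f (%x. V x * v x * \<psi> x)" "L1f (%x. Q x * \<bar>v x\<bar> powr (p - 2) * v x * \<psi> x)"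
    if t: "test \<psi>" for \<psi>
    using H1lim_weighted(2)[OF Hv H1lim_test[OF \<omega> t] fm dominated(1)] H1lim_weighted(2)[OF Hv H1lim_test[OF \<omega> t] Vm dominated(2)]
      power_test_integrable(2)[OF vp vm t] by auto
  have we: "w x * \<psi> x = (lam * (f x * v x * \<psi> x) + Q x * \<bar>v x\<bar> powr (p - 2) * v x * \<psi> x - \<mu> * (V x * v x * \<psi> x)) / k" for \<psi> x
    by (simp add: w_def left_diff_distrib distrib_right mult.assoc)
  have W: "wsol UNIV \<omega> \<zeta> v g w"
    unfolding wsol_def
  proof (intro conjI allI impI)
    show "w \<in> Lmeas" unfolding w_def[abs_def] by measurable
    show "L1f (%x. w x * (\<eta> x)^2)" if t: "test \<eta>" for \<eta>
      using int[OF test_mult_smooth[OF t test_smooth[OF t]]] unfolding power2_eq_square we[of _ "%x. \<eta> x * \<eta> x"] by simp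
    show "(LI x. g x \<bullet> cgrad \<psi> x) = (LI x. w x * \<psi> x)" if t: "test \<psi>" for \<psi>
    proof -
      have "(LI x. w x * \<psi> x) = (lam * (LI x. f x * v x * \<psi> x) + (LI x. Q x * \<bar>v x\<bar> powr (p - 2) * v x * \<psi> x) - \<mu> * (LI x. V x * v x * \<psi> x)) / k"
        unfolding we using int[OF t] by simp
      also have "lam * (LI x. f x * v x * \<psi> x) + (LI x. Q x * \<bar>v x\<bar> powr (p - 2) * v x * \<psi> x) - \<mu> * (LI x. V x * v x * \<psi> x) = k * (LI x. g x \<bullet> cgrad \<psi> x)"
      proof -
        have "k * (LI x. g x \<bullet> cgrad \<psi> x) + \<mu> * (LI x. V x * v x * \<psi> x) = (LI x. Q x * \<bar>v x\<bar> powr (p - 2) * v x * \<psi> x) + lam * (LI x. f x * v x * \<psi> x)"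
          using sol[OF Hv] t unfolding is_solution_def k_def by blast
        then show ?thesis by simp
      qed
      finally show ?thesis using k by simp
    qed
  qed (rule Hv Hu(2) z v0)+
  have smp: "(AE x in lebesgue. x \<in> UNIV \<longrightarrow> v x = 0) \<or> (AE x in lebesgue. x \<in> UNIV \<longrightarrow> v x > 0)"
  proof (rule strong_maximum_principle[OF W open_UNIV connected_UNIV])
    show "0 <= W x" for x using lam \<mu> V0[of x] B k by (simp add: W_def)
    show "\<bar>w x\<bar> <= W x * v x" for x
    proof -
      have "\<bar>lam * (f x * v x) + Q x * \<bar>v x\<bar> powr (p - 2) * v x - \<mu> * (V x * v x)\<bar> <= \<bar>lam * (f x * v x)\<bar> + \<bar>Q x * \<bar>v x\<bar> powr (p - 2) * v x\<bar> + \<bar>\<mu> * (V x * v x)\<bar>"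
        by (rule order_trans[OF abs_triangle_ineq4 add_right_mono[OF abs_triangle_ineq]])
      also have "\<dots> = lam * \<bar>f x\<bar> * v x + \<bar>Q x\<bar> * \<bar>v x\<bar> powr (p - 2) * v x + \<mu> * V x * v x"
        using lam \<mu> V0[of x] v0[of x] by (simp add: abs_mult)
      also have "\<dots> <= lam * \<bar>f x\<bar> * v x + B * \<bar>v x\<bar> powr (p - 2) * v x + \<mu> * V x * v x"
        using QB[of x] v0[of x] by (intro add_mono mult_right_mono order_refl) auto
      also have "\<dots> = k * (W x * v x)" using k by (simp add: W_def distrib_right)
      finally show ?thesis using k by (simp add: w_def abs_divide divide_le_eq mult.commute)
    qed
    fix \<eta> assume t: "test \<eta>"
    note [measurable] = test_meas(1)[OF t]
    have "L1f (%x. \<bar>v x\<bar> powr (p - 2) * (\<eta> x)^2)"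
      by (rule Bochner_Integration.integrable_bound[OF power_test_integrable(1)[OF vp vm t]]) (auto intro!: AE_I2 mult_right_mono)
    moreover have "W x * (\<eta> x)^2 = (lam * (\<bar>f x\<bar> * (\<eta> x)^2) + B * (\<bar>v x\<bar> powr (p - 2) * (\<eta> x)^2) + \<mu> * (V x * (\<eta> x)^2)) / k" for x
      by (simp add: W_def distrib_right mult.assoc)
    ultimately show "L1f (%x. W x * (\<eta> x)^2)" using test_int[OF t] by simp
  qed
  have nz: False if "AE x in lebesgue. v x = 0"
  proof -
    have "AE x in lebesgue. h x * F (v x) = 0" if "F 0 = 0" for h and F :: "real => real"
      using \<open>AE x in lebesgue. v x = 0\<close> by eventually_elim (simp add: that)
    note e = integral_eq_zero_AE[OF this]
    have "J_fun a p \<mu> lam V f Q v g = a / 4 * (LI x. (norm (g x))^2)^2 + 1 / 2 * (LI x. (norm (g x))^2)"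
      unfolding J_fun_def using e[of "%s. s^2" f] e[of "%s. s^2" V] e[of "%s. \<bar>s\<bar> powr p" Q] by simp
    also have "\<dots> >= 0" using a by simp
    finally show False using neg transfer[OF Hv] by simp
  qed
  have pos: "AE x in lebesgue. v x > 0" using smp nz by (simp only: UNIV_I simp_thms) blast
  \<comment> \<open>Value 1 on the null set where v vanishes, to have positivity at every
    point.\<close>
  define v' where "v' x = (if v x > 0 then v x else 1)" for x
  have vm': "v' \<in> Lmeas" unfolding v'_def by measurable
  have Hv': "H1lim \<omega> \<zeta> v' g" by (rule H1lim_cong[OF Hv]) (use pos vm' Hu in \<open>auto simp: v'_def\<close>)
  show ?thesis using sol[OF Hv'] transfer[OF Hv'] neg vm' by (intro exI[of _ v']) (auto simp: v'_def)
qed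

text \<open>Measurability of u is part of the conclusion so that the coefficient Q can later be
  exchanged for one equal to it almost everywhere.\<close>

lemma existence:
  assumes a: "a > 0" and lam: "lam >= 0"
  shows "\<exists>\<mu>0>0. \<forall>\<mu>>\<mu>0. (\<exists>\<psi>. test \<psi> \<and> Jt a lam \<mu> \<psi> < 0) \<longrightarrow>
    (\<exists>u g. u \<in> Lmeas \<and> is_solution a p \<mu> lam V f Q u g \<and> (\<forall>x. u x > 0) \<and> J_fun a p \<mu> lam V f Q u g < 0)"
proof -
  obtain \<mu>0 where m: "\<mu>0 > 0" "!!\<mu>. \<mu> >= \<mu>0 ==> \<exists>\<psi>. test \<psi> \<and> Jt a lam \<mu> \<psi> < 0 ==>
    \<exists>\<zeta> u g. H1lim \<omega> \<zeta> u g \<and> (\<forall>n x. 0 <= \<zeta> n x) \<and> J_fun a p \<mu> lam V f Q u g < 0 \<and>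
       (\<forall>\<xi>. test \<xi> \<longrightarrow> J_fun a p \<mu> lam V f Q u g <= Jt a lam \<mu> \<xi>)"
    using minimizer[OF a lam] by blast
  have "\<exists>u g. u \<in> Lmeas \<and> is_solution a p \<mu> lam V f Q u g \<and> (\<forall>x. u x > 0) \<and> J_fun a p \<mu> lam V f Q u g < 0"
    if h: "\<mu> > \<mu>0" "\<exists>\<psi>. test \<psi> \<and> Jt a lam \<mu> \<psi> < 0" for \<mu>
  proof -
    have \<mu>: "\<mu> > 0" "\<mu> >= \<mu>0" using h m by auto
    obtain \<zeta> u g where "H1lim \<omega> \<zeta> u g" "!!n x. 0 <= \<zeta> n x" "J_fun a p \<mu> lam V f Q u g < 0"
      "!!\<xi>. test \<xi> ==> J_fun a p \<mu> lam V f Q u g <= Jt a lam \<mu> \<xi>" using m(2)[OF \<mu>(2) h(2)] by blast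
    from positive_solution[OF a lam \<mu>(1) this] show ?thesis by blast
  qed
  then show ?thesis using m(1) by blast
qed

section \<open>Test functions of negative energy\<close>

lemma Jt_scale:
  assumes t: "test \<phi>" and s: "s > 0"
  shows "Jt a lam \<mu> (%x. s * \<phi> x) = s^2 * (a / 4 * s^2 * (gnorm2 \<phi>)^2 + (gnorm2 \<phi> + \<mu> * Vq \<phi> - lam * Fq \<phi>) / 2 - s powr (p - 2) / p * Pq \<phi>)"
proof -
  have h: "(LI x. h x * (s * \<phi> x)^2) = s^2 * (LI x. h x * (\<phi> x)^2)" for h
  proof -
    have "(%x. h x * (s * \<phi> x)^2) = (%x. s^2 * (h x * (\<phi> x)^2))" by (simp add: power_mult_distrib fun_eq_iff)
    then show ?thesis by simp
  qed
  have "\<bar>s * \<phi> x\<bar> powr p = s powr p * \<bar>\<phi> x\<bar> powr p" for x using s by (simp add: abs_mult powr_mult)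
  then have "(%x. Q x * \<bar>s * \<phi> x\<bar> powr p) = (%x. s powr p * (Q x * \<bar>\<phi> x\<bar> powr p))" by (simp add: fun_eq_iff)
  then have P: "Pq (%x. s * \<phi> x) = s powr p * Pq \<phi>" by simp
  have "s powr p = s^2 * s powr (p - 2)" using powr_add[of s 2 "p - 2"] s by (simp add: powr_numeral)
  then show ?thesis unfolding Jt_eq h P gnorm2_scale[OF t] by (simp add: power_mult_distrib algebra_simps power2_eq_square add_divide_distrib diff_divide_distrib)
qed

text \<open>The amplitude s is chosen first, large enough for the power term to beat the quadratic
  part for every lam < l; a is then made small enough for the quartic term at this s. Since V does
  not see \<phi>, the choice is independent of \<mu>.\<close>

lemma negative_energy_small_a:
  assumes t: "test \<phi>" and P: "Pq \<phi> > 0" and V: "Vq \<phi> = 0"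
  shows "\<exists>a0>0. \<forall>a lam \<mu>. 0 < a \<and> a < a0 \<and> 0 < lam \<and> lam < l \<longrightarrow> (\<exists>\<psi>. test \<psi> \<and> Jt a lam \<mu> \<psi> < 0)"
proof -
  define G where "G = gnorm2 \<phi>"
  \<comment> \<open>A bound for the quadratic part valid for all lam < l, plus 1 reserved for the
    quartic term.\<close>
  define c0 where "c0 = 1 + (G + l * \<bar>Fq \<phi>\<bar>) / 2"
  \<comment> \<open>The value of s^(p-2) that makes the power term equal to max 1 c0; the maximum
    keeps it positive.\<close>
  define y where "y = p / Pq \<phi> * max 1 c0"
  define s where "s = y powr (1 / (p - 2))"
  have "y > 0" unfolding y_def using p2 P by (intro mult_pos_pos) auto
  then have s: "s > 0" "s powr (p - 2) = y" using p2 by (auto simp: s_def powr_powr)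
  \<comment> \<open>Ensures a s^2 G^2 / 4 < 1; the added 1 keeps the denominator positive.\<close>
  define a0 where "a0 = 4 / (s^2 * G^2 + 1)"
  have D: "s^2 * G^2 + 1 > 0" by (simp add: add_nonneg_pos)
  have "Jt a lam \<mu> (%x. s * \<phi> x) < 0" if a: "0 < a" "a < a0" and lam: "0 < lam" "lam < l" for a lam \<mu>
  proof -
    have "a * (s^2 * G^2 + 1) < 4" using a(2) D by (simp add: a0_def less_divide_eq)
    then have 1: "a / 4 * s^2 * G^2 < 1" using a(1) by (simp add: algebra_simps)
    have "- Fq \<phi> * lam <= \<bar>Fq \<phi>\<bar> * lam" using lam by (intro mult_right_mono) auto
    also have "\<dots> <= \<bar>Fq \<phi>\<bar> * l" using lam by (intro mult_left_mono) auto
    finally have 2: "- (lam * Fq \<phi>) <= l * \<bar>Fq \<phi>\<bar>" by (simp add: mult.commute)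
    have "s powr (p - 2) / p * Pq \<phi> = max 1 c0" using P p2 unfolding s(2) y_def by simp
    then have "c0 <= s powr (p - 2) / p * Pq \<phi>" by simp
    then have "a / 4 * s^2 * G^2 + (G + \<mu> * Vq \<phi> - lam * Fq \<phi>) / 2 - s powr (p - 2) / p * Pq \<phi> < 0"
      using 1 2 unfolding c0_def V by argo
    then show ?thesis unfolding Jt_scale[OF t s(1)] G_def[symmetric] using s(1) by (intro mult_pos_neg) auto
  qed
  moreover have "a0 > 0" using D by (simp add: a0_def)
  ultimately show ?thesis using test_scale[OF t] by blast
qed

text \<open>After division by s^2 the quartic and power terms tend to zero with s, since p > 2, and
  the negative quadratic part decides.\<close>

lemma negative_energy_quadratic:
  assumes t: "test \<phi>" and n: "gnorm2 \<phi> + \<mu> * Vq \<phi> < lam * Fq \<phi>"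
  shows "\<exists>\<psi>. test \<psi> \<and> Jt a lam \<mu> \<psi> < 0"
proof -
  define X where "X = (gnorm2 \<phi> + \<mu> * Vq \<phi> - lam * Fq \<phi>) / 2"
  have "((%s. a / 4 * s^2 * (gnorm2 \<phi>)^2 + X - s powr (p - 2) / p * Pq \<phi>) \<longlongrightarrow> a / 4 * 0^2 * (gnorm2 \<phi>)^2 + X - 0 powr (p - 2) / p * Pq \<phi>) (at_right 0)"
    using p2 by (intro tendsto_diff tendsto_add tendsto_mult tendsto_divide tendsto_power tendsto_const tendsto_ident_at tendsto_powr') (auto simp: eventually_at_filter)
  moreover have "X < 0" using n by (simp add: X_def)
  ultimately have "\<forall>\<^sub>F s in at_right 0. a / 4 * s^2 * (gnorm2 \<phi>)^2 + X - s powr (p - 2) / p * Pq \<phi> < 0"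
    by (intro order_tendstoD(2)[where a = 0]) auto
  then obtain s where s: "s > 0" "a / 4 * s^2 * (gnorm2 \<phi>)^2 + X - s powr (p - 2) / p * Pq \<phi> < 0"
    using eventually_happens'[OF _ eventually_conj[OF _ eventually_at_right_less[of "0::real"]]] by (auto simp: trivial_limit_at_right_real)
  then have "Jt a lam \<mu> (%x. s * \<phi> x) < 0" unfolding Jt_scale[OF t s(1)] X_def by (intro mult_pos_neg) auto
  then show ?thesis using test_scale[OF t] by blast
qed

end

section \<open>Conclusion for an essentially bounded Q\<close>

lemma indicator_times_integrable:
  fixes h :: "'n::euclidean_space => real"
  assumes "U \<in> sets lebesgue" "emeasure lebesgue U < \<infinity>" and [measurable]: "h \<in> Lmeas" and b: "!!x. \<bar>h x\<bar> <= B"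
  shows "L1f (%x. indicator U x * h x)"
proof (rule Bochner_Integration.integrable_bound)
  show "L1f (%x. B * indicator U x :: real)" using assms by (intro integrable_mult_right integrable_real_indicator) auto
  show "AE x in lebesgue. norm (indicator U x * h x) <= norm (B * indicator U x :: real)"
    using b order_trans[OF b abs_ge_self] by (intro AE_I2) (auto simp: indicator_def)
qed (use assms(1) in measurable)

theorem theorem1p7:
  fixes V f Q :: "'n::euclidean_space \<Rightarrow> real" and p :: real
  defines "N \<equiv> real DIM('n)"
  defines "\<Omega> \<equiv> interior {x. V x = 0}"
  assumes N4: "DIM('n) \<ge> 4"
    and p_range: "2 < p" "p < 2 * N / (N - 2)"
    and V1: "\<forall>x. V x \<ge> 0" "continuous_on UNIV V"
    and V2: "\<exists>c>0. {x. V x < c} \<noteq> {} \<and> emeasure lebesgue {x. V x < c} < \<infinity>"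
    and V3: "\<Omega> \<noteq> {}" "connected \<Omega>" "bounded \<Omega>" "smooth_boundary \<Omega>"
            "closure \<Omega> = {x. V x = 0}"
    and D1: "f \<in> borel_measurable lebesgue" "integrable lebesgue (\<lambda>x. \<bar>f x\<bar> powr (N / 2))"
            "emeasure lebesgue {x\<in>\<Omega>. f x > 0} > 0"
    and D2: "Q \<in> borel_measurable lebesgue" "\<exists>C. AE x in lebesgue. \<bar>Q x\<bar> \<le> C"
            "emeasure lebesgue {x\<in>\<Omega>. Q x > 0} > 0"
  shows "(\<exists>a0>0. \<forall>a lam. 0 < a \<and> a < a0 \<and> 0 < lam \<and> lam < lambda1 \<Omega> f \<longrightarrow>
            (\<exists>\<mu>s>0. \<forall>\<mu>>\<mu>s. \<exists>u g. is_solution a p \<mu> lam V f Q u g \<and> (\<forall>x. u x > 0)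
                                \<and> J_fun a p \<mu> lam V f Q u g < 0))
       \<and> (\<forall>a lam. 0 < a \<and> lam \<ge> lambda1 \<Omega> f \<longrightarrow>
            (\<exists>\<mu>s>0. \<forall>\<mu>>\<mu>s. \<exists>u g. is_solution a p \<mu> lam V f Q u g \<and> (\<forall>x. u x > 0)
                                \<and> J_fun a p \<mu> lam V f Q u g < 0))"
proof -
  obtain c where c: "c > 0" "emeasure lebesgue {x. V x < c} < \<infinity>" using V2 by blast
  obtain C0 where C0: "AE x in lebesgue. \<bar>Q x\<bar> \<le> C0" using D2(2) by blast
  \<comment> \<open>The maximum with 1 makes the bound positive, as the locale
    \<open>kirchhoff\<close> demands.\<close>
  define C where "C = max 1 C0"
  note [measurable] = D2(1)
  \<comment> \<open>The bound on Q holds almost everywhere only, while the estimates use it at every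
    point; redefining Q on a null set changes neither the equation nor the energy of a measurable
    u.\<close>
  define Q' where "Q' x = (if \<bar>Q x\<bar> \<le> C then Q x else 0)" for x
  have Qm' [measurable]: "Q' \<in> borel_measurable lebesgue" unfolding Q'_def by measurable
  have QC: "\<bar>Q' x\<bar> \<le> C" for x by (auto simp: Q'_def C_def le_max_iff_disj)
  have QQ: "AE x in lebesgue. Q' x = Q x" using C0 by eventually_elim (simp add: Q'_def C_def)
  have f: "Lhalf f" using D1(1,2) by (simp add: Lhalf_def N_def)
  interpret K: kirchhoff V f Q' p c C
    by unfold_locales (use N4 p_range V1 c f Qm' QC in \<open>auto simp: N_def C_def\<close>)
  interpret P: principal \<Omega> f
    by unfold_locales (use N4 V3 f D1(3) in \<open>auto simp: \<Omega>_def\<close>)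
  have V\<Omega>: "V x = 0" if "x \<in> \<Omega>" for x using that interior_subset unfolding \<Omega>_def by blast
  have solution: "\<exists>\<mu>s>0. \<forall>\<mu>>\<mu>s. \<exists>u g. is_solution a p \<mu> lam V f Q u g \<and> (\<forall>x. u x > 0) \<and> J_fun a p \<mu> lam V f Q u g < 0"
    if a: "a > 0" and lam: "lam \<ge> 0" and neg: "\<And>\<mu>. \<exists>\<psi>. test_fun UNIV \<psi> \<and> K.Jt a lam \<mu> \<psi> < 0" for a lam
  proof -
    obtain \<mu>0 where m: "\<mu>0 > 0" "\<And>\<mu>. \<mu> > \<mu>0 \<Longrightarrow> \<exists>u g. u \<in> borel_measurable lebesgue \<and> is_solution a p \<mu> lam V f Q' u g \<and> (\<forall>x. u x > 0) \<and> J_fun a p \<mu> lam V f Q' u g < 0"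
      using K.existence[OF a lam] neg by blast
    have "is_solution a p \<mu> lam V f Q u g" "J_fun a p \<mu> lam V f Q u g = J_fun a p \<mu> lam V f Q' u g"
      if [measurable]: "u \<in> borel_measurable lebesgue" and s: "is_solution a p \<mu> lam V f Q' u g" for \<mu> u g
    proof -
      have "(LINT x|lebesgue. Q x * h x) = (LINT x|lebesgue. Q' x * h x)" if [measurable]: "h \<in> borel_measurable lebesgue" for h
        by (rule integral_cong_AE) (use QQ in auto)
      note e = this
      show "J_fun a p \<mu> lam V f Q u g = J_fun a p \<mu> lam V f Q' u g"
        unfolding J_fun_def by (subst e) auto
      have "(LINT x|lebesgue. Q x * \<bar>u x\<bar> powr (p - 2) * u x * \<phi> x) = (LINT x|lebesgue. Q' x * \<bar>u x\<bar> powr (p - 2) * u x * \<phi> x)" if "test_fun UNIV \<phi>" for \<phi>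
        using e[of "\<lambda>x. \<bar>u x\<bar> powr (p - 2) * u x * \<phi> x"] test_meas(1)[OF that] by (simp add: mult.assoc)
      then show "is_solution a p \<mu> lam V f Q u g" using s unfolding is_solution_def by simp
    qed
    then show ?thesis using m by (intro exI[of _ \<mu>0]) metis
  qed
  have \<Omega>m: "\<Omega> \<in> sets lebesgue" using P.fin\<Omega>(2) .
  have "{x\<in>\<Omega>. Q x > 0} \<in> sets lebesgue" "{x\<in>\<Omega>. Q' x > 0} \<in> sets lebesgue"
    using \<Omega>m by (simp_all add: Collect_conj_eq)
  then have "emeasure lebesgue {x\<in>\<Omega>. Q' x > 0} = emeasure lebesgue {x\<in>\<Omega>. Q x > 0}"
    using QQ by (intro emeasure_eq_AE) auto
  then have Qpos: "emeasure lebesgue {x\<in>\<Omega>. Q' x > 0} > 0" using D2(3) by simp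
  obtain \<phi> where \<phi>: "test_fun \<Omega> \<phi>" "\<And>x. 0 \<le> \<phi> x" "(LINT x|lebesgue. Q' x * \<phi> x powr p) > 0"
    using exists_test_integral_pos[OF P.op indicator_times_integrable[OF \<Omega>m P.fin\<Omega>(1) Qm' QC] _ Qpos, of p] p_range by auto
  have t: "test_fun UNIV \<phi>" by (rule P.testU[OF \<phi>(1)])
  \<comment> \<open>The test function lives in \<open>\<Omega>\<close>, where V vanishes, so its
    energy does not depend on \<mu>.\<close>
  have supp: "V x * (\<phi> x)\<^sup>2 = 0" for x
    using V\<Omega>[of x] \<phi>(1) closure_subset[of "{x. \<phi> x \<noteq> 0}"] unfolding test_fun_def by (cases "\<phi> x = 0") auto
  have "\<exists>a0>0. \<forall>a lam \<mu>. 0 < a \<and> a < a0 \<and> 0 < lam \<and> lam < lambda1 \<Omega> f \<longrightarrow> (\<exists>\<psi>. test_fun UNIV \<psi> \<and> K.Jt a lam \<mu> \<psi> < 0)"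
    by (rule K.negative_energy_small_a[OF t]) (use \<phi>(2,3) in \<open>simp_all add: supp del: mult_eq_0_iff\<close>)
  then obtain a0 where a0: "a0 > 0" "\<And>a lam \<mu>. 0 < a \<Longrightarrow> a < a0 \<Longrightarrow> 0 < lam \<Longrightarrow> lam < lambda1 \<Omega> f \<Longrightarrow> \<exists>\<psi>. test_fun UNIV \<psi> \<and> K.Jt a lam \<mu> \<psi> < 0"
    by blast
  \<comment> \<open>In this case the test function may depend on \<mu>: negative energy is available
    for every \<mu>, and the threshold comes from \<open>K.existence\<close> alone.\<close>
  have "\<exists>\<psi>. test_fun UNIV \<psi> \<and> K.Jt a lam \<mu> \<psi> < 0" if "lam \<ge> lambda1 \<Omega> f" for a lam \<mu>
    using P.negative_direction[OF V1(2) V\<Omega> that[unfolded P.lambda1_eq], of \<mu>] K.negative_energy_quadratic unfolding P.ff_def by blast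
  moreover have "lambda1 \<Omega> f > 0" using P.l1_pos by (simp add: P.lambda1_eq)
  ultimately show ?thesis using a0 by (intro conjI exI[of _ a0] allI impI solution) auto
qed

end
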